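(* Let $d\ge 2$ and $1\le d_0\le d$ be integers, and let $(X_{n,j},A_{n,j}: n\ge 1,\ 1\le j\le d)$ be the variables of a multicolor urn satisfying assumptions (A) and (B) of the context. Suppose in addition that $2\lambda_0<m$. For $j\in\{1,\ldots,d_0\}$ let $Z_{(j)}$ be the a.s. limit of $Z_{n,j}$ and put $$V_j=\frac{Z_{(j)}}{m^2}\Bigl\{q_j(1-Z_{(j)})^2+Z_{(j)}\sum_{i\le d_0,\,i\ne j}q_i\,Z_{(i)}\Bigr\},\qquad U_j=V_j-Z_{(j)}(1-Z_{(j)}).$$ Then, for each $j\in\{1,\ldots,d_0\}$, as $n\to\infty$, $$C_{n,j}\longrightarrow\mathcal N(0,U_j)\ \text{ stably},\qquad D_{n,j}\longrightarrow\mathcal N(0,V_j)\ \ \mathcal G\text{-stably in strong sense}.$$ In particular, $$(C_{n,j},D_{n,j})\longrightarrow\mathcal N(0,U_j)\times\mathcal N(0,V_j)\ \text{ stably}.$$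
   Context: **Urn setting.** $X_{n,j}$ and $A_{n,j}$ ($n\ge1$, $1\le j\le d$) are real random variables on a probability space $(\Omega,\mathcal A,P)$; $\mathcal G=(\mathcal G_n:n\ge0)$ with $\mathcal G_0=\{\emptyset,\Omega\}$ and $\mathcal G_n=\sigma(X_{k,j},A_{k,j}:1\le k\le n,\,1\le j\le d)$. For constants $a_j>0$, set $N_{n,j}=a_j+\sum_{k=1}^nX_{k,j}A_{k,j}$. Assumption (A): $X_{n,j}\in\{0,1\}$; $\sum_{j=1}^dX_{n,j}=1$; $0\le A_{n,j}\le\beta$ for some constant $\beta$; the vector $(A_{n,j}:1\le j\le d)$ is independent of $\mathcal G_{n-1}\vee\sigma(X_{n,j}:1\le j\le d)$ for every $n\ge 1$; and, for every $n\ge 0$ and $1\le j\le d$, $$Z_{n,j}:=\frac{N_{n,j}}{\sum_{i=1}^dN_{n,i}}=P(X_{n+1,j}=1\mid\mathcal G_n)\quad\text{a.s.}$$ Assumption (B): let $\lambda_0=0$ if $d_0=d$ and $\lambda_0=\max_{d_0<j\le d}\limsup_nEA_{n,j}$ if $d_0<d$. Then $EA_{n,j}=EA_{n,1}$ for all $n\ge1$ and $1\le j\le d_0$; the limit $m:=\lim_nEA_{n,1}$ exists and $m>\lambda_0$; and the limits $q_j:=\lim_nEA_{n,j}^2$ exist for $1\le j\le d_0$. Under (A) and (B), for each $1\le j\le d_0$ the sequence $Z_{n,j}$ converges a.s.; its limit is denoted $Z_{(j)}$. For $1\le j\le d_0$ define $$M_{n,j}=\frac1n\sum_{k=1}^nX_{k,j},\qquad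 C_{n,j}=\sqrt n\,(M_{n,j}-Z_{n,j}),\qquad D_{n,j}=\sqrt n\,(Z_{n,j}-Z_{(j)}).$$ **Kernels and stable convergence.** A kernel on a metric space $S$ is a collection $N=\{N(\omega):\omega\in\Omega\}$ of Borel probability measures on $S$ such that $\omega\mapsto N(\omega)(f)=\int f\,dN(\omega)$ is $\mathcal A$-measurable for each bounded Borel $f:S\to\mathbb R$. For kernels $M,N$ on $S$, $M\times N$ is the kernel on $S\times S$ given by $(M\times N)(\omega)=M(\omega)\times N(\omega)$ (product measure). $\mathcal N(a,b)$ is the Gaussian law on $\mathbb R$ with mean $a$ and variance $b\ge0$ ($\mathcal N(a,0)=\delta_a$); for a non negative real random variable $L$, $\mathcal N(0,L)$ is the kernel $\omega\mapsto\mathcal N(0,L(\omega))$. $S$-valued random variables $Y_n$ converge stably to a kernel $N$ if $P(Y_n\in\cdot\mid H)\to E(N(\cdot)\mid H)$ weakly for all $H\in\mathcal A$ with $P(H)>0$ (where $E(N(\cdot)\mid H)=E(I_HN(\cdot))/P(H)$). For a sequence $\mathcal F=(\mathcal F_n)$ of sub-$\sigma$-fields of $\mathcal A$, $Y_n$ converges $\mathcal F$-stably in strong sense to $N$ if $E(f(Y_n)\mid\mathcal F_n)\to N(f)$ in probability for all bounded continuous $f:S\to\mathbb R$. *)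

theory Defs
  imports "HOL-Probability.Probability"
begin

section \<open>Kernels and modes of convergence\<close>

definition kernel :: "'a measure \<Rightarrow> ('a \<Rightarrow> 's::metric_space measure) \<Rightarrow> bool" where
  "kernel M N \<longleftrightarrow>
     (\<forall>\<omega>\<in>space M. prob_space (N \<omega>) \<and> sets (N \<omega>) = sets borel) \<and>
     (\<forall>f::'s \<Rightarrow> real. f \<in> borel_measurable borel \<longrightarrow> bounded (range f) \<longrightarrow>
        (\<lambda>\<omega>. \<integral>x. f x \<partial>N \<omega>) \<in> borel_measurable M)"

text \<open>The Borel sigma-field of a product metric space contains the product of the Borel
  sigma-fields, and they coincide in the second countable case, in particular for the pairs of
  reals to which this is applied.\<close>

definition prod_kernel ::
  "('a \<Rightarrow> 's measure) \<Rightarrow> ('a \<Rightarrow> 't measure) \<Rightarrow> 'a \<Rightarrow> ('s \<times> 't) measure" where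
  "prod_kernel M N = (\<lambda>\<omega>. M \<omega> \<Otimes>\<^sub>M N \<omega>)"

text \<open>The Gaussian law is parametrised by its variance \<open>b\<close>, whereas \<^const>\<open>normal_density\<close>
  takes the standard deviation. The value for \<open>b < 0\<close> is irrelevant: a variance that is only
  almost surely non negative yields a kernel that is determined up to a null set.\<close>

definition gaussian :: "real \<Rightarrow> real \<Rightarrow> real measure" where
  "gaussian a b = (if b > 0 then density lborel (normal_density a (sqrt b)) else return borel a)"

definition gaussian_kernel :: "('a \<Rightarrow> real) \<Rightarrow> 'a \<Rightarrow> real measure" where
  "gaussian_kernel L = (\<lambda>\<omega>. gaussian 0 (L \<omega>))"

definition weakly_converges :: "(nat \<Rightarrow> 's::metric_space measure) \<Rightarrow> 's measure \<Rightarrow> bool" where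
  "weakly_converges \<mu> \<nu> \<longleftrightarrow>
     (\<forall>f::'s \<Rightarrow> real. continuous_on UNIV f \<longrightarrow> bounded (range f) \<longrightarrow>
        (\<lambda>n. \<integral>x. f x \<partial>\<mu> n) \<longlonglongrightarrow> (\<integral>x. f x \<partial>\<nu>))"

definition converges_in_probability ::
  "'a measure \<Rightarrow> (nat \<Rightarrow> 'a \<Rightarrow> real) \<Rightarrow> ('a \<Rightarrow> real) \<Rightarrow> bool" where
  "converges_in_probability M Y L \<longleftrightarrow>
     (\<forall>\<epsilon>>0. (\<lambda>n. measure M {\<omega>\<in>space M. \<bar>Y n \<omega> - L \<omega>\<bar> > \<epsilon>}) \<longlonglongrightarrow> 0)"

text \<open>Here \<open>uniform_measure M H\<close> is the conditional probability \<open>P(\<cdot> | H)\<close>. Hence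
  \<open>distr (uniform_measure M H) borel Y\<close> is \<open>P(Y \<in> \<cdot> | H)\<close>, and the mixture
  \<open>bind (uniform_measure M H) N\<close> assigns to \<open>B\<close> the mass \<open>E(I\<^sub>H N(B)) / P(H)\<close>.\<close>

definition stably_converges ::
  "'a measure \<Rightarrow> (nat \<Rightarrow> 'a \<Rightarrow> 's::metric_space) \<Rightarrow> ('a \<Rightarrow> 's measure) \<Rightarrow> bool" where
  "stably_converges M Y N \<longleftrightarrow>
     (\<forall>n. Y n \<in> borel_measurable M) \<and> kernel M N \<and>
     (\<forall>H\<in>sets M. measure M H > 0 \<longrightarrow>
        weakly_converges (\<lambda>n. distr (uniform_measure M H) borel (Y n))
          (bind (uniform_measure M H) N))"

definition strongly_stably_converges ::
  "'a measure \<Rightarrow> (nat \<Rightarrow> 'a measure) \<Rightarrow> (nat \<Rightarrow> 'a \<Rightarrow> 's::metric_space) \<Rightarrow>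
   ('a \<Rightarrow> 's measure) \<Rightarrow> bool" where
  "strongly_stably_converges M F Y N \<longleftrightarrow>
     (\<forall>n. subalgebra M (F n)) \<and> (\<forall>n. Y n \<in> borel_measurable M) \<and> kernel M N \<and>
     (\<forall>f::'s \<Rightarrow> real. continuous_on UNIV f \<longrightarrow> bounded (range f) \<longrightarrow>
        converges_in_probability M (\<lambda>n. real_cond_exp M (F n) (\<lambda>\<omega>. f (Y n \<omega>)))
          (\<lambda>\<omega>. \<integral>x. f x \<partial>N \<omega>))"


section \<open>Multicolor urns\<close>

text \<open>Colors are \<open>j \<in> {1..d}\<close> and times \<open>n \<ge> 1\<close>; the values of \<open>X\<close> and \<open>A\<close> at other indices
  are never used, except that limits in \<open>n\<close> ignore \<open>n = 0\<close>.\<close>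

type_synonym 'a urn_array = "nat \<Rightarrow> nat \<Rightarrow> 'a \<Rightarrow> real"

definition rv_events :: "'a measure \<Rightarrow> 'i set \<Rightarrow> ('i \<Rightarrow> 'a \<Rightarrow> real) \<Rightarrow> 'a set set" where
  "rv_events M I Y = (\<Union>i\<in>I. {Y i -` B \<inter> space M | B. B \<in> sets borel})"

definition urn_G ::
  "'a measure \<Rightarrow> nat \<Rightarrow> 'a urn_array \<Rightarrow> 'a urn_array \<Rightarrow> nat \<Rightarrow> 'a measure" where
  "urn_G M d X A n = sigma (space M)
     (rv_events M ({1..n} \<times> {1..d}) (\<lambda>(k, j). X k j) \<union>
      rv_events M ({1..n} \<times> {1..d}) (\<lambda>(k, j). A k j))"

definition urn_N ::
  "(nat \<Rightarrow> real) \<Rightarrow> 'a urn_array \<Rightarrow> 'a urn_array \<Rightarrow> nat \<Rightarrow> nat \<Rightarrow> 'a \<Rightarrow> real" where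
  "urn_N a X A n j \<omega> = a j + (\<Sum>k=1..n. X k j \<omega> * A k j \<omega>)"

definition urn_Z ::
  "nat \<Rightarrow> (nat \<Rightarrow> real) \<Rightarrow> 'a urn_array \<Rightarrow> 'a urn_array \<Rightarrow> nat \<Rightarrow> nat \<Rightarrow> 'a \<Rightarrow> real" where
  "urn_Z d a X A n j \<omega> = urn_N a X A n j \<omega> / (\<Sum>i=1..d. urn_N a X A n i \<omega>)"

definition urn_assms_A ::
  "'a measure \<Rightarrow> nat \<Rightarrow> (nat \<Rightarrow> real) \<Rightarrow> 'a urn_array \<Rightarrow> 'a urn_array \<Rightarrow> bool" where
  "urn_assms_A M d a X A \<longleftrightarrow>
     prob_space M \<and>
     (\<forall>j\<in>{1..d}. a j > 0) \<and>
     (\<forall>n\<ge>1. \<forall>j\<in>{1..d}. X n j \<in> borel_measurable M \<and> A n j \<in> borel_measurable M) \<and>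
     (\<forall>n\<ge>1. \<forall>\<omega>\<in>space M. (\<forall>j\<in>{1..d}. X n j \<omega> \<in> {0, 1}) \<and> (\<Sum>j=1..d. X n j \<omega>) = 1) \<and>
     (\<exists>\<beta>. \<forall>n\<ge>1. \<forall>j\<in>{1..d}. \<forall>\<omega>\<in>space M. 0 \<le> A n j \<omega> \<and> A n j \<omega> \<le> \<beta>) \<and>
     (\<forall>n\<ge>1. prob_space.indep_set M
        (sigma_sets (space M) (rv_events M {1..d} (A n)))
        (sigma_sets (space M) (sets (urn_G M d X A (n - 1)) \<union> rv_events M {1..d} (X n)))) \<and>
     (\<forall>n. \<forall>j\<in>{1..d}. AE \<omega> in M. urn_Z d a X A n j \<omega> =
        real_cond_exp M (urn_G M d X A n)
          (indicator {\<omega>'\<in>space M. X (Suc n) j \<omega>' = 1}) \<omega>)"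

definition urn_lambda0 :: "'a measure \<Rightarrow> nat \<Rightarrow> nat \<Rightarrow> 'a urn_array \<Rightarrow> ereal" where
  "urn_lambda0 M d d0 A =
     (if d0 = d then 0
      else Max ((\<lambda>j. limsup (\<lambda>n. ereal (\<integral>\<omega>. A n j \<omega> \<partial>M))) ` {d0<..d}))"

definition urn_assms_B ::
  "'a measure \<Rightarrow> nat \<Rightarrow> nat \<Rightarrow> 'a urn_array \<Rightarrow> real \<Rightarrow> (nat \<Rightarrow> real) \<Rightarrow> bool" where
  "urn_assms_B M d d0 A m q \<longleftrightarrow>
     (\<forall>n\<ge>1. \<forall>j\<in>{1..d0}. (\<integral>\<omega>. A n j \<omega> \<partial>M) = (\<integral>\<omega>. A n 1 \<omega> \<partial>M)) \<and>
     (\<lambda>n. \<integral>\<omega>. A n 1 \<omega> \<partial>M) \<longlonglongrightarrow> m \<and>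
     urn_lambda0 M d d0 A < ereal m \<and>
     (\<forall>j\<in>{1..d0}. (\<lambda>n. \<integral>\<omega>. (A n j \<omega>)\<^sup>2 \<partial>M) \<longlonglongrightarrow> q j)"

text \<open>The limit exists almost surely for \<open>1 \<le> j \<le> d\<^sub>0\<close> under \<^const>\<open>urn_assms_A\<close> and \<^const>\<open>urn_assms_B\<close>.\<close>

definition urn_Zlim ::
  "nat \<Rightarrow> (nat \<Rightarrow> real) \<Rightarrow> 'a urn_array \<Rightarrow> 'a urn_array \<Rightarrow> nat \<Rightarrow> 'a \<Rightarrow> real" where
  "urn_Zlim d a X A j \<omega> = lim (\<lambda>n. urn_Z d a X A n j \<omega>)"

definition urn_mean :: "'a urn_array \<Rightarrow> nat \<Rightarrow> nat \<Rightarrow> 'a \<Rightarrow> real" where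
  "urn_mean X n j \<omega> = (\<Sum>k=1..n. X k j \<omega>) / real n"

definition urn_C ::
  "nat \<Rightarrow> (nat \<Rightarrow> real) \<Rightarrow> 'a urn_array \<Rightarrow> 'a urn_array \<Rightarrow> nat \<Rightarrow> nat \<Rightarrow> 'a \<Rightarrow> real" where
  "urn_C d a X A n j \<omega> = sqrt (real n) * (urn_mean X n j \<omega> - urn_Z d a X A n j \<omega>)"

definition urn_D ::
  "nat \<Rightarrow> (nat \<Rightarrow> real) \<Rightarrow> 'a urn_array \<Rightarrow> 'a urn_array \<Rightarrow> nat \<Rightarrow> nat \<Rightarrow> 'a \<Rightarrow> real" where
  "urn_D d a X A n j \<omega> = sqrt (real n) * (urn_Z d a X A n j \<omega> - urn_Zlim d a X A j \<omega>)"

definition urn_V ::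
  "nat \<Rightarrow> nat \<Rightarrow> (nat \<Rightarrow> real) \<Rightarrow> 'a urn_array \<Rightarrow> 'a urn_array \<Rightarrow> real \<Rightarrow> (nat \<Rightarrow> real) \<Rightarrow>
   nat \<Rightarrow> 'a \<Rightarrow> real" where
  "urn_V d d0 a X A m q j \<omega> =
     (let Z = (\<lambda>i. urn_Zlim d a X A i \<omega>) in
      Z j / m\<^sup>2 * (q j * (1 - Z j)\<^sup>2 + Z j * (\<Sum>i\<in>{1..d0} - {j}. q i * Z i)))"

definition urn_U ::
  "nat \<Rightarrow> nat \<Rightarrow> (nat \<Rightarrow> real) \<Rightarrow> 'a urn_array \<Rightarrow> 'a urn_array \<Rightarrow> real \<Rightarrow> (nat \<Rightarrow> real) \<Rightarrow>
   nat \<Rightarrow> 'a \<Rightarrow> real" where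
  "urn_U d d0 a X A m q j \<omega> =
     urn_V d d0 a X A m q j \<omega> - urn_Zlim d a X A j \<omega> * (1 - urn_Zlim d a X A j \<omega>)"

end

theory Submission
  imports Defs "HOL-Real_Asymp.Real_Asymp"
begin

text \<open>
  Both limits are central limit theorems for martingale differences with bounded increments whose
  conditional variances converge almost surely. If \<open>\<xi> k\<close> are such differences with conditional
  variances \<open>v k\<close>, then \<open>exp (\<i> s \<Sum>\<xi> k + s\<^sup>2/2 \<Sum>v k)\<close> has a conditional expectation close to 1,
  and replacing \<open>\<Sum>v k\<close> by its limit gives the characteristic function of the Gaussian mixture. For
  \<open>C\<close> the sum runs up to \<open>n\<close> and is tested against a fixed event; for \<open>D\<close> it is the tail from \<open>n\<close>
  onwards and is tested against events of \<open>G n\<close> that vary with \<open>n\<close>, which yields convergence of the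
  conditional expectations in \<open>L\<^sup>1\<close>. The joint statement follows because \<open>C n\<close> is \<open>G n\<close>-measurable.

  For the urn, the total weight \<open>B\<close> of the colors above \<open>d0\<close> is of smaller order than a power
  \<open>\<rho> < 1/2\<close> of the total weight \<open>T\<close> of the others, so these colors contribute a drift that is
  negligible on the scale of the fluctuations, and the total weight grows like \<open>m * n\<close>.
\<close>

text \<open>The limit variances \<open>urn_U\<close> and \<open>urn_V\<close> are random, and the
  obstacle is the weight \<open>exp (- t^2 * L / 2)\<close> that undoes the compensation: to enter
  the product estimate it must be known before the sum starts. For \<open>D\<close> this can be
  arranged, because \<open>(n + 1)^2\<close> times the conditional variance at time \<open>n\<close>
  is known when the tail begins and tends to the limit variance. For \<open>C\<close> the sum starts
  at time 0 and nothing is known yet; there the compensated product is compared with 1 on events of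
  a fixed time, and the weight is inserted afterwards by a density argument. The exponent comes from
  comparing means. A dominant color adds at least \<open>m'\<close> on average, a minor one at most
  \<open>l\<close>, so \<open>B\<close> grows at most like a power of \<open>T\<close> slightly
  above \<open>l / m'\<close>, and the hypothesis on \<lambda> lets \<open>l / m'\<close> be chosen
  below 1/2. The drift of a proportion is of order \<open>B / S^2\<close>, so its tail sums have
  order \<open>n powr (\<rho> - 1)\<close>; after multiplication by \<open>sqrt n\<close> this
  vanishes exactly when \<open>\<rho> < 1 / 2\<close>.\<close>

section \<open>Gaussian kernels and characteristic functions\<close>

text \<open>All centred Gaussian laws are images of one standard normal, so measurability and
  continuity in the variance become those of \<open>(b, x) \<mapsto> sqrt b * x\<close>. The
  truncation \<open>max 0 b\<close> reproduces the point mass that \<open>gaussian\<close> assigns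
  to a variance that is not positive.\<close>

lemma gaussian_eq_distr:
  "gaussian 0 b = distr std_normal_distribution borel (\<lambda>x. sqrt (max 0 b) * x)"
proof (cases "b > 0")
  case True
  interpret real_distribution std_normal_distribution
    by (rule real_dist_normal_dist)
  have "distributed std_normal_distribution lborel (\<lambda>x. (sqrt b * x - 0) / sqrt b) std_normal_density"
    using True by (simp add: distributed_def density_distr distr_id2)
  then have "distributed std_normal_distribution lborel (\<lambda>x. sqrt b * x) (normal_density 0 (sqrt b))"
    using True by (subst normal_standard_normal_convert) auto
  then have "distr std_normal_distribution lborel (\<lambda>x. sqrt b * x) = density lborel (normal_density 0 (sqrt b))"
    by (simp add: distributed_def)
  moreover have "distr std_normal_distribution borel (\<lambda>x. sqrt b * x) = distr std_normal_distribution lborel (\<lambda>x. sqrt b * x)"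
    by (rule distr_cong) auto
  ultimately show ?thesis using True by (simp add: gaussian_def)
next
  case False
  interpret real_distribution std_normal_distribution
    by (rule real_dist_normal_dist)
  have "distr std_normal_distribution borel (\<lambda>x. 0::real) = return borel 0"
    by (rule distr_const) simp
  then show ?thesis using False by (simp add: gaussian_def)
qed

lemma integral_gaussian:
  fixes f :: "real \<Rightarrow> 'b::{banach, second_countable_topology}"
  assumes "f \<in> borel_measurable borel"
  shows "(\<integral>x. f x \<partial>gaussian 0 b) = (\<integral>x. f (sqrt (max 0 b) * x) \<partial>std_normal_distribution)"
  unfolding gaussian_eq_distr by (subst integral_distr) (use assms in auto)

lemma gaussian_real_distribution: "real_distribution (gaussian 0 b)"
proof -
  interpret real_distribution std_normal_distribution
    by (rule real_dist_normal_dist)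
  show ?thesis unfolding gaussian_eq_distr by (rule real_distribution_distr) auto
qed

lemma gaussian_kernel_measurable:
  assumes "L \<in> borel_measurable M"
  shows "gaussian_kernel L \<in> measurable M (prob_algebra borel)"
proof -
  interpret real_distribution std_normal_distribution
    by (rule real_dist_normal_dist)
  have "(\<lambda>\<omega>. distr std_normal_distribution borel (\<lambda>x. sqrt (max 0 (L \<omega>)) * x)) \<in> measurable M (prob_algebra borel)"
  proof (rule measurable_distr_prob_space2[where M=borel])
    have "std_normal_distribution \<in> space (prob_algebra borel)"
      by (simp add: space_prob_algebra prob_space_axioms)
    then show "(\<lambda>\<omega>. std_normal_distribution) \<in> M \<rightarrow>\<^sub>M prob_algebra borel"
      by simp
    show "(\<lambda>(\<omega>, x). sqrt (max 0 (L \<omega>)) * x) \<in> M \<Otimes>\<^sub>M borel \<rightarrow>\<^sub>M borel"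
      using assms by measurable
  qed
  then show ?thesis unfolding gaussian_kernel_def gaussian_eq_distr .
qed

lemma kernelI:
  assumes "N \<in> measurable M (prob_algebra borel)"
  shows "kernel M N"
  unfolding kernel_def
proof (intro conjI ballI allI impI)
  fix \<omega> assume "\<omega> \<in> space M"
  then have "N \<omega> \<in> space (prob_algebra borel)"
    using assms by (rule measurable_space[rotated])
  then show "prob_space (N \<omega>)" "sets (N \<omega>) = sets borel"
    by (auto simp: space_prob_algebra)
next
  fix f :: "'b \<Rightarrow> real" assume "f \<in> borel_measurable borel"
  then show "(\<lambda>\<omega>. \<integral>x. f x \<partial>N \<omega>) \<in> borel_measurable M"
    using measurable_prob_algebraD[OF assms] by measurable
qed

lemma prod_kernel_measurable:
  fixes K :: "'a \<Rightarrow> 'b::second_countable_topology measure" and N :: "'a \<Rightarrow> 'c::second_countable_topology measure"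
  assumes "K \<in> measurable M (prob_algebra borel)" "N \<in> measurable M (prob_algebra borel)"
  shows "prod_kernel K N \<in> measurable M (prob_algebra borel)"
  unfolding prod_kernel_def borel_prod[symmetric]
  using assms by (rule measurable_pair_prob)

lemma char_gaussian: "char (gaussian 0 b) t = exp (- (t\<^sup>2 * max 0 b / 2))"
proof -
  have "char (gaussian 0 b) t = char std_normal_distribution (t * sqrt (max 0 b))"
    unfolding char_def by (subst integral_gaussian) (auto simp: mult.assoc)
  then show ?thesis
    by (simp add: char_std_normal_distribution power_mult_distrib)
qed

lemma integral_gaussian_bound:
  fixes f :: "real \<Rightarrow> real"
  assumes "f \<in> borel_measurable borel" "\<And>x. \<bar>f x\<bar> \<le> c"
  shows "\<bar>\<integral>x. f x \<partial>gaussian 0 b\<bar> \<le> c"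
proof -
  interpret real_distribution "gaussian 0 b" by (rule gaussian_real_distribution)
  have [measurable]: "f \<in> borel_measurable (gaussian 0 b)"
    using assms by simp
  have i: "integrable (gaussian 0 b) f"
    by (rule integrable_const_bound[where B=c]) (use assms in auto)
  have "\<bar>\<integral>x. f x \<partial>gaussian 0 b\<bar> \<le> (\<integral>x. \<bar>f x\<bar> \<partial>gaussian 0 b)"
    using integral_abs_bound by blast
  also have "\<dots> \<le> c"
    by (rule integral_le_const) (use assms i in auto)
  finally show ?thesis .
qed

lemma integral_gaussian_measurable [measurable]:
  fixes f :: "real \<Rightarrow> real"
  assumes "f \<in> borel_measurable borel"
  shows "(\<lambda>b. \<integral>x. f x \<partial>gaussian 0 b) \<in> borel_measurable borel"
proof -
  have "(\<lambda>b. gaussian 0 b) \<in> measurable borel (subprob_algebra borel)"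
    using gaussian_kernel_measurable[of "\<lambda>b. b" borel]
    by (auto simp: gaussian_kernel_def intro: measurable_prob_algebraD)
  then show ?thesis using assms by measurable
qed

lemma integral_gaussian_tendsto:
  fixes f :: "real \<Rightarrow> real"
  assumes f: "continuous_on UNIV f" "\<And>x. \<bar>f x\<bar> \<le> c" and b: "b \<longlonglongrightarrow> l"
  shows "(\<lambda>n. \<integral>x. f x \<partial>gaussian 0 (b n)) \<longlonglongrightarrow> (\<integral>x. f x \<partial>gaussian 0 l)"
proof -
  interpret real_distribution std_normal_distribution
    by (rule real_dist_normal_dist)
  have [measurable]: "f \<in> borel_measurable borel"
    using f(1) by (rule borel_measurable_continuous_onI)
  have "(\<lambda>n. \<integral>x. f (sqrt (max 0 (b n)) * x) \<partial>std_normal_distribution)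
      \<longlonglongrightarrow> (\<integral>x. f (sqrt (max 0 l) * x) \<partial>std_normal_distribution)"
  proof (rule integral_dominated_convergence[where w="\<lambda>_. c"])
    show "AE x in std_normal_distribution. (\<lambda>n. f (sqrt (max 0 (b n)) * x)) \<longlonglongrightarrow> f (sqrt (max 0 l) * x)"
      by (intro AE_I2 continuous_on_tendsto_compose[OF f(1)] tendsto_intros b) auto
  qed (use f in auto)
  then show ?thesis by (simp add: integral_gaussian)
qed

text \<open>The reference laws change with \<open>n\<close> and may fail to converge, so Levy's
  theorem enters through subsequences. Tightness of \<open>\<nu>\<close> gives a limit law along a
  further subsequence, the difference of the characteristic functions carries it over to
  \<open>\<mu>\<close>, and a persistent gap between the integrals is excluded.\<close>

lemma char_diff_imp_integral_diff:
  fixes f :: "real \<Rightarrow> real"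
  assumes mu: "\<And>n. real_distribution (\<mu> n)" and nu: "tight \<nu>"
    and ch: "\<And>t. (\<lambda>n. char (\<mu> n) t - char (\<nu> n) t) \<longlonglongrightarrow> 0"
    and f: "continuous_on UNIV f" "\<And>x. \<bar>f x\<bar> \<le> c"
  shows "(\<lambda>n. (\<integral>x. f x \<partial>\<mu> n) - (\<integral>x. f x \<partial>\<nu> n)) \<longlonglongrightarrow> 0"
proof (rule ccontr)
  have cont: "isCont f x" for x
    using f(1) by (simp add: continuous_on_eq_continuous_at)
  assume "\<not> ?thesis"
  then obtain e where e: "e > 0" and
    ex: "\<forall>N. \<exists>n\<ge>N. n \<in> {n. \<not> norm ((\<integral>x. f x \<partial>\<mu> n) - (\<integral>x. f x \<partial>\<nu> n) - 0) < e}"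
    unfolding LIMSEQ_iff by blast
  have "infinite {n. \<not> norm ((\<integral>x. f x \<partial>\<mu> n) - (\<integral>x. f x \<partial>\<nu> n) - 0) < e}"
    unfolding infinite_nat_iff_unbounded_le using ex by blast
  from infinite_enumerate[OF this] obtain s :: "nat \<Rightarrow> nat" where s: "strict_mono s"
    "\<And>n. \<not> norm ((\<integral>x. f x \<partial>\<mu> (s n)) - (\<integral>x. f x \<partial>\<nu> (s n)) - 0) < e"
    by blast
  obtain r L where r: "strict_mono (r :: nat \<Rightarrow> nat)" and L: "real_distribution L"
    and w: "weak_conv_m (\<nu> \<circ> s \<circ> r) L"
    using tight_imp_convergent_subsubsequence[OF nu s(1)] by blast
  have nu': "real_distribution (\<nu> n)" for n
    using nu by (auto simp: tight_def)
  have "(\<lambda>n. char ((\<nu> \<circ> s \<circ> r) n) t) \<longlonglongrightarrow> char L t" for t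
    by (intro levy_continuity1 w L) (simp add: nu')
  moreover have "(\<lambda>n. char (\<mu> ((s \<circ> r) n)) t - char (\<nu> ((s \<circ> r) n)) t) \<longlonglongrightarrow> 0" for t
    using LIMSEQ_subseq_LIMSEQ[OF ch[of t] strict_mono_o[OF s(1) r]] by (simp add: o_def)
  ultimately have "(\<lambda>n. char ((\<mu> \<circ> s \<circ> r) n) t) \<longlonglongrightarrow> char L t" for t
    using tendsto_add[of "\<lambda>n. char ((\<nu> \<circ> s \<circ> r) n) t" "char L t" sequentially
        "\<lambda>n. char (\<mu> ((s \<circ> r) n)) t - char (\<nu> ((s \<circ> r) n)) t" 0] by simp
  then have w': "weak_conv_m (\<mu> \<circ> s \<circ> r) L"
    by (intro levy_continuity L) (simp_all add: mu)
  have "(\<lambda>n. \<integral>x. f x \<partial>(\<mu> \<circ> s \<circ> r) n) \<longlonglongrightarrow> (\<integral>x. f x \<partial>L)"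
    by (rule weak_conv_imp_integral_bdd_continuous_conv[where B=c]) (use mu L w' cont f in \<open>auto simp: o_def\<close>)
  moreover have "(\<lambda>n. \<integral>x. f x \<partial>(\<nu> \<circ> s \<circ> r) n) \<longlonglongrightarrow> (\<integral>x. f x \<partial>L)"
    by (rule weak_conv_imp_integral_bdd_continuous_conv[where B=c]) (use nu' L w cont f in \<open>auto simp: o_def\<close>)
  ultimately have "(\<lambda>n. (\<integral>x. f x \<partial>(\<mu> \<circ> s \<circ> r) n) - (\<integral>x. f x \<partial>(\<nu> \<circ> s \<circ> r) n)) \<longlonglongrightarrow> 0"
    using tendsto_diff by fastforce
  then show False
    using s(2) e unfolding LIMSEQ_iff by (metis comp_apply order_refl)
qed

section \<open>Averages and tails of real sequences\<close>

text \<open>Toeplitz's lemma. The indices below \<open>N\<close> contribute the fixed amount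
  \<open>c\<close>, which the diverging total weight outgrows; beyond \<open>N\<close> the deviation
  from \<open>l\<close> is at most \<open>e / 2\<close>.\<close>

lemma toeplitz_average:
  fixes w y :: "nat \<Rightarrow> real"
  assumes w: "\<And>k. w k \<ge> 0" and W: "filterlim (\<lambda>n. \<Sum>k<n. w k) at_top sequentially"
    and y: "y \<longlonglongrightarrow> l"
  shows "(\<lambda>n. (\<Sum>k<n. w k * y k) / (\<Sum>k<n. w k)) \<longlonglongrightarrow> l"
proof (rule LIMSEQ_I)
  fix e :: real assume e: "e > 0"
  obtain N where N: "\<And>k. k \<ge> N \<Longrightarrow> \<bar>y k - l\<bar> < e/2"
    using LIMSEQ_D[OF y, of "e/2"] e by auto
  define c where "c = (\<Sum>k<N. w k * \<bar>y k - l\<bar>)"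
  have "c \<ge> 0" unfolding c_def by (intro sum_nonneg) (use w in auto)
  \<comment> \<open>With this threshold \<open>c\<close> is below \<open>e / 2\<close> times the
    total weight, and the summand 1 keeps that weight positive when \<open>c = 0\<close>.\<close>
  obtain N' where N': "\<And>n. n \<ge> N' \<Longrightarrow> (\<Sum>k<n. w k) > 2 * c / e + 1"
    using W unfolding filterlim_at_top_dense eventually_sequentially by blast
  show "\<exists>no. \<forall>n\<ge>no. norm ((\<Sum>k<n. w k * y k) / (\<Sum>k<n. w k) - l) < e"
  proof (intro exI[of _ "max N N'"] allI impI)
    fix n assume n: "n \<ge> max N N'"
    let ?W = "\<Sum>k<n. w k"
    have W2: "?W > 2 * c / e + 1" using N' n by auto
    have "2 * c / e \<ge> 0" using \<open>c \<ge> 0\<close> e by simp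
    then have W0: "?W > 0" using W2 by linarith
    have "\<bar>(\<Sum>k<n. w k * y k) - l * ?W\<bar> = \<bar>\<Sum>k<n. w k * (y k - l)\<bar>"
      by (simp add: sum_distrib_left algebra_simps sum_subtractf)
    also have "\<dots> \<le> (\<Sum>k<n. w k * \<bar>y k - l\<bar>)"
      by (rule order_trans[OF sum_abs]) (simp add: abs_mult w)
    also have "\<dots> = c + (\<Sum>k\<in>{N..<n}. w k * \<bar>y k - l\<bar>)"
      unfolding c_def lessThan_atLeast0 by (rule sum.atLeastLessThan_concat[symmetric]) (use n in auto)
    also have "(\<Sum>k\<in>{N..<n}. w k * \<bar>y k - l\<bar>) \<le> (\<Sum>k\<in>{N..<n}. w k * (e/2))"
      by (intro sum_mono mult_left_mono w) (use N in \<open>auto intro: less_imp_le\<close>)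
    also have "\<dots> \<le> (\<Sum>k<n. w k * (e/2))"
      by (intro sum_mono2) (use w e in auto)
    also have "\<dots> = ?W * (e/2)" by (simp add: sum_distrib_right)
    finally have "\<bar>(\<Sum>k<n. w k * y k) - l * ?W\<bar> \<le> c + ?W * (e/2)" by simp
    moreover have "c < ?W * (e/2)"
    proof -
      have "2 * c / e < ?W" using W2 by linarith
      then show ?thesis using e by (simp add: field_simps)
    qed
    ultimately have "\<bar>(\<Sum>k<n. w k * y k) - l * ?W\<bar> < e * ?W" by (simp add: field_simps)
    moreover have "(\<Sum>k<n. w k * y k) / ?W - l = ((\<Sum>k<n. w k * y k) - l * ?W) / ?W"
      using W0 by (simp add: field_simps)
    ultimately show "norm ((\<Sum>k<n. w k * y k) / ?W - l) < e"
      using W0 by (simp add: pos_divide_less_eq)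
  qed
qed

lemma cesaro_average:
  fixes y :: "nat \<Rightarrow> real"
  assumes "y \<longlonglongrightarrow> l"
  shows "(\<lambda>n. (\<Sum>k<n. y k) / real n) \<longlonglongrightarrow> l"
  using toeplitz_average[of "\<lambda>_. 1" y l] assms
  by (simp add: filterlim_real_sequentially)

text \<open>The weights \<open>sqrt (k + 1) - sqrt k\<close> add up to \<open>sqrt n\<close>. By the
  difference of two squares, dividing \<open>x k\<close> by its weight means multiplying it by
  \<open>sqrt (k + 1) + sqrt k\<close>, which is at most \<open>2 * sqrt (k + 1)\<close>.\<close>

lemma sqrt_average:
  fixes x :: "nat \<Rightarrow> real"
  assumes "(\<lambda>k. sqrt (real (Suc k)) * x k) \<longlonglongrightarrow> 0"
  shows "(\<lambda>n. (\<Sum>k<n. x k) / sqrt (real n)) \<longlonglongrightarrow> 0"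
proof -
  define w where "w k = sqrt (real (Suc k)) - sqrt (real k)" for k
  define y where "y k = x k * (sqrt (real (Suc k)) + sqrt (real k))" for k
  have W: "(\<Sum>k<n. w k) = sqrt (real n)" for n
    unfolding w_def by (induction n) auto
  have "w k * y k = x k" for k
  proof -
    have *: "(a - b) * (z * (a + b)) = z * (a\<^sup>2 - b\<^sup>2)" for a b z :: real
      by (simp add: algebra_simps power2_eq_square)
    have "w k * y k = x k * (real (Suc k) - real k)"
      unfolding w_def y_def * by (simp only: real_sqrt_pow2 of_nat_0_le_iff)
    then show ?thesis by simp
  qed
  moreover have "y \<longlonglongrightarrow> 0"
  proof (rule tendsto_0_le[OF assms, of _ 2])
    have "\<bar>y k\<bar> \<le> \<bar>sqrt (real (Suc k)) * x k\<bar> * 2" for k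
    proof -
      have "\<bar>sqrt (real (Suc k)) + sqrt (real k)\<bar> \<le> 2 * sqrt (real (Suc k))" by simp
      then have "\<bar>x k\<bar> * \<bar>sqrt (real (Suc k)) + sqrt (real k)\<bar> \<le> \<bar>x k\<bar> * (2 * sqrt (real (Suc k)))"
        by (intro mult_left_mono) auto
      then show ?thesis unfolding y_def by (simp add: abs_mult mult_ac)
    qed
    then show "\<forall>\<^sub>F k in sequentially. norm (y k) \<le> norm (sqrt (real (Suc k)) * x k) * 2"
      by simp
  qed
  moreover have "filterlim (\<lambda>n. sqrt (real n)) at_top sequentially"
    by real_asymp
  ultimately show ?thesis
    using toeplitz_average[of w y 0] W by (simp add: w_def)
qed

text \<open>The counterpart of Toeplitz's lemma for tails: the weights telescope, so the tail from
  \<open>n\<close> has mass \<open>g n\<close>. The conditions start at \<open>k = 1\<close> because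
  the intended \<open>g\<close> are inverse powers, for which \<open>g 0\<close> is the value 0 of a
  division by zero.\<close>

lemma tail_average:
  fixes w y g :: "nat \<Rightarrow> real"
  assumes w: "\<And>k. k \<ge> 1 \<Longrightarrow> w k \<ge> 0" "\<And>k. k \<ge> 1 \<Longrightarrow> w k = g k - g (Suc k)"
    and g: "\<And>k. k \<ge> 1 \<Longrightarrow> g k > 0" "g \<longlonglongrightarrow> 0" and y: "y \<longlonglongrightarrow> l"
  shows "summable (\<lambda>k. w k * y k)"
    and "(\<lambda>n. (\<Sum>k. w (k + n) * y (k + n)) / g n) \<longlonglongrightarrow> l"
proof -
  have sw: "(\<lambda>k. w (k + n)) sums g n" if "n \<ge> 1" for n
  proof -
    have "(\<lambda>k. g (k + n) - g (Suc k + n)) sums (g (0 + n) - 0)"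
      by (rule telescope_sums'[of "\<lambda>k. g (k + n)"]) (rule LIMSEQ_ignore_initial_segment[OF g(2)])
    moreover have "(\<lambda>k. w (k + n)) = (\<lambda>k. g (k + n) - g (Suc k + n))"
    proof
      show "w (k + n) = g (k + n) - g (Suc k + n)" for k
        using w(2)[of "k + n"] that by simp
    qed
    ultimately show ?thesis by simp
  qed
  obtain C where C: "\<And>k. \<bar>y k\<bar> \<le> C"
  proof -
    have "Bseq y" using y by (intro convergent_imp_Bseq) (rule convergentI)
    then show ?thesis using that by (metis BseqE real_norm_def)
  qed
  have "summable (\<lambda>k. w (k + 1) * y (k + 1))"
  proof (rule summable_comparison_test')
    show "summable (\<lambda>k. w (k + 1) * C)"
      using sw[of 1] by (intro summable_mult2) (auto simp: sums_iff)
    show "norm (w (k + 1) * y (k + 1)) \<le> w (k + 1) * C" for k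
      using w(1)[of "k + 1"] C[of "k + 1"] by (simp add: abs_mult mult_left_mono)
  qed
  then show sm: "summable (\<lambda>k. w k * y k)"
    by (subst (asm) summable_iff_shift)
  show "(\<lambda>n. (\<Sum>k. w (k + n) * y (k + n)) / g n) \<longlonglongrightarrow> l"
  proof (rule LIMSEQ_I)
    fix e :: real assume e: "e > 0"
    obtain N where N: "\<And>k. k \<ge> N \<Longrightarrow> \<bar>y k - l\<bar> < e/2"
      using LIMSEQ_D[OF y, of "e/2"] e by auto
    show "\<exists>no. \<forall>n\<ge>no. norm ((\<Sum>k. w (k + n) * y (k + n)) / g n - l) < e"
    proof (intro exI[of _ "max N 1"] allI impI)
      fix n assume n: "n \<ge> max N 1"
      have sm': "summable (\<lambda>k. w (k + n) * y (k + n))"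
        using sm by (subst summable_iff_shift[of "\<lambda>k. w k * y k" n])
      have sn: "summable (\<lambda>k. w (k + n))" "(\<Sum>k. w (k + n)) = g n"
        using sw[of n] n by (auto simp: sums_iff)
      have "(\<Sum>k. w (k + n) * y (k + n)) - l * g n = (\<Sum>k. w (k + n) * y (k + n) - w (k + n) * l)"
        using suminf_diff[OF sm' summable_mult2[OF sn(1), of l]] suminf_mult2[OF sn(1), of l] sn(2)
        by (simp add: mult.commute)
      also have "norm \<dots> \<le> (\<Sum>k. w (k + n) * (e/2))"
      proof (rule norm_suminf_le)
        show "norm (w (k + n) * y (k + n) - w (k + n) * l) \<le> w (k + n) * (e / 2)" for k
        proof -
          have "norm (w (k + n) * y (k + n) - w (k + n) * l) = w (k + n) * \<bar>y (k + n) - l\<bar>"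
            using w(1)[of "k + n"] n by (simp add: abs_mult flip: right_diff_distrib)
          also have "\<dots> \<le> w (k + n) * (e / 2)"
            by (rule mult_left_mono) (use w(1)[of "k + n"] N[of "k + n"] n in auto)
          finally show ?thesis .
        qed
      qed (use sn in \<open>auto intro: summable_mult2\<close>)
      also have "\<dots> = g n * (e/2)"
        unfolding suminf_mult2[OF sn(1), symmetric] sn(2) ..
      finally have *: "\<bar>(\<Sum>k. w (k + n) * y (k + n)) - l * g n\<bar> \<le> g n * (e/2)"
        by simp
      have g0: "g n > 0" using g n by auto
      have "(\<Sum>k. w (k + n) * y (k + n)) / g n - l = ((\<Sum>k. w (k + n) * y (k + n)) - l * g n) / g n"
        using g0 by (simp add: field_simps)
      then have "norm ((\<Sum>k. w (k + n) * y (k + n)) / g n - l) \<le> e/2"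
        using * g0 by (simp add: pos_divide_le_eq mult.commute)
      then show "norm ((\<Sum>k. w (k + n) * y (k + n)) / g n - l) < e" using e by linarith
    qed
  qed
qed

text \<open>The case \<open>g k = 1 / sqrt k\<close> of \<open>tail_average\<close>, whose weights
  are asymptotic to \<open>1 / (2 * k * sqrt k)\<close>; this is the source of the limit 2 in the
  proof.\<close>

lemma sqrt_tail:
  fixes x :: "nat \<Rightarrow> real"
  assumes "(\<lambda>k. real (Suc k) * sqrt (real (Suc k)) * x k) \<longlonglongrightarrow> 0"
  shows "summable x" and "(\<lambda>n. sqrt (real n) * (\<Sum>k. x (k + n))) \<longlonglongrightarrow> 0"
proof -
  define g where "g k = 1 / sqrt (real k)" for k
  define w where "w k = g k - g (Suc k)" for k
  define y where "y k = x k / w k" for k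
  have g: "g k > 0" if "k \<ge> 1" for k unfolding g_def using that by simp
  have w: "w k > 0" if "k \<ge> 1" for k
    unfolding w_def g_def using that by (simp add: field_simps)
  have g0: "g \<longlonglongrightarrow> 0" unfolding g_def by real_asymp
  have "y = (\<lambda>k. real (Suc k) * sqrt (real (Suc k)) * x k * (1 / (real (Suc k) * sqrt (real (Suc k)) * w k)))"
    by (auto simp: y_def fun_eq_iff)
  moreover have "(\<lambda>k. 1 / (real (Suc k) * sqrt (real (Suc k)) * w k)) \<longlonglongrightarrow> 2"
    unfolding w_def g_def by real_asymp
  ultimately have y: "y \<longlonglongrightarrow> 0" using tendsto_mult[OF assms] by fastforce
  have wy: "w k * y k = x k" if "k \<ge> 1" for k
    using w[OF that] by (simp add: y_def)
  have t: "summable (\<lambda>k. w k * y k)" "(\<lambda>n. (\<Sum>k. w (k + n) * y (k + n)) / g n) \<longlonglongrightarrow> 0"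
    using tail_average[of w g y 0] w g g0 y by (auto simp: w_def less_imp_le)
  show "summable x"
    by (subst summable_cong[where g="\<lambda>k. w k * y k"]) (auto simp: t(1) wy eventually_sequentially intro!: exI[of _ 1])
  show "(\<lambda>n. sqrt (real n) * (\<Sum>k. x (k + n))) \<longlonglongrightarrow> 0"
  proof (rule Lim_transform_eventually[OF t(2)])
    show "\<forall>\<^sub>F n in sequentially. (\<Sum>k. w (k + n) * y (k + n)) / g n = sqrt (real n) * (\<Sum>k. x (k + n))"
      by (rule eventually_sequentiallyI[of 1]) (simp add: wy g_def mult.commute)
  qed
qed

text \<open>The case \<open>g k = 1 / k\<close> of \<open>tail_average\<close>: the weights are
  \<open>1 / (k * (k + 1))\<close>, so multiplying them by \<open>(k + 1)^2\<close> gives 1 in the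
  limit.\<close>

lemma square_tail:
  fixes v :: "nat \<Rightarrow> real"
  assumes "(\<lambda>k. (real (Suc k))\<^sup>2 * v k) \<longlonglongrightarrow> l"
  shows "(\<lambda>n. real n * (\<Sum>k. v (k + n))) \<longlonglongrightarrow> l"
proof -
  define g where "g k = 1 / real k" for k
  define w where "w k = g k - g (Suc k)" for k
  define y where "y k = v k / w k" for k
  have g: "g k > 0" if "k \<ge> 1" for k unfolding g_def using that by simp
  have w: "w k > 0" if "k \<ge> 1" for k
    unfolding w_def g_def using that by (simp add: frac_less2)
  have g0: "g \<longlonglongrightarrow> 0" unfolding g_def by real_asymp
  have "y = (\<lambda>k. (real (Suc k))\<^sup>2 * v k * (1 / ((real (Suc k))\<^sup>2 * w k)))"
    by (auto simp: y_def fun_eq_iff)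
  moreover have "(\<lambda>k. 1 / ((real (Suc k))\<^sup>2 * w k)) \<longlonglongrightarrow> 1"
    unfolding w_def g_def by real_asymp
  ultimately have y: "y \<longlonglongrightarrow> l" using tendsto_mult[OF assms] by fastforce
  have wy: "w k * y k = v k" if "k \<ge> 1" for k
    using w[OF that] by (simp add: y_def)
  have t: "(\<lambda>n. (\<Sum>k. w (k + n) * y (k + n)) / g n) \<longlonglongrightarrow> l"
    using tail_average[of w g y l] w g g0 y by (auto simp: w_def less_imp_le)
  show ?thesis
  proof (rule Lim_transform_eventually[OF t])
    show "\<forall>\<^sub>F n in sequentially. (\<Sum>k. w (k + n) * y (k + n)) / g n = real n * (\<Sum>k. v (k + n))"
      by (rule eventually_sequentiallyI[of 1]) (simp add: wy g_def mult.commute)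
  qed
qed

section \<open>Bounded martingale differences\<close>

lemma summable_square_inverse: "summable (\<lambda>k. (K / real (Suc k))\<^sup>2)"
proof -
  have "summable (\<lambda>k. K\<^sup>2 * inverse ((real (Suc k))\<^sup>2))"
    by (intro summable_mult inverse_power_summable[where 'a=real, of 2, THEN summable_Suc_iff[THEN iffD2]]) simp
  moreover have "(\<lambda>k. (K / real (Suc k))\<^sup>2) = (\<lambda>k. K\<^sup>2 * inverse ((real (Suc k))\<^sup>2))"
    by (simp only: power_divide) (simp only: divide_inverse)
  ultimately show ?thesis by (simp only:)
qed

locale filtered_prob_space = prob_space M for M :: "'a measure" +
  fixes F :: "nat \<Rightarrow> 'a measure"
  assumes subalg: "\<And>n. subalgebra M (F n)"
    and sets_Suc: "\<And>n. sets (F n) \<subseteq> sets (F (Suc n))"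
begin

lemma space_F [simp]: "space (F n) = space M"
  using subalg[of n] by (simp add: subalgebra_def)

lemma sets_mono: "n \<le> k \<Longrightarrow> sets (F n) \<subseteq> sets (F k)"
  by (induction k rule: dec_induct) (use sets_Suc in blast)+

lemma subalgebra_mono: "n \<le> k \<Longrightarrow> subalgebra (F k) (F n)"
  using sets_mono by (simp add: subalgebra_def)

lemma measurable_mono: "f \<in> measurable (F n) N \<Longrightarrow> n \<le> k \<Longrightarrow> f \<in> measurable (F k) N"
  using measurable_from_subalg[OF subalgebra_mono] by blast

lemma measurable_M: "f \<in> measurable (F n) N \<Longrightarrow> f \<in> measurable M N"
  using measurable_from_subalg[OF subalg] by blast

lemma sets_M: "H \<in> sets (F n) \<Longrightarrow> H \<in> sets M"
  using subalg[of n] by (auto simp: subalgebra_def)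

lemma integrable_bounded:
  fixes f :: "'a \<Rightarrow> 'b::{banach, second_countable_topology}"
  assumes "f \<in> borel_measurable M" "\<And>\<omega>. \<omega> \<in> space M \<Longrightarrow> norm (f \<omega>) \<le> c"
  shows "integrable M f"
  by (rule integrable_const_bound[where B=c]) (use assms in auto)

text \<open>Ville's inequality, with the supermartingale property tested on events. Stopping times
  are replaced by the increasing events \<open>H n\<close> that the level \<open>c\<close> has been
  reached by time \<open>n\<close>.\<close>

lemma maximal_inequality:
  fixes V :: "nat \<Rightarrow> 'a \<Rightarrow> real"
  assumes adapted: "\<And>n. V n \<in> borel_measurable (F n)" and int: "\<And>n. integrable M (V n)"
    and nonneg: "\<And>n \<omega>. \<omega> \<in> space M \<Longrightarrow> V n \<omega> \<ge> 0"
    and super: "\<And>n H. H \<in> sets (F n) \<Longrightarrow>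
      (\<integral>\<omega>. indicator H \<omega> * V (Suc n) \<omega> \<partial>M) \<le> (\<integral>\<omega>. indicator H \<omega> * V n \<omega> \<partial>M)"
    and c: "c > 0"
  shows "prob {\<omega>\<in>space M. \<exists>n. V n \<omega> \<ge> c} \<le> expectation (V 0) / c"
proof -
  define H where "H n = {\<omega>\<in>space M. \<exists>k\<le>n. V k \<omega> \<ge> c}" for n
  have HF: "H n \<in> sets (F n)" for n
  proof -
    have "{\<omega>\<in>space (F n). V k \<omega> \<ge> c} \<in> sets (F n)" if "k \<le> n" for k
      using measurable_mono[OF adapted that] by measurable
    then have "(\<Union>k\<in>{..n}. {\<omega>\<in>space (F n). V k \<omega> \<ge> c}) \<in> sets (F n)" by auto
    also have "(\<Union>k\<in>{..n}. {\<omega>\<in>space (F n). V k \<omega> \<ge> c}) = H n" by (auto simp: H_def)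
    finally show ?thesis .
  qed
  have H: "H n \<in> sets M" for n using HF sets_M by blast
  have [measurable]: "V n \<in> borel_measurable M" for n using int by auto
  have ii: "integrable M (\<lambda>\<omega>. indicator A \<omega> * V n \<omega>)" if "A \<in> sets M" for A n
    using integrable_mult_indicator[OF that int[of n]] by simp
  have ic: "integrable M (\<lambda>\<omega>. indicator A \<omega> * c)" if "A \<in> sets M" for A
    by (rule integrable_bounded[where c=c]) (use that c in \<open>auto simp: indicator_def\<close>)
  \<comment> \<open>Each path that has reached the level is charged the amount \<open>c\<close>,
    every other path its current value. The total cannot grow: outside \<open>H n\<close> the
    process is a supermartingale in mean, and on the newly stopped part \<open>V (Suc n)\<close> is
    at least \<open>c\<close>.\<close>
  have main: "c * prob (H n) + (\<integral>\<omega>. indicator (space M - H n) \<omega> * V n \<omega> \<partial>M) \<le> expectation (V 0)" for n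
  proof (induction n)
    case 0
    have "c * prob (H 0) = (\<integral>\<omega>. indicator (H 0) \<omega> * c \<partial>M)" using H by simp
    also have "\<dots> \<le> (\<integral>\<omega>. indicator (H 0) \<omega> * V 0 \<omega> \<partial>M)"
      by (intro integral_mono ii ic H) (auto simp: H_def indicator_def)
    finally have "c * prob (H 0) + (\<integral>\<omega>. indicator (space M - H 0) \<omega> * V 0 \<omega> \<partial>M) \<le>
      (\<integral>\<omega>. indicator (H 0) \<omega> * V 0 \<omega> + indicator (space M - H 0) \<omega> * V 0 \<omega> \<partial>M)"
      using ii[OF H, of 0 0] ii[of "space M - H 0" 0] H by simp
    also have "\<dots> = expectation (V 0)"
      by (intro Bochner_Integration.integral_cong) (auto simp: indicator_def)
    finally show ?case .
  next
    case (Suc n)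
    define D where "D = H (Suc n) - H n"
    have D: "D \<in> sets M" unfolding D_def using H by auto
    have sub: "H n \<subseteq> H (Suc n)" unfolding H_def by (auto intro: le_SucI)
    have "prob (H (Suc n)) = prob (H n) + prob D"
      unfolding D_def using finite_measure_Diff[OF H H sub] by simp
    moreover have "c * prob D + (\<integral>\<omega>. indicator (space M - H (Suc n)) \<omega> * V (Suc n) \<omega> \<partial>M)
      \<le> (\<integral>\<omega>. indicator (space M - H n) \<omega> * V n \<omega> \<partial>M)"
    proof -
      have "c * prob D = (\<integral>\<omega>. indicator D \<omega> * c \<partial>M)" using D by simp
      also have "\<dots> \<le> (\<integral>\<omega>. indicator D \<omega> * V (Suc n) \<omega> \<partial>M)"
        by (intro integral_mono ii ic D)
          (auto simp: D_def H_def indicator_def le_Suc_eq)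
      finally have "c * prob D + (\<integral>\<omega>. indicator (space M - H (Suc n)) \<omega> * V (Suc n) \<omega> \<partial>M)
        \<le> (\<integral>\<omega>. indicator D \<omega> * V (Suc n) \<omega> + indicator (space M - H (Suc n)) \<omega> * V (Suc n) \<omega> \<partial>M)"
        using ii[OF D, of "Suc n"] ii[of "space M - H (Suc n)" "Suc n"] H by simp
      also have "\<dots> = (\<integral>\<omega>. indicator (space M - H n) \<omega> * V (Suc n) \<omega> \<partial>M)"
        by (intro Bochner_Integration.integral_cong) (use sub in \<open>auto simp: indicator_def D_def\<close>)
      also have "\<dots> \<le> (\<integral>\<omega>. indicator (space M - H n) \<omega> * V n \<omega> \<partial>M)"
        by (rule super) (use sets.compl_sets[OF HF, of n] in simp)
      finally show ?thesis .
    qed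
    ultimately show ?case using Suc.IH by (simp add: algebra_simps)
  qed
  have "prob (H n) \<le> expectation (V 0) / c" for n
  proof -
    have "(\<integral>\<omega>. indicator (space M - H n) \<omega> * V n \<omega> \<partial>M) \<ge> 0"
      by (intro Bochner_Integration.integral_nonneg_AE AE_I2) (auto simp: nonneg)
    then show ?thesis using main[of n] c by (simp add: field_simps)
  qed
  moreover have lim: "(\<lambda>n. prob (H n)) \<longlonglongrightarrow> prob (\<Union>n. H n)"
    by (rule finite_Lim_measure_incseq) (use H in \<open>auto simp: incseq_def H_def intro: order_trans\<close>)
  moreover have "(\<Union>n. H n) = {\<omega>\<in>space M. \<exists>n. V n \<omega> \<ge> c}" by (auto simp: H_def)
  ultimately show ?thesis using LIMSEQ_le_const2[OF lim, of "expectation (V 0) / c"] by auto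
qed

text \<open>The probability of reaching the level \<open>Suc c\<close> is at most the initial mean
  over \<open>Suc c\<close>; let \<open>c\<close> grow.\<close>

lemma AE_bounded:
  fixes V :: "nat \<Rightarrow> 'a \<Rightarrow> real"
  assumes adapted: "\<And>n. V n \<in> borel_measurable (F n)" and int: "\<And>n. integrable M (V n)"
    and nonneg: "\<And>n \<omega>. \<omega> \<in> space M \<Longrightarrow> V n \<omega> \<ge> 0"
    and super: "\<And>n H. H \<in> sets (F n) \<Longrightarrow>
      (\<integral>\<omega>. indicator H \<omega> * V (Suc n) \<omega> \<partial>M) \<le> (\<integral>\<omega>. indicator H \<omega> * V n \<omega> \<partial>M)"
  shows "AE \<omega> in M. \<exists>c. \<forall>n. V n \<omega> \<le> c"
proof -
  have [measurable]: "V n \<in> borel_measurable M" for n using int by auto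
  let ?B = "{\<omega>\<in>space M. \<forall>c::nat. \<exists>n. V n \<omega> \<ge> real (Suc c)}"
  have B: "?B \<in> sets M" by measurable
  have "prob ?B \<le> expectation (V 0) / real (Suc c)" for c
  proof -
    have "prob ?B \<le> prob {\<omega>\<in>space M. \<exists>n. V n \<omega> \<ge> real (Suc c)}"
      by (intro finite_measure_mono) auto
    also have "\<dots> \<le> expectation (V 0) / real (Suc c)"
      by (rule maximal_inequality) (use assms in auto)
    finally show ?thesis .
  qed
  moreover have "(\<lambda>c. expectation (V 0) / real (Suc c)) \<longlonglongrightarrow> 0"
    by (rule LIMSEQ_Suc[OF lim_const_over_n])
  ultimately have "prob ?B \<le> 0"
    by (intro LIMSEQ_le_const) auto
  then have "prob ?B = 0" using measure_nonneg[of M ?B] by linarith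
  then have "AE \<omega> in M. \<omega> \<notin> ?B"
    using B by (intro AE_not_in) (auto simp: null_sets_def emeasure_eq_measure)
  then show ?thesis
    using AE_space
  proof eventually_elim
    case (elim \<omega>)
    then obtain c :: nat where "\<And>n. V n \<omega> < real (Suc c)" by (auto simp: not_le)
    then show ?case by (intro exI[of _ "real (Suc c)"]) (auto intro: less_imp_le)
  qed
qed

text \<open>A sequence is indexed by the time at which it is predicted: \<open>\<xi> n\<close> is known at time \<open>Suc n\<close>
  and centred given \<open>F n\<close>. Centring and conditional variances are tested against bounded
  \<open>F n\<close>-measurable functions.\<close>

definition mart_diff :: "(nat \<Rightarrow> 'a \<Rightarrow> real) \<Rightarrow> (nat \<Rightarrow> real) \<Rightarrow> bool" where
  "mart_diff \<xi> b \<longleftrightarrow> (\<forall>n. \<xi> n \<in> borel_measurable (F (Suc n))) \<and>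
     (\<forall>n. \<forall>\<omega>\<in>space M. \<bar>\<xi> n \<omega>\<bar> \<le> b n) \<and>
     (\<forall>n W c. W \<in> borel_measurable (F n) \<longrightarrow> (\<forall>\<omega>\<in>space M. \<bar>W \<omega>\<bar> \<le> c) \<longrightarrow>
        (\<integral>\<omega>. W \<omega> * \<xi> n \<omega> \<partial>M) = 0)"

definition cond_var :: "(nat \<Rightarrow> 'a \<Rightarrow> real) \<Rightarrow> (nat \<Rightarrow> 'a \<Rightarrow> real) \<Rightarrow> bool" where
  "cond_var \<xi> v \<longleftrightarrow> (\<forall>n. v n \<in> borel_measurable (F n)) \<and>
     (\<forall>n W c. W \<in> borel_measurable (F n) \<longrightarrow> (\<forall>\<omega>\<in>space M. \<bar>W \<omega>\<bar> \<le> c) \<longrightarrow>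
        (\<integral>\<omega>. W \<omega> * (\<xi> n \<omega>)\<^sup>2 \<partial>M) = (\<integral>\<omega>. W \<omega> * v n \<omega> \<partial>M))"

text \<open>A second moment argument with deterministic bounds: the squared partial sums that start
  at \<open>N\<close> stay small with probability tending to 1 as \<open>N\<close> grows, so almost
  every sequence of partial sums is Cauchy.\<close>

lemma mart_diff_summable:
  assumes md: "mart_diff \<xi> b" and b: "summable (\<lambda>n. (b n)\<^sup>2)"
  shows "AE \<omega> in M. summable (\<lambda>n. \<xi> n \<omega>)"
proof -
  have xF: "\<xi> n \<in> borel_measurable (F (Suc n))" for n
    using md unfolding mart_diff_def by blast
  have xb: "\<omega> \<in> space M \<Longrightarrow> \<bar>\<xi> n \<omega>\<bar> \<le> b n" for n \<omega>
    using md unfolding mart_diff_def by blast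
  have x0: "W \<in> borel_measurable (F n) \<Longrightarrow> (\<And>\<omega>. \<omega> \<in> space M \<Longrightarrow> \<bar>W \<omega>\<bar> \<le> c) \<Longrightarrow>
        (\<integral>\<omega>. W \<omega> * \<xi> n \<omega> \<partial>M) = 0" for W n c
    using md unfolding mart_diff_def by blast+
  have [measurable]: "\<xi> n \<in> borel_measurable M" for n using xF measurable_M by blast
  have b0: "b n \<ge> 0" for n
  proof -
    obtain \<omega> where "\<omega> \<in> space M" using not_empty by blast
    then show ?thesis using xb[of \<omega> n] by linarith
  qed
  define r where "r N = (\<Sum>l. (b (l + N))\<^sup>2)" for N
  have sN: "summable (\<lambda>l. (b (l + N))\<^sup>2)" for N using b by (subst summable_iff_shift)
  have r0: "r N \<ge> 0" for N unfolding r_def by (intro suminf_nonneg sN) auto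
  have rS: "r N = (b N)\<^sup>2 + r (Suc N)" for N
    unfolding r_def using suminf_split_head[OF sN[of N]] by simp
  have rlim: "r \<longlonglongrightarrow> 0" unfolding r_def using suminf_exist_split2[OF b] .
  have max: "prob {\<omega>\<in>space M. \<exists>n. (\<Sum>k<n. \<xi> (k + N) \<omega>)\<^sup>2 \<ge> e} \<le> r N / e" if e: "e > 0" for N e
  proof -
    interpret N: filtered_prob_space M "\<lambda>n. F (n + N)"
      by unfold_locales (use subalg sets_Suc in auto)
    define S where "S n \<omega> = (\<Sum>k<n. \<xi> (k + N) \<omega>)" for n \<omega>
    \<comment> \<open>The square of a partial sum grows in mean by at most \<open>(b k)^2\<close>
      per step. Adding the remaining tail \<open>r\<close> of these bounds absorbs the growth, so
      that \<open>V\<close> is a nonnegative supermartingale with initial value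
      \<open>r N\<close>.\<close>
    define V where "V n \<omega> = (S n \<omega>)\<^sup>2 + r (n + N)" for n \<omega>
    have SF: "S n \<in> borel_measurable (F (n + N))" for n
      unfolding S_def by (intro borel_measurable_sum measurable_mono[OF xF]) auto
    have [measurable]: "S n \<in> borel_measurable M" for n using SF measurable_M by blast
    have Sb: "\<bar>S n \<omega>\<bar> \<le> (\<Sum>k<n. b (k + N))" if "\<omega> \<in> space M" for n \<omega>
      unfolding S_def by (rule order_trans[OF sum_abs sum_mono]) (rule xb[OF that])
    have S2b: "(S n \<omega>)\<^sup>2 \<le> (\<Sum>k<n. b (k + N))\<^sup>2" if "\<omega> \<in> space M" for n \<omega>
      using power_mono[OF Sb[OF that, of n], of 2] by simp
    have iS: "integrable M (\<lambda>\<omega>. W \<omega> * (S n \<omega>)\<^sup>2)" if "W \<in> borel_measurable M" "\<And>\<omega>. \<bar>W \<omega>\<bar> \<le> 1" for W n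
    proof (rule integrable_bounded)
      show "norm (W \<omega> * (S n \<omega>)\<^sup>2) \<le> 1 * (\<Sum>k<n. b (k + N))\<^sup>2" if w: "\<omega> \<in> space M" for \<omega>
        unfolding norm_mult using that \<open>\<And>\<omega>. \<bar>W \<omega>\<bar> \<le> 1\<close> S2b[OF w, of n] by (intro mult_mono) auto
    qed (use that in measurable)
    have le: "prob {\<omega>\<in>space M. \<exists>n. V n \<omega> \<ge> e} \<le> expectation (V 0) / e"
    proof (rule N.maximal_inequality)
      show "V n \<in> borel_measurable (F (n + N))" for n
        unfolding V_def using SF[of n] by measurable
      show "integrable M (V n)" for n
        unfolding V_def using iS[of "\<lambda>_. 1" n] by simp
      show "V n \<omega> \<ge> 0" for n \<omega> unfolding V_def using r0[of "n + N"] by simp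
      show "(\<integral>\<omega>. indicator H \<omega> * V (Suc n) \<omega> \<partial>M) \<le> (\<integral>\<omega>. indicator H \<omega> * V n \<omega> \<partial>M)"
        if H: "H \<in> sets (F (n + N))" for n H
      proof -
        have [measurable]: "H \<in> sets M" using H sets_M by blast
        \<comment> \<open>Twice the partial sum on \<open>H\<close>: the coefficient of the cross
          term in the new square, which centring annihilates.\<close>
        define W where "W \<omega> = 2 * (indicator H \<omega> * S n \<omega>)" for \<omega>
        have WF: "W \<in> borel_measurable (F (n + N))"
          unfolding W_def using H SF[of n] by measurable
        have Wb: "\<bar>W \<omega>\<bar> \<le> 2 * (\<Sum>k<n. b (k + N))" if "\<omega> \<in> space M" for \<omega>
          unfolding W_def using Sb[OF that, of n] by (auto simp: indicator_def)
        have [measurable]: "W \<in> borel_measurable M" using WF measurable_M by blast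
        have W0: "(\<integral>\<omega>. W \<omega> * \<xi> (n + N) \<omega> \<partial>M) = 0"
          by (rule x0[OF WF Wb])
        have iW: "integrable M (\<lambda>\<omega>. W \<omega> * \<xi> (n + N) \<omega>)"
          by (rule integrable_bounded[where c="2 * (\<Sum>k<n. b (k + N)) * b (n + N)"])
            (use Wb xb b0 in \<open>auto simp: abs_mult intro!: mult_mono sum_nonneg\<close>)
        have iV: "integrable M (\<lambda>\<omega>. indicator H \<omega> * V n \<omega>)" for n
        proof (rule integrable_bounded)
          show "norm (indicator H \<omega> * V n \<omega>) \<le> (\<Sum>k<n. b (k + N))\<^sup>2 + r (n + N)" if w: "\<omega> \<in> space M" for \<omega>
            using S2b[OF w, of n] r0[of "n + N"] by (auto simp: V_def indicator_def)
        qed (unfold V_def, measurable)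
        have "(\<integral>\<omega>. indicator H \<omega> * V (Suc n) \<omega> \<partial>M) \<le> (\<integral>\<omega>. indicator H \<omega> * V n \<omega> + W \<omega> * \<xi> (n + N) \<omega> \<partial>M)"
        proof (rule integral_mono[OF iV Bochner_Integration.integrable_add[OF iV iW]])
          fix \<omega> assume w: "\<omega> \<in> space M"
          have "(\<xi> (n + N) \<omega>)\<^sup>2 \<le> (b (n + N))\<^sup>2"
            using power_mono[OF xb[OF w, of "n + N"], of 2] by simp
          then show "indicator H \<omega> * V (Suc n) \<omega> \<le> indicator H \<omega> * V n \<omega> + W \<omega> * \<xi> (n + N) \<omega>"
            using rS[of "n + N"]
            by (auto simp: V_def W_def S_def indicator_def power2_eq_square algebra_simps)
        qed
        also have "\<dots> = (\<integral>\<omega>. indicator H \<omega> * V n \<omega> \<partial>M)"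
          using iV iW W0 by simp
        finally show ?thesis .
      qed
    qed (use e in auto)
    have V0: "expectation (V 0) = r N" unfolding V_def S_def by (simp add: prob_space)
    have "prob {\<omega>\<in>space M. \<exists>n. (S n \<omega>)\<^sup>2 \<ge> e} \<le> prob {\<omega>\<in>space M. \<exists>n. V n \<omega> \<ge> e}"
    proof (rule finite_measure_mono)
      show "{\<omega>\<in>space M. \<exists>n. V n \<omega> \<ge> e} \<in> sets M" unfolding V_def by measurable
      show "{\<omega>\<in>space M. \<exists>n. (S n \<omega>)\<^sup>2 \<ge> e} \<subseteq> {\<omega>\<in>space M. \<exists>n. V n \<omega> \<ge> e}"
        unfolding V_def using r0 by (auto intro: order_trans add_increasing2)
    qed
    from order_trans[OF this le] show ?thesis unfolding V0 S_def .
  qed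
  have ae: "AE \<omega> in M. \<exists>N. \<forall>n. (\<Sum>k<n. \<xi> (k + N) \<omega>)\<^sup>2 < e" if e: "e > 0" for e
  proof -
    let ?B = "{\<omega>\<in>space M. \<forall>N. \<exists>n. (\<Sum>k<n. \<xi> (k + N) \<omega>)\<^sup>2 \<ge> e}"
    have B: "?B \<in> sets M" by measurable
    have "prob ?B \<le> r N / e" for N
    proof -
      have "prob ?B \<le> prob {\<omega>\<in>space M. \<exists>n. (\<Sum>k<n. \<xi> (k + N) \<omega>)\<^sup>2 \<ge> e}"
        by (intro finite_measure_mono) auto
      also have "\<dots> \<le> r N / e" by (rule max[OF e])
      finally show ?thesis .
    qed
    moreover have "(\<lambda>N. r N / e) \<longlonglongrightarrow> 0 / e" by (intro tendsto_divide rlim) (use e in auto)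
    ultimately have "prob ?B \<le> 0 / e"
      by (intro LIMSEQ_le_const) auto
    then have "prob ?B = 0" using measure_nonneg[of M ?B] by simp
    then have "AE \<omega> in M. \<omega> \<notin> ?B"
      using B by (intro AE_not_in) (auto simp: null_sets_def emeasure_eq_measure)
    then show ?thesis using AE_space by eventually_elim (auto simp: not_le)
  qed
  have "AE \<omega> in M. \<forall>i::nat. \<exists>N. \<forall>n. (\<Sum>k<n. \<xi> (k + N) \<omega>)\<^sup>2 < (1 / real (Suc i))\<^sup>2"
    unfolding AE_all_countable by (intro allI ae) auto
  then show ?thesis
  proof eventually_elim
    case (elim \<omega>)
    have "Cauchy (\<lambda>n. \<Sum>k<n. \<xi> k \<omega>)"
    proof (rule metric_CauchyI)
      fix e :: real assume "e > 0"
      then obtain i where i: "1 / real (Suc i) < e / 2" using nat_approx_posE[of "e/2"] by auto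
      obtain N where N: "\<And>n. (\<Sum>k<n. \<xi> (k + N) \<omega>)\<^sup>2 < (1 / real (Suc i))\<^sup>2" using elim by blast
      have *: "\<bar>(\<Sum>k<n. \<xi> k \<omega>) - (\<Sum>k<N. \<xi> k \<omega>)\<bar> < e / 2" if "n \<ge> N" for n
      proof -
        have "(\<Sum>k<n. \<xi> k \<omega>) - (\<Sum>k<N. \<xi> k \<omega>) = (\<Sum>k<n-N. \<xi> (k + N) \<omega>)"
        proof -
          have "(\<Sum>k<n. \<xi> k \<omega>) = (\<Sum>k<N. \<xi> k \<omega>) + (\<Sum>k\<in>{N..<n}. \<xi> k \<omega>)"
            unfolding lessThan_atLeast0 by (rule sum.atLeastLessThan_concat[symmetric]) (use that in auto)
          also have "(\<Sum>k\<in>{N..<n}. \<xi> k \<omega>) = (\<Sum>k<n-N. \<xi> (k + N) \<omega>)"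
            using that sum.shift_bounds_nat_ivl[of "\<lambda>k. \<xi> k \<omega>" 0 N "n - N"] by (simp add: lessThan_atLeast0)
          finally show ?thesis by simp
        qed
        then have "\<bar>(\<Sum>k<n. \<xi> k \<omega>) - (\<Sum>k<N. \<xi> k \<omega>)\<bar> < 1 / real (Suc i)"
          using N[of "n - N"] by (simp add: abs_square_less_1 power2_less_imp_less[of "\<bar>_\<bar>"])
        then show ?thesis using i by linarith
      qed
      have "dist (\<Sum>k<m. \<xi> k \<omega>) (\<Sum>k<n. \<xi> k \<omega>) < e" if "m \<ge> N" "n \<ge> N" for m n
        unfolding dist_real_def using *[OF that(1)] *[OF that(2)] by arith
      then show "\<exists>N. \<forall>m\<ge>N. \<forall>n\<ge>N. dist (\<Sum>k<m. \<xi> k \<omega>) (\<Sum>k<n. \<xi> k \<omega>) < e" by blast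
    qed
    then show ?case by (simp add: summable_iff_convergent Cauchy_convergent_iff)
  qed
qed

section \<open>Characteristic functions of sums of martingale differences\<close>

lemma mart_diff_complex:
  fixes W :: "'a \<Rightarrow> complex"
  assumes md: "mart_diff \<xi> b" and W: "W \<in> borel_measurable (F n)" "\<And>\<omega>. \<omega> \<in> space M \<Longrightarrow> cmod (W \<omega>) \<le> c"
  shows "integrable M (\<lambda>\<omega>. W \<omega> * of_real (\<xi> n \<omega>))" "(\<integral>\<omega>. W \<omega> * of_real (\<xi> n \<omega>) \<partial>M) = 0"
proof -
  have [measurable]: "\<xi> n \<in> borel_measurable M" "W \<in> borel_measurable M"
    using md W(1) measurable_M unfolding mart_diff_def by blast+
  have xb: "\<omega> \<in> space M \<Longrightarrow> \<bar>\<xi> n \<omega>\<bar> \<le> b n" for \<omega>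
    using md unfolding mart_diff_def by blast
  show i: "integrable M (\<lambda>\<omega>. W \<omega> * of_real (\<xi> n \<omega>))"
  proof (rule integrable_bounded)
    show "norm (W \<omega> * of_real (\<xi> n \<omega>)) \<le> c * b n" if w: "\<omega> \<in> space M" for \<omega>
      unfolding norm_mult using W(2)[OF w] xb[OF w] by (intro mult_mono) (auto intro: order_trans[OF norm_ge_zero])
  qed measurable
  have *: "(\<lambda>\<omega>. Re (W \<omega>)) \<in> borel_measurable (F n)" "(\<lambda>\<omega>. Im (W \<omega>)) \<in> borel_measurable (F n)"
    using W(1) by measurable
  have bd: "\<forall>\<omega>\<in>space M. \<bar>Re (W \<omega>)\<bar> \<le> c" "\<forall>\<omega>\<in>space M. \<bar>Im (W \<omega>)\<bar> \<le> c"
    using W(2) order_trans[OF abs_Re_le_cmod] order_trans[OF abs_Im_le_cmod] by blast+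
  have "(\<integral>\<omega>. Re (W \<omega>) * \<xi> n \<omega> \<partial>M) = 0" "(\<integral>\<omega>. Im (W \<omega>) * \<xi> n \<omega> \<partial>M) = 0"
    using md *(1) bd(1) *(2) bd(2) unfolding mart_diff_def by blast+
  then show "(\<integral>\<omega>. W \<omega> * of_real (\<xi> n \<omega>) \<partial>M) = 0"
    using integral_Re[OF i] integral_Im[OF i] by (simp add: complex_eq_iff)
qed

lemma cond_var_complex:
  fixes W :: "'a \<Rightarrow> complex"
  assumes md: "mart_diff \<xi> b" and cv: "cond_var \<xi> v" and v: "\<And>\<omega>. \<omega> \<in> space M \<Longrightarrow> \<bar>v n \<omega>\<bar> \<le> B"
    and W: "W \<in> borel_measurable (F n)" "\<And>\<omega>. \<omega> \<in> space M \<Longrightarrow> cmod (W \<omega>) \<le> c"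
  shows "integrable M (\<lambda>\<omega>. W \<omega> * of_real ((\<xi> n \<omega>)\<^sup>2 - v n \<omega>))"
    "(\<integral>\<omega>. W \<omega> * of_real ((\<xi> n \<omega>)\<^sup>2 - v n \<omega>) \<partial>M) = 0"
proof -
  have [measurable]: "\<xi> n \<in> borel_measurable M" "W \<in> borel_measurable M" "v n \<in> borel_measurable M"
    using md cv W(1) measurable_M unfolding mart_diff_def cond_var_def by blast+
  have xb: "\<omega> \<in> space M \<Longrightarrow> \<bar>\<xi> n \<omega>\<bar> \<le> b n" for \<omega>
    using md unfolding mart_diff_def by blast
  have x2: "(\<xi> n \<omega>)\<^sup>2 \<le> (b n)\<^sup>2" if "\<omega> \<in> space M" for \<omega>
    using power_mono[OF xb[OF that], of 2] by simp
  have i1: "integrable M (\<lambda>\<omega>. W \<omega> * of_real ((\<xi> n \<omega>)\<^sup>2))"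
  proof (rule integrable_bounded)
    show "norm (W \<omega> * of_real ((\<xi> n \<omega>)\<^sup>2)) \<le> c * (b n)\<^sup>2" if w: "\<omega> \<in> space M" for \<omega>
      unfolding norm_mult using W(2)[OF w] x2[OF w] by (intro mult_mono) (auto simp: norm_power intro: order_trans[OF norm_ge_zero])
  qed measurable
  have i2: "integrable M (\<lambda>\<omega>. W \<omega> * of_real (v n \<omega>))"
  proof (rule integrable_bounded)
    show "norm (W \<omega> * of_real (v n \<omega>)) \<le> c * B" if w: "\<omega> \<in> space M" for \<omega>
      unfolding norm_mult using W(2)[OF w] v[OF w] by (intro mult_mono) (auto intro: order_trans[OF norm_ge_zero])
  qed measurable
  show "integrable M (\<lambda>\<omega>. W \<omega> * of_real ((\<xi> n \<omega>)\<^sup>2 - v n \<omega>))"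
    using Bochner_Integration.integrable_diff[OF i1 i2] by (simp add: algebra_simps)
  have *: "(\<lambda>\<omega>. Re (W \<omega>)) \<in> borel_measurable (F n)" "(\<lambda>\<omega>. Im (W \<omega>)) \<in> borel_measurable (F n)"
    using W(1) by measurable
  have bd: "\<forall>\<omega>\<in>space M. \<bar>Re (W \<omega>)\<bar> \<le> c" "\<forall>\<omega>\<in>space M. \<bar>Im (W \<omega>)\<bar> \<le> c"
    using W(2) order_trans[OF abs_Re_le_cmod] order_trans[OF abs_Im_le_cmod] by blast+
  have "(\<integral>\<omega>. Re (W \<omega>) * (\<xi> n \<omega>)\<^sup>2 \<partial>M) = (\<integral>\<omega>. Re (W \<omega>) * v n \<omega> \<partial>M)"
    "(\<integral>\<omega>. Im (W \<omega>) * (\<xi> n \<omega>)\<^sup>2 \<partial>M) = (\<integral>\<omega>. Im (W \<omega>) * v n \<omega> \<partial>M)"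
    using cv *(1) bd(1) *(2) bd(2) unfolding cond_var_def by blast+
  then have "(\<integral>\<omega>. W \<omega> * of_real ((\<xi> n \<omega>)\<^sup>2) \<partial>M) = (\<integral>\<omega>. W \<omega> * of_real (v n \<omega>) \<partial>M)"
    using integral_Re[OF i1] integral_Im[OF i1] integral_Re[OF i2] integral_Im[OF i2]
    by (simp add: complex_eq_iff flip: of_real_power)
  then show "(\<integral>\<omega>. W \<omega> * of_real ((\<xi> n \<omega>)\<^sup>2 - v n \<omega>) \<partial>M) = 0"
    using Bochner_Integration.integral_diff[OF i1 i2] by (simp add: algebra_simps)
qed

text \<open>Compensating each factor of the characteristic function by the conditional variance makes the
  expectation of the product nearly constant; no assumption on the limit of the variances is
  needed, which is why the limit may be random.\<close>

definition cf_term :: "(nat \<Rightarrow> 'a \<Rightarrow> real) \<Rightarrow> (nat \<Rightarrow> 'a \<Rightarrow> real) \<Rightarrow> real \<Rightarrow> nat \<Rightarrow> 'a \<Rightarrow> complex" where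
  "cf_term \<xi> v s k \<omega> = iexp (s * \<xi> k \<omega>) * of_real (exp (s\<^sup>2 / 2 * v k \<omega>))"

lemma prod_cf_term:
  "(\<Prod>k\<in>I. cf_term \<xi> v s k \<omega>) = iexp (s * (\<Sum>k\<in>I. \<xi> k \<omega>)) * of_real (exp (s\<^sup>2 / 2 * (\<Sum>k\<in>I. v k \<omega>)))"
  unfolding cf_term_def prod.distrib
  by (cases "finite I") (simp_all add: exp_sum[symmetric] sum_distrib_left flip: of_real_prod)

text \<open>Up to cubic terms a compensated factor has conditional mean
  \<open>exp x * (1 - x)\<close>, where \<open>x\<close> is the exponent of its compensator. The
  upper bound is \<open>1 - x \<le> exp (- x)\<close>; the lower one combines
  \<open>exp x \<ge> 1 + x\<close> with \<open>(1 + x) * (1 - x + x^2) = 1 + x^3\<close>.\<close>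

lemma exp_one_minus_bounds:
  fixes x :: real assumes "x \<ge> 0"
  shows "\<bar>exp x * (1 - x) - 1\<bar> \<le> x\<^sup>2 * exp x"
proof -
  have a: "exp x * (1 - x) \<le> 1"
  proof -
    have "1 - x \<le> exp (- x)" using exp_ge_add_one_self[of "-x"] by simp
    then have "exp x * (1 - x) \<le> exp x * exp (- x)" by (intro mult_left_mono) auto
    then show ?thesis by (simp flip: exp_add)
  qed
  have "1 \<le> exp x * (1 - x + x\<^sup>2)"
  proof -
    have "(1 + x) * (1 - x + x\<^sup>2) = 1 + x ^ 3" by (simp add: algebra_simps power2_eq_square power3_eq_cube)
    moreover have "1 - x + x\<^sup>2 \<ge> 0"
      using zero_le_power2[of "x - 1/2"] by (simp add: power2_eq_square algebra_simps)
    moreover have "exp x \<ge> 1 + x" by (rule exp_ge_add_one_self)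
    ultimately show ?thesis using assms mult_right_mono[of "1 + x" "exp x" "1 - x + x\<^sup>2"] zero_le_power[of x 3] by linarith
  qed
  then show ?thesis using a by (simp add: algebra_simps)
qed

text \<open>One factor is peeled off at a time. Given the past, \<open>iexp (s * \<xi>)\<close> has
  mean \<open>1 - x\<close> up to a cubic error, where \<open>x = s^2 / 2 * v\<close>, and the
  compensator \<open>exp x\<close> restores 1 up to \<open>x^2 * exp x\<close>. The exponential in
  the bound controls the modulus of the product, the sum collects the errors of the factors.\<close>

lemma cf_prod_bound:
  fixes W :: "'a \<Rightarrow> complex" and s :: real
  assumes md: "mart_diff \<xi> b" and cv: "cond_var \<xi> v"
    and v: "\<And>n \<omega>. \<omega> \<in> space M \<Longrightarrow> 0 \<le> v n \<omega>" "\<And>n \<omega>. \<omega> \<in> space M \<Longrightarrow> v n \<omega> \<le> (b n)\<^sup>2"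
    and W: "W \<in> borel_measurable (F n)" "\<And>\<omega>. \<omega> \<in> space M \<Longrightarrow> cmod (W \<omega>) \<le> c" and nN: "n \<le> N"
  shows "cmod ((\<integral>\<omega>. W \<omega> * (\<Prod>k\<in>{n..<N}. cf_term \<xi> v s k \<omega>) \<partial>M) - (\<integral>\<omega>. W \<omega> \<partial>M)) \<le>
    c * exp (s\<^sup>2 / 2 * (\<Sum>k\<in>{n..<N}. (b k)\<^sup>2)) * (\<Sum>k\<in>{n..<N}. \<bar>s * b k\<bar> ^ 3 + \<bar>s * b k\<bar> ^ 4)"
  using nN
proof (induction N rule: dec_induct)
  case base
  then show ?case by simp
next
  case (step N)
  have xF: "\<xi> k \<in> borel_measurable (F (Suc k))" for k
    using md unfolding mart_diff_def by blast
  have xb: "\<omega> \<in> space M \<Longrightarrow> \<bar>\<xi> k \<omega>\<bar> \<le> b k" for k \<omega>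
    using md unfolding mart_diff_def by blast
  have vF: "v k \<in> borel_measurable (F k)" for k
    using cv unfolding cond_var_def by blast
  have c0: "c \<ge> 0"
  proof -
    obtain \<omega> where "\<omega> \<in> space M" using not_empty by blast
    then show ?thesis using W(2)[of \<omega>] norm_ge_zero[of "W \<omega>"] by linarith
  qed
  have b0: "b k \<ge> 0" for k
  proof -
    obtain \<omega> where "\<omega> \<in> space M" using not_empty by blast
    then show ?thesis using xb[of \<omega> k] by linarith
  qed
  define E where "E N = exp (s\<^sup>2 / 2 * (\<Sum>k\<in>{n..<N}. (b k)\<^sup>2))" for N
  define P where "P \<omega> = W \<omega> * (\<Prod>k\<in>{n..<N}. cf_term \<xi> v s k \<omega>)" for \<omega>
  define x where "x \<omega> = s\<^sup>2 / 2 * v N \<omega>" for \<omega>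
  define W' where "W' \<omega> = P \<omega> * of_real (exp (x \<omega>))" for \<omega>
  have PF: "P \<in> borel_measurable (F N)"
    unfolding P_def cf_term_def
  proof (intro borel_measurable_times borel_measurable_prod)
    show "W \<in> borel_measurable (F N)" using W(1) step(1) by (rule measurable_mono)
    fix k assume "k \<in> {n..<N}"
    then have [measurable]: "\<xi> k \<in> borel_measurable (F N)" "v k \<in> borel_measurable (F N)"
      using measurable_mono[OF xF, of k N] measurable_mono[OF vF, of k N] by auto
    show "(\<lambda>\<omega>. iexp (s * \<xi> k \<omega>)) \<in> borel_measurable (F N)" by measurable
    show "(\<lambda>\<omega>. complex_of_real (exp (s\<^sup>2 / 2 * v k \<omega>))) \<in> borel_measurable (F N)" by measurable
  qed
  have xFN: "x \<in> borel_measurable (F N)" unfolding x_def using vF[of N] by measurable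
  have W'F: "W' \<in> borel_measurable (F N)" unfolding W'_def using PF xFN by measurable
  have [measurable]: "W' \<in> borel_measurable M" "P \<in> borel_measurable M" "x \<in> borel_measurable M" "\<xi> N \<in> borel_measurable M"
    "v N \<in> borel_measurable M"
    using W'F PF xFN xF vF measurable_M by blast+
  have x0: "x \<omega> \<ge> 0" if "\<omega> \<in> space M" for \<omega> unfolding x_def using v(1)[OF that] by simp
  have xle: "x \<omega> \<le> s\<^sup>2 / 2 * (b N)\<^sup>2" if "\<omega> \<in> space M" for \<omega>
    unfolding x_def by (rule mult_left_mono[OF v(2)[OF that]]) simp
  have Pb: "cmod (P \<omega>) \<le> c * E N" if w: "\<omega> \<in> space M" for \<omega>
  proof -
    have "cmod (P \<omega>) = cmod (W \<omega>) * exp (s\<^sup>2 / 2 * (\<Sum>k\<in>{n..<N}. v k \<omega>))"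
      unfolding P_def prod_cf_term by (simp add: norm_mult)
    also have "\<dots> \<le> c * E N"
      unfolding E_def
      by (intro mult_mono W w c0) (auto intro!: mult_left_mono sum_mono v(2)[OF w])
    finally show ?thesis .
  qed
  have ES: "E (Suc N) = E N * exp (s\<^sup>2 / 2 * (b N)\<^sup>2)"
    unfolding E_def using step(1) by (simp add: exp_add[symmetric] distrib_left)
  have W'b: "cmod (W' \<omega>) \<le> c * E (Suc N)" if w: "\<omega> \<in> space M" for \<omega>
  proof -
    have "cmod (W' \<omega>) \<le> (c * E N) * exp (s\<^sup>2 / 2 * (b N)\<^sup>2)"
      unfolding W'_def norm_mult using Pb[OF w] xle[OF w] c0
      by (intro mult_mono) (auto simp: E_def)
    then show ?thesis unfolding ES by (simp add: mult.assoc)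
  qed
  have EE: "E N \<le> E (Suc N)" unfolding ES by (simp add: E_def)
  have iP: "integrable M P" by (rule integrable_bounded[OF _ Pb]) auto
  note o1 = mart_diff_complex[OF md W'F W'b]
  have vb: "\<omega> \<in> space M \<Longrightarrow> \<bar>v N \<omega>\<bar> \<le> (b N)\<^sup>2" for \<omega> using v by simp
  note o2 = cond_var_complex[OF md cv vb W'F W'b]
  let ?I = "\<lambda>\<omega>. W' \<omega> * iexp (s * \<xi> N \<omega>)"
  have iI: "integrable M ?I"
    by (rule integrable_bounded[where c="c * E (Suc N)"]) (use W'b in \<open>auto simp: norm_mult\<close>)
  \<comment> \<open>The first and second order terms of the expansion are subtracted. Their
    integrals vanish by centring and by the defining property of the conditional variance, so the
    integral is unchanged while the integrand becomes pointwise small.\<close>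
  let ?D = "\<lambda>\<omega>. ?I \<omega> - P \<omega> - \<i> * of_real s * (W' \<omega> * of_real (\<xi> N \<omega>))
        + of_real (s\<^sup>2 / 2) * (W' \<omega> * of_real ((\<xi> N \<omega>)\<^sup>2 - v N \<omega>))"
  have iD: "integrable M ?D"
    by (intro Bochner_Integration.integrable_diff Bochner_Integration.integrable_add integrable_mult_right iI iP o1(1) o2(1))
  have "(\<integral>\<omega>. ?D \<omega> \<partial>M) = (\<integral>\<omega>. ?I \<omega> \<partial>M) - (\<integral>\<omega>. P \<omega> \<partial>M)"
    using iI iP o1 o2 by simp
  moreover have "cmod (\<integral>\<omega>. ?D \<omega> \<partial>M) \<le> c * E (Suc N) * (\<bar>s * b N\<bar> ^ 3 + \<bar>s * b N\<bar> ^ 4)"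
  proof -
    have Db: "cmod (?D \<omega>) \<le> c * E (Suc N) * (\<bar>s * b N\<bar> ^ 3 + \<bar>s * b N\<bar> ^ 4)" if w: "\<omega> \<in> space M" for \<omega>
    proof -
      define y where "y = s * \<xi> N \<omega>"
      have yb: "\<bar>y\<bar> \<le> \<bar>s * b N\<bar>" unfolding y_def abs_mult
        by (rule mult_left_mono) (use xb[OF w, of N] in auto)
      have "?D \<omega> = W' \<omega> * (iexp y - (1 + \<i> * y + (\<i> * y)\<^sup>2 / 2)) + P \<omega> * of_real (exp (x \<omega>) * (1 - x \<omega>) - 1)"
        unfolding W'_def y_def x_def by (simp add: algebra_simps power2_eq_square)
      also have "cmod \<dots> \<le> cmod (W' \<omega>) * \<bar>y\<bar> ^ 3 + cmod (P \<omega>) * ((x \<omega>)\<^sup>2 * exp (x \<omega>))"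
      proof (intro norm_triangle_mono)
        have "cmod (iexp y - (1 + \<i> * y + (\<i> * y)\<^sup>2 / 2)) \<le> \<bar>y\<bar> ^ 3 / 6"
          using iexp_approx1[of y 2] by (simp add: numeral_eq_Suc fact_numeral)
        also have "\<dots> \<le> \<bar>y\<bar> ^ 3" by simp
        finally show "cmod (W' \<omega> * (iexp y - (1 + \<i> * y + (\<i> * y)\<^sup>2 / 2))) \<le> cmod (W' \<omega>) * \<bar>y\<bar> ^ 3"
          unfolding norm_mult by (intro mult_left_mono) auto
        show "cmod (P \<omega> * of_real (exp (x \<omega>) * (1 - x \<omega>) - 1)) \<le> cmod (P \<omega>) * ((x \<omega>)\<^sup>2 * exp (x \<omega>))"
          unfolding norm_mult norm_of_real using exp_one_minus_bounds[OF x0[OF w]] by (intro mult_left_mono) auto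
      qed
      \<comment> \<open>The factor \<open>exp (x \<omega>)\<close> is exactly what distinguishes
        \<open>W'\<close> from \<open>P\<close>, so both errors end up with the same weight.\<close>
      also have "cmod (P \<omega>) * ((x \<omega>)\<^sup>2 * exp (x \<omega>)) = cmod (W' \<omega>) * (x \<omega>)\<^sup>2"
        unfolding W'_def by (simp add: norm_mult)
      also have "cmod (W' \<omega>) * \<bar>y\<bar> ^ 3 + cmod (W' \<omega>) * (x \<omega>)\<^sup>2 \<le> c * E (Suc N) * \<bar>s * b N\<bar> ^ 3 + c * E (Suc N) * \<bar>s * b N\<bar> ^ 4"
      proof (intro add_mono mult_mono W'b w power_mono yb)
        have "(x \<omega>)\<^sup>2 \<le> (s\<^sup>2 / 2 * (b N)\<^sup>2)\<^sup>2" by (intro power_mono x0 xle w)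
        also have "\<dots> = \<bar>s * b N\<bar> ^ 4 / 4" by (simp add: power_mult_distrib power_divide flip: power_mult)
        also have "\<dots> \<le> \<bar>s * b N\<bar> ^ 4" by simp
        finally show "(x \<omega>)\<^sup>2 \<le> \<bar>s * b N\<bar> ^ 4" .
      qed (use c0 in \<open>auto simp: E_def\<close>)
      finally show ?thesis by (simp add: distrib_left)
    qed
    have "cmod (\<integral>\<omega>. ?D \<omega> \<partial>M) \<le> (\<integral>\<omega>. cmod (?D \<omega>) \<partial>M)" by (rule integral_norm_bound)
    also have "\<dots> \<le> c * E (Suc N) * (\<bar>s * b N\<bar> ^ 3 + \<bar>s * b N\<bar> ^ 4)"
      by (rule integral_le_const[OF integrable_norm[OF iD]]) (use Db in auto)
    finally show ?thesis .
  qed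
  ultimately have st: "cmod ((\<integral>\<omega>. ?I \<omega> \<partial>M) - (\<integral>\<omega>. P \<omega> \<partial>M)) \<le> c * E (Suc N) * (\<bar>s * b N\<bar> ^ 3 + \<bar>s * b N\<bar> ^ 4)"
    by simp
  have "(\<integral>\<omega>. W \<omega> * (\<Prod>k\<in>{n..<Suc N}. cf_term \<xi> v s k \<omega>) \<partial>M) = (\<integral>\<omega>. ?I \<omega> \<partial>M)"
    by (rule Bochner_Integration.integral_cong)
      (use step(1) in \<open>simp_all add: W'_def P_def x_def cf_term_def mult_ac\<close>)
  then have "cmod ((\<integral>\<omega>. W \<omega> * (\<Prod>k\<in>{n..<Suc N}. cf_term \<xi> v s k \<omega>) \<partial>M) - (\<integral>\<omega>. W \<omega> \<partial>M))
     \<le> cmod ((\<integral>\<omega>. ?I \<omega> \<partial>M) - (\<integral>\<omega>. P \<omega> \<partial>M)) + cmod ((\<integral>\<omega>. P \<omega> \<partial>M) - (\<integral>\<omega>. W \<omega> \<partial>M))"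
    using norm_triangle_ineq[of "(\<integral>\<omega>. ?I \<omega> \<partial>M) - (\<integral>\<omega>. P \<omega> \<partial>M)" "(\<integral>\<omega>. P \<omega> \<partial>M) - (\<integral>\<omega>. W \<omega> \<partial>M)"] by simp
  also have "\<dots> \<le> c * E (Suc N) * (\<bar>s * b N\<bar> ^ 3 + \<bar>s * b N\<bar> ^ 4) + c * E N * (\<Sum>k\<in>{n..<N}. \<bar>s * b k\<bar> ^ 3 + \<bar>s * b k\<bar> ^ 4)"
    using st step.IH unfolding P_def E_def by (intro add_mono) auto
  also have "\<dots> \<le> c * E (Suc N) * (\<bar>s * b N\<bar> ^ 3 + \<bar>s * b N\<bar> ^ 4) + c * E (Suc N) * (\<Sum>k\<in>{n..<N}. \<bar>s * b k\<bar> ^ 3 + \<bar>s * b k\<bar> ^ 4)"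
    by (intro add_left_mono mult_right_mono mult_left_mono EE c0 sum_nonneg) auto
  also have "\<dots> = c * E (Suc N) * (\<Sum>k\<in>{n..<Suc N}. \<bar>s * b k\<bar> ^ 3 + \<bar>s * b k\<bar> ^ 4)"
    using step(1) by (simp add: distrib_left)
  finally show ?case unfolding E_def .
qed

text \<open>The limit of \<open>cf_prod_bound\<close> as the upper end of the product tends to
  infinity. The bound \<open>B2\<close> is uniform in that end, and so supplies the constant for
  dominated convergence.\<close>

lemma cf_tail_bound:
  fixes W :: "'a \<Rightarrow> complex" and s :: real
  assumes md: "mart_diff \<xi> b" and cv: "cond_var \<xi> v"
    and v: "\<And>n \<omega>. \<omega> \<in> space M \<Longrightarrow> 0 \<le> v n \<omega>" "\<And>n \<omega>. \<omega> \<in> space M \<Longrightarrow> v n \<omega> \<le> (b n)\<^sup>2"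
    and W: "W \<in> borel_measurable (F n)" "\<And>\<omega>. \<omega> \<in> space M \<Longrightarrow> cmod (W \<omega>) \<le> c"
    and b: "summable (\<lambda>n. (b n)\<^sup>2)"
    and B: "\<And>N. (\<Sum>k\<in>{n..<N}. (b k)\<^sup>2) \<le> B2" "\<And>N. (\<Sum>k\<in>{n..<N}. \<bar>s * b k\<bar> ^ 3 + \<bar>s * b k\<bar> ^ 4) \<le> B3"
  shows "cmod ((\<integral>\<omega>. W \<omega> * (iexp (s * (\<Sum>k. \<xi> (k + n) \<omega>)) * of_real (exp (s\<^sup>2 / 2 * (\<Sum>k. v (k + n) \<omega>)))) \<partial>M)
      - (\<integral>\<omega>. W \<omega> \<partial>M)) \<le> c * exp (s\<^sup>2 / 2 * B2) * B3"
proof -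
  have xF: "\<xi> k \<in> borel_measurable (F (Suc k))" for k
    using md unfolding mart_diff_def by blast
  have vF: "v k \<in> borel_measurable (F k)" for k
    using cv unfolding cond_var_def by blast
  have [measurable]: "\<xi> k \<in> borel_measurable M" "v k \<in> borel_measurable M" "W \<in> borel_measurable M" for k
    using xF vF W(1) measurable_M by blast+
  have c0: "c \<ge> 0"
  proof -
    obtain \<omega> where "\<omega> \<in> space M" using not_empty by blast
    then show ?thesis using W(2)[of \<omega>] norm_ge_zero[of "W \<omega>"] by linarith
  qed
  have sv: "summable (\<lambda>k. v k \<omega>)" if "\<omega> \<in> space M" for \<omega>
    by (rule summable_comparison_test'[OF b, of 0]) (use v that in auto)
  have shift: "(\<Sum>k\<in>{n..<N + n}. f k) = (\<Sum>k<N. f (k + n))" for N and f :: "nat \<Rightarrow> real"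
    using sum.shift_bounds_nat_ivl[of f 0 n N] by (simp add: lessThan_atLeast0)
  let ?P = "\<lambda>N \<omega>. W \<omega> * (\<Prod>k\<in>{n..<N + n}. cf_term \<xi> v s k \<omega>)"
  have "(\<lambda>N. \<integral>\<omega>. ?P N \<omega> \<partial>M) \<longlonglongrightarrow>
      (\<integral>\<omega>. W \<omega> * (iexp (s * (\<Sum>k. \<xi> (k + n) \<omega>)) * of_real (exp (s\<^sup>2 / 2 * (\<Sum>k. v (k + n) \<omega>)))) \<partial>M)"
  proof (rule integral_dominated_convergence[where w="\<lambda>_. c * exp (s\<^sup>2 / 2 * B2)"])
    show "AE \<omega> in M. (\<lambda>N. ?P N \<omega>) \<longlonglongrightarrow> W \<omega> * (iexp (s * (\<Sum>k. \<xi> (k + n) \<omega>)) * of_real (exp (s\<^sup>2 / 2 * (\<Sum>k. v (k + n) \<omega>))))"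
      using mart_diff_summable[OF md b] AE_space
    proof eventually_elim
      case (elim \<omega>)
      have "summable (\<lambda>k. \<xi> (k + n) \<omega>)" "summable (\<lambda>k. v (k + n) \<omega>)"
        using elim(1) sv[OF elim(2)]
          summable_iff_shift[of "\<lambda>k. \<xi> k \<omega>" n] summable_iff_shift[of "\<lambda>k. v k \<omega>" n] by simp_all
      then have "(\<lambda>N. \<Sum>k<N. \<xi> (k + n) \<omega>) \<longlonglongrightarrow> (\<Sum>k. \<xi> (k + n) \<omega>)" "(\<lambda>N. \<Sum>k<N. v (k + n) \<omega>) \<longlonglongrightarrow> (\<Sum>k. v (k + n) \<omega>)"
        by (auto intro: summable_LIMSEQ)
      then show ?case unfolding prod_cf_term shift by (intro tendsto_intros)
    qed
    show "AE \<omega> in M. norm (?P N \<omega>) \<le> c * exp (s\<^sup>2 / 2 * B2)" for N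
    proof (rule AE_I2)
      fix \<omega> assume w: "\<omega> \<in> space M"
      have "(\<Sum>k\<in>{n..<N + n}. v k \<omega>) \<le> B2"
        by (rule order_trans[OF sum_mono B(1)[of "N + n"]]) (rule v(2)[OF w])
      then show "norm (?P N \<omega>) \<le> c * exp (s\<^sup>2 / 2 * B2)"
        unfolding prod_cf_term norm_mult using W(2)[OF w] c0
        by (intro mult_mono) (auto intro!: mult_left_mono)
    qed
  qed (unfold cf_term_def, measurable)
  then have "(\<lambda>N. cmod ((\<integral>\<omega>. ?P N \<omega> \<partial>M) - (\<integral>\<omega>. W \<omega> \<partial>M))) \<longlonglongrightarrow>
     cmod ((\<integral>\<omega>. W \<omega> * (iexp (s * (\<Sum>k. \<xi> (k + n) \<omega>)) * of_real (exp (s\<^sup>2 / 2 * (\<Sum>k. v (k + n) \<omega>)))) \<partial>M) - (\<integral>\<omega>. W \<omega> \<partial>M))"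
    by (intro tendsto_intros)
  then show ?thesis
  proof (rule LIMSEQ_le_const2, intro exI[of _ 0] allI impI)
    fix N
    have "cmod ((\<integral>\<omega>. ?P N \<omega> \<partial>M) - (\<integral>\<omega>. W \<omega> \<partial>M)) \<le>
       c * exp (s\<^sup>2 / 2 * (\<Sum>k\<in>{n..<N+n}. (b k)\<^sup>2)) * (\<Sum>k\<in>{n..<N+n}. \<bar>s * b k\<bar> ^ 3 + \<bar>s * b k\<bar> ^ 4)"
      by (rule cf_prod_bound[OF md cv v W]) auto
    also have "\<dots> \<le> c * exp (s\<^sup>2 / 2 * B2) * B3"
      using B c0 by (intro mult_mono) (auto intro!: mult_left_mono sum_nonneg)
    finally show "cmod ((\<integral>\<omega>. ?P N \<omega> \<partial>M) - (\<integral>\<omega>. W \<omega> \<partial>M)) \<le> c * exp (s\<^sup>2 / 2 * B2) * B3" .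
  qed
qed

end

section \<open>Stable convergence\<close>

lemma integral_uniform_measure:
  fixes f :: "'a \<Rightarrow> real"
  assumes "prob_space M" "H \<in> sets M" "measure M H > 0" "f \<in> borel_measurable M"
  shows "(\<integral>\<omega>. f \<omega> \<partial>uniform_measure M H) = (\<integral>\<omega>. indicator H \<omega> * f \<omega> \<partial>M) / measure M H"
proof -
  interpret prob_space M by fact
  have "uniform_measure M H = density M (\<lambda>\<omega>. ennreal (indicator H \<omega> / measure M H))"
    unfolding uniform_measure_def
  proof (rule density_cong)
    have "1 / ennreal (prob H) = ennreal (1 / prob H)"
      using divide_ennreal[of 1 "prob H"] assms(3) by simp
    then show "AE \<omega> in M. indicator H \<omega> / emeasure M H = ennreal (indicator H \<omega> / prob H)"
      by (intro AE_I2) (simp add: emeasure_eq_measure indicator_def)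
  qed (use assms(2) in measurable)
  then have "(\<integral>\<omega>. f \<omega> \<partial>uniform_measure M H) = (\<integral>\<omega>. (indicator H \<omega> / measure M H) *\<^sub>R f \<omega> \<partial>M)"
    using assms by (simp only:) (subst integral_density, auto)
  also have "\<dots> = (\<integral>\<omega>. indicator H \<omega> * f \<omega> \<partial>M) / measure M H"
    by simp
  finally show ?thesis .
qed

lemma prob_space_uniform:
  assumes "prob_space M" "measure M H > 0"
  shows "prob_space (uniform_measure M H)"
proof -
  interpret prob_space M by fact
  show ?thesis by (rule prob_space_uniform_measure) (use assms in \<open>auto simp: emeasure_eq_measure\<close>)
qed

lemma integral_bind_uniform:
  fixes f :: "'s::metric_space \<Rightarrow> real"
  assumes M: "prob_space M" and H: "H \<in> sets M" "measure M H > 0"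
    and N: "N \<in> measurable M (prob_algebra borel)"
    and f: "f \<in> borel_measurable borel" "\<And>x. \<bar>f x\<bar> \<le> c"
  shows "(\<integral>x. f x \<partial>bind (uniform_measure M H) N) = (\<integral>\<omega>. indicator H \<omega> * (\<integral>x. f x \<partial>N \<omega>) \<partial>M) / measure M H"
proof -
  interpret U: prob_space "uniform_measure M H" using prob_space_uniform M H by blast
  have N': "N \<in> measurable M (subprob_algebra borel)" using N by (rule measurable_prob_algebraD)
  then have N'': "N \<in> measurable (uniform_measure M H) (subprob_algebra borel)" by simp
  have "(\<integral>x. f x \<partial>bind (uniform_measure M H) N) = (\<integral>\<omega>. (\<integral>x. f x \<partial>N \<omega>) \<partial>uniform_measure M H)"
  proof (rule integral_bind[OF f(1) _ N'', where B=c and B'=1])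
    show "AE \<omega> in uniform_measure M H. emeasure (N \<omega>) (space (N \<omega>)) \<le> ennreal 1"
    proof (rule AE_I2)
      fix \<omega> assume "\<omega> \<in> space (uniform_measure M H)"
      then have "N \<omega> \<in> space (subprob_algebra borel)" using measurable_space[OF N''] by blast
      then show "emeasure (N \<omega>) (space (N \<omega>)) \<le> ennreal 1"
        by (auto simp: space_subprob_algebra intro: subprob_space.emeasure_space_le_1)
    qed
    show "finite_measure (uniform_measure M H)" by (rule U.finite_measure_axioms)
  qed (use f in auto)
  also have "\<dots> = (\<integral>\<omega>. indicator H \<omega> * (\<integral>x. f x \<partial>N \<omega>) \<partial>M) / measure M H"
    by (rule integral_uniform_measure[OF M H]) (use N' f in measurable)
  finally show ?thesis .
qed

lemma stably_convergesI:
  fixes Y :: "nat \<Rightarrow> 'a \<Rightarrow> 's::metric_space"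
  assumes M: "prob_space M" and Y: "\<And>n. Y n \<in> borel_measurable M"
    and N: "N \<in> measurable M (prob_algebra borel)"
    and lim: "\<And>H (f :: 's \<Rightarrow> real) c. H \<in> sets M \<Longrightarrow> continuous_on UNIV f \<Longrightarrow> (\<And>x. \<bar>f x\<bar> \<le> c) \<Longrightarrow>
      (\<lambda>n. \<integral>\<omega>. indicator H \<omega> * f (Y n \<omega>) \<partial>M) \<longlonglongrightarrow> (\<integral>\<omega>. indicator H \<omega> * (\<integral>x. f x \<partial>N \<omega>) \<partial>M)"
  shows "stably_converges M Y N"
  unfolding stably_converges_def weakly_converges_def
proof (intro conjI allI ballI impI)
  fix H and f :: "'s \<Rightarrow> real"
  assume H: "H \<in> sets M" "0 < measure M H" and f: "continuous_on UNIV f" "bounded (range f)"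
  obtain c where c: "\<And>x. \<bar>f x\<bar> \<le> c" using f(2) by (auto simp: bounded_iff)
  have [measurable]: "f \<in> borel_measurable borel" using f(1) by (rule borel_measurable_continuous_onI)
  have "(\<integral>x. f x \<partial>distr (uniform_measure M H) borel (Y n)) = (\<integral>\<omega>. indicator H \<omega> * f (Y n \<omega>) \<partial>M) / measure M H" for n
    using Y[of n] by (subst integral_distr) (auto intro!: integral_uniform_measure[OF M H])
  then show "(\<lambda>n. \<integral>x. f x \<partial>distr (uniform_measure M H) borel (Y n)) \<longlonglongrightarrow> (\<integral>x. f x \<partial>bind (uniform_measure M H) N)"
    using lim[OF H(1) f(1), of c] c H(2)
    by (simp add: integral_bind_uniform[OF M H N _ c] tendsto_divide)
qed (use Y kernelI[OF N] in auto)

section \<open>From events of the filtration to integrable test functions\<close>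

context filtered_prob_space
begin

text \<open>Simple functions are dense among the integrable ones, and the common bound
  \<open>C\<close> makes the approximation error uniform in \<open>n\<close>.\<close>

lemma tendsto_integral_extend_integrable:
  fixes P :: "nat \<Rightarrow> 'a \<Rightarrow> real"
  assumes G: "subalgebra M G" and P: "\<And>n. P n \<in> borel_measurable M" "\<And>n \<omega>. \<omega> \<in> space M \<Longrightarrow> \<bar>P n \<omega>\<bar> \<le> C"
    and lim: "\<And>H. H \<in> sets G \<Longrightarrow> (\<lambda>n. \<integral>\<omega>. indicator H \<omega> * P n \<omega> \<partial>M) \<longlonglongrightarrow> 0"
    and h: "h \<in> borel_measurable G" "integrable M h"
  shows "(\<lambda>n. \<integral>\<omega>. h \<omega> * P n \<omega> \<partial>M) \<longlonglongrightarrow> 0"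
proof -
  note [measurable] = P(1)
  have C0: "C \<ge> 0"
  proof -
    obtain \<omega> where "\<omega> \<in> space M" using not_empty by blast
    then show ?thesis using P(2)[of \<omega> 0] by linarith
  qed
  have iP: "integrable M (\<lambda>\<omega>. f \<omega> * P n \<omega>)" if "integrable M f" for f n
    by (rule Bochner_Integration.integrable_bound[where f="\<lambda>\<omega>. C * f \<omega>"])
      (use that P C0 in \<open>auto simp: abs_mult mult.commute[of "\<bar>f _\<bar>"] intro!: mult_right_mono\<close>)
  \<comment> \<open>Passing to the restricted space makes the induction build simple functions from
    sets of \<open>G\<close>, which is where the hypothesis \<open>lim\<close> speaks.\<close>
  have "integrable (restr_to_subalg M G) h"
    by (rule integrable_in_subalg) (use G h in auto)
  then show ?thesis
  proof (induction rule: integrable_induct)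
    case (base A c)
    then have A: "A \<in> sets G" using sets_restr_to_subalg[OF G] by simp
    have "(\<lambda>n. c * (\<integral>\<omega>. indicator A \<omega> * P n \<omega> \<partial>M)) \<longlonglongrightarrow> c * 0"
      by (intro tendsto_intros lim A)
    then show ?case by (simp add: mult_ac)
  next
    case (add f g)
    have "integrable M f" "integrable M g"
      using add integrable_from_subalg[OF G] by blast+
    then show ?case
      using tendsto_add[OF add.IH] iP by (simp add: distrib_right)
  next
    case (lim f s)
    have i: "integrable M f" "\<And>i. integrable M (s i)"
      using lim integrable_from_subalg[OF G] by blast+
    have sp: "space (restr_to_subalg M G) = space M" by (rule space_restr_to_subalg)
    have "(\<lambda>i. \<integral>\<omega>. \<bar>f \<omega> - s i \<omega>\<bar> \<partial>M) \<longlonglongrightarrow> (\<integral>\<omega>. 0 \<partial>M)"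
    proof (rule integral_dominated_convergence[where w="\<lambda>\<omega>. 3 * \<bar>f \<omega>\<bar>"])
      show "AE \<omega> in M. (\<lambda>i. \<bar>f \<omega> - s i \<omega>\<bar>) \<longlonglongrightarrow> 0"
      proof (rule AE_I2)
        fix \<omega> assume "\<omega> \<in> space M"
        then have "(\<lambda>i. s i \<omega>) \<longlonglongrightarrow> f \<omega>" using lim.hyps(2) sp by simp
        then have "(\<lambda>i. \<bar>f \<omega> - s i \<omega>\<bar>) \<longlonglongrightarrow> \<bar>f \<omega> - f \<omega>\<bar>" by (intro tendsto_intros)
        then show "(\<lambda>i. \<bar>f \<omega> - s i \<omega>\<bar>) \<longlonglongrightarrow> 0" by simp
      qed
      show "AE \<omega> in M. norm \<bar>f \<omega> - s i \<omega>\<bar> \<le> 3 * \<bar>f \<omega>\<bar>" for i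
      proof (rule AE_I2)
        fix \<omega> assume "\<omega> \<in> space M"
        then have "\<bar>s i \<omega>\<bar> \<le> 2 * \<bar>f \<omega>\<bar>" using lim.hyps(3) sp by simp
        then show "norm \<bar>f \<omega> - s i \<omega>\<bar> \<le> 3 * \<bar>f \<omega>\<bar>" by simp
      qed
    qed (use i in auto)
    then have s0: "(\<lambda>i. \<integral>\<omega>. \<bar>f \<omega> - s i \<omega>\<bar> \<partial>M) \<longlonglongrightarrow> 0" by simp
    show ?case
    proof (rule LIMSEQ_I)
      fix e :: real assume e: "e > 0"
      \<comment> \<open>The summand 1 keeps the quotient meaningful for
        \<open>C = 0\<close>.\<close>
      have "e / (2 * (C + 1)) > 0" using e C0 by simp
      from LIMSEQ_D[OF s0 this] obtain i where
        "norm ((\<integral>\<omega>. \<bar>f \<omega> - s i \<omega>\<bar> \<partial>M) - 0) < e / (2 * (C + 1))" by blast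
      then have si: "(\<integral>\<omega>. \<bar>f \<omega> - s i \<omega>\<bar> \<partial>M) < e / (2 * (C + 1))" by simp
      have Cb: "C * (\<integral>\<omega>. \<bar>f \<omega> - s i \<omega>\<bar> \<partial>M) \<le> e / 2"
      proof -
        have "C * (\<integral>\<omega>. \<bar>f \<omega> - s i \<omega>\<bar> \<partial>M) \<le> (C + 1) * (\<integral>\<omega>. \<bar>f \<omega> - s i \<omega>\<bar> \<partial>M)"
          by (intro mult_right_mono Bochner_Integration.integral_nonneg_AE AE_I2) auto
        also have "\<dots> \<le> e / 2" using si C0 by (simp add: field_simps)
        finally show ?thesis .
      qed
      obtain N where N: "\<And>n. n \<ge> N \<Longrightarrow> \<bar>\<integral>\<omega>. s i \<omega> * P n \<omega> \<partial>M\<bar> < e / 2"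
        using LIMSEQ_D[OF lim.IH[of i], of "e/2"] e by auto
      have "\<bar>\<integral>\<omega>. f \<omega> * P n \<omega> \<partial>M\<bar> < e" if "n \<ge> N" for n
      proof -
        have ifs: "integrable M (\<lambda>\<omega>. (f \<omega> - s i \<omega>) * P n \<omega>)"
          using i by (intro iP) auto
        have "(\<integral>\<omega>. f \<omega> * P n \<omega> \<partial>M) = (\<integral>\<omega>. s i \<omega> * P n \<omega> + (f \<omega> - s i \<omega>) * P n \<omega> \<partial>M)"
          by (simp add: algebra_simps)
        also have "\<dots> = (\<integral>\<omega>. s i \<omega> * P n \<omega> \<partial>M) + (\<integral>\<omega>. (f \<omega> - s i \<omega>) * P n \<omega> \<partial>M)"
          by (rule Bochner_Integration.integral_add[OF iP[OF i(2)] ifs])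
        finally have "\<bar>\<integral>\<omega>. f \<omega> * P n \<omega> \<partial>M\<bar> \<le> \<bar>\<integral>\<omega>. s i \<omega> * P n \<omega> \<partial>M\<bar> + \<bar>\<integral>\<omega>. (f \<omega> - s i \<omega>) * P n \<omega> \<partial>M\<bar>"
          by simp
        moreover have "\<bar>\<integral>\<omega>. (f \<omega> - s i \<omega>) * P n \<omega> \<partial>M\<bar> \<le> e / 2"
        proof -
          have "\<bar>\<integral>\<omega>. (f \<omega> - s i \<omega>) * P n \<omega> \<partial>M\<bar> \<le> (\<integral>\<omega>. \<bar>(f \<omega> - s i \<omega>) * P n \<omega>\<bar> \<partial>M)"
            by (rule integral_abs_bound)
          also have "\<dots> \<le> (\<integral>\<omega>. C * \<bar>f \<omega> - s i \<omega>\<bar> \<partial>M)"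
          proof (rule integral_mono)
            show "\<bar>(f \<omega> - s i \<omega>) * P n \<omega>\<bar> \<le> C * \<bar>f \<omega> - s i \<omega>\<bar>" if "\<omega> \<in> space M" for \<omega>
              unfolding abs_mult using mult_left_mono[OF P(2)[OF that, of n], of "\<bar>f \<omega> - s i \<omega>\<bar>"] by (simp add: mult.commute)
          qed (use ifs i in auto)
          finally show ?thesis using Cb by simp
        qed
        ultimately show ?thesis using N[OF that] by linarith
      qed
      then show "\<exists>no. \<forall>n\<ge>no. norm ((\<integral>\<omega>. f \<omega> * P n \<omega> \<partial>M) - 0) < e" by auto
    qed
  qed
qed

definition Finf :: "'a measure" where
  "Finf = sigma (space M) (\<Union>n. sets (F n))"

lemma sets_Finf: "sets Finf = sigma_sets (space M) (\<Union>n. sets (F n))"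
  and space_Finf [simp]: "space Finf = space M"
proof -
  have "(\<Union>n. sets (F n)) \<subseteq> Pow (space M)" using sets.space_closed space_F by blast
  then show "sets Finf = sigma_sets (space M) (\<Union>n. sets (F n))" "space Finf = space M"
    unfolding Finf_def by (auto simp: sets_measure_of space_measure_of)
qed

lemma subalgebra_Finf: "subalgebra M Finf"
  unfolding subalgebra_def sets_Finf space_Finf
  by (intro conjI refl sets.sigma_sets_subset UN_least subsetI) (rule sets_M)

lemma measurable_Finf: "f \<in> measurable (F n) N \<Longrightarrow> f \<in> measurable Finf N"
proof (rule measurable_from_subalg[rotated])
  show "subalgebra Finf (F n)" unfolding subalgebra_def sets_Finf by (auto intro: sigma_sets.Basic)
qed

text \<open>Functions that become asymptotically orthogonal to every \<open>F N\<close> are asymptotically orthogonal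
  to all integrable functions, since conditioning on \<^term>\<open>Finf\<close> does not change the integrals.\<close>

lemma tendsto_integral_extend:
  fixes P :: "nat \<Rightarrow> 'a \<Rightarrow> real"
  assumes P: "\<And>n. P n \<in> borel_measurable Finf" "\<And>n \<omega>. \<omega> \<in> space M \<Longrightarrow> \<bar>P n \<omega>\<bar> \<le> C"
    and lim: "\<And>N H. H \<in> sets (F N) \<Longrightarrow> (\<lambda>n. \<integral>\<omega>. indicator H \<omega> * P n \<omega> \<partial>M) \<longlonglongrightarrow> 0"
    and h: "integrable M h"
  shows "(\<lambda>n. \<integral>\<omega>. h \<omega> * P n \<omega> \<partial>M) \<longlonglongrightarrow> 0"
proof -
  have PM [measurable]: "P n \<in> borel_measurable M" for n
    using measurable_from_subalg[OF subalgebra_Finf P(1)] .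
  have C0: "C \<ge> 0"
  proof -
    obtain \<omega> where "\<omega> \<in> space M" using not_empty by blast
    then show ?thesis using P(2)[of \<omega> 0] by linarith
  qed
  have iP: "integrable M (\<lambda>\<omega>. f \<omega> * P n \<omega>)" if "integrable M f" for f n
    by (rule Bochner_Integration.integrable_bound[where f="\<lambda>\<omega>. C * f \<omega>"])
      (use that P C0 in \<open>auto simp: abs_mult mult.commute[of "\<bar>f _\<bar>"] intro!: mult_right_mono\<close>)
  have iH: "integrable M (\<lambda>\<omega>. indicator A \<omega> * P n \<omega>)" if "A \<in> sets M" for A n
    by (rule iP, rule integrable_bounded[where c=1]) (use that in \<open>auto simp: indicator_def\<close>)
  have bd: "\<bar>\<integral>\<omega>. indicator A \<omega> * P n \<omega> \<partial>M\<bar> \<le> C * prob A" if A: "A \<in> sets M" for A n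
  proof -
    have "\<bar>\<integral>\<omega>. indicator A \<omega> * P n \<omega> \<partial>M\<bar> \<le> (\<integral>\<omega>. \<bar>indicator A \<omega> * P n \<omega>\<bar> \<partial>M)"
      by (rule integral_abs_bound)
    also have "\<dots> \<le> (\<integral>\<omega>. C * indicator A \<omega> \<partial>M)"
    proof (rule integral_mono)
      show "integrable M (\<lambda>\<omega>. C * indicator A \<omega>)"
        by (rule integrable_bounded[where c=C]) (use A C0 in \<open>auto simp: indicator_def\<close>)
    qed (use A iH[OF A, of n] P(2) in \<open>auto simp: indicator_def\<close>)
    finally show ?thesis using A by simp
  qed
  have FM: "A \<in> sigma_sets (space M) (\<Union>n. sets (F n)) \<Longrightarrow> A \<in> sets M" for A
    using subalgebra_Finf sets_Finf unfolding subalgebra_def by blast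
  \<comment> \<open>The union of an increasing sequence of sigma-fields is closed under intersection
    but need not be a sigma-field, hence Dynkin's theorem.\<close>
  have "Int_stable (\<Union>n. sets (F n))"
  proof (rule Int_stableI)
    fix A B assume "A \<in> (\<Union>n. sets (F n))" "B \<in> (\<Union>n. sets (F n))"
    then obtain i j where "A \<in> sets (F i)" "B \<in> sets (F j)" by blast
    then have "A \<in> sets (F (max i j))" "B \<in> sets (F (max i j))"
      using sets_mono[of i "max i j"] sets_mono[of j "max i j"] by auto
    then show "A \<inter> B \<in> (\<Union>n. sets (F n))" by blast
  qed
  moreover have "(\<Union>n. sets (F n)) \<subseteq> Pow (space M)" using sets.space_closed space_F by blast
  ultimately have "(\<lambda>n. \<integral>\<omega>. indicator H \<omega> * P n \<omega> \<partial>M) \<longlonglongrightarrow> 0" if "H \<in> sigma_sets (space M) (\<Union>n. sets (F n))" for H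
    using that
  proof (induction rule: sigma_sets_induct_disjoint)
    case (basic A)
    then show ?case using lim by blast
  next
    case empty
    then show ?case by simp
  next
    case (compl A)
    have top: "space M \<in> sets (F 0)" using sets.top[of "F 0"] by simp
    have A: "A \<in> sets M" using compl FM by blast
    have "(\<integral>\<omega>. indicator (space M - A) \<omega> * P n \<omega> \<partial>M) =
      (\<integral>\<omega>. indicator (space M) \<omega> * P n \<omega> \<partial>M) - (\<integral>\<omega>. indicator A \<omega> * P n \<omega> \<partial>M)" for n
    proof -
      have "(\<integral>\<omega>. indicator (space M - A) \<omega> * P n \<omega> \<partial>M) = (\<integral>\<omega>. indicator (space M) \<omega> * P n \<omega> - indicator A \<omega> * P n \<omega> \<partial>M)"
        by (rule Bochner_Integration.integral_cong) (auto simp: indicator_def)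
      also have "\<dots> = (\<integral>\<omega>. indicator (space M) \<omega> * P n \<omega> \<partial>M) - (\<integral>\<omega>. indicator A \<omega> * P n \<omega> \<partial>M)"
        by (rule Bochner_Integration.integral_diff[OF iH iH]) (use A in auto)
      finally show ?thesis .
    qed
    then show ?case using tendsto_diff[OF lim[OF top] compl.IH] by simp
  next
    case (union A)
    have A: "A i \<in> sets M" for i using union FM by blast
    have "(\<lambda>n. \<integral>\<omega>. indicator (\<Union>i<k. A i) \<omega> * P n \<omega> \<partial>M) \<longlonglongrightarrow> 0" for k
    proof -
      have "(\<integral>\<omega>. indicator (\<Union>i<k. A i) \<omega> * P n \<omega> \<partial>M) = (\<Sum>i<k. \<integral>\<omega>. indicator (A i) \<omega> * P n \<omega> \<partial>M)" for n
      proof -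
        have "(\<integral>\<omega>. indicator (\<Union>i<k. A i) \<omega> * P n \<omega> \<partial>M) = (\<integral>\<omega>. (\<Sum>i<k. indicator (A i) \<omega> * P n \<omega>) \<partial>M)"
        proof (rule Bochner_Integration.integral_cong)
          fix \<omega>
          have "disjoint_family_on A {..<k}" using union.hyps(1) by (rule disjoint_family_on_mono[rotated]) auto
          then show "indicator (\<Union>i<k. A i) \<omega> * P n \<omega> = (\<Sum>i<k. indicator (A i) \<omega> * P n \<omega>)"
            by (simp add: indicator_UN_disjoint sum_distrib_right)
        qed simp
        also have "\<dots> = (\<Sum>i<k. \<integral>\<omega>. indicator (A i) \<omega> * P n \<omega> \<partial>M)"
          by (rule Bochner_Integration.integral_sum) (rule iH[OF A])
        finally show ?thesis .
      qed
      then show ?thesis using tendsto_sum[of "{..<k}" "\<lambda>i n. \<integral>\<omega>. indicator (A i) \<omega> * P n \<omega> \<partial>M" "\<lambda>_. 0"] union.IH by simp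
    qed note fin = this
    \<comment> \<open>Finite partial unions are settled by additivity. What is left has small
      probability, and \<open>bd\<close> bounds its contribution by \<open>C\<close> times that
      probability for all \<open>n\<close> at once.\<close>
    let ?U = "\<Union>i. A i"
    have lp: "(\<lambda>k. prob (\<Union>i<k. A i)) \<longlonglongrightarrow> prob (\<Union>k. \<Union>i<k. A i)"
      by (rule finite_Lim_measure_incseq) (use A in \<open>fastforce simp: incseq_def\<close>)+
    have "(\<Union>k. \<Union>i<k. A i) = ?U" by auto
    with lp have lp: "(\<lambda>k. prob (\<Union>i<k. A i)) \<longlonglongrightarrow> prob ?U" by simp
    show ?case
    proof (rule LIMSEQ_I)
      fix e :: real assume e: "e > 0"
      have "e / (2 * (C + 1)) > 0" using e C0 by simp
      from LIMSEQ_D[OF lp this] obtain k where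
        "norm (prob (\<Union>i<k. A i) - prob ?U) < e / (2 * (C + 1))" by blast
      then have k: "\<bar>prob (\<Union>i<k. A i) - prob ?U\<bar> < e / (2 * (C + 1))" by simp
      define D where "D = ?U - (\<Union>i<k. A i)"
      have D: "D \<in> sets M" unfolding D_def using A by auto
      have UA: "(\<Union>i<k. A i) \<in> sets M" "?U \<in> sets M" using A by auto
      have pD: "prob D = prob ?U - prob (\<Union>i<k. A i)"
        unfolding D_def by (rule finite_measure_Diff) (use UA in auto)
      have Cb: "C * prob D \<le> e / 2"
      proof -
        have "C * prob D \<le> (C + 1) * prob D" by (intro mult_right_mono) auto
        also have "\<dots> \<le> (C + 1) * (e / (2 * (C + 1)))" using k C0 pD by (intro mult_left_mono) auto
        also have "\<dots> = e / 2" using C0 by (simp add: field_simps)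
        finally show ?thesis .
      qed
      obtain N where N: "\<And>n. n \<ge> N \<Longrightarrow> \<bar>\<integral>\<omega>. indicator (\<Union>i<k. A i) \<omega> * P n \<omega> \<partial>M\<bar> < e / 2"
        using LIMSEQ_D[OF fin[of k], of "e/2"] e by auto
      have "\<bar>\<integral>\<omega>. indicator ?U \<omega> * P n \<omega> \<partial>M\<bar> < e" if "n \<ge> N" for n
      proof -
        have "(\<integral>\<omega>. indicator ?U \<omega> * P n \<omega> \<partial>M) = (\<integral>\<omega>. indicator (\<Union>i<k. A i) \<omega> * P n \<omega> + indicator D \<omega> * P n \<omega> \<partial>M)"
          by (rule Bochner_Integration.integral_cong) (auto simp: D_def indicator_def)
        also have "\<dots> = (\<integral>\<omega>. indicator (\<Union>i<k. A i) \<omega> * P n \<omega> \<partial>M) + (\<integral>\<omega>. indicator D \<omega> * P n \<omega> \<partial>M)"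
          by (rule Bochner_Integration.integral_add[OF iH[OF UA(1)] iH[OF D]])
        finally show ?thesis using N[OF that] bd[OF D, of n] Cb by linarith
      qed
      then show "\<exists>no. \<forall>n\<ge>no. norm ((\<integral>\<omega>. indicator ?U \<omega> * P n \<omega> \<partial>M) - 0) < e" by auto
    qed
  qed
  then have limH: "(\<lambda>n. \<integral>\<omega>. indicator H \<omega> * P n \<omega> \<partial>M) \<longlonglongrightarrow> 0" if "H \<in> sets Finf" for H
    using that sets_Finf by blast
  interpret S: finite_measure_subalgebra M Finf
    by unfold_locales (rule subalgebra_Finf)
  have "(\<integral>\<omega>. h \<omega> * P n \<omega> \<partial>M) = (\<integral>\<omega>. real_cond_exp M Finf h \<omega> * P n \<omega> \<partial>M)" for n
    using S.real_cond_exp_intg(2)[of "P n" h] iP[OF h, of n] P(1)[of n] h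
    by (simp add: mult.commute)
  moreover have "(\<lambda>n. \<integral>\<omega>. real_cond_exp M Finf h \<omega> * P n \<omega> \<partial>M) \<longlonglongrightarrow> 0"
    by (rule tendsto_integral_extend_integrable[OF subalgebra_Finf PM P(2) limH])
      (use h in auto)
  ultimately show ?thesis by simp
qed

lemma tendsto_integral_extend_complex:
  fixes P :: "nat \<Rightarrow> 'a \<Rightarrow> complex"
  assumes P: "\<And>n. P n \<in> borel_measurable Finf" "\<And>n \<omega>. \<omega> \<in> space M \<Longrightarrow> cmod (P n \<omega>) \<le> C"
    and lim: "\<And>N H. H \<in> sets (F N) \<Longrightarrow> (\<lambda>n. \<integral>\<omega>. of_real (indicator H \<omega>) * P n \<omega> \<partial>M) \<longlonglongrightarrow> 0"
    and h: "h \<in> borel_measurable M" "\<And>\<omega>. \<omega> \<in> space M \<Longrightarrow> \<bar>h \<omega>\<bar> \<le> c"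
  shows "(\<lambda>n. \<integral>\<omega>. of_real (h \<omega>) * P n \<omega> \<partial>M) \<longlonglongrightarrow> 0"
proof -
  have PM [measurable]: "P n \<in> borel_measurable M" for n
    using measurable_from_subalg[OF subalgebra_Finf P(1)] .
  have ih: "integrable M h" by (rule integrable_bounded) (use h in auto)
  have iP: "integrable M (\<lambda>\<omega>. of_real (f \<omega>) * P n \<omega>)"
    if f: "f \<in> borel_measurable M" "\<And>\<omega>. \<omega> \<in> space M \<Longrightarrow> \<bar>f \<omega>\<bar> \<le> c" for f n c
  proof (rule integrable_bounded)
    show "norm (of_real (f \<omega>) * P n \<omega>) \<le> c * C" if "\<omega> \<in> space M" for \<omega>
      unfolding norm_mult using f(2)[OF that] P(2)[OF that, of n]
      by (intro mult_mono) auto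
  qed (use f in measurable)
  have ReIm: "Re (\<integral>\<omega>. of_real (f \<omega>) * P n \<omega> \<partial>M) = (\<integral>\<omega>. f \<omega> * Re (P n \<omega>) \<partial>M)"
     "Im (\<integral>\<omega>. of_real (f \<omega>) * P n \<omega> \<partial>M) = (\<integral>\<omega>. f \<omega> * Im (P n \<omega>) \<partial>M)"
    if f: "f \<in> borel_measurable M" "\<And>\<omega>. \<omega> \<in> space M \<Longrightarrow> \<bar>f \<omega>\<bar> \<le> c" for f n c
    using integral_Re[OF iP[OF f]] integral_Im[OF iP[OF f]] by simp_all
  have ReImH: "Re (\<integral>\<omega>. of_real (indicator H \<omega>) * P n \<omega> \<partial>M) = (\<integral>\<omega>. indicator H \<omega> * Re (P n \<omega>) \<partial>M)"
     "Im (\<integral>\<omega>. of_real (indicator H \<omega>) * P n \<omega> \<partial>M) = (\<integral>\<omega>. indicator H \<omega> * Im (P n \<omega>) \<partial>M)"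
    if "H \<in> sets (F N)" for H N n
    using ReIm[of "indicator H" 1 n] sets_M[OF that] by (auto simp: indicator_def)
  have "(\<lambda>n. \<integral>\<omega>. h \<omega> * Re (P n \<omega>) \<partial>M) \<longlonglongrightarrow> 0"
  proof (rule tendsto_integral_extend[OF _ _ _ ih])
    show "(\<lambda>\<omega>. Re (P n \<omega>)) \<in> borel_measurable Finf" for n using P(1)[of n] by measurable
    show "\<bar>Re (P n \<omega>)\<bar> \<le> C" if "\<omega> \<in> space M" for n \<omega> using abs_Re_le_cmod P(2)[OF that] order_trans by blast
    show "(\<lambda>n. \<integral>\<omega>. indicator H \<omega> * Re (P n \<omega>) \<partial>M) \<longlonglongrightarrow> 0" if H: "H \<in> sets (F N)" for H N
      using tendsto_Re[OF lim[OF H]] ReImH[OF H] by simp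
  qed
  moreover have "(\<lambda>n. \<integral>\<omega>. h \<omega> * Im (P n \<omega>) \<partial>M) \<longlonglongrightarrow> 0"
  proof (rule tendsto_integral_extend[OF _ _ _ ih])
    show "(\<lambda>\<omega>. Im (P n \<omega>)) \<in> borel_measurable Finf" for n using P(1)[of n] by measurable
    show "\<bar>Im (P n \<omega>)\<bar> \<le> C" if "\<omega> \<in> space M" for n \<omega> using abs_Im_le_cmod P(2)[OF that] order_trans by blast
    show "(\<lambda>n. \<integral>\<omega>. indicator H \<omega> * Im (P n \<omega>) \<partial>M) \<longlonglongrightarrow> 0" if H: "H \<in> sets (F N)" for H N
      using tendsto_Im[OF lim[OF H]] ReImH[OF H] by simp
  qed
  ultimately show ?thesis
    using ReIm[OF h] by (simp add: tendsto_complex_iff)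
qed

section \<open>Gaussian mixtures as limits\<close>

text \<open>Outside \<open>H n\<close> both sides are replaced by the point mass at 0, which turns the comparison
  into one of probability measures.\<close>

lemma gaussian_mixture_tendsto:
  fixes Y L :: "nat \<Rightarrow> 'a \<Rightarrow> real" and f :: "real \<Rightarrow> real"
  assumes Y: "\<And>n. Y n \<in> borel_measurable M" and H: "\<And>n. H n \<in> sets M"
    and L: "\<And>n. L n \<in> borel_measurable M" "\<And>n \<omega>. \<omega> \<in> space M \<Longrightarrow> 0 \<le> L n \<omega>" "\<And>n \<omega>. \<omega> \<in> space M \<Longrightarrow> L n \<omega> \<le> K"
    and ch: "\<And>t. (\<lambda>n. \<integral>\<omega>. of_real (indicator (H n) \<omega>) * (iexp (t * Y n \<omega>) - of_real (exp (- (t\<^sup>2 * L n \<omega> / 2)))) \<partial>M) \<longlonglongrightarrow> 0"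
    and f: "continuous_on UNIV f" "\<And>x. \<bar>f x\<bar> \<le> c"
  shows "(\<lambda>n. \<integral>\<omega>. indicator (H n) \<omega> * (f (Y n \<omega>) - (\<integral>x. f x \<partial>gaussian 0 (L n \<omega>))) \<partial>M) \<longlonglongrightarrow> 0"
proof -
  note [measurable] = Y H L(1)
  interpret S: real_distribution std_normal_distribution by (rule real_dist_normal_dist)
  interpret Q: pair_prob_space M std_normal_distribution ..
  define J where "J n \<omega> = indicator (H n) \<omega> * L n \<omega>" for n \<omega>
  have [measurable]: "J n \<in> borel_measurable M" for n unfolding J_def by measurable
  define \<mu> where "\<mu> n = distr M borel (\<lambda>\<omega>. indicator (H n) \<omega> * Y n \<omega>)" for n
  \<comment> \<open>The mixture of the laws \<open>gaussian 0 (J n \<omega>)\<close> over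
    \<open>\<omega>\<close>, realised by scaling a standard normal variable on a second factor of
    the probability space.\<close>
  define \<nu> where "\<nu> n = distr (M \<Otimes>\<^sub>M std_normal_distribution) borel (\<lambda>(\<omega>, x). sqrt (max 0 (J n \<omega>)) * x)" for n
  have mu: "real_distribution (\<mu> n)" for n unfolding \<mu>_def by (rule real_distribution_distr) measurable
  have nu: "real_distribution (\<nu> n)" for n
    unfolding \<nu>_def by (rule Q.real_distribution_distr) measurable
  \<comment> \<open>Stated for values in a Banach algebra so as to serve both the complex
    exponentials of the characteristic function and the real test function \<open>f\<close>.\<close>
  have diff: "(\<integral>x. g x \<partial>\<mu> n) - (\<integral>x. g x \<partial>\<nu> n)
     = (\<integral>\<omega>. of_real (indicator (H n) \<omega>) * (g (Y n \<omega>) - (\<integral>x. g x \<partial>gaussian 0 (L n \<omega>))) \<partial>M)"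
    if g: "g \<in> borel_measurable borel" "\<And>x. norm (g x) \<le> B"
    for g :: "real \<Rightarrow> 'b::{banach, second_countable_topology, real_normed_algebra_1}" and n B
  proof -
    note [measurable] = g(1)
    let ?G = "\<lambda>(\<omega>, x). g (sqrt (max 0 (J n \<omega>)) * x)"
    have i2: "integrable (M \<Otimes>\<^sub>M std_normal_distribution) ?G"
      by (rule Q.integrable_const_bound[where B=B]) (use g(2) in auto)
    have i1: "integrable M (\<lambda>\<omega>. g (indicator (H n) \<omega> * Y n \<omega>))"
      by (rule integrable_bounded) (use g(2) in auto)
    have "(\<integral>x. g x \<partial>\<nu> n) = (\<integral>p. ?G p \<partial>(M \<Otimes>\<^sub>M std_normal_distribution))"
      unfolding \<nu>_def by (subst integral_distr) (auto simp: case_prod_unfold)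
    also have "\<dots> = (\<integral>\<omega>. (\<integral>x. g x \<partial>gaussian 0 (J n \<omega>)) \<partial>M)"
      using Q.integral_fst'[OF i2] by (simp add: integral_gaussian[OF g(1)])
    finally have n: "(\<integral>x. g x \<partial>\<nu> n) = (\<integral>\<omega>. (\<integral>x. g x \<partial>gaussian 0 (J n \<omega>)) \<partial>M)" .
    have in': "integrable M (\<lambda>\<omega>. \<integral>x. g x \<partial>gaussian 0 (J n \<omega>))"
      using Q.integrable_fst'[OF i2] by (simp add: integral_gaussian[OF g(1)])
    have "(\<integral>x. g x \<partial>\<mu> n) = (\<integral>\<omega>. g (indicator (H n) \<omega> * Y n \<omega>) \<partial>M)"
      unfolding \<mu>_def by (subst integral_distr) auto
    then have "(\<integral>x. g x \<partial>\<mu> n) - (\<integral>x. g x \<partial>\<nu> n) =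
      (\<integral>\<omega>. g (indicator (H n) \<omega> * Y n \<omega>) - (\<integral>x. g x \<partial>gaussian 0 (J n \<omega>)) \<partial>M)"
      unfolding n by (simp add: Bochner_Integration.integral_diff[OF i1 in'])
    also have "\<dots> = (\<integral>\<omega>. of_real (indicator (H n) \<omega>) * (g (Y n \<omega>) - (\<integral>x. g x \<partial>gaussian 0 (L n \<omega>))) \<partial>M)"
    proof (rule Bochner_Integration.integral_cong)
      have "(\<integral>x. g x \<partial>gaussian 0 0) = g 0"
        using S.prob_space by (simp add: integral_gaussian[OF g(1)])
      then show "g (indicator (H n) \<omega> * Y n \<omega>) - (\<integral>x. g x \<partial>gaussian 0 (J n \<omega>))
        = of_real (indicator (H n) \<omega>) * (g (Y n \<omega>) - (\<integral>x. g x \<partial>gaussian 0 (L n \<omega>)))" for \<omega>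
        by (auto simp: J_def indicator_def)
    qed simp
    finally show ?thesis .
  qed
  \<comment> \<open>The variances are bounded by \<open>K\<close>, so one interval that carries most
    of the standard normal law controls, after scaling, all mixtures at once.\<close>
  have tight: "tight \<nu>"
    unfolding tight_def
  proof (intro conjI allI impI nu)
    fix e :: real assume e: "e > 0"
    have "(\<lambda>k. S.prob {- real k<..<real k}) \<longlonglongrightarrow> S.prob (\<Union>k. {- real k<..<real k})"
      by (rule S.finite_Lim_measure_incseq) (auto simp: incseq_def)
    moreover have "(\<Union>k. {- real k<..<real k}) = UNIV"
    proof -
      have "\<exists>k. - real k < x \<and> x < real k" for x
      proof -
        obtain k where "\<bar>x\<bar> < real k" using reals_Archimedean2 by blast
        then have "- real k < x \<and> x < real k" by linarith
        then show ?thesis ..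
      qed
      then show ?thesis by auto
    qed
    ultimately have "(\<lambda>k. S.prob {- real k<..<real k}) \<longlonglongrightarrow> 1"
      using S.prob_space by simp
    then have "\<forall>\<^sub>F k in sequentially. S.prob {- real k<..<real k} > 1 - e"
      by (rule order_tendstoD) (use e in simp)
    then obtain k where k: "S.prob {- real k<..<real k} > 1 - e"
      using eventually_happens'[OF sequentially_bot] by blast
    \<comment> \<open>The two summands 1 make \<open>a\<close> positive and strictly larger than the
      maximal scale times \<open>k\<close>.\<close>
    define a where "a = (sqrt (max 0 K) + 1) * (real k + 1)"
    have a: "a > 0" unfolding a_def by (intro mult_pos_pos add_nonneg_pos) auto
    have "1 - e < measure (\<nu> n) {-a<..a}" for n
    proof -
      have sub: "space M \<times> {- real k<..<real k} \<subseteq> (\<lambda>(\<omega>, x). sqrt (max 0 (J n \<omega>)) * x) -` {-a<..a} \<inter> space (M \<Otimes>\<^sub>M std_normal_distribution)"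
      proof
        fix p assume "p \<in> space M \<times> {- real k<..<real k}"
        then obtain \<omega> x where p: "p = (\<omega>, x)" and w: "\<omega> \<in> space M" and x: "- real k < x" "x < real k" by auto
        have "max 0 (J n \<omega>) \<le> max 0 K" using L(2)[OF w, of n] L(3)[OF w, of n] by (auto simp: J_def indicator_def)
        then have "sqrt (max 0 (J n \<omega>)) * \<bar>x\<bar> \<le> (sqrt (max 0 K) + 1) * real k"
          using x by (intro mult_mono add_increasing2 real_sqrt_le_mono) auto
        also have "\<dots> < a" unfolding a_def by (intro mult_strict_left_mono add_nonneg_pos) auto
        finally have "\<bar>sqrt (max 0 (J n \<omega>)) * x\<bar> < a" by (simp add: abs_mult)
        then have "- a < sqrt (max 0 (J n \<omega>)) * x \<and> sqrt (max 0 (J n \<omega>)) * x \<le> a" by linarith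
        then show "p \<in> (\<lambda>(\<omega>, x). sqrt (max 0 (J n \<omega>)) * x) -` {-a<..a} \<inter> space (M \<Otimes>\<^sub>M std_normal_distribution)"
          using w by (simp add: p space_pair_measure)
      qed
      have "S.prob {- real k<..<real k} = measure (M \<Otimes>\<^sub>M std_normal_distribution) (space M \<times> {- real k<..<real k})"
        unfolding measure_def by (subst S.emeasure_pair_measure_Times) (auto simp: emeasure_space_1)
      also have "\<dots> \<le> measure (M \<Otimes>\<^sub>M std_normal_distribution) ((\<lambda>(\<omega>, x). sqrt (max 0 (J n \<omega>)) * x) -` {-a<..a} \<inter> space (M \<Otimes>\<^sub>M std_normal_distribution))"
        by (rule Q.finite_measure_mono[OF sub]) measurable
      also have "\<dots> = measure (\<nu> n) {-a<..a}"
        unfolding \<nu>_def by (rule measure_distr[symmetric]) measurable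
      finally show ?thesis using k by linarith
    qed
    then show "\<exists>a b. a < b \<and> (\<forall>n. 1 - e < measure (\<nu> n) {a<..b})"
      using a by (intro exI[of _ "-a"] exI[of _ a]) auto
  qed
  have ch': "(\<lambda>n. char (\<mu> n) t - char (\<nu> n) t) \<longlonglongrightarrow> 0" for t
  proof -
    have "char (\<mu> n) t - char (\<nu> n) t = (\<integral>\<omega>. of_real (indicator (H n) \<omega>) * (iexp (t * Y n \<omega>) - of_real (exp (- (t\<^sup>2 * L n \<omega> / 2)))) \<partial>M)" for n
    proof -
      have "char (\<mu> n) t - char (\<nu> n) t = (\<integral>\<omega>. of_real (indicator (H n) \<omega>) * (iexp (t * Y n \<omega>) - char (gaussian 0 (L n \<omega>)) t) \<partial>M)"
        unfolding char_def
      proof (rule diff)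
        show "norm (iexp (t * x)) \<le> 1" for x by simp
      qed measurable
      also have "\<dots> = (\<integral>\<omega>. of_real (indicator (H n) \<omega>) * (iexp (t * Y n \<omega>) - of_real (exp (- (t\<^sup>2 * L n \<omega> / 2)))) \<partial>M)"
        unfolding char_gaussian by (rule Bochner_Integration.integral_cong) (use L(2) in auto)
      finally show ?thesis .
    qed
    then show ?thesis using ch[of t] by simp
  qed
  have "(\<lambda>n. (\<integral>x. f x \<partial>\<mu> n) - (\<integral>x. f x \<partial>\<nu> n)) \<longlonglongrightarrow> 0"
    by (rule char_diff_imp_integral_diff[OF mu tight ch' f])
  moreover have fm: "f \<in> borel_measurable borel" using f(1) by (rule borel_measurable_continuous_onI)
  have "norm (f x) \<le> c" for x using f(2) by simp
  note diff[OF fm this]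
  ultimately show ?thesis by simp
qed

lemma cmod_iexp_diff_le:
  assumes "b \<ge> 0"
  shows "cmod (iexp a - of_real (exp (- b))) \<le> 2"
proof -
  have "cmod (iexp a - of_real (exp (- b))) \<le> cmod (iexp a) + cmod (of_real (exp (- b)))"
    by (rule norm_triangle_ineq4)
  also have "\<dots> \<le> 1 + 1" using assms by (intro add_mono) simp_all
  finally show ?thesis by simp
qed

text \<open>Here \<open>y\<close> is a martingale sum approximating the statistic \<open>Y\<close>,
  \<open>Q\<close> is its accumulated conditional variance and \<open>L\<close> the variance
  intended for the limit. Multiplying the compensated characteristic function by
  \<open>exp (- (t^2 * L / 2))\<close> cancels the compensator in the limit, and the bound
  \<open>E\<close> permits dominated convergence.\<close>

lemma compensated_cf_imp:
  fixes Y y Q L :: "nat \<Rightarrow> 'a \<Rightarrow> real"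
  assumes meas: "\<And>n. Y n \<in> borel_measurable M" "\<And>n. y n \<in> borel_measurable M" "\<And>n. Q n \<in> borel_measurable M"
      "\<And>n. L n \<in> borel_measurable M" "\<And>n. H n \<in> sets M"
    and L: "\<And>n \<omega>. \<omega> \<in> space M \<Longrightarrow> 0 \<le> L n \<omega>"
    and Q: "\<And>n \<omega>. \<omega> \<in> space M \<Longrightarrow> exp (t\<^sup>2 / 2 * Q n \<omega>) \<le> E"
    and lim: "AE \<omega> in M. (\<lambda>n. Q n \<omega> - L n \<omega>) \<longlonglongrightarrow> 0" "AE \<omega> in M. (\<lambda>n. Y n \<omega> - y n \<omega>) \<longlonglongrightarrow> 0"
    and cf: "(\<lambda>n. \<integral>\<omega>. of_real (indicator (H n) \<omega> * exp (- (t\<^sup>2 * L n \<omega> / 2))) *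
        (iexp (t * y n \<omega>) * of_real (exp (t\<^sup>2 / 2 * Q n \<omega>)) - 1) \<partial>M) \<longlonglongrightarrow> 0"
  shows "(\<lambda>n. \<integral>\<omega>. of_real (indicator (H n) \<omega>) * (iexp (t * Y n \<omega>) - of_real (exp (- (t\<^sup>2 * L n \<omega> / 2)))) \<partial>M) \<longlonglongrightarrow> 0"
proof -
  note [measurable] = meas
  let ?I = "\<lambda>n \<omega>. of_real (indicator (H n) \<omega>) :: complex"
  let ?G = "\<lambda>n \<omega>. iexp (t * y n \<omega>) * of_real (exp (t\<^sup>2 / 2 * Q n \<omega>))"
  let ?T = "\<lambda>n \<omega>. ?I n \<omega> * (iexp (t * Y n \<omega>) - of_real (exp (- (t\<^sup>2 * L n \<omega> / 2))))"
  let ?R = "\<lambda>n \<omega>. of_real (indicator (H n) \<omega> * exp (- (t\<^sup>2 * L n \<omega> / 2))) * (?G n \<omega> - 1)"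
  have Tb: "cmod (?T n \<omega>) \<le> 1 * 2" if w: "\<omega> \<in> space M" for n \<omega>
    unfolding norm_mult
  proof (rule mult_mono)
    show "cmod (iexp (t * Y n \<omega>) - of_real (exp (- (t\<^sup>2 * L n \<omega> / 2)))) \<le> 2"
      by (rule cmod_iexp_diff_le) (use L[OF w, of n] in simp)
  qed (auto simp: indicator_def)
  have Rb: "cmod (?R n \<omega>) \<le> 1 * (E + 1)" if w: "\<omega> \<in> space M" for n \<omega>
    unfolding norm_mult
  proof (rule mult_mono)
    show "cmod (of_real (indicator (H n) \<omega> * exp (- (t\<^sup>2 * L n \<omega> / 2)))) \<le> 1"
      unfolding norm_of_real using L[OF w, of n] by (auto simp: indicator_def)
    have "cmod (?G n \<omega>) \<le> E" using Q[OF w, of n] by (simp add: norm_mult)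
    then show "cmod (?G n \<omega> - 1) \<le> E + 1" using norm_triangle_ineq4[of "?G n \<omega>" 1] by simp
  qed auto
  have iT: "integrable M (?T n)" and iR: "integrable M (?R n)" for n
    by (rule integrable_bounded[OF _ Tb] integrable_bounded[OF _ Rb]; measurable)+
  have "(\<lambda>n. \<integral>\<omega>. ?R n \<omega> - ?T n \<omega> \<partial>M) \<longlonglongrightarrow> (\<integral>\<omega>. 0 \<partial>M)"
  proof (rule integral_dominated_convergence[where w="\<lambda>_. E + 3"])
    show "AE \<omega> in M. (\<lambda>n. ?R n \<omega> - ?T n \<omega>) \<longlonglongrightarrow> 0"
      using lim
    proof eventually_elim
      case (elim \<omega>)
      define c where "c n = t\<^sup>2 / 2 * (Q n \<omega> - L n \<omega>)" for n
      \<comment> \<open>The difference is governed by two quantities that vanish along almost every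
        path: \<open>exp (c n) - 1\<close> from replacing \<open>Q\<close> by \<open>L\<close>, and
        \<open>iexp (t * (Y - y)) - 1\<close> from replacing \<open>y\<close> by
        \<open>Y\<close>.\<close>
      have eq: "?R n \<omega> - ?T n \<omega> = ?I n \<omega> * (iexp (t * y n \<omega>) * ((of_real (exp (c n)) - 1) - (iexp (t * (Y n \<omega> - y n \<omega>)) - 1)))" for n
      proof -
        have 1: "iexp (t * Y n \<omega>) = iexp (t * y n \<omega>) * iexp (t * (Y n \<omega> - y n \<omega>))"
          by (simp add: algebra_simps flip: exp_add)
        have 2: "complex_of_real (exp (c n)) = of_real (exp (t\<^sup>2 / 2 * Q n \<omega>)) * of_real (exp (- (t\<^sup>2 * L n \<omega> / 2)))"
          unfolding c_def of_real_mult[symmetric] exp_add[symmetric] by (simp add: field_simps)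
        show ?thesis unfolding 1 2 by (simp add: algebra_simps)
      qed
      have "c \<longlonglongrightarrow> t\<^sup>2 / 2 * 0" unfolding c_def by (intro tendsto_intros elim)
      then have c0: "c \<longlonglongrightarrow> 0" by simp
      have "(\<lambda>n. cmod (complex_of_real (exp (c n)) - 1) + cmod (iexp (t * (Y n \<omega> - y n \<omega>)) - 1)) \<longlonglongrightarrow>
          cmod (complex_of_real (exp 0) - 1) + cmod (iexp (t * 0) - 1)"
        by (intro tendsto_intros c0 elim)
      then have "(\<lambda>n. cmod (complex_of_real (exp (c n)) - 1) + cmod (iexp (t * (Y n \<omega> - y n \<omega>)) - 1)) \<longlonglongrightarrow> 0" by simp
      moreover have "cmod (?R n \<omega> - ?T n \<omega>) \<le> cmod (complex_of_real (exp (c n)) - 1) + cmod (iexp (t * (Y n \<omega> - y n \<omega>)) - 1)" for n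
      proof -
        have "cmod (?R n \<omega> - ?T n \<omega>) \<le> 1 * (1 * cmod ((of_real (exp (c n)) - 1) - (iexp (t * (Y n \<omega> - y n \<omega>)) - 1)))"
          unfolding eq norm_mult by (intro mult_mono) (auto simp: indicator_def)
        also have "\<dots> \<le> cmod (complex_of_real (exp (c n)) - 1) + cmod (iexp (t * (Y n \<omega> - y n \<omega>)) - 1)"
          unfolding mult_1_left by (rule norm_triangle_ineq4)
        finally show ?thesis .
      qed
      ultimately show ?case by (intro Lim_null_comparison[where f="\<lambda>n. ?R n \<omega> - ?T n \<omega>"] always_eventually allI)
    qed
    show "AE \<omega> in M. norm (?R n \<omega> - ?T n \<omega>) \<le> E + 3" for n
    proof (rule AE_I2)
      fix \<omega> assume w: "\<omega> \<in> space M"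
      show "norm (?R n \<omega> - ?T n \<omega>) \<le> E + 3"
        using order_trans[OF norm_triangle_ineq4 add_mono[OF Rb[OF w, of n] Tb[OF w, of n]]] by (simp add: add.commute)
    qed
  qed auto
  then have "(\<lambda>n. (\<integral>\<omega>. ?R n \<omega> \<partial>M) - (\<integral>\<omega>. ?T n \<omega> \<partial>M)) \<longlonglongrightarrow> 0"
    unfolding Bochner_Integration.integral_diff[OF iR iT] by simp
  from tendsto_diff[OF cf this] show ?thesis by simp
qed

text \<open>The limit variance is revealed only by the whole sequence, so its exponential cannot
  serve as the starting weight in \<open>cf_prod_bound\<close>. The product is therefore compared
  with 1 on events of a fixed \<open>F N\<close>, and the weight, as well as an arbitrary event of
  \<open>M\<close>, enters through \<open>tendsto_integral_extend_complex\<close>.\<close>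

lemma stable_clt:
  fixes Y :: "nat \<Rightarrow> 'a \<Rightarrow> real" and f :: "real \<Rightarrow> real"
  assumes md: "mart_diff \<xi> (\<lambda>_. K)" and cv: "cond_var \<xi> v"
    and v: "\<And>n \<omega>. \<omega> \<in> space M \<Longrightarrow> 0 \<le> v n \<omega>" "\<And>n \<omega>. \<omega> \<in> space M \<Longrightarrow> v n \<omega> \<le> K\<^sup>2"
    and L: "L \<in> borel_measurable M" "AE \<omega> in M. (\<lambda>n. v n \<omega>) \<longlonglongrightarrow> L \<omega>"
    and Y: "\<And>n. Y n \<in> borel_measurable M" "AE \<omega> in M. (\<lambda>n. Y n \<omega> - (\<Sum>k<n. \<xi> k \<omega>) / sqrt (real n)) \<longlonglongrightarrow> 0"
    and H: "H \<in> sets M" and f: "continuous_on UNIV f" "\<And>x. \<bar>f x\<bar> \<le> c"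
  shows "(\<lambda>n. \<integral>\<omega>. indicator H \<omega> * f (Y n \<omega>) \<partial>M) \<longlonglongrightarrow> (\<integral>\<omega>. indicator H \<omega> * (\<integral>x. f x \<partial>gaussian 0 (L \<omega>)) \<partial>M)"
proof -
  have xF: "\<xi> k \<in> borel_measurable (F (Suc k))" for k
    using md unfolding mart_diff_def by blast
  have vF: "v k \<in> borel_measurable (F k)" for k
    using cv unfolding cond_var_def by blast
  have [measurable]: "\<xi> k \<in> borel_measurable M" "v k \<in> borel_measurable M" for k
    using xF vF measurable_M by blast+
  note [measurable] = L(1) Y(1) H
  have [measurable]: "f \<in> borel_measurable borel" using f(1) by (rule borel_measurable_continuous_onI)
  \<comment> \<open>A version of \<open>L\<close> that satisfies the bounds everywhere; being the
    limit of \<open>v\<close>, the variable \<open>L\<close> agrees with it almost surely.\<close>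
  define L' where "L' \<omega> = max 0 (min (K\<^sup>2) (L \<omega>))" for \<omega>
  have [measurable]: "L' \<in> borel_measurable M" unfolding L'_def by measurable
  have L'L: "AE \<omega> in M. L' \<omega> = L \<omega>"
    using L(2) AE_space
  proof eventually_elim
    case (elim \<omega>)
    have "L \<omega> \<ge> 0" by (rule LIMSEQ_le_const[OF elim(1)]) (use v(1)[OF elim(2)] in auto)
    moreover have "L \<omega> \<le> K\<^sup>2" by (rule LIMSEQ_le_const2[OF elim(1)]) (use v(2)[OF elim(2)] in auto)
    ultimately show ?case by (simp add: L'_def)
  qed
  have L'0: "0 \<le> L' \<omega>" "L' \<omega> \<le> K\<^sup>2" for \<omega> by (auto simp: L'_def)
  have ch: "(\<lambda>n. \<integral>\<omega>. of_real (indicator H \<omega>) * (iexp (t * Y n \<omega>) - of_real (exp (- (t\<^sup>2 * L' \<omega> / 2)))) \<partial>M) \<longlonglongrightarrow> 0" for t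
  proof -
    define s where "s n = t / sqrt (real n)" for n
    have s2: "(s n)\<^sup>2 = t\<^sup>2 / real n" for n by (simp add: s_def power_divide)
    define E where "E = exp (t\<^sup>2 * K\<^sup>2 / 2)"
    have E1: "E \<ge> 1" unfolding E_def by simp
    define Q where "Q N n \<omega> = (\<Prod>k<N. cf_term \<xi> v (s n) k \<omega>)" for N n \<omega>
    have Qcm: "cmod (Q N n \<omega>) = exp ((s n)\<^sup>2 / 2 * (\<Sum>k<N. v k \<omega>))" for N n \<omega>
      unfolding Q_def prod_cf_term by (simp add: norm_mult)
    have sv: "(\<Sum>k<N. v k \<omega>) \<le> real N * K\<^sup>2" if "\<omega> \<in> space M" for N \<omega>
      using sum_mono[of "{..<N}" "\<lambda>k. v k \<omega>" "\<lambda>_. K\<^sup>2"] v(2)[OF that] by simp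
    have QE: "cmod (Q N n \<omega>) \<le> E" if w: "\<omega> \<in> space M" and "N \<le> n" for N n \<omega>
    proof -
      have "(s n)\<^sup>2 / 2 * (\<Sum>k<N. v k \<omega>) \<le> (s n)\<^sup>2 / 2 * (real n * K\<^sup>2)"
        using order_trans[OF sv[OF w, of N] mult_right_mono[of "real N" "real n" "K\<^sup>2"]] that(2)
        by (intro mult_left_mono) auto
      also have "\<dots> \<le> t\<^sup>2 * K\<^sup>2 / 2" unfolding s2 by (cases "n = 0") auto
      finally show ?thesis unfolding Qcm E_def by simp
    qed
    have QF: "Q N n \<in> borel_measurable (F N)" for N n
      unfolding Q_def cf_term_def
    proof (intro borel_measurable_times borel_measurable_prod)
      fix k assume "k \<in> {..<N}"
      then have [measurable]: "\<xi> k \<in> borel_measurable (F N)" "v k \<in> borel_measurable (F N)"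
        using measurable_mono[OF xF, of k N] measurable_mono[OF vF, of k N] by auto
      show "(\<lambda>\<omega>. iexp (s n * \<xi> k \<omega>)) \<in> borel_measurable (F N)" by measurable
      show "(\<lambda>\<omega>. complex_of_real (exp ((s n)\<^sup>2 / 2 * v k \<omega>))) \<in> borel_measurable (F N)" by measurable
    qed
    have [measurable]: "Q N n \<in> borel_measurable M" for N n using QF measurable_M by blast
    define h where "h \<omega> = indicator H \<omega> * exp (- (t\<^sup>2 * L' \<omega> / 2))" for \<omega>
    have [measurable]: "h \<in> borel_measurable M" unfolding h_def by measurable
    have hb: "\<bar>h \<omega>\<bar> \<le> 1" for \<omega> unfolding h_def using L'0(1)[of \<omega>] by (auto simp: indicator_def)
    have main: "(\<lambda>n. \<integral>\<omega>. of_real (h \<omega>) * (Q n n \<omega> - 1) \<partial>M) \<longlonglongrightarrow> 0"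
    proof (rule tendsto_integral_extend_complex)
      show "(\<lambda>\<omega>. Q n n \<omega> - 1) \<in> borel_measurable Finf" for n
        using measurable_Finf[OF QF[of n n]] by measurable
      show "cmod (Q n n \<omega> - 1) \<le> E + 1" if "\<omega> \<in> space M" for n \<omega>
        using norm_triangle_ineq4[of "Q n n \<omega>" 1] QE[OF that, of n n] by simp
      show "\<bar>h \<omega>\<bar> \<le> 1" for \<omega> by (rule hb)
      fix N H assume H: "H \<in> sets (F N)"
      then have [measurable]: "H \<in> sets M" by (rule sets_M)
      let ?I = "\<lambda>\<omega>. of_real (indicator H \<omega>) :: complex"
      \<comment> \<open>The first \<open>N\<close> factors, which precede the time at which
        \<open>H\<close> is known, tend to 1 because \<open>s n\<close> tends to 0.\<close>
      have a: "(\<lambda>n. \<integral>\<omega>. ?I \<omega> * (Q N n \<omega> - 1) \<partial>M) \<longlonglongrightarrow> (\<integral>\<omega>. 0 \<partial>M)"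
      proof (rule integral_dominated_convergence[where w="\<lambda>_. exp (t\<^sup>2 * (real N * K\<^sup>2)) + 1"])
        have s0: "s \<longlonglongrightarrow> 0" unfolding s_def by real_asymp
        show "AE \<omega> in M. (\<lambda>n. ?I \<omega> * (Q N n \<omega> - 1)) \<longlonglongrightarrow> 0"
        proof (rule AE_I2)
          fix \<omega>
          have "(\<lambda>n. ?I \<omega> * (Q N n \<omega> - 1)) \<longlonglongrightarrow> ?I \<omega> * ((\<Prod>k<N. iexp (0 * \<xi> k \<omega>) * of_real (exp (0\<^sup>2 / 2 * v k \<omega>))) - 1)"
            unfolding Q_def cf_term_def by (intro tendsto_intros s0) auto
          then show "(\<lambda>n. ?I \<omega> * (Q N n \<omega> - 1)) \<longlonglongrightarrow> 0" by simp
        qed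
        show "AE \<omega> in M. norm (?I \<omega> * (Q N n \<omega> - 1)) \<le> exp (t\<^sup>2 * (real N * K\<^sup>2)) + 1" for n
        proof (rule AE_I2)
          fix \<omega> assume w: "\<omega> \<in> space M"
          have "(s n)\<^sup>2 \<le> t\<^sup>2" unfolding s2 by (cases "n = 0") (auto simp: divide_le_eq mult_le_cancel_left1)
          then have "(s n)\<^sup>2 / 2 \<le> t\<^sup>2" using zero_le_power2[of t] by linarith
          then have "(s n)\<^sup>2 / 2 * (\<Sum>k<N. v k \<omega>) \<le> t\<^sup>2 * (real N * K\<^sup>2)"
            using sv[OF w, of N] v(1)[OF w] by (intro mult_mono sum_nonneg) auto
          then have "cmod (Q N n \<omega>) \<le> exp (t\<^sup>2 * (real N * K\<^sup>2))" unfolding Qcm by simp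
          then show "norm (?I \<omega> * (Q N n \<omega> - 1)) \<le> exp (t\<^sup>2 * (real N * K\<^sup>2)) + 1"
            using norm_triangle_ineq4[of "Q N n \<omega>" 1] by (auto simp: norm_mult indicator_def)
        qed
      qed auto
      \<comment> \<open>From \<open>N\<close> on, \<open>cf_prod_bound\<close> applies with the
        event and the first \<open>N\<close> factors as weight. The error is \<open>n\<close> times
        a cube of order \<open>n powr (- 3 / 2)\<close>, hence of order
        \<open>1 / sqrt n\<close>.\<close>
      have b: "(\<lambda>n. (\<integral>\<omega>. ?I \<omega> * Q n n \<omega> \<partial>M) - (\<integral>\<omega>. ?I \<omega> * Q N n \<omega> \<partial>M)) \<longlonglongrightarrow> 0"
      proof (rule Lim_null_comparison)
        show "\<forall>\<^sub>F n in sequentially. norm ((\<integral>\<omega>. ?I \<omega> * Q n n \<omega> \<partial>M) - (\<integral>\<omega>. ?I \<omega> * Q N n \<omega> \<partial>M)) \<le> E * E * (real n * (\<bar>s n * K\<bar> ^ 3 + \<bar>s n * K\<bar> ^ 4))"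
        proof (rule eventually_sequentiallyI)
          fix n assume n: "N \<le> n"
          have "Q n n \<omega> = Q N n \<omega> * (\<Prod>k\<in>{N..<n}. cf_term \<xi> v (s n) k \<omega>)" for \<omega>
            unfolding Q_def lessThan_atLeast0 by (rule prod.atLeastLessThan_concat[symmetric]) (use n in auto)
          then have "(\<integral>\<omega>. ?I \<omega> * Q n n \<omega> \<partial>M) = (\<integral>\<omega>. (?I \<omega> * Q N n \<omega>) * (\<Prod>k\<in>{N..<n}. cf_term \<xi> v (s n) k \<omega>) \<partial>M)"
            by (simp add: mult.assoc)
          then have "norm ((\<integral>\<omega>. ?I \<omega> * Q n n \<omega> \<partial>M) - (\<integral>\<omega>. ?I \<omega> * Q N n \<omega> \<partial>M)) \<le>
             E * exp ((s n)\<^sup>2 / 2 * (\<Sum>k\<in>{N..<n}. K\<^sup>2)) * (\<Sum>k\<in>{N..<n}. \<bar>s n * K\<bar> ^ 3 + \<bar>s n * K\<bar> ^ 4)"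
            by (simp only:) (rule cf_prod_bound[OF md cv v],
              use QF[of N n] H n QE[OF _ n] E1 in \<open>auto simp: norm_mult indicator_def intro: order_trans[OF zero_le_one]\<close>)
          also have "\<dots> \<le> E * E * (real n * (\<bar>s n * K\<bar> ^ 3 + \<bar>s n * K\<bar> ^ 4))"
          proof (intro mult_mono)
            have "(s n)\<^sup>2 / 2 * (\<Sum>k\<in>{N..<n}. K\<^sup>2) \<le> (s n)\<^sup>2 / 2 * (real n * K\<^sup>2)"
              by (intro mult_left_mono) (auto intro!: mult_right_mono)
            also have "\<dots> \<le> t\<^sup>2 * K\<^sup>2 / 2" unfolding s2 by (cases "n = 0") auto
            finally show "exp ((s n)\<^sup>2 / 2 * (\<Sum>k\<in>{N..<n}. K\<^sup>2)) \<le> E" unfolding E_def by simp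
            show "(\<Sum>k\<in>{N..<n}. \<bar>s n * K\<bar> ^ 3 + \<bar>s n * K\<bar> ^ 4) \<le> real n * (\<bar>s n * K\<bar> ^ 3 + \<bar>s n * K\<bar> ^ 4)"
              by (simp add: mult_right_mono)
          qed (use E1 in \<open>auto intro!: sum_nonneg mult_nonneg_nonneg\<close>)
          finally show "norm ((\<integral>\<omega>. ?I \<omega> * Q n n \<omega> \<partial>M) - (\<integral>\<omega>. ?I \<omega> * Q N n \<omega> \<partial>M)) \<le> E * E * (real n * (\<bar>s n * K\<bar> ^ 3 + \<bar>s n * K\<bar> ^ 4))" .
        qed
        show "(\<lambda>n. E * E * (real n * (\<bar>s n * K\<bar> ^ 3 + \<bar>s n * K\<bar> ^ 4))) \<longlonglongrightarrow> 0"
        proof -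
          have "\<bar>s n * K\<bar> = \<bar>t * K\<bar> / sqrt (real n)" for n unfolding s_def by (simp add: abs_mult)
          moreover have "(\<lambda>n. E * E * (real n * ((x / sqrt (real n)) ^ 3 + (x / sqrt (real n)) ^ 4))) \<longlonglongrightarrow> 0" for x
          proof -
            have "(\<lambda>n. E * E * (x ^ 3 * (real n / sqrt (real n) ^ 3) + x ^ 4 * (real n / sqrt (real n) ^ 4))) \<longlonglongrightarrow> E * E * (x ^ 3 * 0 + x ^ 4 * 0)"
              by (intro tendsto_intros) real_asymp+
            then show ?thesis by (simp add: power_divide algebra_simps)
          qed
          ultimately show ?thesis by simp
        qed
      qed
      have iI: "integrable M (\<lambda>\<omega>. ?I \<omega> * Q j n \<omega>)" for j n
      proof (rule integrable_bounded)
        show "norm (?I \<omega> * Q j n \<omega>) \<le> exp ((s n)\<^sup>2 / 2 * (real j * K\<^sup>2))" if "\<omega> \<in> space M" for \<omega>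
          unfolding norm_mult Qcm using sv[OF that, of j] by (auto simp: indicator_def intro!: mult_left_mono)
      qed measurable
      have iI1: "integrable M ?I"
        by (rule integrable_bounded[where c=1]) (auto simp: indicator_def)
      have "(\<integral>\<omega>. ?I \<omega> * (Q j n \<omega> - 1) \<partial>M) = (\<integral>\<omega>. ?I \<omega> * Q j n \<omega> \<partial>M) - (\<integral>\<omega>. ?I \<omega> \<partial>M)" for j n
        unfolding right_diff_distrib mult_1_right by (rule Bochner_Integration.integral_diff[OF iI iI1])
      then show "(\<lambda>n. \<integral>\<omega>. ?I \<omega> * (Q n n \<omega> - 1) \<partial>M) \<longlonglongrightarrow> 0"
        using tendsto_add[OF a b] by simp
    qed measurable
    have Qn: "Q n n \<omega> = iexp (t * ((\<Sum>k<n. \<xi> k \<omega>) / sqrt (real n))) * of_real (exp (t\<^sup>2 / 2 * ((\<Sum>k<n. v k \<omega>) / real n)))" for n \<omega>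
      unfolding Q_def prod_cf_term s2 unfolding s_def by simp
    show ?thesis
    proof (rule compensated_cf_imp[where E=E, OF _ _ _ _ _ _ _ _ Y(2) main[unfolded Qn h_def]])
      show "exp (t\<^sup>2 / 2 * ((\<Sum>k<n. v k \<omega>) / real n)) \<le> E" if "\<omega> \<in> space M" for n \<omega>
        using QE[OF that order_refl, of n] unfolding Qcm s2 by (simp add: mult.commute)
      show "AE \<omega> in M. (\<lambda>n. (\<Sum>k<n. v k \<omega>) / real n - L' \<omega>) \<longlonglongrightarrow> 0"
        using L(2) L'L
      proof eventually_elim
        case (elim \<omega>)
        show ?case using cesaro_average[OF elim(1)] elim(2) by (simp add: LIM_zero)
      qed
    qed (use L'0 in auto)
  qed
  have lim: "(\<lambda>n. \<integral>\<omega>. indicator H \<omega> * (f (Y n \<omega>) - (\<integral>x. f x \<partial>gaussian 0 (L' \<omega>))) \<partial>M) \<longlonglongrightarrow> 0"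
    by (rule gaussian_mixture_tendsto[where K="K\<^sup>2", OF _ _ _ _ _ ch f]) (use L'0 in auto)
  have g: "\<bar>\<integral>x. f x \<partial>gaussian 0 b\<bar> \<le> c" for b by (rule integral_gaussian_bound) (use f in auto)
  have i1: "integrable M (\<lambda>\<omega>. indicator H \<omega> * f (Y n \<omega>))" for n
    by (rule integrable_bounded[where c=c]) (use f order_trans[OF abs_ge_zero f(2)] in \<open>auto simp: indicator_def\<close>)
  have i2: "integrable M (\<lambda>\<omega>. indicator H \<omega> * (\<integral>x. f x \<partial>gaussian 0 (L' \<omega>)))"
    by (rule integrable_bounded[where c=c]) (use g order_trans[OF abs_ge_zero f(2)] in \<open>auto simp: indicator_def\<close>)
  have "(\<integral>\<omega>. indicator H \<omega> * (f (Y n \<omega>) - (\<integral>x. f x \<partial>gaussian 0 (L' \<omega>))) \<partial>M) =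
      (\<integral>\<omega>. indicator H \<omega> * f (Y n \<omega>) \<partial>M) - (\<integral>\<omega>. indicator H \<omega> * (\<integral>x. f x \<partial>gaussian 0 (L' \<omega>)) \<partial>M)" for n
    unfolding right_diff_distrib by (rule Bochner_Integration.integral_diff[OF i1 i2])
  with lim have "(\<lambda>n. \<integral>\<omega>. indicator H \<omega> * f (Y n \<omega>) \<partial>M) \<longlonglongrightarrow> (\<integral>\<omega>. indicator H \<omega> * (\<integral>x. f x \<partial>gaussian 0 (L' \<omega>)) \<partial>M)"
    by (simp add: LIM_zero_iff)
  also have "(\<integral>\<omega>. indicator H \<omega> * (\<integral>x. f x \<partial>gaussian 0 (L' \<omega>)) \<partial>M) = (\<integral>\<omega>. indicator H \<omega> * (\<integral>x. f x \<partial>gaussian 0 (L \<omega>)) \<partial>M)"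
    by (rule integral_cong_AE) (use L'L in auto)
  finally show ?thesis .
qed

text \<open>Telescoping, since \<open>1 / (k + 1)^2 \<le> 1 / k - 1 / (k + 1)\<close>.\<close>

lemma sum_inverse_square_bound:
  assumes "n \<ge> 1"
  shows "(\<Sum>k\<in>{n..<N}. (K / real (Suc k))\<^sup>2) \<le> K\<^sup>2 / real n"
proof -
  have "(\<Sum>k\<in>{n..<N}. 1 / (real (Suc k))\<^sup>2) \<le> 1 / real n - 1 / real N" if "n \<le> N" for N
    using that
  proof (induction N rule: dec_induct)
    case (step N)
    have "1 / (real (Suc N))\<^sup>2 \<le> 1 / real N - 1 / real (Suc N)"
    proof -
      have "1 / real N - 1 / real (Suc N) = 1 / (real N * real (Suc N))"
        using step(1) assms by (simp add: field_simps)
      moreover have "1 / (real (Suc N))\<^sup>2 \<le> 1 / (real N * real (Suc N))"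
        using step(1) assms by (intro divide_left_mono) (auto simp: power2_eq_square)
      ultimately show ?thesis by simp
    qed
    then show ?case using step by simp
  qed simp
  note tele = this
  have *: "(\<Sum>k\<in>{n..<N}. 1 / (real (Suc k))\<^sup>2) \<le> 1 / real n"
  proof (cases "n \<le> N")
    case True
    have "1 / real N \<ge> 0" by simp
    then show ?thesis using tele[OF True] by linarith
  qed simp
  have "(\<Sum>k\<in>{n..<N}. (K / real (Suc k))\<^sup>2) = K\<^sup>2 * (\<Sum>k\<in>{n..<N}. 1 / (real (Suc k))\<^sup>2)"
    by (simp add: sum_distrib_left power_divide)
  also have "\<dots> \<le> K\<^sup>2 * (1 / real n)"
    by (intro mult_left_mono *) simp
  finally show ?thesis by simp
qed

text \<open>The variance \<open>L n\<close> is known at time \<open>n\<close>, just when the tail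
  begins. Thus its exponential and the event \<open>H n\<close>, even though both vary with
  \<open>n\<close>, can be put into the weight of \<open>cf_tail_bound\<close>, and no extension of
  test events is involved.\<close>

lemma strong_clt:
  fixes D :: "nat \<Rightarrow> 'a \<Rightarrow> real" and f :: "real \<Rightarrow> real"
  assumes md: "mart_diff \<xi> (\<lambda>k. K / real (Suc k))" and cv: "cond_var \<xi> v"
    and v: "\<And>n \<omega>. \<omega> \<in> space M \<Longrightarrow> 0 \<le> v n \<omega>" "\<And>n \<omega>. \<omega> \<in> space M \<Longrightarrow> v n \<omega> \<le> (K / real (Suc n))\<^sup>2"
    and L: "\<And>n. L n \<in> borel_measurable (F n)" "\<And>n \<omega>. \<omega> \<in> space M \<Longrightarrow> 0 \<le> L n \<omega>" "\<And>n \<omega>. \<omega> \<in> space M \<Longrightarrow> L n \<omega> \<le> B"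
    and lim: "AE \<omega> in M. (\<lambda>k. (real (Suc k))\<^sup>2 * v k \<omega> - L k \<omega>) \<longlonglongrightarrow> 0" "AE \<omega> in M. convergent (\<lambda>n. L n \<omega>)"
    and D: "\<And>n. D n \<in> borel_measurable M" "AE \<omega> in M. (\<lambda>n. D n \<omega> + sqrt (real n) * (\<Sum>k. \<xi> (k + n) \<omega>)) \<longlonglongrightarrow> 0"
    and H: "\<And>n. H n \<in> sets (F n)" and f: "continuous_on UNIV f" "\<And>x. \<bar>f x\<bar> \<le> c"
  shows "(\<lambda>n. \<integral>\<omega>. indicator (H n) \<omega> * (f (D n \<omega>) - (\<integral>x. f x \<partial>gaussian 0 (L n \<omega>))) \<partial>M) \<longlonglongrightarrow> 0"
proof -
  have xF: "\<xi> k \<in> borel_measurable (F (Suc k))" for k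
    using md unfolding mart_diff_def by blast
  have vF: "v k \<in> borel_measurable (F k)" for k
    using cv unfolding cond_var_def by blast
  have [measurable]: "\<xi> k \<in> borel_measurable M" "v k \<in> borel_measurable M" "L k \<in> borel_measurable M" "H k \<in> sets M" for k
    using xF vF L(1) measurable_M H sets_M by blast+
  note [measurable] = D(1)
  note b2 = summable_square_inverse[of K]
  have sv: "summable (\<lambda>k. v k \<omega>)" if "\<omega> \<in> space M" for \<omega>
    by (rule summable_comparison_test'[OF b2, of 0]) (use v that in auto)
  have svb: "(\<Sum>k. v (k + n) \<omega>) \<le> K\<^sup>2 / real n" if w: "\<omega> \<in> space M" and n: "n \<ge> 1" for n \<omega>
  proof (rule suminf_le_const)
    show "summable (\<lambda>k. v (k + n) \<omega>)" using sv[OF w] by (subst summable_iff_shift)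
    fix N
    have "(\<Sum>k<N. v (k + n) \<omega>) = (\<Sum>k\<in>{n..<N + n}. v k \<omega>)"
      using sum.shift_bounds_nat_ivl[of "\<lambda>k. v k \<omega>" 0 n N] by (simp add: lessThan_atLeast0)
    also have "\<dots> \<le> (\<Sum>k\<in>{n..<N + n}. (K / real (Suc k))\<^sup>2)" by (intro sum_mono v w)
    also have "\<dots> \<le> K\<^sup>2 / real n" by (rule sum_inverse_square_bound[OF n])
    finally show "(\<Sum>k<N. v (k + n) \<omega>) \<le> K\<^sup>2 / real n" .
  qed
  have ch: "(\<lambda>n. \<integral>\<omega>. of_real (indicator (H n) \<omega>) * (iexp (t * D n \<omega>) - of_real (exp (- (t\<^sup>2 * L n \<omega> / 2)))) \<partial>M) \<longlonglongrightarrow> 0" for t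
  proof -
    \<comment> \<open>The minus sign comes from \<open>D n\<close>, which approximates
      \<open>- sqrt n\<close> times the tail sum.\<close>
    define s where "s n = - t * sqrt (real n)" for n
    have s2: "(s n)\<^sup>2 = t\<^sup>2 * real n" for n by (simp add: s_def power_mult_distrib)
    define E where "E = exp (t\<^sup>2 / 2 * K\<^sup>2)"
    have E1: "E \<ge> 1" unfolding E_def by simp
    define G where "G n \<omega> = iexp (s n * (\<Sum>k. \<xi> (k + n) \<omega>)) * of_real (exp ((s n)\<^sup>2 / 2 * (\<Sum>k. v (k + n) \<omega>)))" for n \<omega>
    have [measurable]: "G n \<in> borel_measurable M" for n unfolding G_def by measurable
    have GE: "cmod (G n \<omega>) \<le> E" if w: "\<omega> \<in> space M" for n \<omega>
    proof (cases "n = 0")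
      case True
      then show ?thesis using E1 by (simp add: G_def s_def)
    next
      case False
      have "(s n)\<^sup>2 / 2 * (\<Sum>k. v (k + n) \<omega>) \<le> (s n)\<^sup>2 / 2 * (K\<^sup>2 / real n)"
        by (intro mult_left_mono svb w) (use False in auto)
      also have "\<dots> = t\<^sup>2 / 2 * K\<^sup>2" unfolding s2 using False by simp
      finally show ?thesis unfolding G_def E_def by (simp add: norm_mult)
    qed
    define W where "W n \<omega> = complex_of_real (indicator (H n) \<omega> * exp (- (t\<^sup>2 * L n \<omega> / 2)))" for n \<omega>
    have WF: "W n \<in> borel_measurable (F n)" for n
      unfolding W_def using L(1)[of n] H[of n] by measurable
    have [measurable]: "W n \<in> borel_measurable M" for n using WF measurable_M by blast
    have Wb: "cmod (W n \<omega>) \<le> 1" if "\<omega> \<in> space M" for n \<omega>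
      unfolding W_def norm_of_real using L(2)[OF that, of n] by (auto simp: indicator_def)
    have main: "(\<lambda>n. (\<integral>\<omega>. W n \<omega> * G n \<omega> \<partial>M) - (\<integral>\<omega>. W n \<omega> \<partial>M)) \<longlonglongrightarrow> 0"
    proof (rule Lim_null_comparison)
      define x where "x = \<bar>t * K\<bar>"
      let ?d = "\<lambda>n. x / sqrt (real n)"
      have "norm ((\<integral>\<omega>. W n \<omega> * G n \<omega> \<partial>M) - (\<integral>\<omega>. W n \<omega> \<partial>M)) \<le> E * ((?d n + (?d n)\<^sup>2) * x\<^sup>2)" if n: "n \<ge> 1" for n
      proof -
        \<comment> \<open>Each term is at most \<open>x / sqrt n\<close>, while the squares of the
          terms add up to at most \<open>x^2\<close>. So one factor of each cube, and two of each
          fourth power, are traded for a quantity that tends to 0.\<close>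
        have B3: "(\<Sum>k\<in>{n..<N}. \<bar>s n * (K / real (Suc k))\<bar> ^ 3 + \<bar>s n * (K / real (Suc k))\<bar> ^ 4) \<le> (?d n + (?d n)\<^sup>2) * x\<^sup>2" for N
        proof -
          have "\<bar>s n * (K / real (Suc k))\<bar> \<le> ?d n" if "k \<in> {n..<N}" for k
          proof -
            have "\<bar>s n * (K / real (Suc k))\<bar> = x * (sqrt (real n) / real (Suc k))"
              unfolding s_def x_def by (simp add: abs_mult)
            also have "\<dots> \<le> x * (sqrt (real n) / real n)"
              using that n unfolding x_def by (intro mult_left_mono divide_left_mono) auto
            also have "sqrt (real n) / real n = 1 / sqrt (real n)"
              using n by (simp add: real_div_sqrt field_simps)
            finally show ?thesis by simp
          qed
          then have "(\<Sum>k\<in>{n..<N}. \<bar>s n * (K / real (Suc k))\<bar> ^ 3 + \<bar>s n * (K / real (Suc k))\<bar> ^ 4)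
            \<le> (\<Sum>k\<in>{n..<N}. (?d n + (?d n)\<^sup>2) * (s n * (K / real (Suc k)))\<^sup>2)"
          proof (intro sum_mono)
            fix k assume k: "k \<in> {n..<N}" and *: "\<And>k. k \<in> {n..<N} \<Longrightarrow> \<bar>s n * (K / real (Suc k))\<bar> \<le> ?d n"
            define y where "y = \<bar>s n * (K / real (Suc k))\<bar>"
            have y: "0 \<le> y" "y \<le> ?d n" unfolding y_def using *[OF k] by auto
            have "y ^ 3 + y ^ 4 = (y + y\<^sup>2) * y\<^sup>2" by (simp add: algebra_simps eval_nat_numeral)
            also have "\<dots> \<le> (?d n + (?d n)\<^sup>2) * y\<^sup>2"
              by (intro mult_right_mono add_mono power_mono y) auto
            finally show "\<bar>s n * (K / real (Suc k))\<bar> ^ 3 + \<bar>s n * (K / real (Suc k))\<bar> ^ 4 \<le> (?d n + (?d n)\<^sup>2) * (s n * (K / real (Suc k)))\<^sup>2"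
              unfolding y_def by (simp only: power2_abs)
          qed
          also have "\<dots> = (?d n + (?d n)\<^sup>2) * ((s n)\<^sup>2 * (\<Sum>k\<in>{n..<N}. (K / real (Suc k))\<^sup>2))"
            unfolding power_mult_distrib sum_distrib_left ..
          also have "\<dots> \<le> (?d n + (?d n)\<^sup>2) * ((s n)\<^sup>2 * (K\<^sup>2 / real n))"
            by (intro mult_left_mono sum_inverse_square_bound n) (auto simp: x_def)
          also have "(s n)\<^sup>2 * (K\<^sup>2 / real n) = x\<^sup>2" unfolding s2 x_def using n by (simp add: power_mult_distrib)
          finally show ?thesis .
        qed
        have "norm ((\<integral>\<omega>. W n \<omega> * G n \<omega> \<partial>M) - (\<integral>\<omega>. W n \<omega> \<partial>M)) \<le> 1 * exp ((s n)\<^sup>2 / 2 * (K\<^sup>2 / real n)) * ((?d n + (?d n)\<^sup>2) * x\<^sup>2)"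
          unfolding G_def
          by (rule cf_tail_bound[OF md cv v WF Wb b2 sum_inverse_square_bound[OF n] B3]) auto
        also have "(s n)\<^sup>2 / 2 * (K\<^sup>2 / real n) = t\<^sup>2 / 2 * K\<^sup>2" unfolding s2 using n by simp
        finally show ?thesis unfolding E_def by simp
      qed
      then show "\<forall>\<^sub>F n in sequentially. norm ((\<integral>\<omega>. W n \<omega> * G n \<omega> \<partial>M) - (\<integral>\<omega>. W n \<omega> \<partial>M)) \<le> E * ((?d n + (?d n)\<^sup>2) * x\<^sup>2)"
        by (rule eventually_sequentiallyI)
      have d0: "?d \<longlonglongrightarrow> 0" by real_asymp
      have "(\<lambda>n. E * ((?d n + (?d n)\<^sup>2) * x\<^sup>2)) \<longlonglongrightarrow> E * ((0 + 0\<^sup>2) * x\<^sup>2)"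
        by (intro tendsto_intros d0)
      then show "(\<lambda>n. E * ((?d n + (?d n)\<^sup>2) * x\<^sup>2)) \<longlonglongrightarrow> 0" by simp
    qed
    have iW: "integrable M (\<lambda>\<omega>. W n \<omega> * G n \<omega>)" "integrable M (W n)" for n
    proof -
      show "integrable M (\<lambda>\<omega>. W n \<omega> * G n \<omega>)"
      proof (rule integrable_bounded)
        show "cmod (W n \<omega> * G n \<omega>) \<le> 1 * E" if w: "\<omega> \<in> space M" for \<omega>
          unfolding norm_mult using Wb[OF w, of n] GE[OF w, of n] by (intro mult_mono) auto
      qed measurable
      show "integrable M (W n)" by (rule integrable_bounded[OF _ Wb]) measurable
    qed
    have "(\<integral>\<omega>. W n \<omega> * (G n \<omega> - 1) \<partial>M) = (\<integral>\<omega>. W n \<omega> * G n \<omega> \<partial>M) - (\<integral>\<omega>. W n \<omega> \<partial>M)" for n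
      unfolding right_diff_distrib mult_1_right by (rule Bochner_Integration.integral_diff[OF iW])
    with main have main': "(\<lambda>n. \<integral>\<omega>. W n \<omega> * (G n \<omega> - 1) \<partial>M) \<longlonglongrightarrow> 0" by simp
    have Gn: "G n \<omega> = iexp (t * (- sqrt (real n) * (\<Sum>k. \<xi> (k + n) \<omega>))) * of_real (exp (t\<^sup>2 / 2 * (real n * (\<Sum>k. v (k + n) \<omega>))))" for n \<omega>
      unfolding G_def s2 unfolding s_def by (simp add: mult.assoc)
    show ?thesis
    proof (rule compensated_cf_imp[where E=E, OF _ _ _ _ _ L(2) _ _ _ main'[unfolded Gn W_def]])
      show "exp (t\<^sup>2 / 2 * (real n * (\<Sum>k. v (k + n) \<omega>))) \<le> E" if "\<omega> \<in> space M" for n \<omega>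
        using GE[OF that, of n] unfolding Gn by (simp add: norm_mult)
      show "AE \<omega> in M. (\<lambda>n. D n \<omega> - - sqrt (real n) * (\<Sum>k. \<xi> (k + n) \<omega>)) \<longlonglongrightarrow> 0" using D(2) by simp
      show "AE \<omega> in M. (\<lambda>n. real n * (\<Sum>k. v (k + n) \<omega>) - L n \<omega>) \<longlonglongrightarrow> 0"
        using lim
      proof eventually_elim
        case (elim \<omega>)
        obtain l where l: "(\<lambda>n. L n \<omega>) \<longlonglongrightarrow> l" using elim(2) by (auto simp: convergent_def)
        have "(\<lambda>k. (real (Suc k))\<^sup>2 * v k \<omega>) \<longlonglongrightarrow> l"
          using tendsto_add[OF elim(1) l] by simp
        from tendsto_diff[OF square_tail[OF this] l] show ?case by simp
      qed
    qed measurable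
  qed
  show ?thesis
    by (rule gaussian_mixture_tendsto[where K=B, OF _ _ _ _ _ ch f]) (use L in auto)
qed

lemma sigma_finite_subalgebra_F: "sigma_finite_subalgebra M (F n)"
proof -
  interpret finite_measure_subalgebra M "F n" by unfold_locales (rule subalg)
  show ?thesis by (rule sigma_finite_subalgebra_axioms)
qed

text \<open>Events that may vary with \<open>n\<close> give convergence in mean: on the event
  \<open>H n\<close> where the conditional expectation exceeds its target, and on the complement,
  the signed integrals add up to the integral of the absolute difference.\<close>

lemma cond_exp_gaussian_L1:
  fixes D :: "nat \<Rightarrow> 'a \<Rightarrow> real" and f :: "real \<Rightarrow> real"
  assumes L: "\<And>n. L n \<in> borel_measurable (F n)" "V \<in> borel_measurable M" "AE \<omega> in M. (\<lambda>n. L n \<omega>) \<longlonglongrightarrow> V \<omega>"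
    and D: "\<And>n. D n \<in> borel_measurable M"
    and f: "continuous_on UNIV f" "\<And>x. \<bar>f x\<bar> \<le> c"
    and lim: "\<And>H. (\<And>n. H n \<in> sets (F n)) \<Longrightarrow>
      (\<lambda>n. \<integral>\<omega>. indicator (H n) \<omega> * (f (D n \<omega>) - (\<integral>x. f x \<partial>gaussian 0 (L n \<omega>))) \<partial>M) \<longlonglongrightarrow> 0"
  shows "(\<lambda>n. \<integral>\<omega>. \<bar>real_cond_exp M (F n) (\<lambda>\<omega>. f (D n \<omega>)) \<omega> - (\<integral>x. f x \<partial>gaussian 0 (V \<omega>))\<bar> \<partial>M) \<longlonglongrightarrow> 0"
proof -
  have [measurable]: "f \<in> borel_measurable borel" using f(1) by (rule borel_measurable_continuous_onI)
  have [measurable]: "L n \<in> borel_measurable M" for n using L(1) measurable_M by blast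
  note [measurable] = L(2) D
  define X where "X n = real_cond_exp M (F n) (\<lambda>\<omega>. f (D n \<omega>))" for n
  define g where "g n \<omega> = (\<integral>x. f x \<partial>gaussian 0 (L n \<omega>))" for n \<omega>
  define h where "h \<omega> = (\<integral>x. f x \<partial>gaussian 0 (V \<omega>))" for \<omega>
  note S' = sigma_finite_subalgebra_F
  have gb: "\<bar>\<integral>x. f x \<partial>gaussian 0 b\<bar> \<le> c" for b by (rule integral_gaussian_bound) (use f in auto)
  have iD: "integrable M (\<lambda>\<omega>. f (D n \<omega>))" for n by (rule integrable_bounded) (use f in auto)
  have XF [measurable]: "X n \<in> borel_measurable (F n)" for n unfolding X_def by (rule borel_measurable_cond_exp)
  have [measurable]: "X n \<in> borel_measurable M" for n using XF measurable_M by blast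
  have iX: "integrable M (X n)" for n
    unfolding X_def by (rule sigma_finite_subalgebra.real_cond_exp_int(1)[OF S' iD])
  have gF: "g n \<in> borel_measurable (F n)" for n unfolding g_def using L(1)[of n] by measurable
  have [measurable]: "g n \<in> borel_measurable M" "h \<in> borel_measurable M" for n unfolding g_def h_def by measurable
  have ig: "integrable M (g n)" "integrable M h" for n
    by (rule integrable_bounded[where c=c]; use gb in \<open>simp add: g_def h_def\<close>)+
  have eq: "(\<integral>\<omega>. indicator H \<omega> * (X n \<omega> - g n \<omega>) \<partial>M) = (\<integral>\<omega>. indicator H \<omega> * (f (D n \<omega>) - g n \<omega>) \<partial>M)"
    if H: "H \<in> sets (F n)" for H n
  proof -
    have [measurable]: "H \<in> sets M" using H sets_M by blast
    have i: "integrable M (\<lambda>\<omega>. indicator H \<omega> * u \<omega>)" if "integrable M u" for u :: "'a \<Rightarrow> real"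
      using integrable_mult_indicator[OF _ that, of H] by simp
    have "(\<integral>\<omega>. indicator H \<omega> * X n \<omega> \<partial>M) = (\<integral>\<omega>. indicator H \<omega> * f (D n \<omega>) \<partial>M)"
      unfolding X_def
      by (rule sigma_finite_subalgebra.real_cond_exp_intg(2)[OF S' i[OF iD]]) (use H in auto)
    then show ?thesis
      unfolding right_diff_distrib
      using Bochner_Integration.integral_diff[OF i[OF iX[of n]] i[OF ig(1)[of n]]]
        Bochner_Integration.integral_diff[OF i[OF iD[of n]] i[OF ig(1)[of n]]] by simp
  qed
  define H where "H n = {\<omega>\<in>space (F n). X n \<omega> > g n \<omega>}" for n
  have HF: "H n \<in> sets (F n)" for n
    unfolding H_def using XF[of n] gF[of n] by measurable
  have HcF: "space M - H n \<in> sets (F n)" for n using sets.compl_sets[OF HF[of n]] by simp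
  have [measurable]: "H n \<in> sets M" for n using HF sets_M by blast
  have 1: "(\<integral>\<omega>. \<bar>X n \<omega> - g n \<omega>\<bar> \<partial>M) = (\<integral>\<omega>. indicator (H n) \<omega> * (f (D n \<omega>) - g n \<omega>) \<partial>M)
      - (\<integral>\<omega>. indicator (space M - H n) \<omega> * (f (D n \<omega>) - g n \<omega>) \<partial>M)" for n
  proof -
    have i: "integrable M (\<lambda>\<omega>. indicator A \<omega> * (X n \<omega> - g n \<omega>))" if "A \<in> sets M" for A
      using integrable_mult_indicator[OF that Bochner_Integration.integrable_diff[OF iX[of n] ig(1)[of n]]] by simp
    have "(\<integral>\<omega>. \<bar>X n \<omega> - g n \<omega>\<bar> \<partial>M) = (\<integral>\<omega>. indicator (H n) \<omega> * (X n \<omega> - g n \<omega>) - indicator (space M - H n) \<omega> * (X n \<omega> - g n \<omega>) \<partial>M)"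
      by (rule Bochner_Integration.integral_cong) (auto simp: H_def indicator_def)
    also have "\<dots> = (\<integral>\<omega>. indicator (H n) \<omega> * (X n \<omega> - g n \<omega>) \<partial>M) - (\<integral>\<omega>. indicator (space M - H n) \<omega> * (X n \<omega> - g n \<omega>) \<partial>M)"
      by (rule Bochner_Integration.integral_diff; rule i) auto
    finally show ?thesis unfolding eq[OF HF] eq[OF HcF] .
  qed
  have a: "(\<lambda>n. \<integral>\<omega>. \<bar>X n \<omega> - g n \<omega>\<bar> \<partial>M) \<longlonglongrightarrow> 0"
    unfolding 1 using tendsto_diff[OF lim[OF HF] lim[OF HcF]] unfolding g_def by simp
  \<comment> \<open>The target with variance \<open>L n\<close> is exchanged for the one with the
    limit \<open>V\<close>, by continuity of Gaussian integrals in the variance.\<close>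
  have b: "(\<lambda>n. \<integral>\<omega>. \<bar>g n \<omega> - h \<omega>\<bar> \<partial>M) \<longlonglongrightarrow> (\<integral>\<omega>. 0 \<partial>M)"
  proof (rule integral_dominated_convergence[where w="\<lambda>_. 2 * c"])
    show "AE \<omega> in M. (\<lambda>n. \<bar>g n \<omega> - h \<omega>\<bar>) \<longlonglongrightarrow> 0"
      using L(3)
    proof eventually_elim
      case (elim \<omega>)
      have "(\<lambda>n. g n \<omega>) \<longlonglongrightarrow> h \<omega>"
        unfolding g_def h_def by (rule integral_gaussian_tendsto[OF f elim])
      then have "(\<lambda>n. \<bar>g n \<omega> - h \<omega>\<bar>) \<longlonglongrightarrow> \<bar>h \<omega> - h \<omega>\<bar>" by (intro tendsto_intros)
      then show ?case by simp
    qed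
    show "AE \<omega> in M. norm \<bar>g n \<omega> - h \<omega>\<bar> \<le> 2 * c" for n
    proof (rule AE_I2)
      fix \<omega>
      have "\<bar>g n \<omega>\<bar> \<le> c" "\<bar>h \<omega>\<bar> \<le> c" using gb by (auto simp: g_def h_def)
      then show "norm \<bar>g n \<omega> - h \<omega>\<bar> \<le> 2 * c" unfolding real_norm_def by linarith
    qed
  qed auto
  have le: "(\<integral>\<omega>. \<bar>X n \<omega> - h \<omega>\<bar> \<partial>M) \<le> (\<integral>\<omega>. \<bar>X n \<omega> - g n \<omega>\<bar> \<partial>M) + (\<integral>\<omega>. \<bar>g n \<omega> - h \<omega>\<bar> \<partial>M)" for n
  proof -
    have "(\<integral>\<omega>. \<bar>X n \<omega> - h \<omega>\<bar> \<partial>M) \<le> (\<integral>\<omega>. \<bar>X n \<omega> - g n \<omega>\<bar> + \<bar>g n \<omega> - h \<omega>\<bar> \<partial>M)"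
      by (rule integral_mono) (use iX ig in auto)
    also have "\<dots> = (\<integral>\<omega>. \<bar>X n \<omega> - g n \<omega>\<bar> \<partial>M) + (\<integral>\<omega>. \<bar>g n \<omega> - h \<omega>\<bar> \<partial>M)"
      by (rule Bochner_Integration.integral_add) (use iX ig in auto)
    finally show ?thesis .
  qed
  have "(\<lambda>n. \<integral>\<omega>. \<bar>X n \<omega> - h \<omega>\<bar> \<partial>M) \<longlonglongrightarrow> 0"
  proof (rule tendsto_sandwich[OF _ _ tendsto_const])
    show "\<forall>\<^sub>F n in sequentially. 0 \<le> (\<integral>\<omega>. \<bar>X n \<omega> - h \<omega>\<bar> \<partial>M)"
      by (auto intro!: Bochner_Integration.integral_nonneg_AE)
    show "\<forall>\<^sub>F n in sequentially. (\<integral>\<omega>. \<bar>X n \<omega> - h \<omega>\<bar> \<partial>M) \<le> (\<integral>\<omega>. \<bar>X n \<omega> - g n \<omega>\<bar> \<partial>M) + (\<integral>\<omega>. \<bar>g n \<omega> - h \<omega>\<bar> \<partial>M)"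
      using le by simp
    show "(\<lambda>n. (\<integral>\<omega>. \<bar>X n \<omega> - g n \<omega>\<bar> \<partial>M) + (\<integral>\<omega>. \<bar>g n \<omega> - h \<omega>\<bar> \<partial>M)) \<longlonglongrightarrow> 0"
      using tendsto_add[OF a b] by simp
  qed
  then show ?thesis unfolding X_def h_def .
qed

lemma strongly_stably_convergesI:
  fixes D :: "nat \<Rightarrow> 'a \<Rightarrow> real"
  assumes D: "\<And>n. D n \<in> borel_measurable M" and V: "V \<in> borel_measurable M"
    and L1: "\<And>f c. continuous_on UNIV f \<Longrightarrow> (\<And>x. \<bar>f x\<bar> \<le> c) \<Longrightarrow>
      (\<lambda>n. \<integral>\<omega>. \<bar>real_cond_exp M (F n) (\<lambda>\<omega>. f (D n \<omega>)) \<omega> - (\<integral>x. f x \<partial>gaussian 0 (V \<omega>))\<bar> \<partial>M) \<longlonglongrightarrow> 0"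
  shows "strongly_stably_converges M F D (gaussian_kernel V)"
  unfolding strongly_stably_converges_def converges_in_probability_def
proof (intro conjI allI impI)
  show "kernel M (gaussian_kernel V)" by (intro kernelI gaussian_kernel_measurable V)
  fix f :: "real \<Rightarrow> real" and e :: real
  assume f: "continuous_on UNIV f" "bounded (range f)" and e: "e > 0"
  obtain c where c: "\<And>x. \<bar>f x\<bar> \<le> c" using f(2) by (auto simp: bounded_iff)
  note [measurable] = D V
  have [measurable]: "f \<in> borel_measurable borel" using f(1) by (rule borel_measurable_continuous_onI)
  let ?X = "\<lambda>n \<omega>. \<bar>real_cond_exp M (F n) (\<lambda>\<omega>. f (D n \<omega>)) \<omega> - (\<integral>x. f x \<partial>gaussian_kernel V \<omega>)\<bar>"
  note S' = sigma_finite_subalgebra_F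
  have iD: "integrable M (\<lambda>\<omega>. f (D n \<omega>))" for n by (rule integrable_bounded) (use c in auto)
  have gb: "\<bar>\<integral>x. f x \<partial>gaussian 0 b\<bar> \<le> c" for b by (rule integral_gaussian_bound) (use c in auto)
  have "integrable M (\<lambda>\<omega>. \<integral>x. f x \<partial>gaussian_kernel V \<omega>)"
    unfolding gaussian_kernel_def by (rule integrable_bounded) (use gb in auto)
  then have iX: "integrable M (?X n)" for n
    using sigma_finite_subalgebra.real_cond_exp_int(1)[OF S' iD] by auto
  show "(\<lambda>n. prob {\<omega>\<in>space M. ?X n \<omega> > e}) \<longlonglongrightarrow> 0"
  proof (rule tendsto_sandwich[OF _ _ tendsto_const])
    have "(\<lambda>n. (\<integral>\<omega>. ?X n \<omega> \<partial>M) / e) \<longlonglongrightarrow> 0 / e"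
      using L1[OF f(1) c] e unfolding gaussian_kernel_def by (intro tendsto_divide) auto
    then show "(\<lambda>n. (\<integral>\<omega>. ?X n \<omega> \<partial>M) / e) \<longlonglongrightarrow> 0" by simp
    have "prob {\<omega>\<in>space M. ?X n \<omega> > e} \<le> (\<integral>\<omega>. ?X n \<omega> \<partial>M) / e" for n
    proof -
      have "prob {\<omega>\<in>space M. ?X n \<omega> > e} \<le> prob {\<omega>\<in>space M. ?X n \<omega> \<ge> e}"
        by (rule finite_measure_mono) (use borel_measurable_integrable[OF iX[of n]] in auto)
      also have "\<dots> \<le> (\<integral>\<omega>. ?X n \<omega> \<partial>M) / e"
        by (rule integral_Markov_inequality_measure[OF iX sets.empty_sets]) (use e in auto)
      finally show ?thesis .
    qed
    then show "\<forall>\<^sub>F n in sequentially. prob {\<omega>\<in>space M. ?X n \<omega> > e} \<le> (\<integral>\<omega>. ?X n \<omega> \<partial>M) / e" by simp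
  qed simp
qed (use subalg D in auto)

text \<open>\<open>C n\<close> is known at time \<open>n\<close>, so conditioning on \<open>F n\<close> only affects \<open>D n\<close>.\<close>

lemma product_tendsto:
  fixes C D :: "nat \<Rightarrow> 'a \<Rightarrow> real" and f g :: "real \<Rightarrow> real"
  assumes C: "\<And>n. C n \<in> borel_measurable (F n)" and D: "\<And>n. D n \<in> borel_measurable Finf"
    and UV: "U \<in> borel_measurable Finf" "V \<in> borel_measurable Finf"
    and f: "continuous_on UNIV f" "\<And>x. \<bar>f x\<bar> \<le> c" and g: "continuous_on UNIV g" "\<And>x. \<bar>g x\<bar> \<le> c'"
    and stab: "\<And>H. H \<in> sets M \<Longrightarrow> (\<lambda>n. \<integral>\<omega>. indicator H \<omega> * f (C n \<omega>) \<partial>M) \<longlonglongrightarrow> (\<integral>\<omega>. indicator H \<omega> * (\<integral>x. f x \<partial>gaussian 0 (U \<omega>)) \<partial>M)"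
    and L1: "(\<lambda>n. \<integral>\<omega>. \<bar>real_cond_exp M (F n) (\<lambda>\<omega>. g (D n \<omega>)) \<omega> - (\<integral>x. g x \<partial>gaussian 0 (V \<omega>))\<bar> \<partial>M) \<longlonglongrightarrow> 0"
    and H: "H \<in> sets M"
  shows "(\<lambda>n. \<integral>\<omega>. indicator H \<omega> * (f (C n \<omega>) * g (D n \<omega>)) \<partial>M) \<longlonglongrightarrow>
    (\<integral>\<omega>. indicator H \<omega> * ((\<integral>x. f x \<partial>gaussian 0 (U \<omega>)) * (\<integral>x. g x \<partial>gaussian 0 (V \<omega>))) \<partial>M)"
proof -
  have fgm [measurable]: "f \<in> borel_measurable borel" "g \<in> borel_measurable borel"
    using f(1) g(1) by (auto intro: borel_measurable_continuous_onI)
  have CM [measurable]: "C n \<in> borel_measurable M" for n using C measurable_M by blast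
  have [measurable]: "D n \<in> borel_measurable M" "U \<in> borel_measurable M" "V \<in> borel_measurable M" for n
    using D UV measurable_from_subalg[OF subalgebra_Finf] by blast+
  define u where "u \<omega> = (\<integral>x. f x \<partial>gaussian 0 (U \<omega>))" for \<omega>
  define w where "w \<omega> = (\<integral>x. g x \<partial>gaussian 0 (V \<omega>))" for \<omega>
  define X where "X n = real_cond_exp M (F n) (\<lambda>\<omega>. g (D n \<omega>))" for n
  have ub: "\<bar>u \<omega>\<bar> \<le> c" for \<omega> unfolding u_def by (rule integral_gaussian_bound) (use f in auto)
  have wb: "\<bar>w \<omega>\<bar> \<le> c'" for \<omega> unfolding w_def by (rule integral_gaussian_bound) (use g in auto)
  have c0: "c \<ge> 0" "c' \<ge> 0" using f(2)[of 0] g(2)[of 0] by linarith+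
  have uwF: "u \<in> borel_measurable Finf" "w \<in> borel_measurable Finf" unfolding u_def w_def using UV by measurable
  have [measurable]: "u \<in> borel_measurable M" "w \<in> borel_measurable M" unfolding u_def w_def by measurable
  note S' = sigma_finite_subalgebra_F
  have iD: "integrable M (\<lambda>\<omega>. g (D n \<omega>))" for n by (rule integrable_bounded) (use g in auto)
  have iX: "integrable M (X n)" for n
    unfolding X_def by (rule sigma_finite_subalgebra.real_cond_exp_int(1)[OF S' iD])
  have iw: "integrable M w" by (rule integrable_bounded) (use wb in auto)
  have P0: "(\<lambda>n. \<integral>\<omega>. indicator H \<omega> * (f (C n \<omega>) * g (D n \<omega>) - u \<omega> * w \<omega>) \<partial>M) \<longlonglongrightarrow> 0"
  \<comment> \<open>An event of \<open>M\<close> need not be known at any finite time. Since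
    \<open>C\<close>, \<open>D\<close> and the limit variances are all
    \<open>Finf\<close>-measurable, events of some \<open>F N\<close> suffice.\<close>
  proof (rule tendsto_integral_extend)
    show "(\<lambda>\<omega>. f (C n \<omega>) * g (D n \<omega>) - u \<omega> * w \<omega>) \<in> borel_measurable Finf" for n
      using measurable_Finf[OF C[of n]] D[of n] uwF by measurable
    have "\<bar>f (C n \<omega>) * g (D n \<omega>)\<bar> \<le> c * c'" "\<bar>u \<omega> * w \<omega>\<bar> \<le> c * c'" for n \<omega>
      unfolding abs_mult by (intro mult_mono f g ub wb c0 abs_ge_zero)+
    then show "\<bar>f (C n \<omega>) * g (D n \<omega>) - u \<omega> * w \<omega>\<bar> \<le> 2 * (c * c')" for n \<omega>
      using order_trans[OF abs_triangle_ineq4] by (smt (verit))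
    show "integrable M (indicator H :: 'a \<Rightarrow> real)"
      by (rule integrable_bounded[where c=1]) (use H in \<open>auto simp: indicator_def\<close>)
    fix N H assume HF: "H \<in> sets (F N)"
    then have [measurable]: "H \<in> sets M" by (rule sets_M)
    let ?I = "indicator H :: 'a \<Rightarrow> real"
    have a: "(\<lambda>n. \<integral>\<omega>. (?I \<omega> * w \<omega>) * (f (C n \<omega>) - u \<omega>) \<partial>M) \<longlonglongrightarrow> 0"
    proof (rule tendsto_integral_extend_integrable)
      \<comment> \<open>Stable convergence of \<open>C\<close> holds on every event of
        \<open>M\<close>, so the extension to the weight, the indicator of \<open>H\<close> times
        \<open>w\<close>, is made over the full sigma-field.\<close>
      show "subalgebra M M" by (simp add: subalgebra_def)
      show "\<bar>f (C n \<omega>) - u \<omega>\<bar> \<le> 2 * c" for n \<omega>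
        using f(2)[of "C n \<omega>"] ub[of \<omega>] by linarith
      show "(\<lambda>n. \<integral>\<omega>. indicator H \<omega> * (f (C n \<omega>) - u \<omega>) \<partial>M) \<longlonglongrightarrow> 0" if [measurable]: "H \<in> sets M" for H
      proof -
        have "(\<integral>\<omega>. indicator H \<omega> * (f (C n \<omega>) - u \<omega>) \<partial>M) = (\<integral>\<omega>. indicator H \<omega> * f (C n \<omega>) \<partial>M) - (\<integral>\<omega>. indicator H \<omega> * u \<omega> \<partial>M)" for n
          unfolding right_diff_distrib
          by (rule Bochner_Integration.integral_diff; rule integrable_bounded[where c=c])
            (use f ub c0 in \<open>auto simp: indicator_def\<close>)
        then show ?thesis using stab[OF that] unfolding u_def[symmetric] by (simp add: LIM_zero)
      qed
      show "integrable M (\<lambda>\<omega>. ?I \<omega> * w \<omega>)"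
        by (rule integrable_bounded[where c=c']) (use wb c0 in \<open>auto simp: indicator_def\<close>)
    qed measurable
    have b: "(\<lambda>n. \<integral>\<omega>. (?I \<omega> * f (C n \<omega>)) * (X n \<omega> - w \<omega>) \<partial>M) \<longlonglongrightarrow> 0"
    proof (rule Lim_null_comparison)
      have i: "integrable M (\<lambda>\<omega>. (?I \<omega> * f (C n \<omega>)) * (X n \<omega> - w \<omega>))" for n
      proof (rule Bochner_Integration.integrable_bound)
        show "integrable M (\<lambda>\<omega>. c * (X n \<omega> - w \<omega>))" using iX iw by auto
        have "norm ((?I \<omega> * f (C n \<omega>)) * (X n \<omega> - w \<omega>)) \<le> norm (c * (X n \<omega> - w \<omega>))" for \<omega>
          unfolding norm_mult by (rule mult_right_mono) (use f(2)[of "C n \<omega>"] c0 in \<open>auto simp: indicator_def\<close>)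
        then show "AE \<omega> in M. norm ((?I \<omega> * f (C n \<omega>)) * (X n \<omega> - w \<omega>)) \<le> norm (c * (X n \<omega> - w \<omega>))" by simp
      qed (use borel_measurable_integrable[OF iX[of n]] in measurable)
      have "norm (\<integral>\<omega>. (?I \<omega> * f (C n \<omega>)) * (X n \<omega> - w \<omega>) \<partial>M) \<le> c * (\<integral>\<omega>. \<bar>X n \<omega> - w \<omega>\<bar> \<partial>M)" for n
      proof -
        have "norm (\<integral>\<omega>. (?I \<omega> * f (C n \<omega>)) * (X n \<omega> - w \<omega>) \<partial>M) \<le> (\<integral>\<omega>. norm ((?I \<omega> * f (C n \<omega>)) * (X n \<omega> - w \<omega>)) \<partial>M)"
          by (rule integral_norm_bound)
        also have "\<dots> \<le> (\<integral>\<omega>. c * \<bar>X n \<omega> - w \<omega>\<bar> \<partial>M)"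
        proof (rule integral_mono)
          show "norm ((?I \<omega> * f (C n \<omega>)) * (X n \<omega> - w \<omega>)) \<le> c * \<bar>X n \<omega> - w \<omega>\<bar>" for \<omega>
            unfolding real_norm_def abs_mult by (rule mult_right_mono) (use f(2)[of "C n \<omega>"] c0 in \<open>auto simp: indicator_def\<close>)
        qed (use i iX iw in auto)
        finally show ?thesis by simp
      qed
      then show "\<forall>\<^sub>F n in sequentially. norm (\<integral>\<omega>. (?I \<omega> * f (C n \<omega>)) * (X n \<omega> - w \<omega>) \<partial>M) \<le> c * (\<integral>\<omega>. \<bar>X n \<omega> - w \<omega>\<bar> \<partial>M)" by simp
      show "(\<lambda>n. c * (\<integral>\<omega>. \<bar>X n \<omega> - w \<omega>\<bar> \<partial>M)) \<longlonglongrightarrow> 0"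
        using tendsto_mult_right_zero[OF L1, of c] unfolding X_def w_def .
    qed
    \<comment> \<open>For \<open>n \<ge> N\<close> both \<open>H\<close> and \<open>C n\<close> are
      known at time \<open>n\<close>, so \<open>g (D n)\<close> may be replaced by its conditional
      expectation \<open>X n\<close>; \<open>f (C n) * w\<close> is then inserted as the
      intermediate term.\<close>
    have e: "(\<integral>\<omega>. ?I \<omega> * (f (C n \<omega>) * g (D n \<omega>) - u \<omega> * w \<omega>) \<partial>M) =
       (\<integral>\<omega>. (?I \<omega> * f (C n \<omega>)) * (X n \<omega> - w \<omega>) \<partial>M) + (\<integral>\<omega>. (?I \<omega> * w \<omega>) * (f (C n \<omega>) - u \<omega>) \<partial>M)"
      if n: "n \<ge> N" for n
    proof -
      have ICF: "(\<lambda>\<omega>. ?I \<omega> * f (C n \<omega>)) \<in> borel_measurable (F n)"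
      proof -
        have "H \<in> sets (F n)" using sets_mono[OF n] HF by blast
        then show ?thesis using C[of n] by measurable
      qed
      have i1: "integrable M (\<lambda>\<omega>. (?I \<omega> * f (C n \<omega>)) * v \<omega>)" if v: "integrable M v" for v :: "'a \<Rightarrow> real"
      proof (rule Bochner_Integration.integrable_bound)
        show "integrable M (\<lambda>\<omega>. c * v \<omega>)" using v by auto
        have "norm ((?I \<omega> * f (C n \<omega>)) * v \<omega>) \<le> norm (c * v \<omega>)" for \<omega>
          unfolding norm_mult by (rule mult_right_mono) (use f(2)[of "C n \<omega>"] c0 in \<open>auto simp: indicator_def\<close>)
        then show "AE \<omega> in M. norm ((?I \<omega> * f (C n \<omega>)) * v \<omega>) \<le> norm (c * v \<omega>)" by simp
      qed (use borel_measurable_integrable[OF v] in measurable)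
      have i2: "integrable M (\<lambda>\<omega>. (?I \<omega> * w \<omega>) * (f (C n \<omega>) - u \<omega>))"
      proof (rule integrable_bounded)
        show "norm ((?I \<omega> * w \<omega>) * (f (C n \<omega>) - u \<omega>)) \<le> c' * (2 * c)" for \<omega>
          unfolding norm_mult using wb[of \<omega>] c0 f(2)[of "C n \<omega>"] ub[of \<omega>]
          by (intro mult_mono) (auto simp: indicator_def)
      qed measurable
      have "(\<integral>\<omega>. ?I \<omega> * (f (C n \<omega>) * g (D n \<omega>) - u \<omega> * w \<omega>) \<partial>M) =
        (\<integral>\<omega>. ((?I \<omega> * f (C n \<omega>)) * g (D n \<omega>) - (?I \<omega> * f (C n \<omega>)) * w \<omega>) + (?I \<omega> * w \<omega>) * (f (C n \<omega>) - u \<omega>) \<partial>M)"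
        by (rule Bochner_Integration.integral_cong) (auto simp: algebra_simps)
      also have "\<dots> = ((\<integral>\<omega>. (?I \<omega> * f (C n \<omega>)) * g (D n \<omega>) \<partial>M) - (\<integral>\<omega>. (?I \<omega> * f (C n \<omega>)) * w \<omega> \<partial>M)) + (\<integral>\<omega>. (?I \<omega> * w \<omega>) * (f (C n \<omega>) - u \<omega>) \<partial>M)"
        using i1[OF iD[of n]] i1[OF iw] i2 by simp
      also have "(\<integral>\<omega>. (?I \<omega> * f (C n \<omega>)) * g (D n \<omega>) \<partial>M) = (\<integral>\<omega>. (?I \<omega> * f (C n \<omega>)) * X n \<omega> \<partial>M)"
        unfolding X_def
        by (rule sigma_finite_subalgebra.real_cond_exp_intg(2)[OF S' i1[OF iD] ICF, symmetric]) measurable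
      also have "\<dots> - (\<integral>\<omega>. (?I \<omega> * f (C n \<omega>)) * w \<omega> \<partial>M) = (\<integral>\<omega>. (?I \<omega> * f (C n \<omega>)) * (X n \<omega> - w \<omega>) \<partial>M)"
        unfolding right_diff_distrib by (rule Bochner_Integration.integral_diff[OF i1[OF iX] i1[OF iw], symmetric])
      finally show ?thesis .
    qed
    show "(\<lambda>n. \<integral>\<omega>. ?I \<omega> * (f (C n \<omega>) * g (D n \<omega>) - u \<omega> * w \<omega>) \<partial>M) \<longlonglongrightarrow> 0"
      by (rule Lim_transform_eventually[OF tendsto_add_zero[OF b a]])
        (use e in \<open>auto simp: eventually_sequentially intro!: exI[of _ N]\<close>)
  qed
  have fgb: "\<bar>f (C n \<omega>) * g (D n \<omega>)\<bar> \<le> c * c'" "\<bar>u \<omega> * w \<omega>\<bar> \<le> c * c'" for n \<omega>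
      unfolding abs_mult by (intro mult_mono f g ub wb c0 abs_ge_zero)+
  have "(\<integral>\<omega>. indicator H \<omega> * (f (C n \<omega>) * g (D n \<omega>) - u \<omega> * w \<omega>) \<partial>M) =
     (\<integral>\<omega>. indicator H \<omega> * (f (C n \<omega>) * g (D n \<omega>)) \<partial>M) - (\<integral>\<omega>. indicator H \<omega> * (u \<omega> * w \<omega>) \<partial>M)" for n
    unfolding right_diff_distrib[of "indicator H _"]
    by (rule Bochner_Integration.integral_diff; rule integrable_bounded[where c="c * c'"])
      (use H fgb c0 in \<open>auto simp: indicator_def\<close>)
  with P0 have "(\<lambda>n. \<integral>\<omega>. indicator H \<omega> * (f (C n \<omega>) * g (D n \<omega>)) \<partial>M) \<longlonglongrightarrow> (\<integral>\<omega>. indicator H \<omega> * (u \<omega> * w \<omega>) \<partial>M)"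
    by (simp add: LIM_zero_iff)
  then show ?thesis unfolding u_def w_def .
qed

end

section \<open>Weak convergence in the plane\<close>

text \<open>Finite sums of products of bounded continuous functions of one coordinate each. They
  form an algebra which, after a cut-off of the coordinates, contains the polynomials supplied by
  the Stone-Weierstrass theorem.\<close>

inductive tensor :: "(real \<times> real \<Rightarrow> real) \<Rightarrow> bool" where
  prod: "continuous_on UNIV f \<Longrightarrow> (\<And>x. \<bar>f x\<bar> \<le> a) \<Longrightarrow> continuous_on UNIV g \<Longrightarrow> (\<And>x. \<bar>g x\<bar> \<le> b) \<Longrightarrow>
    tensor (\<lambda>z. f (fst z) * g (snd z))"
| add: "tensor p \<Longrightarrow> tensor q \<Longrightarrow> tensor (\<lambda>z. p z + q z)"

lemma tensor_mult:
  assumes "tensor p" "tensor q"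
  shows "tensor (\<lambda>z. p z * q z)"
  using assms
proof (induction p rule: tensor.induct)
  case (prod f a g b)
  note fg = prod(1-4)
  show ?case using prod(5)
  proof (induction q rule: tensor.induct)
    case (prod f' a' g' b')
    have fb: "\<bar>f x * f' x\<bar> \<le> a * a'" for x
      unfolding abs_mult by (rule mult_mono) (use fg(2) prod(2) order_trans[OF abs_ge_zero fg(2)] in auto)
    have gb: "\<bar>g x * g' x\<bar> \<le> b * b'" for x
      unfolding abs_mult by (rule mult_mono) (use fg(4) prod(4) order_trans[OF abs_ge_zero fg(4)] in auto)
    have "tensor (\<lambda>z. (f (fst z) * f' (fst z)) * (g (snd z) * g' (snd z)))"
      using tensor.prod[of "\<lambda>x. f x * f' x" "a * a'" "\<lambda>x. g x * g' x" "b * b'"] fb gb fg(1,3) prod(1,3)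
      by (auto intro: continuous_on_mult)
    then show ?case by (simp add: mult_ac)
  next
    case (add p q)
    then show ?case using tensor.add by (force simp: distrib_left)
  qed
next
  case (add p p')
  then show ?case using tensor.add[of "\<lambda>z. p z * q z" "\<lambda>z. p' z * q z"] by (simp add: distrib_right)
qed

definition clamp :: "real \<Rightarrow> real \<Rightarrow> real" where
  "clamp K x = max (- K) (min K x)"

text \<open>Polynomials are unbounded on the plane. Cutting the coordinates off at \<open>K\<close>
  turns every linear constituent into a sum of bounded functions of one coordinate, and
  \<open>tensor_mult\<close> takes care of the products.\<close>

lemma tensor_polynomial_clamp:
  assumes "real_polynomial_function p" "K \<ge> 0"
  shows "tensor (\<lambda>z. p (clamp K (fst z), clamp K (snd z)))"
  using assms(1)
proof (induction p rule: real_polynomial_function.induct)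
  have cc: "continuous_on UNIV (\<lambda>x. clamp K x)" unfolding clamp_def by (intro continuous_intros)
  have one: "continuous_on UNIV (\<lambda>x. 1::real)" by simp
  {
    case (linear h)
    then interpret bounded_linear h .
    have *: "h (x, y) = x * h (1, 0) + y * h (0, 1)" for x y
      using add[of "(x, 0)" "(0, y)"] scaleR[of x "(1, 0)"] scaleR[of y "(0, 1)"] by simp
    have b: "\<bar>clamp K x * c\<bar> \<le> K * \<bar>c\<bar>" for x c
      unfolding abs_mult by (rule mult_right_mono) (use assms(2) in \<open>auto simp: clamp_def\<close>)
    have "tensor (\<lambda>z. clamp K (fst z) * h (1, 0) * 1)"
      by (rule tensor.prod[where f="\<lambda>x. clamp K x * h (1, 0)" and g="\<lambda>_. 1" and b=1, OF _ b one])
        (auto intro!: continuous_intros cc)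
    moreover have "tensor (\<lambda>z. 1 * (clamp K (snd z) * h (0, 1)))"
      by (rule tensor.prod[where g="\<lambda>x. clamp K x * h (0, 1)" and f="\<lambda>_. 1" and a=1, OF one _ _ b])
        (auto intro!: continuous_intros cc)
    ultimately have "tensor (\<lambda>z. clamp K (fst z) * h (1, 0) * 1 + 1 * (clamp K (snd z) * h (0, 1)))"
      by (rule tensor.add)
    moreover have "h (clamp K (fst z), clamp K (snd z)) = clamp K (fst z) * h (1, 0) * 1 + 1 * (clamp K (snd z) * h (0, 1))" for z
      using *[of "clamp K (fst z)" "clamp K (snd z)"] by simp
    ultimately show ?case by simp
  next
    case (const c)
    have "tensor (\<lambda>z. c * 1)"
      by (rule tensor.prod[where f="\<lambda>_. c" and g="\<lambda>_. 1" and a="\<bar>c\<bar>" and b=1]) auto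
    then show ?case by simp
  next
    case (add f g)
    then show ?case by (intro tensor.add)
  next
    case (mult f g)
    then show ?case by (intro tensor_mult)
  }
qed

lemma tensor_bounded_continuous:
  assumes "tensor p"
  shows "continuous_on UNIV p" "\<exists>c. \<forall>z. \<bar>p z\<bar> \<le> c"
proof -
  show "continuous_on UNIV p"
    using assms
  proof induction
    case (prod f a g b)
    have "continuous_on UNIV (\<lambda>z::real \<times> real. f (fst z))" "continuous_on UNIV (\<lambda>z::real \<times> real. g (snd z))"
      by (rule continuous_on_compose2[OF prod(1) continuous_on_fst[OF continuous_on_id] subset_UNIV]
        continuous_on_compose2[OF prod(3) continuous_on_snd[OF continuous_on_id] subset_UNIV])+
    then show ?case by (rule continuous_on_mult)
  qed (rule continuous_on_add)
  show "\<exists>c. \<forall>z. \<bar>p z\<bar> \<le> c"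
    using assms
  proof induction
    case (prod f a g b)
    have "\<bar>f (fst z) * g (snd z)\<bar> \<le> a * b" for z
      unfolding abs_mult by (rule mult_mono) (use prod order_trans[OF abs_ge_zero prod(2)] in auto)
    then show ?case by blast
  next
    case (add p q)
    then obtain c c' where c: "\<And>z. \<bar>p z\<bar> \<le> c" "\<And>z. \<bar>q z\<bar> \<le> c'" by blast
    have "\<bar>p z + q z\<bar> \<le> c + c'" for z using c(1)[of z] c(2)[of z] by linarith
    then show ?case by blast
  qed
qed

text \<open>On a square the test function is approximated by a polynomial. The mass outside is
  bounded by the integral of a tensor function, so the tightness required of the
  \<open>\<mu> n\<close> also follows from convergence on products.\<close>

lemma weakly_converges_pairI:
  fixes \<mu> :: "nat \<Rightarrow> (real \<times> real) measure"
  assumes mu: "\<And>n. prob_space (\<mu> n)" "\<And>n. sets (\<mu> n) = sets borel"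
    and nu: "prob_space \<nu>" "sets \<nu> = sets borel"
    and lim: "\<And>(f :: real \<Rightarrow> real) (g :: real \<Rightarrow> real) a b. continuous_on UNIV f \<Longrightarrow> (\<And>x. \<bar>f x\<bar> \<le> a) \<Longrightarrow> continuous_on UNIV g \<Longrightarrow> (\<And>x. \<bar>g x\<bar> \<le> b) \<Longrightarrow>
      (\<lambda>n. \<integral>z. f (fst z) * g (snd z) \<partial>\<mu> n) \<longlonglongrightarrow> (\<integral>z. f (fst z) * g (snd z) \<partial>\<nu>)"
  shows "weakly_converges \<mu> \<nu>"
  unfolding weakly_converges_def
proof (intro allI impI)
  fix F :: "real \<times> real \<Rightarrow> real"
  assume F: "continuous_on UNIV F" "bounded (range F)"
  obtain B where "\<And>z. \<bar>F z\<bar> \<le> B" using F(2) by (auto simp: bounded_iff)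
  then obtain B where B: "\<And>z. \<bar>F z\<bar> \<le> B" and B0: "B > 0"
    by (metis abs_ge_zero add.commute add_pos_nonneg less_add_one order_less_imp_le order_trans zero_less_one le_less_trans)
  interpret N: prob_space \<nu> by (rule nu)
  interpret Mu: prob_space "\<mu> n" for n by (rule mu)
  have meas: "f \<in> borel_measurable (\<mu> n)" "f \<in> borel_measurable \<nu>" if "continuous_on UNIV f" for f :: "real \<times> real \<Rightarrow> real" and n
    using borel_measurable_continuous_onI[OF that] mu(2)[of n] nu(2) by (simp_all cong: measurable_cong_sets)
  have iM: "integrable (\<mu> n) f" "integrable \<nu> f" if "continuous_on UNIV f" "\<And>z. \<bar>f z\<bar> \<le> c" for f :: "real \<times> real \<Rightarrow> real" and n c
    by (rule Mu.integrable_const_bound[where B=c] N.integrable_const_bound[where B=c]; use that meas in auto)+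
  have tens: "(\<lambda>n. \<integral>z. p z \<partial>\<mu> n) \<longlonglongrightarrow> (\<integral>z. p z \<partial>\<nu>)" if "tensor p" for p
    using that
  proof induction
    case (prod f a g b)
    show ?case by (rule lim[OF prod])
  next
    case (add p q)
    obtain c c' where c: "\<And>z. \<bar>p z\<bar> \<le> c" "\<And>z. \<bar>q z\<bar> \<le> c'" using tensor_bounded_continuous add(1,2) by meson
    have cont: "continuous_on UNIV p" "continuous_on UNIV q" using tensor_bounded_continuous add(1,2) by blast+
    show ?case
      using tendsto_add[OF add(3,4)] iM[OF cont(1) c(1)] iM[OF cont(2) c(2)] by simp
  qed
  \<comment> \<open>A continuous substitute for the indicator of \<open>\<bar>x\<bar> > K\<close>,
    so that the hypothesis covers its integrals.\<close>
  define \<kappa> where "\<kappa> K x = min 1 (max 0 (\<bar>x\<bar> - K))" for K x :: real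
  have kc: "continuous_on UNIV (\<lambda>x. \<kappa> K x)" for K unfolding \<kappa>_def by (intro continuous_intros)
  have kb: "0 \<le> \<kappa> K x" "\<bar>\<kappa> K x\<bar> \<le> 1" for K x by (auto simp: \<kappa>_def)
  define T where "T K z = \<kappa> K (fst z) * 1 + 1 * \<kappa> K (snd z)" for K and z :: "real \<times> real"
  have one: "continuous_on UNIV (\<lambda>x. 1::real)" "\<bar>1::real\<bar> \<le> 1" by auto
  have Tt: "tensor (T K)" for K
    unfolding T_def by (intro tensor.add tensor.prod[OF kc kb(2) one] tensor.prod[OF one kc kb(2)])
  have Tc: "continuous_on UNIV (T K)" for K by (rule tensor_bounded_continuous(1)[OF Tt])
  have Tb: "0 \<le> T K z" "\<bar>T K z\<bar> \<le> 2" for K z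
    using kb[of K "fst z"] kb[of K "snd z"] unfolding T_def by (auto simp: abs_le_iff)
  have T0: "(\<lambda>k. \<integral>z. T (real k) z \<partial>\<nu>) \<longlonglongrightarrow> (\<integral>z. 0 \<partial>\<nu>)"
  proof (rule integral_dominated_convergence[where w="\<lambda>_. 2"])
    show "AE z in \<nu>. (\<lambda>k. T (real k) z) \<longlonglongrightarrow> 0"
    proof (rule AE_I2)
      fix z
      obtain N :: nat where N: "\<bar>fst z\<bar> + \<bar>snd z\<bar> < real N" using reals_Archimedean2 by blast
      have "T (real k) z = 0" if "k \<ge> N" for k
      proof -
        have "real N \<le> real k" using that by simp
        then show ?thesis using N unfolding T_def \<kappa>_def by simp
      qed
      then have "\<forall>\<^sub>F k in sequentially. T (real k) z = 0" by (rule eventually_sequentiallyI)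
      then show "(\<lambda>k. T (real k) z) \<longlonglongrightarrow> 0" by (rule tendsto_eventually)
    qed
  qed (use Tb meas Tc in auto)
  show "(\<lambda>n. \<integral>z. F z \<partial>\<mu> n) \<longlonglongrightarrow> (\<integral>z. F z \<partial>\<nu>)"
  proof (rule LIMSEQ_I)
    fix r :: real assume r: "r > 0"
    \<comment> \<open>The tail under \<open>\<mu> n\<close>, the tail under \<open>\<nu>\<close> and
      three approximation errors add up to \<open>4 * B * e + 2 * B * e + 3 * e\<close>, which is
      less than \<open>8 * (B + 1) * e\<close>.\<close>
    define e where "e = r / (8 * (B + 1))"
    have e: "e > 0" unfolding e_def using r B0 by simp
    have e': "2 * B * (2 * e) + 2 * B * e + 3 * e < r"
    proof -
      have "2 * B * (2 * e) + 2 * B * e + 3 * e < 8 * (B + 1) * e" using e B0 by (simp add: algebra_simps add_pos_pos)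
      also have "\<dots> = r" unfolding e_def using B0 by simp
      finally show ?thesis .
    qed
    obtain k :: nat where k: "(\<integral>z. T (real k) z \<partial>\<nu>) < e"
    proof -
      have "\<forall>\<^sub>F k in sequentially. (\<integral>z. T (real k) z \<partial>\<nu>) < e"
        by (rule order_tendstoD(2)[OF T0]) (use e in simp)
      then show ?thesis using that eventually_happens'[OF sequentially_bot] by blast
    qed
    \<comment> \<open>The shift by 1 passes the ramp of \<open>\<kappa>\<close>, so that
      \<open>T (real k)\<close> is at least 1 outside the square.\<close>
    define K where "K = real k + 1"
    have K0: "K \<ge> 0" unfolding K_def by simp
    let ?S = "{-K..K} \<times> {-K..K}"
    let ?c = "\<lambda>z. (clamp K (fst z), clamp K (snd z))"
    have cS: "?c z \<in> ?S" for z unfolding clamp_def using K0 by auto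
    obtain p where p: "real_polynomial_function p" "\<And>z. z \<in> ?S \<Longrightarrow> \<bar>F z - p z\<bar> < e"
      using Stone_Weierstrass_real_polynomial_function[of ?S F e] compact_Times[of "{-K..K}" "{-K..K}"]
        continuous_on_subset[OF F(1)] e by auto
    define q where "q z = p (?c z)" for z
    have qt: "tensor q" unfolding q_def by (rule tensor_polynomial_clamp[OF p(1) K0])
    have qc: "continuous_on UNIV q" by (rule tensor_bounded_continuous(1)[OF qt])
    obtain c where qb: "\<And>z. \<bar>q z\<bar> \<le> c" using tensor_bounded_continuous(2)[OF qt] by blast
    have pw: "\<bar>F z - q z\<bar> \<le> 2 * B * T (real k) z + e" for z
    proof -
      have a: "\<bar>F (?c z) - q z\<bar> < e" unfolding q_def using p(2)[OF cS] .
      have "\<bar>F z - F (?c z)\<bar> \<le> 2 * B * T (real k) z"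
      proof (cases "z \<in> ?S")
        case True
        then have "?c z = z" by (cases z) (auto simp: clamp_def)
        then have "F z - F (?c z) = 0" by simp
        then show ?thesis using Tb(1)[of "real k" z] B0 by simp
      next
        case False
        then have "\<bar>fst z\<bar> > K \<or> \<bar>snd z\<bar> > K" by (cases z) auto
        then have "\<kappa> (real k) (fst z) = 1 \<or> \<kappa> (real k) (snd z) = 1" unfolding K_def \<kappa>_def by auto
        then have "T (real k) z \<ge> 1"
          unfolding T_def using kb(1)[of "real k" "fst z"] kb(1)[of "real k" "snd z"] by auto
        then have "2 * B * 1 \<le> 2 * B * T (real k) z" using B0 by (intro mult_left_mono) auto
        then show ?thesis using B[of z] B[of "?c z"] by linarith
      qed
      then show ?thesis using a by linarith
    qed
    have intle: "\<bar>(\<integral>z. F z \<partial>Q) - (\<integral>z. q z \<partial>Q)\<bar> \<le> 2 * B * (\<integral>z. T (real k) z \<partial>Q) + e"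
      if "prob_space Q" and i: "integrable Q F" "integrable Q q" "integrable Q (T (real k))" for Q
    proof -
      interpret Q: prob_space Q by fact
      have "\<bar>(\<integral>z. F z \<partial>Q) - (\<integral>z. q z \<partial>Q)\<bar> = \<bar>\<integral>z. F z - q z \<partial>Q\<bar>" using i by simp
      also have "\<dots> \<le> (\<integral>z. \<bar>F z - q z\<bar> \<partial>Q)" by (rule integral_abs_bound)
      also have "\<dots> \<le> (\<integral>z. 2 * B * T (real k) z + e \<partial>Q)"
        by (rule integral_mono) (use i pw in auto)
      also have "\<dots> = 2 * B * (\<integral>z. T (real k) z \<partial>Q) + e" using i Q.prob_space by simp
      finally show ?thesis .
    qed
    have "\<forall>\<^sub>F n in sequentially. (\<integral>z. T (real k) z \<partial>\<mu> n) < 2 * e"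
      by (rule order_tendstoD(2)[OF tens[OF Tt]]) (use k e in simp)
    moreover have "\<forall>\<^sub>F n in sequentially. \<bar>(\<integral>z. q z \<partial>\<mu> n) - (\<integral>z. q z \<partial>\<nu>)\<bar> < e"
      using tendstoD[OF tens[OF qt] e] by (simp add: dist_real_def)
    ultimately have "\<forall>\<^sub>F n in sequentially. norm ((\<integral>z. F z \<partial>\<mu> n) - (\<integral>z. F z \<partial>\<nu>)) < r"
    proof eventually_elim
      case (elim n)
      have 1: "\<bar>(\<integral>z. F z \<partial>\<mu> n) - (\<integral>z. q z \<partial>\<mu> n)\<bar> \<le> 2 * B * (\<integral>z. T (real k) z \<partial>\<mu> n) + e"
        by (rule intle[OF mu(1) iM(1)[OF F(1) B] iM(1)[OF qc qb] iM(1)[OF Tc Tb(2)]])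
      have 2: "\<bar>(\<integral>z. F z \<partial>\<nu>) - (\<integral>z. q z \<partial>\<nu>)\<bar> \<le> 2 * B * (\<integral>z. T (real k) z \<partial>\<nu>) + e"
        by (rule intle[OF nu(1) iM(2)[OF F(1) B] iM(2)[OF qc qb] iM(2)[OF Tc Tb(2)]])
      have 3: "2 * B * (\<integral>z. T (real k) z \<partial>\<mu> n) \<le> 2 * B * (2 * e)" "2 * B * (\<integral>z. T (real k) z \<partial>\<nu>) \<le> 2 * B * e"
        using elim(1) k B0 by (auto intro!: mult_left_mono)
      show ?case using 1 2 3 elim(2) e' unfolding real_norm_def by linarith
    qed
    then show "\<exists>no. \<forall>n\<ge>no. norm ((\<integral>z. F z \<partial>\<mu> n) - (\<integral>z. F z \<partial>\<nu>)) < r"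
      by (simp add: eventually_sequentially)
  qed
qed

lemma integral_prod_kernel_gaussian:
  fixes f g :: "real \<Rightarrow> real"
  assumes "f \<in> borel_measurable borel" "g \<in> borel_measurable borel" "\<And>x. \<bar>f x\<bar> \<le> a" "\<And>x. \<bar>g x\<bar> \<le> b"
  shows "(\<integral>z. f (fst z) * g (snd z) \<partial>prod_kernel (gaussian_kernel U) (gaussian_kernel V) \<omega>)
    = (\<integral>x. f x \<partial>gaussian 0 (U \<omega>)) * (\<integral>x. g x \<partial>gaussian 0 (V \<omega>))"
proof -
  interpret A: real_distribution "gaussian 0 (U \<omega>)" by (rule gaussian_real_distribution)
  interpret B: real_distribution "gaussian 0 (V \<omega>)" by (rule gaussian_real_distribution)
  interpret P: pair_prob_space "gaussian 0 (U \<omega>)" "gaussian 0 (V \<omega>)" ..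
  have [measurable]: "f \<in> borel_measurable (gaussian 0 (U \<omega>))" "g \<in> borel_measurable (gaussian 0 (V \<omega>))"
    using assms by simp_all
  have "integrable (gaussian 0 (U \<omega>) \<Otimes>\<^sub>M gaussian 0 (V \<omega>)) (\<lambda>z. f (fst z) * g (snd z))"
  proof (rule P.integrable_const_bound[where B="a * b"])
    have "norm (f (fst z) * g (snd z)) \<le> a * b" for z :: "real \<times> real"
      unfolding norm_mult by (rule mult_mono) (use assms order_trans[OF abs_ge_zero assms(3)] in auto)
    then show "AE z in gaussian 0 (U \<omega>) \<Otimes>\<^sub>M gaussian 0 (V \<omega>). norm (f (fst z) * g (snd z)) \<le> a * b" by simp
  qed measurable
  from P.integral_fst'[OF this] show ?thesis
    unfolding prod_kernel_def gaussian_kernel_def by simp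
qed

lemma stably_converges_pairI:
  fixes C D :: "nat \<Rightarrow> 'a \<Rightarrow> real"
  assumes M: "prob_space M" and C: "\<And>n. C n \<in> borel_measurable M" and D: "\<And>n. D n \<in> borel_measurable M"
    and UV: "U \<in> borel_measurable M" "V \<in> borel_measurable M"
    and lim: "\<And>(f :: real \<Rightarrow> real) (g :: real \<Rightarrow> real) a b H. H \<in> sets M \<Longrightarrow> continuous_on UNIV f \<Longrightarrow> (\<And>x. \<bar>f x\<bar> \<le> a) \<Longrightarrow> continuous_on UNIV g \<Longrightarrow> (\<And>x. \<bar>g x\<bar> \<le> b) \<Longrightarrow>
      (\<lambda>n. \<integral>\<omega>. indicator H \<omega> * (f (C n \<omega>) * g (D n \<omega>)) \<partial>M) \<longlonglongrightarrow>
      (\<integral>\<omega>. indicator H \<omega> * ((\<integral>x. f x \<partial>gaussian 0 (U \<omega>)) * (\<integral>x. g x \<partial>gaussian 0 (V \<omega>))) \<partial>M)"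
  shows "stably_converges M (\<lambda>n \<omega>. (C n \<omega>, D n \<omega>)) (prod_kernel (gaussian_kernel U) (gaussian_kernel V))"
  unfolding stably_converges_def
proof (intro conjI allI ballI impI)
  note [measurable] = C D UV
  show CD: "(\<lambda>\<omega>. (C n \<omega>, D n \<omega>)) \<in> borel_measurable M" for n by measurable
  have N: "prod_kernel (gaussian_kernel U) (gaussian_kernel V) \<in> measurable M (prob_algebra borel)"
    by (intro prod_kernel_measurable gaussian_kernel_measurable UV)
  then show "kernel M (prod_kernel (gaussian_kernel U) (gaussian_kernel V))" by (rule kernelI)
  fix H assume H: "H \<in> sets M" "0 < measure M H"
  interpret U: prob_space "uniform_measure M H" using prob_space_uniform M H by blast
  have N': "prod_kernel (gaussian_kernel U) (gaussian_kernel V) \<in> measurable (uniform_measure M H) (prob_algebra borel)"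
    using N by simp
  have "uniform_measure M H \<in> space (prob_algebra (uniform_measure M H))"
    by (simp add: space_prob_algebra U.prob_space_axioms)
  note bnd = prob_space_bind'[OF this N'] sets_bind'[OF this N']
  show "weakly_converges (\<lambda>n. distr (uniform_measure M H) borel (\<lambda>\<omega>. (C n \<omega>, D n \<omega>)))
     (bind (uniform_measure M H) (prod_kernel (gaussian_kernel U) (gaussian_kernel V)))"
  proof (rule weakly_converges_pairI)
    show "prob_space (distr (uniform_measure M H) borel (\<lambda>\<omega>. (C n \<omega>, D n \<omega>)))" for n
      by (rule U.prob_space_distr) (use CD in simp)
    show "prob_space (bind (uniform_measure M H) (prod_kernel (gaussian_kernel U) (gaussian_kernel V)))"
      "sets (bind (uniform_measure M H) (prod_kernel (gaussian_kernel U) (gaussian_kernel V))) = sets borel"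
      by (rule bnd)+
    fix f g :: "real \<Rightarrow> real" and a b
    assume f: "continuous_on UNIV f" "\<And>x. \<bar>f x\<bar> \<le> a" and g: "continuous_on UNIV g" "\<And>x. \<bar>g x\<bar> \<le> b"
    have [measurable]: "f \<in> borel_measurable borel" "g \<in> borel_measurable borel"
      using f(1) g(1) by (auto intro: borel_measurable_continuous_onI)
    have fgm: "(\<lambda>z. f (fst z) * g (snd z)) \<in> borel_measurable borel"
      unfolding borel_prod[symmetric] by measurable
    have fgb: "\<bar>f (fst z) * g (snd z)\<bar> \<le> a * b" for z :: "real \<times> real"
      unfolding abs_mult by (rule mult_mono) (use f g order_trans[OF abs_ge_zero f(2)] in auto)
    have 1: "(\<integral>z. f (fst z) * g (snd z) \<partial>distr (uniform_measure M H) borel (\<lambda>\<omega>. (C n \<omega>, D n \<omega>)))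
       = (\<integral>\<omega>. indicator H \<omega> * (f (C n \<omega>) * g (D n \<omega>)) \<partial>M) / measure M H" for n
      using CD[of n] fgm by (subst integral_distr) (auto intro!: integral_uniform_measure[OF M H])
    have 2: "(\<integral>z. f (fst z) * g (snd z) \<partial>bind (uniform_measure M H) (prod_kernel (gaussian_kernel U) (gaussian_kernel V)))
       = (\<integral>\<omega>. indicator H \<omega> * ((\<integral>x. f x \<partial>gaussian 0 (U \<omega>)) * (\<integral>x. g x \<partial>gaussian 0 (V \<omega>))) \<partial>M) / measure M H"
      unfolding integral_bind_uniform[OF M H N fgm fgb]
      by (subst integral_prod_kernel_gaussian[OF _ _ f(2) g(2)]) auto
    show "(\<lambda>n. \<integral>z. f (fst z) * g (snd z) \<partial>distr (uniform_measure M H) borel (\<lambda>\<omega>. (C n \<omega>, D n \<omega>)))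
       \<longlonglongrightarrow> (\<integral>z. f (fst z) * g (snd z) \<partial>bind (uniform_measure M H) (prod_kernel (gaussian_kernel U) (gaussian_kernel V)))"
      unfolding 1 2 using lim[OF H(1) f g] H(2) by (intro tendsto_divide) auto
  qed simp
qed

section \<open>The urn process\<close>

text \<open>Kronecker's lemma. Summation by parts writes the average as \<open>s n\<close> minus the
  Cesaro mean of \<open>s\<close>, and both have the same limit.\<close>

lemma kronecker_average:
  fixes x :: "nat \<Rightarrow> real"
  assumes "summable (\<lambda>k. x k / real (Suc k))"
  shows "(\<lambda>n. (\<Sum>k<n. x k) / real n) \<longlonglongrightarrow> 0"
proof -
  define s where "s n = (\<Sum>k<n. x k / real (Suc k))" for n
  obtain l where l: "s \<longlonglongrightarrow> l"
    using assms unfolding s_def summable_iff_convergent convergent_def by blast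
  have *: "(\<Sum>k<n. x k) = real n * s n - (\<Sum>k<n. s k)" for n
  proof (induction n)
    case (Suc n)
    have "s (Suc n) = s n + x n / real (Suc n)" by (simp add: s_def)
    then have "real (Suc n) * s (Suc n) = real (Suc n) * s n + x n"
      by (simp add: distrib_left del: of_nat_Suc)
    then show ?case using Suc by (simp add: algebra_simps)
  qed (simp add: s_def)
  have "(\<lambda>n. s n - (\<Sum>k<n. s k) / real n) \<longlonglongrightarrow> l - l"
    by (intro tendsto_diff l cesaro_average)
  then have "(\<lambda>n. s n - (\<Sum>k<n. s k) / real n) \<longlonglongrightarrow> 0" by simp
  then show ?thesis
  proof (rule Lim_transform_eventually)
    show "\<forall>\<^sub>F n in sequentially. s n - (\<Sum>k<n. s k) / real n = (\<Sum>k<n. x k) / real n"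
      by (rule eventually_sequentiallyI[of 1]) (simp add: * diff_divide_distrib)
  qed
qed

locale urn =
  fixes M :: "'a measure" and d d0 :: nat
    and X A :: "nat \<Rightarrow> nat \<Rightarrow> 'a \<Rightarrow> real"
    and a q :: "nat \<Rightarrow> real" and m :: real
  assumes d0: "1 \<le> d0" "d0 \<le> d"
    and urn_A: "urn_assms_A M d a X A"
    and urn_B: "urn_assms_B M d d0 A m q"
    and lambda0: "2 * urn_lambda0 M d d0 A < ereal m"
begin

abbreviation "G \<equiv> urn_G M d X A"
abbreviation "N \<equiv> urn_N a X A"
abbreviation "Z \<equiv> urn_Z d a X A"
abbreviation "Zl \<equiv> urn_Zlim d a X A"

definition S :: "nat \<Rightarrow> 'a \<Rightarrow> real" where "S n \<omega> = (\<Sum>i=1..d. N n i \<omega>)"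
definition T :: "nat \<Rightarrow> 'a \<Rightarrow> real" where "T n \<omega> = (\<Sum>i\<in>{1..d0}. N n i \<omega>)"
definition B :: "nat \<Rightarrow> 'a \<Rightarrow> real" where "B n \<omega> = (\<Sum>i\<in>{d0<..d}. N n i \<omega>)"
text \<open>Shifted by one, like the martingale differences: index \<open>n\<close> belongs to the
  draw \<open>Suc n\<close>, which is predicted at time \<open>n\<close>.\<close>

definition \<mu> :: "nat \<Rightarrow> nat \<Rightarrow> real" where "\<mu> n i = (\<integral>\<omega>. A (Suc n) i \<omega> \<partial>M)"
definition \<sigma> :: "nat \<Rightarrow> nat \<Rightarrow> real" where "\<sigma> n i = (\<integral>\<omega>. (A (Suc n) i \<omega>)\<^sup>2 \<partial>M)"

definition \<beta> :: real where
  "\<beta> = (SOME b. 0 < b \<and> (\<forall>n\<ge>1. \<forall>j\<in>{1..d}. \<forall>\<omega>\<in>space M. 0 \<le> A n j \<omega> \<and> A n j \<omega> \<le> b))"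

lemma beta_pos: "0 < \<beta>"
  and A_bounds: "j \<in> {1..d} \<Longrightarrow> \<omega> \<in> space M \<Longrightarrow> 0 \<le> A (Suc n) j \<omega> \<and> A (Suc n) j \<omega> \<le> \<beta>"
proof -
  obtain b where b: "\<forall>n\<ge>1. \<forall>j\<in>{1..d}. \<forall>\<omega>\<in>space M. 0 \<le> A n j \<omega> \<and> A n j \<omega> \<le> b"
    using urn_A unfolding urn_assms_A_def by blast
  have "\<exists>b. 0 < b \<and> (\<forall>n\<ge>1. \<forall>j\<in>{1..d}. \<forall>\<omega>\<in>space M. 0 \<le> A n j \<omega> \<and> A n j \<omega> \<le> b)"
    by (rule exI[of _ "max b 1"]) (use b in \<open>auto simp: le_max_iff_disj\<close>)
  from someI_ex[OF this, folded \<beta>_def] show "0 < \<beta>" "j \<in> {1..d} \<Longrightarrow> \<omega> \<in> space M \<Longrightarrow> 0 \<le> A (Suc n) j \<omega> \<and> A (Suc n) j \<omega> \<le> \<beta>"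
    by auto
qed

lemma a_pos: "j \<in> {1..d} \<Longrightarrow> 0 < a j"
  using urn_A unfolding urn_assms_A_def by blast

lemma XA_measurable: "1 \<le> n \<Longrightarrow> j \<in> {1..d} \<Longrightarrow> X n j \<in> borel_measurable M"
  "1 \<le> n \<Longrightarrow> j \<in> {1..d} \<Longrightarrow> A n j \<in> borel_measurable M"
  using urn_A unfolding urn_assms_A_def by blast+

text \<open>Here \<open>i\<close> is the color drawn. Every sum over the colors weighted by
  \<open>X\<close> collapses to its term at \<open>i\<close>, so expressions in the draw can be
  evaluated color by color.\<close>

lemma X_one_hot:
  assumes "\<omega> \<in> space M"
  obtains i where "i \<in> {1..d}" "\<And>f. (\<Sum>j=1..d. X (Suc n) j \<omega> * f j) = (f i :: real)" "X (Suc n) i \<omega> = 1"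
    "\<And>j. j \<in> {1..d} \<Longrightarrow> j \<noteq> i \<Longrightarrow> X (Suc n) j \<omega> = 0"
proof -
  have 01: "\<forall>j\<in>{1..d}. X (Suc n) j \<omega> \<in> {0, 1}" and sum: "(\<Sum>j=1..d. X (Suc n) j \<omega>) = 1"
    using urn_A assms unfolding urn_assms_A_def by auto
  have "\<exists>i\<in>{1..d}. X (Suc n) i \<omega> \<noteq> 0"
    using sum by (metis sum.neutral zero_neq_one)
  then obtain i where i: "i \<in> {1..d}" "X (Suc n) i \<omega> = 1" using 01 by auto
  have rest: "(\<Sum>j\<in>{1..d} - {i}. X (Suc n) j \<omega>) = 0"
    using sum i sum.remove[of "{1..d}" i "\<lambda>j. X (Suc n) j \<omega>"] by simp
  have z: "X (Suc n) j \<omega> = 0" if "j \<in> {1..d}" "j \<noteq> i" for j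
  proof -
    have "0 \<le> X (Suc n) j \<omega>" if "j \<in> {1..d} - {i}" for j
      using bspec[OF 01, of j] that by auto
    then have "\<forall>j\<in>{1..d} - {i}. X (Suc n) j \<omega> = 0"
      using rest by (subst (asm) sum_nonneg_eq_0_iff) auto
    then show ?thesis using that by blast
  qed
  have "(\<Sum>j=1..d. X (Suc n) j \<omega> * f j) = f i" for f
    using i z sum.remove[of "{1..d}" i "\<lambda>j. X (Suc n) j \<omega> * f j"] by simp
  then show ?thesis using that i z by blast
qed

sublocale prob_space M
  using urn_A unfolding urn_assms_A_def by blast

lemma rv_events_sets:
  assumes "\<And>i. i \<in> I \<Longrightarrow> Y i \<in> borel_measurable M"
  shows "rv_events M I Y \<subseteq> sets M"
  unfolding rv_events_def using measurable_sets[OF assms] by auto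

lemma rv_events_mono: "I \<subseteq> J \<Longrightarrow> rv_events M I Y \<subseteq> rv_events M J Y"
  unfolding rv_events_def by (rule UN_mono) auto

lemma rv_eventsI: "i \<in> I \<Longrightarrow> V \<in> sets borel \<Longrightarrow> Y i -` V \<inter> space M \<in> rv_events M I Y"
  unfolding rv_events_def by blast

lemma G_generators: "rv_events M ({1..n} \<times> {1..d}) (\<lambda>(k, j). X k j) \<union> rv_events M ({1..n} \<times> {1..d}) (\<lambda>(k, j). A k j) \<subseteq> sets M"
  by (intro Un_least rv_events_sets) (auto simp: XA_measurable)

lemma sets_G: "sets (G n) = sigma_sets (space M)
    (rv_events M ({1..n} \<times> {1..d}) (\<lambda>(k, j). X k j) \<union> rv_events M ({1..n} \<times> {1..d}) (\<lambda>(k, j). A k j))"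
  and space_G: "space (G n) = space M"
  unfolding urn_G_def using order_trans[OF G_generators sets.space_closed]
  by (rule sets_measure_of space_measure_of)+

sublocale filtered_prob_space M G
proof
  show "subalgebra M (G n)" for n
    unfolding subalgebra_def space_G sets_G using sets.sigma_sets_subset[OF G_generators[of n]] by blast
  show "sets (G n) \<subseteq> sets (G (Suc n))" for n
    unfolding sets_G by (intro sigma_sets_mono' Un_mono rv_events_mono) auto
qed

lemma XA_measurable_G: 
  assumes "1 \<le> k" "k \<le> n" "j \<in> {1..d}"
  shows "X k j \<in> borel_measurable (G n)" "A k j \<in> borel_measurable (G n)"
proof -
  have "X k j -` V \<inter> space M \<in> sets (G n)" if "V \<in> sets borel" for V
    unfolding sets_G using assms that rv_eventsI[of "(k, j)" "{1..n} \<times> {1..d}" V "\<lambda>(k, j). X k j"]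
    by (intro sigma_sets.Basic UnI1) simp
  then show "X k j \<in> borel_measurable (G n)" by (intro measurableI) (auto simp: space_G)
  have "A k j -` V \<inter> space M \<in> sets (G n)" if "V \<in> sets borel" for V
    unfolding sets_G using assms that rv_eventsI[of "(k, j)" "{1..n} \<times> {1..d}" V "\<lambda>(k, j). A k j"]
    by (intro sigma_sets.Basic UnI2) simp
  then show "A k j \<in> borel_measurable (G n)" by (intro measurableI) (auto simp: space_G)
qed

lemma N_measurable_G: "j \<in> {1..d} \<Longrightarrow> N n j \<in> borel_measurable (G n)"
  unfolding urn_N_def[abs_def]
  by (intro borel_measurable_add borel_measurable_const borel_measurable_sum borel_measurable_times XA_measurable_G) auto

lemma S_measurable_G: "S n \<in> borel_measurable (G n)"
  and T_measurable_G: "T n \<in> borel_measurable (G n)"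
  and B_measurable_G: "B n \<in> borel_measurable (G n)"
  unfolding S_def[abs_def] T_def[abs_def] B_def[abs_def]
  using d0 by (auto intro!: borel_measurable_sum N_measurable_G)

lemma Z_eq: "Z n j \<omega> = N n j \<omega> / S n \<omega>"
  by (simp add: urn_Z_def S_def)

lemma Z_measurable_G: "j \<in> {1..d} \<Longrightarrow> Z n j \<in> borel_measurable (G n)"
  unfolding Z_eq[abs_def] by (intro borel_measurable_divide N_measurable_G S_measurable_G)

lemma N_Suc: "N (Suc n) j \<omega> = N n j \<omega> + X (Suc n) j \<omega> * A (Suc n) j \<omega>"
  by (simp add: urn_N_def)

lemma S_Suc: "S (Suc n) \<omega> = S n \<omega> + (\<Sum>i=1..d. X (Suc n) i \<omega> * A (Suc n) i \<omega>)"
  by (simp add: S_def N_Suc sum.distrib)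

lemma T_Suc: "T (Suc n) \<omega> = T n \<omega> + (\<Sum>i\<in>{1..d0}. X (Suc n) i \<omega> * A (Suc n) i \<omega>)"
  by (simp add: T_def N_Suc sum.distrib)

lemma B_Suc: "B (Suc n) \<omega> = B n \<omega> + (\<Sum>i\<in>{d0<..d}. X (Suc n) i \<omega> * A (Suc n) i \<omega>)"
  by (simp add: B_def N_Suc sum.distrib)

lemma colors_split: "{1..d} = {1..d0} \<union> {d0<..d}" "{1..d0} \<inter> {d0<..d} = {}"
  using d0 by auto

lemma sum_colors: "(\<Sum>i=1..d. f i) = (\<Sum>i\<in>{1..d0}. f i) + (\<Sum>i\<in>{d0<..d}. f i :: real)"
  unfolding colors_split(1) by (rule sum.union_disjoint) (use colors_split in auto)

lemma S_eq: "S n \<omega> = T n \<omega> + B n \<omega>"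
  unfolding S_def T_def B_def by (rule sum_colors)

lemma N_ge: "j \<in> {1..d} \<Longrightarrow> \<omega> \<in> space M \<Longrightarrow> a j \<le> N n j \<omega>"
proof (induction n)
  case (Suc n)
  have "X (Suc n) j \<omega> \<in> {0, 1}" using urn_A Suc.prems unfolding urn_assms_A_def by auto
  then show ?case using Suc A_bounds[OF Suc.prems, of n] by (auto simp: N_Suc)
qed (simp add: urn_N_def)

lemma N_pos: "j \<in> {1..d} \<Longrightarrow> \<omega> \<in> space M \<Longrightarrow> 0 < N n j \<omega>"
  using N_ge a_pos by (meson less_le_trans)

definition S0 :: real where "S0 = (\<Sum>i=1..d. a i)"

lemma T_ge: "\<omega> \<in> space M \<Longrightarrow> a 1 \<le> T n \<omega>"
proof -
  assume w: "\<omega> \<in> space M"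
  have "a 1 \<le> N n 1 \<omega>" using N_ge[OF _ w, of 1] d0 by auto
  also have "\<dots> \<le> T n \<omega>" unfolding T_def
    by (rule member_le_sum) (use d0 N_pos[OF _ w] in \<open>auto intro: less_imp_le\<close>)
  finally show ?thesis .
qed

lemma a1_pos: "0 < a 1" using a_pos[of 1] d0 by simp

lemma T_pos: "\<omega> \<in> space M \<Longrightarrow> 0 < T n \<omega>" using T_ge a1_pos by (meson less_le_trans)

lemma B_nonneg: "\<omega> \<in> space M \<Longrightarrow> 0 \<le> B n \<omega>"
  unfolding B_def by (intro sum_nonneg) (use N_pos in \<open>force intro: less_imp_le\<close>)

lemma S_pos: "\<omega> \<in> space M \<Longrightarrow> 0 < S n \<omega>" using T_pos B_nonneg by (simp add: S_eq add_pos_nonneg)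

lemma S_le: "\<omega> \<in> space M \<Longrightarrow> S n \<omega> \<le> S0 + \<beta> * real n"
proof (induction n)
  case (Suc n)
  obtain i where i: "i \<in> {1..d}" "\<And>f. (\<Sum>j=1..d. X (Suc n) j \<omega> * f j) = (f i :: real)"
    using X_one_hot[OF Suc.prems, of n] by metis
  then show ?case using Suc A_bounds[OF i(1) Suc.prems, of n] by (simp add: S_Suc algebra_simps)
qed (simp add: S_def S0_def urn_N_def)

lemma Z_bounds: "j \<in> {1..d} \<Longrightarrow> \<omega> \<in> space M \<Longrightarrow> 0 \<le> Z n j \<omega> \<and> Z n j \<omega> \<le> 1"
proof -
  assume j: "j \<in> {1..d}" and w: "\<omega> \<in> space M"
  have "N n j \<omega> \<le> S n \<omega>" unfolding S_def
    by (rule member_le_sum) (use j N_pos[OF _ w] in \<open>auto intro: less_imp_le\<close>)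
  then show ?thesis using N_pos[OF j w, of n] S_pos[OF w, of n] by (simp add: Z_eq)
qed

lemma sum_Z: "\<omega> \<in> space M \<Longrightarrow> (\<Sum>i=1..d. Z n i \<omega>) = 1"
  using S_pos[of \<omega> n] by (simp add: Z_eq S_def flip: sum_divide_distrib)

lemma sum_Z_convex:
  assumes "\<omega> \<in> space M" "\<And>i. i \<in> {1..d} \<Longrightarrow> f i \<le> c"
  shows "(\<Sum>i=1..d. Z n i \<omega> * f i) \<le> c"
proof -
  have "(\<Sum>i=1..d. Z n i \<omega> * f i) \<le> (\<Sum>i=1..d. Z n i \<omega> * c)"
    using Z_bounds[OF _ assms(1)] assms(2) by (intro sum_mono mult_left_mono) auto
  also have "\<dots> = c" using sum_Z[OF assms(1), of n] by (simp flip: sum_distrib_right)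
  finally show ?thesis .
qed

section \<open>One-step averages of the urn\<close>

lemma mu_bounds: "i \<in> {1..d} \<Longrightarrow> 0 \<le> \<mu> n i \<and> \<mu> n i \<le> \<beta>"
  and A_integrable: "i \<in> {1..d} \<Longrightarrow> integrable M (A (Suc n) i)" "i \<in> {1..d} \<Longrightarrow> integrable M (\<lambda>\<omega>. (A (Suc n) i \<omega>)\<^sup>2)"
proof -
  assume i: "i \<in> {1..d}"
  have [measurable]: "A (Suc n) i \<in> borel_measurable M" using XA_measurable(2)[of "Suc n"] i by simp
  show iA: "integrable M (A (Suc n) i)" by (rule integrable_bounded[where c=\<beta>]) (use A_bounds[OF i] in auto)
  show "integrable M (\<lambda>\<omega>. (A (Suc n) i \<omega>)\<^sup>2)"
    by (rule integrable_bounded[where c="\<beta>\<^sup>2"]) (use A_bounds[OF i] in \<open>auto intro: power_mono\<close>)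
  show "0 \<le> \<mu> n i \<and> \<mu> n i \<le> \<beta>"
    unfolding \<mu>_def using A_bounds[OF i] iA by (auto intro!: integral_le_const Bochner_Integration.integral_nonneg_AE AE_I2)
qed

text \<open>The weights added at time \<open>Suc n\<close> are independent of the past together with
  the drawn color, so the mean of \<open>g (A (Suc n) i)\<close> splits off; the indicator of the
  draw then averages to \<open>Z n i\<close>.\<close>

lemma integral_color_indep:
  fixes g :: "real \<Rightarrow> real"
  assumes i: "i \<in> {1..d}" and W: "W \<in> borel_measurable (G n)" "\<And>\<omega>. \<omega> \<in> space M \<Longrightarrow> \<bar>W \<omega>\<bar> \<le> c"
    and g: "g \<in> borel_measurable borel" "integrable M (\<lambda>\<omega>. g (A (Suc n) i \<omega>))"
  shows "integrable M (\<lambda>\<omega>. W \<omega> * X (Suc n) i \<omega> * g (A (Suc n) i \<omega>))"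
    and "(\<integral>\<omega>. W \<omega> * X (Suc n) i \<omega> * g (A (Suc n) i \<omega>) \<partial>M) = (\<integral>\<omega>. Z n i \<omega> * W \<omega> \<partial>M) * (\<integral>\<omega>. g (A (Suc n) i \<omega>) \<partial>M)"
proof -
  let ?X = "X (Suc n)" and ?A = "A (Suc n)"
  let ?E1 = "rv_events M {1..d} ?A"
  let ?E2 = "sets (G n) \<union> rv_events M {1..d} ?X"
  have [measurable]: "?X i \<in> borel_measurable M" "?A i \<in> borel_measurable M" "W \<in> borel_measurable M"
    using i XA_measurable measurable_M[OF W(1)] by auto
  have XM: "rv_events M {1..d} ?X \<subseteq> sets M" by (rule rv_events_sets) (use XA_measurable in auto)
  have E2: "?E2 \<subseteq> Pow (space M)"
    using sets.space_closed[of M] XM sets_M by blast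
  \<comment> \<open>The past together with the color drawn next: \<open>W * X (Suc n) i\<close> is
    measurable for it, hence lies on the side independent of \<open>A (Suc n)\<close>.\<close>
  define K where "K = sigma (space M) ?E2"
  have setsK: "sets K = sigma_sets (space M) ?E2" and spaceK: "space K = space M"
    unfolding K_def using E2 by (auto intro: sets_measure_of space_measure_of)
  have WK: "W \<in> borel_measurable K"
    by (rule measurable_from_subalg[OF _ W(1)]) (auto simp: subalgebra_def setsK spaceK)
  have XK: "?X i \<in> borel_measurable K"
  proof (rule measurableI)
    fix V :: "real set" assume "V \<in> sets borel"
    then have "?X i -` V \<inter> space M \<in> rv_events M {1..d} ?X" using i by (intro rv_eventsI)
    then show "?X i -` V \<inter> space K \<in> sets K" unfolding setsK spaceK by blast
  qed simp
  have WXK: "(\<lambda>\<omega>. W \<omega> * ?X i \<omega>) \<in> borel_measurable K" using WK XK by measurable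
  have "\<forall>n\<ge>1. indep_set (sigma_sets (space M) (rv_events M {1..d} (A n)))
      (sigma_sets (space M) (sets (G (n - 1)) \<union> rv_events M {1..d} (X n)))"
    using urn_A unfolding urn_assms_A_def by blast
  from this[rule_format, of "Suc n"]
  have ind0: "indep_set (sigma_sets (space M) ?E1) (sigma_sets (space M) ?E2)" by simp
  have "indep_var borel (\<lambda>\<omega>. g (?A i \<omega>)) borel (\<lambda>\<omega>. W \<omega> * ?X i \<omega>)"
    unfolding indep_var_eq
  proof (intro conjI)
    show "indep_set (sigma_sets (space M) {(\<lambda>\<omega>. g (?A i \<omega>)) -` V \<inter> space M |V. V \<in> sets borel})
       (sigma_sets (space M) {(\<lambda>\<omega>. W \<omega> * ?X i \<omega>) -` V \<inter> space M |V. V \<in> sets borel})"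
      unfolding indep_set_def
    proof (rule indep_sets_mono_sets[OF ind0[unfolded indep_set_def]])
      fix b :: bool
      have 1: "{(\<lambda>\<omega>. g (?A i \<omega>)) -` V \<inter> space M |V. V \<in> sets borel} \<subseteq> ?E1"
      proof safe
        fix V :: "real set" assume "V \<in> sets borel"
        then have "g -` V \<in> sets borel" using measurable_sets[OF g(1)] by simp
        then show "(\<lambda>\<omega>. g (?A i \<omega>)) -` V \<inter> space M \<in> ?E1"
          using rv_eventsI[OF i, of "g -` V" ?A] by (simp add: vimage_def)
      qed
      have 2: "{(\<lambda>\<omega>. W \<omega> * ?X i \<omega>) -` V \<inter> space M |V. V \<in> sets borel} \<subseteq> sigma_sets (space M) ?E2"
        using measurable_sets[OF WXK] unfolding setsK spaceK by auto
      show "(case b of True \<Rightarrow> sigma_sets (space M) {(\<lambda>\<omega>. g (?A i \<omega>)) -` V \<inter> space M |V. V \<in> sets borel}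
         | False \<Rightarrow> sigma_sets (space M) {(\<lambda>\<omega>. W \<omega> * ?X i \<omega>) -` V \<inter> space M |V. V \<in> sets borel})
         \<subseteq> (case b of True \<Rightarrow> sigma_sets (space M) ?E1 | False \<Rightarrow> sigma_sets (space M) ?E2)"
        using sigma_sets_mono'[OF 1, of "space M"] sigma_sets_mono[OF 2] by (cases b) auto
    qed
  qed (use g in measurable)
  moreover have iWX: "integrable M (\<lambda>\<omega>. W \<omega> * ?X i \<omega>)"
  proof (rule integrable_bounded)
    fix \<omega> assume w: "\<omega> \<in> space M"
    have "?X i \<omega> \<in> {0, 1}" using urn_A w i unfolding urn_assms_A_def by auto
    then show "norm (W \<omega> * ?X i \<omega>) \<le> c" using W(2)[OF w] by (auto intro: order_trans[OF abs_ge_zero])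
  qed measurable
  ultimately have 1: "(\<integral>\<omega>. g (?A i \<omega>) * (W \<omega> * ?X i \<omega>) \<partial>M) = (\<integral>\<omega>. g (?A i \<omega>) \<partial>M) * (\<integral>\<omega>. W \<omega> * ?X i \<omega> \<partial>M)"
    and 2: "integrable M (\<lambda>\<omega>. g (?A i \<omega>) * (W \<omega> * ?X i \<omega>))"
    using indep_var_lebesgue_integral indep_var_integrable g(2) by blast+
  show "integrable M (\<lambda>\<omega>. W \<omega> * ?X i \<omega> * g (?A i \<omega>))" using 2 by (simp add: mult_ac)
  interpret Gn: finite_measure_subalgebra M "G n" by unfold_locales (rule subalg)
  let ?I = "indicator {\<omega>\<in>space M. ?X i \<omega> = 1} :: 'a \<Rightarrow> real"
  have "(\<integral>\<omega>. W \<omega> * ?X i \<omega> \<partial>M) = (\<integral>\<omega>. W \<omega> * ?I \<omega> \<partial>M)"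
  proof (rule Bochner_Integration.integral_cong)
    fix \<omega> assume w: "\<omega> \<in> space M"
    have "?X i \<omega> \<in> {0, 1}" using urn_A w i unfolding urn_assms_A_def by auto
    then show "W \<omega> * ?X i \<omega> = W \<omega> * ?I \<omega>" using w by (auto simp: indicator_def)
  qed simp
  also have "\<dots> = (\<integral>\<omega>. W \<omega> * real_cond_exp M (G n) ?I \<omega> \<partial>M)"
  proof (rule Gn.real_cond_exp_intg(2)[symmetric])
    show "integrable M (\<lambda>\<omega>. W \<omega> * ?I \<omega>)"
      by (rule integrable_bounded[where c=c]) (use W(2) in \<open>auto simp: indicator_def intro: order_trans[OF abs_ge_zero]\<close>)
  qed (use W in auto)
  also have "\<dots> = (\<integral>\<omega>. Z n i \<omega> * W \<omega> \<partial>M)"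
  proof (rule integral_cong_AE)
    have "AE \<omega> in M. Z n i \<omega> = real_cond_exp M (G n) ?I \<omega>"
      using urn_A i unfolding urn_assms_A_def by blast
    then show "AE \<omega> in M. W \<omega> * real_cond_exp M (G n) ?I \<omega> = Z n i \<omega> * W \<omega>" by eventually_elim simp
    show "(\<lambda>\<omega>. Z n i \<omega> * W \<omega>) \<in> borel_measurable M"
      using measurable_M[OF Z_measurable_G[OF i, of n]] by measurable
  qed measurable
  finally show "(\<integral>\<omega>. W \<omega> * ?X i \<omega> * g (?A i \<omega>) \<partial>M) = (\<integral>\<omega>. Z n i \<omega> * W \<omega> \<partial>M) * (\<integral>\<omega>. g (?A i \<omega>) \<partial>M)"
    using 1 by (simp add: mult_ac)
qed

text \<open>Averaging turns the draw into the probabilities \<open>Z n i\<close>, and the added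
  weight and its square into their means. Degree two covers all later uses: squared increments for
  the variances, and linear bounds for the supermartingales.\<close>

lemma integral_step:
  assumes meas: "\<And>i. i \<in> {1..d} \<Longrightarrow> \<phi> i \<in> borel_measurable (G n)" "\<And>i. i \<in> {1..d} \<Longrightarrow> \<psi> i \<in> borel_measurable (G n)"
      "\<And>i. i \<in> {1..d} \<Longrightarrow> \<theta> i \<in> borel_measurable (G n)"
    and bd: "\<And>i \<omega>. i \<in> {1..d} \<Longrightarrow> \<omega> \<in> space M \<Longrightarrow> \<bar>\<phi> i \<omega>\<bar> \<le> c" "\<And>i \<omega>. i \<in> {1..d} \<Longrightarrow> \<omega> \<in> space M \<Longrightarrow> \<bar>\<psi> i \<omega>\<bar> \<le> c"
      "\<And>i \<omega>. i \<in> {1..d} \<Longrightarrow> \<omega> \<in> space M \<Longrightarrow> \<bar>\<theta> i \<omega>\<bar> \<le> c"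
  shows "(\<integral>\<omega>. (\<Sum>i=1..d. X (Suc n) i \<omega> * (\<phi> i \<omega> + \<psi> i \<omega> * A (Suc n) i \<omega> + \<theta> i \<omega> * (A (Suc n) i \<omega>)\<^sup>2)) \<partial>M)
     = (\<integral>\<omega>. (\<Sum>i=1..d. Z n i \<omega> * (\<phi> i \<omega> + \<psi> i \<omega> * \<mu> n i + \<theta> i \<omega> * \<sigma> n i)) \<partial>M)"
    and "integrable M (\<lambda>\<omega>. \<Sum>i=1..d. X (Suc n) i \<omega> * (\<phi> i \<omega> + \<psi> i \<omega> * A (Suc n) i \<omega> + \<theta> i \<omega> * (A (Suc n) i \<omega>)\<^sup>2))"
    and "integrable M (\<lambda>\<omega>. \<Sum>i=1..d. Z n i \<omega> * (\<phi> i \<omega> + \<psi> i \<omega> * \<mu> n i + \<theta> i \<omega> * \<sigma> n i))"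
proof -
  let ?X = "X (Suc n)" and ?A = "A (Suc n)"
  note g1 = integral_color_indep[where g="\<lambda>_. 1", OF _ _ _ borel_measurable_const integrable_const]
  note g2 = integral_color_indep[where g="\<lambda>x. x", OF _ _ _ measurable_ident_sets[OF refl] A_integrable(1)]
  note g3 = integral_color_indep[where g="\<lambda>x. x\<^sup>2", OF _ _ _ borel_measurable_power[OF measurable_ident_sets[OF refl]] A_integrable(2)]
  have iZ: "integrable M (\<lambda>\<omega>. Z n i \<omega> * W \<omega>)"
    if i: "i \<in> {1..d}" and W: "W \<in> borel_measurable (G n)" "\<And>\<omega>. \<omega> \<in> space M \<Longrightarrow> \<bar>W \<omega>\<bar> \<le> c" for i W
  proof (rule integrable_bounded)
    show "norm (Z n i \<omega> * W \<omega>) \<le> 1 * c" if w: "\<omega> \<in> space M" for \<omega>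
      unfolding norm_mult using Z_bounds[OF i w, of n] W(2)[OF w]
      by (intro mult_mono) auto
    show "(\<lambda>\<omega>. Z n i \<omega> * W \<omega>) \<in> borel_measurable M"
      using measurable_M[OF Z_measurable_G[OF i, of n]] measurable_M[OF W(1)] by measurable
  qed
  have eq: "(\<Sum>i=1..d. ?X i \<omega> * (\<phi> i \<omega> + \<psi> i \<omega> * ?A i \<omega> + \<theta> i \<omega> * (?A i \<omega>)\<^sup>2)) =
    (\<Sum>i=1..d. \<phi> i \<omega> * ?X i \<omega> * 1 + \<psi> i \<omega> * ?X i \<omega> * ?A i \<omega> + \<theta> i \<omega> * ?X i \<omega> * (?A i \<omega>)\<^sup>2)" for \<omega>
    by (rule sum.cong) (auto simp: algebra_simps)
  have eq2: "(\<Sum>i=1..d. Z n i \<omega> * (\<phi> i \<omega> + \<psi> i \<omega> * \<mu> n i + \<theta> i \<omega> * \<sigma> n i)) =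
    (\<Sum>i=1..d. (Z n i \<omega> * \<phi> i \<omega>) * 1 + (Z n i \<omega> * \<psi> i \<omega>) * \<mu> n i + (Z n i \<omega> * \<theta> i \<omega>) * \<sigma> n i)" for \<omega>
    by (rule sum.cong) (auto simp: algebra_simps)
  have i1: "integrable M (\<lambda>\<omega>. \<phi> i \<omega> * ?X i \<omega> * 1)" "integrable M (\<lambda>\<omega>. \<psi> i \<omega> * ?X i \<omega> * ?A i \<omega>)"
    "integrable M (\<lambda>\<omega>. \<theta> i \<omega> * ?X i \<omega> * (?A i \<omega>)\<^sup>2)" if "i \<in> {1..d}" for i
    by (rule g1(1)[OF that meas(1)[OF that] bd(1)[OF that]] g2(1)[OF that meas(2)[OF that] bd(2)[OF that] that]
      g3(1)[OF that meas(3)[OF that] bd(3)[OF that] that]; assumption)+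
  show "integrable M (\<lambda>\<omega>. \<Sum>i=1..d. ?X i \<omega> * (\<phi> i \<omega> + \<psi> i \<omega> * ?A i \<omega> + \<theta> i \<omega> * (?A i \<omega>)\<^sup>2))"
    unfolding eq by (intro Bochner_Integration.integrable_sum Bochner_Integration.integrable_add i1)
  have i2: "integrable M (\<lambda>\<omega>. Z n i \<omega> * \<phi> i \<omega> * 1)" "integrable M (\<lambda>\<omega>. Z n i \<omega> * \<psi> i \<omega> * \<mu> n i)"
    "integrable M (\<lambda>\<omega>. Z n i \<omega> * \<theta> i \<omega> * \<sigma> n i)" if "i \<in> {1..d}" for i
    by (intro integrable_mult_left iZ that meas bd; assumption)+
  show "integrable M (\<lambda>\<omega>. \<Sum>i=1..d. Z n i \<omega> * (\<phi> i \<omega> + \<psi> i \<omega> * \<mu> n i + \<theta> i \<omega> * \<sigma> n i))"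
    unfolding eq2 by (intro Bochner_Integration.integrable_sum Bochner_Integration.integrable_add i2)
  have sumint: "(\<integral>\<omega>. (\<Sum>i=1..d. f i \<omega> + g i \<omega> + h i \<omega>) \<partial>M) = (\<Sum>i=1..d. (\<integral>\<omega>. f i \<omega> \<partial>M) + (\<integral>\<omega>. g i \<omega> \<partial>M) + (\<integral>\<omega>. h i \<omega> \<partial>M))"
    if int: "\<And>i. i \<in> {1..d} \<Longrightarrow> integrable M (f i)" "\<And>i. i \<in> {1..d} \<Longrightarrow> integrable M (g i)" "\<And>i. i \<in> {1..d} \<Longrightarrow> integrable M (h i)"
    for f g h :: "nat \<Rightarrow> 'a \<Rightarrow> real"
  proof -
    have "(\<integral>\<omega>. (\<Sum>i=1..d. f i \<omega> + g i \<omega> + h i \<omega>) \<partial>M) = (\<Sum>i=1..d. \<integral>\<omega>. f i \<omega> + g i \<omega> + h i \<omega> \<partial>M)"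
      by (rule Bochner_Integration.integral_sum) (intro Bochner_Integration.integrable_add int)
    also have "\<dots> = (\<Sum>i=1..d. (\<integral>\<omega>. f i \<omega> \<partial>M) + (\<integral>\<omega>. g i \<omega> \<partial>M) + (\<integral>\<omega>. h i \<omega> \<partial>M))"
      by (rule sum.cong) (simp_all add: int)
    finally show ?thesis .
  qed
  have "(\<integral>\<omega>. (\<Sum>i=1..d. ?X i \<omega> * (\<phi> i \<omega> + \<psi> i \<omega> * ?A i \<omega> + \<theta> i \<omega> * (?A i \<omega>)\<^sup>2)) \<partial>M)
    = (\<Sum>i=1..d. (\<integral>\<omega>. \<phi> i \<omega> * ?X i \<omega> * 1 \<partial>M) + (\<integral>\<omega>. \<psi> i \<omega> * ?X i \<omega> * ?A i \<omega> \<partial>M) + (\<integral>\<omega>. \<theta> i \<omega> * ?X i \<omega> * (?A i \<omega>)\<^sup>2 \<partial>M))"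
    unfolding eq
    by (rule sumint; rule i1)
  also have "\<dots> = (\<Sum>i=1..d. (\<integral>\<omega>. Z n i \<omega> * \<phi> i \<omega> * 1 \<partial>M) + (\<integral>\<omega>. Z n i \<omega> * \<psi> i \<omega> * \<mu> n i \<partial>M) + (\<integral>\<omega>. Z n i \<omega> * \<theta> i \<omega> * \<sigma> n i \<partial>M))"
  proof (rule sum.cong)
    fix i assume i: "i \<in> {1..d}"
    show "(\<integral>\<omega>. \<phi> i \<omega> * ?X i \<omega> * 1 \<partial>M) + (\<integral>\<omega>. \<psi> i \<omega> * ?X i \<omega> * ?A i \<omega> \<partial>M) + (\<integral>\<omega>. \<theta> i \<omega> * ?X i \<omega> * (?A i \<omega>)\<^sup>2 \<partial>M) =
      (\<integral>\<omega>. Z n i \<omega> * \<phi> i \<omega> * 1 \<partial>M) + (\<integral>\<omega>. Z n i \<omega> * \<psi> i \<omega> * \<mu> n i \<partial>M) + (\<integral>\<omega>. Z n i \<omega> * \<theta> i \<omega> * \<sigma> n i \<partial>M)"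
      using g1(2)[OF i meas(1)[OF i] bd(1)[OF i]] g2(2)[OF i meas(2)[OF i] bd(2)[OF i] i] g3(2)[OF i meas(3)[OF i] bd(3)[OF i] i] by (simp add: \<mu>_def \<sigma>_def prob_space)
  qed simp
  also have "\<dots> = (\<integral>\<omega>. (\<Sum>i=1..d. Z n i \<omega> * (\<phi> i \<omega> + \<psi> i \<omega> * \<mu> n i + \<theta> i \<omega> * \<sigma> n i)) \<partial>M)"
    unfolding eq2
    by (rule sumint[symmetric]; rule i2)
  finally show "(\<integral>\<omega>. (\<Sum>i=1..d. ?X i \<omega> * (\<phi> i \<omega> + \<psi> i \<omega> * ?A i \<omega> + \<theta> i \<omega> * (?A i \<omega>)\<^sup>2)) \<partial>M)
     = (\<integral>\<omega>. (\<Sum>i=1..d. Z n i \<omega> * (\<phi> i \<omega> + \<psi> i \<omega> * \<mu> n i + \<theta> i \<omega> * \<sigma> n i)) \<partial>M)" .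
qed

end

section \<open>Growth of the total weights\<close>

text \<open>At \<open>u = 0\<close> the two sides agree, with slopes
  \<open>- \<rho> < - \<kappa>\<close>. Giving up slope from \<open>\<rho>\<close> to
  \<open>\<kappa>\<close> pays for the higher order terms in the supermartingale of
  \<open>B_growth\<close>.\<close>

lemma powr_minus_le_linear:
  fixes \<kappa> \<rho> :: real
  assumes "\<kappa> < \<rho>"
  shows "\<exists>u0>0. \<forall>u. 0 \<le> u \<longrightarrow> u < u0 \<longrightarrow> (1 + u) powr (- \<rho>) \<le> 1 - \<kappa> * u"
proof -
  let ?f = "\<lambda>u::real. (1 + u) powr (- \<rho>) + \<kappa> * u"
  have "(?f has_real_derivative \<kappa> - \<rho>) (at 0)"
    by (auto intro!: derivative_eq_intros)
  from DERIV_neg_dec_right[OF this] obtain e where e: "e > 0" "\<And>h. 0 < h \<Longrightarrow> h < e \<Longrightarrow> ?f (0 + h) < ?f 0"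
    using assms by auto
  have "(1 + u) powr (- \<rho>) \<le> 1 - \<kappa> * u" if "0 \<le> u" "u < e" for u
    using e(2)[of u] that by (cases "u = 0") auto
  then show ?thesis using e(1) by blast
qed

text \<open>From \<open>N\<close> on the sequence decreases. A positive limit \<open>L\<close> would
  keep \<open>L\<close> times the partial sums of \<open>\<delta>\<close> below the starting value
  and thus make \<open>\<delta>\<close> summable.\<close>

lemma decay_tendsto_zero:
  fixes e \<delta> :: "nat \<Rightarrow> real"
  assumes e: "\<And>n. 0 \<le> e n" "\<And>n. n \<ge> N \<Longrightarrow> e (Suc n) \<le> (1 - \<delta> n) * e n"
    and \<delta>: "\<And>n. 0 \<le> \<delta> n" "\<not> summable \<delta>"
  shows "e \<longlonglongrightarrow> 0"
proof -
  define f where "f n = e (n + N)" for n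
  have st: "f (Suc n) \<le> f n - \<delta> (n + N) * f n" for n
    using e(2)[of "n + N"] by (simp add: f_def algebra_simps)
  have f0: "0 \<le> f n" for n using e(1) by (simp add: f_def)
  have "f (Suc n) \<le> f n" for n
    using st[of n] mult_nonneg_nonneg[OF \<delta>(1) f0, of "n + N" n] by linarith
  then have dec: "decseq f" by (rule decseq_SucI)
  obtain L where L: "f \<longlonglongrightarrow> L" "\<And>n. L \<le> f n" using decseq_convergent[OF dec, of 0] f0 by blast
  have "L \<ge> 0" by (rule LIMSEQ_le_const[OF L(1)]) (use f0 in auto)
  moreover have "\<not> L > 0"
  proof
    assume Lp: "L > 0"
    have s: "L * (\<Sum>k<n. \<delta> (k + N)) \<le> f 0 - f n" for n
    proof (induction n)
      case (Suc n)
      have "L * \<delta> (n + N) \<le> \<delta> (n + N) * f n"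
        using mult_left_mono[OF L(2)[of n] \<delta>(1)[of "n + N"]] by (simp add: mult.commute)
      then show ?case using Suc st[of n] by (simp add: distrib_left)
    qed simp
    have "(\<Sum>k<n. \<delta> (k + N)) \<le> f 0 / L" for n
      using s[of n] f0[of n] Lp by (simp add: pos_le_divide_eq mult.commute)
    then have "summable (\<lambda>k. \<delta> (k + N))"
      using \<delta>(1) by (intro summableI_nonneg_bounded) auto
    then show False using \<delta>(2) by (simp add: summable_iff_shift)
  qed
  ultimately have "L = 0" by simp
  then show ?thesis using L(1) unfolding f_def by (simp add: LIMSEQ_ignore_initial_segment LIMSEQ_offset)
qed

context urn
begin

text \<open>The expression is the second moment of \<open>x + y * A (Suc n) i\<close>, in the
  expanded form that \<open>integral_step\<close> produces.\<close>

lemma second_moment_bounds: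
  assumes i: "i \<in> {1..d}" and b: "\<And>\<omega>. \<omega> \<in> space M \<Longrightarrow> \<bar>x + y * A (Suc n) i \<omega>\<bar> \<le> b"
  shows "0 \<le> x\<^sup>2 + 2 * x * y * \<mu> n i + y\<^sup>2 * \<sigma> n i \<and> x\<^sup>2 + 2 * x * y * \<mu> n i + y\<^sup>2 * \<sigma> n i \<le> b\<^sup>2"
proof -
  note iA = A_integrable[OF i, of n]
  have e: "(x + y * A (Suc n) i \<omega>)\<^sup>2 = x\<^sup>2 + 2 * x * y * A (Suc n) i \<omega> + y\<^sup>2 * (A (Suc n) i \<omega>)\<^sup>2" for \<omega>
    by (simp add: power2_eq_square algebra_simps)
  have "(\<integral>\<omega>. (x + y * A (Suc n) i \<omega>)\<^sup>2 \<partial>M) = x\<^sup>2 + 2 * x * y * \<mu> n i + y\<^sup>2 * \<sigma> n i"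
    unfolding e \<mu>_def \<sigma>_def using iA by (simp add: prob_space)
  moreover have "integrable M (\<lambda>\<omega>. (x + y * A (Suc n) i \<omega>)\<^sup>2)"
    unfolding e using iA by simp
  moreover have "(x + y * A (Suc n) i \<omega>)\<^sup>2 \<le> b\<^sup>2" if "\<omega> \<in> space M" for \<omega>
    using power_mono[OF b[OF that], of 2] by simp
  ultimately show ?thesis
    by (auto intro!: integral_le_const AE_I2 simp flip: \<open>(\<integral>\<omega>. (x + y * A (Suc n) i \<omega>)\<^sup>2 \<partial>M) = _\<close>)
qed

text \<open>Exactly one color is drawn, so squaring \<open>\<xi>\<close> squares a single
  coefficient and yields again a sum linear in \<open>X\<close>, whose one-step average is
  \<open>v\<close>. The bound \<open>b\<close> is asked for with two separate sample points
  \<open>\<omega>\<close> and \<open>\<omega>'\<close> because in \<open>v\<close> the weight is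
  integrated while the coefficients stay fixed.\<close>

lemma urn_mart_diff:
  fixes \<phi> \<psi> :: "nat \<Rightarrow> nat \<Rightarrow> 'a \<Rightarrow> real"
  assumes meas: "\<And>n i. i \<in> {1..d} \<Longrightarrow> \<phi> n i \<in> borel_measurable (G n)" "\<And>n i. i \<in> {1..d} \<Longrightarrow> \<psi> n i \<in> borel_measurable (G n)"
    and bd: "\<And>n i \<omega>. i \<in> {1..d} \<Longrightarrow> \<omega> \<in> space M \<Longrightarrow> \<bar>\<phi> n i \<omega>\<bar> \<le> c n" "\<And>n i \<omega>. i \<in> {1..d} \<Longrightarrow> \<omega> \<in> space M \<Longrightarrow> \<bar>\<psi> n i \<omega>\<bar> \<le> c n"
    and b: "\<And>n i \<omega> \<omega>'. i \<in> {1..d} \<Longrightarrow> \<omega> \<in> space M \<Longrightarrow> \<omega>' \<in> space M \<Longrightarrow> \<bar>\<phi> n i \<omega> + \<psi> n i \<omega> * A (Suc n) i \<omega>'\<bar> \<le> b n"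
    and zero: "\<And>n \<omega>. \<omega> \<in> space M \<Longrightarrow> (\<Sum>i=1..d. Z n i \<omega> * (\<phi> n i \<omega> + \<psi> n i \<omega> * \<mu> n i)) = 0"
  defines "\<xi> \<equiv> \<lambda>n \<omega>. \<Sum>i=1..d. X (Suc n) i \<omega> * (\<phi> n i \<omega> + \<psi> n i \<omega> * A (Suc n) i \<omega>)"
    and "v \<equiv> \<lambda>n \<omega>. \<Sum>i=1..d. Z n i \<omega> * ((\<phi> n i \<omega>)\<^sup>2 + 2 * \<phi> n i \<omega> * \<psi> n i \<omega> * \<mu> n i + (\<psi> n i \<omega>)\<^sup>2 * \<sigma> n i)"
  shows "mart_diff \<xi> b" and "cond_var \<xi> v"
    and "\<omega> \<in> space M \<Longrightarrow> 0 \<le> v n \<omega>" and "\<omega> \<in> space M \<Longrightarrow> v n \<omega> \<le> (b n)\<^sup>2"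
proof -
  have c0: "c n \<ge> 0" for n
  proof -
    obtain \<omega> where "\<omega> \<in> space M" using not_empty by blast
    then show ?thesis using bd(1)[of 1 \<omega> n] d0 by force
  qed
  show "mart_diff \<xi> b"
    unfolding mart_diff_def
  proof (intro conjI allI ballI impI)
    show "\<xi> n \<in> borel_measurable (G (Suc n))" for n
      unfolding \<xi>_def
      by (intro borel_measurable_sum borel_measurable_times borel_measurable_add XA_measurable_G measurable_mono[OF meas(1)] measurable_mono[OF meas(2)]) auto
    show "\<bar>\<xi> n \<omega>\<bar> \<le> b n" if w: "\<omega> \<in> space M" for n \<omega>
    proof -
      obtain i where i: "i \<in> {1..d}" "\<And>f. (\<Sum>j=1..d. X (Suc n) j \<omega> * f j) = (f i :: real)"
        using X_one_hot[OF w, of n] by metis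
      show ?thesis unfolding \<xi>_def i(2) by (rule b[OF i(1) w w])
    qed
    fix n and W :: "'a \<Rightarrow> real" and c'
    assume W: "W \<in> borel_measurable (G n)" "\<forall>\<omega>\<in>space M. \<bar>W \<omega>\<bar> \<le> c'"
    have m: "\<bar>W \<omega> * x\<bar> \<le> \<bar>c'\<bar> * c n" if "\<omega> \<in> space M" "\<bar>x\<bar> \<le> c n" for \<omega> x
      unfolding abs_mult using W(2) that by (intro mult_mono) auto
    have "(\<integral>\<omega>. W \<omega> * \<xi> n \<omega> \<partial>M) = (\<integral>\<omega>. (\<Sum>i=1..d. X (Suc n) i \<omega> * (W \<omega> * \<phi> n i \<omega> + (W \<omega> * \<psi> n i \<omega>) * A (Suc n) i \<omega> + 0 * (A (Suc n) i \<omega>)\<^sup>2)) \<partial>M)"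
      by (rule Bochner_Integration.integral_cong) (auto simp: \<xi>_def sum_distrib_left algebra_simps)
    also have "\<dots> = (\<integral>\<omega>. (\<Sum>i=1..d. Z n i \<omega> * (W \<omega> * \<phi> n i \<omega> + (W \<omega> * \<psi> n i \<omega>) * \<mu> n i + 0 * \<sigma> n i)) \<partial>M)"
      by (rule integral_step(1)[where c="\<bar>c'\<bar> * c n"])
        (use W meas c0 m bd in \<open>auto intro!: borel_measurable_times\<close>)
    also have "\<dots> = (\<integral>\<omega>. W \<omega> * (\<Sum>i=1..d. Z n i \<omega> * (\<phi> n i \<omega> + \<psi> n i \<omega> * \<mu> n i)) \<partial>M)"
      by (rule Bochner_Integration.integral_cong) (auto simp: sum_distrib_left algebra_simps)
    also have "\<dots> = (\<integral>\<omega>. 0 \<partial>M)"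
      by (rule Bochner_Integration.integral_cong) (auto simp: zero simp del: One_nat_def)
    finally show "(\<integral>\<omega>. W \<omega> * \<xi> n \<omega> \<partial>M) = 0" by simp
  qed
  show "cond_var \<xi> v"
    unfolding cond_var_def
  proof (intro conjI allI impI)
    show "v n \<in> borel_measurable (G n)" for n
      unfolding v_def
      by (intro borel_measurable_sum borel_measurable_times borel_measurable_add borel_measurable_power borel_measurable_const Z_measurable_G meas)
    fix n and W :: "'a \<Rightarrow> real" and c'
    assume W: "W \<in> borel_measurable (G n)" "\<forall>\<omega>\<in>space M. \<bar>W \<omega>\<bar> \<le> c'"
    have m: "\<bar>W \<omega> * (x * y)\<bar> \<le> 2 * (\<bar>c'\<bar> * (c n * c n))" "\<bar>W \<omega> * (2 * x * y)\<bar> \<le> 2 * (\<bar>c'\<bar> * (c n * c n))"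
      if "\<omega> \<in> space M" "\<bar>x\<bar> \<le> c n" "\<bar>y\<bar> \<le> c n" for \<omega> x y
    proof -
      have "\<bar>W \<omega> * (x * y)\<bar> \<le> \<bar>c'\<bar> * (c n * c n)"
        unfolding abs_mult using W(2) that by (intro mult_mono) auto
      moreover have "\<bar>W \<omega> * (2 * x * y)\<bar> = 2 * \<bar>W \<omega> * (x * y)\<bar>" by (simp add: abs_mult)
      moreover have "0 \<le> \<bar>W \<omega> * (x * y)\<bar>" by simp
      ultimately show "\<bar>W \<omega> * (x * y)\<bar> \<le> 2 * (\<bar>c'\<bar> * (c n * c n))" "\<bar>W \<omega> * (2 * x * y)\<bar> \<le> 2 * (\<bar>c'\<bar> * (c n * c n))"
        by linarith+
    qed
    have "(\<integral>\<omega>. W \<omega> * (\<xi> n \<omega>)\<^sup>2 \<partial>M) = (\<integral>\<omega>. (\<Sum>i=1..d. X (Suc n) i \<omega> * (W \<omega> * (\<phi> n i \<omega> * \<phi> n i \<omega>) + (W \<omega> * (2 * \<phi> n i \<omega> * \<psi> n i \<omega>)) * A (Suc n) i \<omega> + (W \<omega> * (\<psi> n i \<omega> * \<psi> n i \<omega>)) * (A (Suc n) i \<omega>)\<^sup>2)) \<partial>M)"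
    proof (rule Bochner_Integration.integral_cong)
      fix \<omega> assume w: "\<omega> \<in> space M"
      obtain i where i: "i \<in> {1..d}" "\<And>f. (\<Sum>j=1..d. X (Suc n) j \<omega> * f j) = (f i :: real)"
        using X_one_hot[OF w, of n] by metis
      show "W \<omega> * (\<xi> n \<omega>)\<^sup>2 = (\<Sum>i=1..d. X (Suc n) i \<omega> * (W \<omega> * (\<phi> n i \<omega> * \<phi> n i \<omega>) + (W \<omega> * (2 * \<phi> n i \<omega> * \<psi> n i \<omega>)) * A (Suc n) i \<omega> + (W \<omega> * (\<psi> n i \<omega> * \<psi> n i \<omega>)) * (A (Suc n) i \<omega>)\<^sup>2))"
        unfolding \<xi>_def i(2) by (simp add: power2_eq_square algebra_simps)
    qed simp
    also have "\<dots> = (\<integral>\<omega>. (\<Sum>i=1..d. Z n i \<omega> * (W \<omega> * (\<phi> n i \<omega> * \<phi> n i \<omega>) + (W \<omega> * (2 * \<phi> n i \<omega> * \<psi> n i \<omega>)) * \<mu> n i + (W \<omega> * (\<psi> n i \<omega> * \<psi> n i \<omega>)) * \<sigma> n i)) \<partial>M)"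
      by (rule integral_step(1)[where c="2 * (\<bar>c'\<bar> * (c n * c n))"])
        (intro borel_measurable_times borel_measurable_const W meas m bd; assumption)+
    also have "\<dots> = (\<integral>\<omega>. W \<omega> * v n \<omega> \<partial>M)"
      by (rule Bochner_Integration.integral_cong) (auto simp: v_def sum_distrib_left power2_eq_square algebra_simps)
    finally show "(\<integral>\<omega>. W \<omega> * (\<xi> n \<omega>)\<^sup>2 \<partial>M) = (\<integral>\<omega>. W \<omega> * v n \<omega> \<partial>M)" .
  qed
  show "0 \<le> v n \<omega>" if w: "\<omega> \<in> space M"
    unfolding v_def
  proof (intro sum_nonneg mult_nonneg_nonneg)
    fix i assume i: "i \<in> {1..d}"
    show "0 \<le> Z n i \<omega>" using Z_bounds[OF i w] by blast
    show "0 \<le> (\<phi> n i \<omega>)\<^sup>2 + 2 * \<phi> n i \<omega> * \<psi> n i \<omega> * \<mu> n i + (\<psi> n i \<omega>)\<^sup>2 * \<sigma> n i"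
      using second_moment_bounds[OF i b[OF i w]] by blast
  qed
  show "v n \<omega> \<le> (b n)\<^sup>2" if w: "\<omega> \<in> space M"
    unfolding v_def by (rule sum_Z_convex[OF w]) (use second_moment_bounds[OF _ b[OF _ w]] in blast)
qed

lemma mean_bounds:
  obtains l m' n0 where "0 \<le> l" "2 * l < m'" "m' < m"
    "\<And>n i. n \<ge> n0 \<Longrightarrow> i \<in> {1..d0} \<Longrightarrow> m' \<le> \<mu> n i" "\<And>n i. n \<ge> n0 \<Longrightarrow> i \<in> {d0<..d} \<Longrightarrow> \<mu> n i \<le> l"
proof -
  let ?E = "\<lambda>n i. \<integral>\<omega>. A n i \<omega> \<partial>M"
  let ?lam = "urn_lambda0 M d d0 A"
  have lim: "(\<lambda>n. ?E n 1) \<longlonglongrightarrow> m" and eq: "\<And>n i. n \<ge> 1 \<Longrightarrow> i \<in> {1..d0} \<Longrightarrow> ?E n i = ?E n 1"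
    using urn_B unfolding urn_assms_B_def by blast+
  have ls: "limsup (\<lambda>n. ereal (?E n i)) \<le> ?lam" if "i \<in> {d0<..d}" for i
    unfolding urn_lambda0_def using that by (auto intro!: Max_ge)
  have l0: "0 \<le> ?lam"
  proof (cases "d0 = d")
    case False
    then have d: "d \<in> {d0<..d}" using d0 by auto
    have "0 \<le> limsup (\<lambda>n. ereal (?E n d))"
    proof (rule le_Limsup)
      have "0 \<le> ?E (Suc n) d" for n using mu_bounds[of d n] d0 unfolding \<mu>_def by auto
      then have "0 \<le> ereal (?E n d)" if "n \<ge> 1" for n using that by (cases n) auto
      then show "\<forall>\<^sub>F n in sequentially. 0 \<le> ereal (?E n d)" by (rule eventually_sequentiallyI)
    qed simp
    then show ?thesis using ls[OF d] by (rule order_trans)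
  qed (simp add: urn_lambda0_def)
  obtain r where r: "?lam = ereal r" "0 \<le> r" "2 * r < m"
  proof (cases ?lam)
    case (real r)
    then show ?thesis using that[of r] l0 lambda0 by auto
  qed (use l0 lambda0 in auto)
  \<comment> \<open>The gap in \<open>2 * r < m\<close> is divided by midpoints, so that
    \<open>l\<close> is strictly above all limits superior of the minor means, \<open>m'\<close>
    strictly below the limit of the dominant ones, and \<open>2 * l < m'\<close> still
    holds.\<close>
  define l where "l = (r + m / 2) / 2"
  define m' where "m' = (2 * l + m) / 2"
  have l: "r < l" "2 * l < m" "0 \<le> l" and m': "2 * l < m'" "m' < m" unfolding m'_def l_def using r by auto
  have "\<forall>\<^sub>F n in sequentially. \<forall>i\<in>{d0<..d}. ?E n i < l"
  proof (rule eventually_ball_finite)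
    show "\<forall>i\<in>{d0<..d}. \<forall>\<^sub>F n in sequentially. ?E n i < l"
    proof
      fix i assume "i \<in> {d0<..d}"
      then have "limsup (\<lambda>n. ereal (?E n i)) < ereal l" using ls[of i] r(1) l(1) by (auto intro: le_less_trans)
      from Limsup_lessD[OF this] show "\<forall>\<^sub>F n in sequentially. ?E n i < l" by simp
    qed
  qed simp
  moreover have "\<forall>\<^sub>F n in sequentially. m' < ?E n 1" by (rule order_tendstoD(1)[OF lim m'(2)])
  ultimately have "\<forall>\<^sub>F n in sequentially. (\<forall>i\<in>{d0<..d}. ?E n i < l) \<and> m' < ?E n 1" by (rule eventually_conj)
  then obtain n0 where n0: "\<And>n. n \<ge> n0 \<Longrightarrow> (\<forall>i\<in>{d0<..d}. ?E n i < l) \<and> m' < ?E n 1"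
    unfolding eventually_sequentially by blast
  show ?thesis
  proof (rule that[of l m' n0])
    show "m' \<le> \<mu> n i" if "n \<ge> n0" "i \<in> {1..d0}" for n i
      using n0[of "Suc n"] eq[of "Suc n" i] that by (simp add: \<mu>_def)
    show "\<mu> n i \<le> l" if "n \<ge> n0" "i \<in> {d0<..d}" for n i
      using n0[of "Suc n"] that unfolding \<mu>_def by (auto intro: less_imp_le)
  qed (use l m' in auto)
qed

lemma m_pos: "0 < m"
  using mean_bounds by (metis dual_order.strict_trans2 dual_order.strict_trans mult_nonneg_nonneg zero_le_numeral)

lemma step_cases:
  assumes w: "\<omega> \<in> space M"
  obtains i where "i \<in> {1..d}" "\<And>f. (\<Sum>j=1..d. X (Suc n) j \<omega> * f j) = (f i :: real)"
    "T (Suc n) \<omega> = T n \<omega> + (if i \<le> d0 then A (Suc n) i \<omega> else 0)"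
    "B (Suc n) \<omega> = B n \<omega> + (if i \<le> d0 then 0 else A (Suc n) i \<omega>)"
    "S (Suc n) \<omega> = S n \<omega> + A (Suc n) i \<omega>"
proof -
  obtain i where i: "i \<in> {1..d}" "\<And>f. (\<Sum>j=1..d. X (Suc n) j \<omega> * f j) = (f i :: real)"
    using X_one_hot[OF w, of n] by metis
  have "(\<Sum>j\<in>{1..d0}. X (Suc n) j \<omega> * A (Suc n) j \<omega>) = (\<Sum>j=1..d. X (Suc n) j \<omega> * (if j \<le> d0 then A (Suc n) j \<omega> else 0))"
    unfolding sum_colors by simp
  also have "\<dots> = (if i \<le> d0 then A (Suc n) i \<omega> else 0)" by (rule i(2))
  finally have T: "T (Suc n) \<omega> = T n \<omega> + (if i \<le> d0 then A (Suc n) i \<omega> else 0)" by (simp add: T_Suc)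
  have "(\<Sum>j\<in>{d0<..d}. X (Suc n) j \<omega> * A (Suc n) j \<omega>) = (\<Sum>j=1..d. X (Suc n) j \<omega> * (if j \<le> d0 then 0 else A (Suc n) j \<omega>))"
    unfolding sum_colors by simp
  also have "\<dots> = (if i \<le> d0 then 0 else A (Suc n) i \<omega>)" by (rule i(2))
  finally have B: "B (Suc n) \<omega> = B n \<omega> + (if i \<le> d0 then 0 else A (Suc n) i \<omega>)" by (simp add: B_Suc)
  have "S (Suc n) \<omega> = S n \<omega> + A (Suc n) i \<omega>" by (simp add: S_Suc i(2) del: One_nat_def)
  then show ?thesis using that i T B by blast
qed

lemma T_mono:
  assumes w: "\<omega> \<in> space M" and "n \<le> k"
  shows "T n \<omega> \<le> T k \<omega>"
  using assms(2)
proof (induction k rule: dec_induct)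
  case (step k)
  show ?case
  proof (rule step_cases[OF w, of k])
    fix i assume "i \<in> {1..d}" "T (Suc k) \<omega> = T k \<omega> + (if i \<le> d0 then A (Suc k) i \<omega> else 0)"
    then show ?thesis using step.IH A_bounds[of i \<omega> k] w by auto
  qed
qed simp

text \<open>Here \<open>T\<close> is the total weight of the dominant colors. It tends to infinity because
  \<open>exp (- t T)\<close> loses a fraction of order \<open>1/n\<close> of its mean at each step.\<close>

lemma T_tendsto: "AE \<omega> in M. filterlim (\<lambda>n. T n \<omega>) at_top sequentially"
proof -
  obtain l m' n0 where mm: "0 \<le> l" "2 * l < m'" "m' < m"
    "\<And>n i. n \<ge> n0 \<Longrightarrow> i \<in> {1..d0} \<Longrightarrow> m' \<le> \<mu> n i" "\<And>n i. n \<ge> n0 \<Longrightarrow> i \<in> {d0<..d} \<Longrightarrow> \<mu> n i \<le> l"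
    by (rule mean_bounds) blast
  have [measurable]: "T n \<in> borel_measurable M" for n using measurable_M[OF T_measurable_G] .
  \<comment> \<open>This keeps \<open>t * A\<close> at most 1, the range in which
    \<open>exp (- x) \<le> 1 - x / 2\<close> is used.\<close>
  define t where "t = 1 / (\<beta> + 1)"
  have t0: "t > 0" unfolding t_def using beta_pos by simp
  have tA: "0 \<le> t * A (Suc n) i \<omega> \<and> t * A (Suc n) i \<omega> \<le> 1" if "i \<in> {1..d}" "\<omega> \<in> space M" for n i \<omega>
    using A_bounds[OF that, of n] beta_pos unfolding t_def by (simp add: divide_le_eq)
  define E where "E n = expectation (\<lambda>\<omega>. exp (- t * T n \<omega>))" for n
  have eb: "\<bar>exp (- t * T n \<omega>)\<bar> \<le> 1" if "\<omega> \<in> space M" for n \<omega>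
    using T_pos[OF that, of n] t0 by simp
  have ie: "integrable M (\<lambda>\<omega>. exp (- t * T n \<omega>))" for n
    by (rule integrable_bounded[where c=1]) (use eb in auto)
  have S0p: "S0 > 0"
    unfolding S0_def by (rule sum_pos) (use a_pos d0 in auto)
  \<comment> \<open>Color 1 alone is drawn with probability at least
    \<open>a 1 / (S0 + \<beta> * n)\<close>, and drawing it costs at least a fraction
    \<open>t / 2 * m'\<close> on average. The resulting series diverges like the harmonic
    one.\<close>
  define \<delta> where "\<delta> n = (t / 2 * a 1 * m') / (S0 + \<beta> * real n)" for n
  have m'0: "m' > 0" using mm by linarith
  have step: "E (Suc n) \<le> (1 - \<delta> n) * E n" if n: "n \<ge> n0" for n
  proof -
    \<comment> \<open>Coefficients of an upper bound for \<open>exp (- t * T (Suc n))\<close> that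
      is linear in the added weight, the form \<open>integral_step\<close> can average.\<close>
    define \<psi> where "\<psi> i \<omega> = (if i \<le> d0 then - (t / 2) * exp (- t * T n \<omega>) else 0)" for i :: nat and \<omega>
    have TG: "(\<lambda>\<omega>. exp (- t * T n \<omega>)) \<in> borel_measurable (G n)" using T_measurable_G[of n] by measurable
    have \<psi>G: "\<psi> i \<in> borel_measurable (G n)" for i unfolding \<psi>_def using TG by (cases "i \<le> d0") simp_all
    note st = integral_step[where \<phi>="\<lambda>i \<omega>. exp (- t * T n \<omega>)" and \<psi>=\<psi> and \<theta>="\<lambda>_ _. 0" and n=n and c="1 + t",
       OF TG \<psi>G borel_measurable_const]
    have c1: "\<bar>exp (- t * T n \<omega>)\<bar> \<le> 1 + t" if "\<omega> \<in> space M" for \<omega> using eb[OF that, of n] t0 by linarith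
    have c2: "\<bar>\<psi> i \<omega>\<bar> \<le> 1 + t" if "\<omega> \<in> space M" for i \<omega>
    proof -
      have "t / 2 * exp (- t * T n \<omega>) \<le> t / 2 * 1" using eb[OF that, of n] t0 by (intro mult_left_mono) auto
      moreover have "\<bar>\<psi> i \<omega>\<bar> = (if i \<le> d0 then t / 2 * exp (- t * T n \<omega>) else 0)"
        unfolding \<psi>_def using t0 by (simp add: abs_mult)
      moreover have "t / 2 * 1 \<le> 1 + t" "0 \<le> 1 + t" using t0 by auto
      ultimately show ?thesis by (smt (verit))
    qed
    have c3: "\<bar>0::real\<bar> \<le> 1 + t" using t0 by simp
    have "E (Suc n) \<le> (\<integral>\<omega>. (\<Sum>i=1..d. X (Suc n) i \<omega> * (exp (- t * T n \<omega>) + \<psi> i \<omega> * A (Suc n) i \<omega> + 0 * (A (Suc n) i \<omega>)\<^sup>2)) \<partial>M)"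
      unfolding E_def
    proof (rule integral_mono[OF ie st(2)])
      fix \<omega> assume w: "\<omega> \<in> space M"
      show "exp (- t * T (Suc n) \<omega>) \<le> (\<Sum>i=1..d. X (Suc n) i \<omega> * (exp (- t * T n \<omega>) + \<psi> i \<omega> * A (Suc n) i \<omega> + 0 * (A (Suc n) i \<omega>)\<^sup>2))"
      proof (rule step_cases[OF w, of n])
        fix i assume i: "i \<in> {1..d}" "\<And>f. (\<Sum>j=1..d. X (Suc n) j \<omega> * f j) = (f i :: real)"
          "T (Suc n) \<omega> = T n \<omega> + (if i \<le> d0 then A (Suc n) i \<omega> else 0)"
        define x where "x = t * A (Suc n) i \<omega>"
        have x: "0 \<le> x" "x \<le> 1" using tA[OF i(1) w, of n] unfolding x_def by auto
        have "exp (- x) \<le> 1 - x / 2"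
        proof -
          have "exp (- x) * (1 + x) \<le> exp (- x) * exp x" by (intro mult_left_mono) (auto simp: exp_ge_add_one_self)
          then have "exp (- x) * (1 + x) \<le> 1" by (simp flip: exp_add)
          then have "exp (- x) \<le> 1 / (1 + x)" using x by (simp add: pos_le_divide_eq)
          also have "\<dots> \<le> 1 - x / 2"
          proof -
            have "0 \<le> x * (1 - x)" using x by simp
            then have "1 \<le> (1 - x / 2) * (1 + x)" by (simp add: algebra_simps)
            then show ?thesis using x by (simp add: pos_divide_le_eq)
          qed
          finally show ?thesis .
        qed
        then have "exp (- t * T n \<omega>) * exp (- x) \<le> exp (- t * T n \<omega>) * (1 - x / 2)" by (intro mult_left_mono) auto
        also have "exp (- t * T n \<omega>) * exp (- x) = exp (- t * (T n \<omega> + A (Suc n) i \<omega>))"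
          unfolding exp_add[symmetric] x_def by (simp add: algebra_simps)
        also have "exp (- t * T n \<omega>) * (1 - x / 2) = exp (- t * T n \<omega>) + (- (t / 2) * exp (- t * T n \<omega>)) * A (Suc n) i \<omega> + 0 * (A (Suc n) i \<omega>)\<^sup>2"
          unfolding x_def by (simp add: algebra_simps)
        finally have le: "exp (- t * (T n \<omega> + A (Suc n) i \<omega>)) \<le> exp (- t * T n \<omega>) + (- (t / 2) * exp (- t * T n \<omega>)) * A (Suc n) i \<omega> + 0 * (A (Suc n) i \<omega>)\<^sup>2" .
        show ?thesis
        proof (cases "i \<le> d0")
          case True
          then show ?thesis unfolding i(2) i(3) \<psi>_def using le by (simp only: if_True)
        next
          case False
          then show ?thesis unfolding i(2) i(3) \<psi>_def by simp
        qed
      qed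
    qed (use c1 c2 c3 in auto)
    also have "\<dots> = (\<integral>\<omega>. (\<Sum>i=1..d. Z n i \<omega> * (exp (- t * T n \<omega>) + \<psi> i \<omega> * \<mu> n i + 0 * \<sigma> n i)) \<partial>M)"
      by (rule st(1)) (use c1 c2 c3 in auto)
    also have "\<dots> \<le> (\<integral>\<omega>. (1 - \<delta> n) * exp (- t * T n \<omega>) \<partial>M)"
    proof (rule integral_mono[OF st(3)])
      fix \<omega> assume w: "\<omega> \<in> space M"
      define e where "e = exp (- t * T n \<omega>)"
      have e0: "e > 0" unfolding e_def by simp
      have "a 1 / (S0 + \<beta> * real n) \<le> Z n 1 \<omega>"
        unfolding Z_eq using N_ge[of 1 \<omega> n] S_le[OF w, of n] S_pos[OF w, of n] a1_pos d0 w
        by (intro frac_le) auto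
      then have "\<delta> n \<le> t / 2 * m' * Z n 1 \<omega>"
        unfolding \<delta>_def using t0 m'0 mult_left_mono[of "a 1 / (S0 + \<beta> * real n)" "Z n 1 \<omega>" "t / 2 * m'"] by (simp add: mult_ac)
      also have "\<dots> \<le> t / 2 * (\<Sum>i\<in>{1..d0}. Z n i \<omega> * \<mu> n i)"
      proof -
        have "m' * Z n 1 \<omega> \<le> Z n 1 \<omega> * \<mu> n 1"
          unfolding mult.commute[of m'] using mm(4)[OF n, of 1] Z_bounds[of 1 \<omega> n] d0 w by (intro mult_left_mono) auto
        also have "\<dots> \<le> (\<Sum>i\<in>{1..d0}. Z n i \<omega> * \<mu> n i)"
          by (rule member_le_sum) (use d0 Z_bounds[OF _ w, of _ n] mu_bounds[of _ n] in auto)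
        finally show ?thesis using t0 by (simp add: mult.assoc)
      qed
      finally have "e * \<delta> n \<le> e * (t / 2 * (\<Sum>i\<in>{1..d0}. Z n i \<omega> * \<mu> n i))" using e0 by (intro mult_left_mono) auto
      moreover have "(\<Sum>i=1..d. Z n i \<omega> * (e + \<psi> i \<omega> * \<mu> n i + 0 * \<sigma> n i)) = e * (\<Sum>i=1..d. Z n i \<omega>) - e * (t / 2 * (\<Sum>i\<in>{1..d0}. Z n i \<omega> * \<mu> n i))"
      proof -
        have "(\<Sum>i=1..d. Z n i \<omega> * (e + \<psi> i \<omega> * \<mu> n i + 0 * \<sigma> n i)) = (\<Sum>i=1..d. Z n i \<omega> * e) + (\<Sum>i=1..d. Z n i \<omega> * (\<psi> i \<omega> * \<mu> n i))"
          by (simp add: sum.distrib distrib_left)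
        also have "(\<Sum>i=1..d. Z n i \<omega> * (\<psi> i \<omega> * \<mu> n i)) = (\<Sum>i\<in>{1..d0}. - (e * (t / 2)) * (Z n i \<omega> * \<mu> n i))"
          unfolding sum_colors by (auto simp: \<psi>_def e_def intro!: sum.cong)
        finally show ?thesis unfolding sum_distrib_left[symmetric] sum_distrib_right[symmetric] by simp
      qed
      ultimately show "(\<Sum>i=1..d. Z n i \<omega> * (exp (- t * T n \<omega>) + \<psi> i \<omega> * \<mu> n i + 0 * \<sigma> n i)) \<le> (1 - \<delta> n) * exp (- t * T n \<omega>)"
        unfolding e_def[symmetric] sum_Z[OF w] by (simp add: algebra_simps)
    qed (use c1 c2 c3 ie in auto)
    finally show ?thesis unfolding E_def by simp
  qed
  have E0: "E \<longlonglongrightarrow> 0"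
  proof (rule decay_tendsto_zero[where N=n0 and \<delta>=\<delta>])
    show "E (Suc n) \<le> (1 - \<delta> n) * E n" if "n0 \<le> n" for n using step[OF that] .
    show "0 \<le> E n" for n unfolding E_def by (intro Bochner_Integration.integral_nonneg_AE) simp
    define k where "k = (t / 2 * a 1 * m') / (S0 + \<beta>)"
    have k: "k > 0" unfolding k_def using t0 a1_pos m'0 S0p beta_pos by (intro divide_pos_pos mult_pos_pos add_pos_pos) auto
    show d: "0 \<le> \<delta> n" for n unfolding \<delta>_def using t0 a1_pos m'0 S0p beta_pos
      by (intro divide_nonneg_nonneg mult_nonneg_nonneg add_nonneg_nonneg) auto
    have kd: "k * inverse (real (Suc n)) \<le> \<delta> n" for n
    proof -
      have "S0 + \<beta> * real n \<le> (S0 + \<beta>) * real (Suc n)" using S0p beta_pos by (simp add: algebra_simps)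
      then have "(t / 2 * a 1 * m') / ((S0 + \<beta>) * real (Suc n)) \<le> (t / 2 * a 1 * m') / (S0 + \<beta> * real n)"
        using t0 a1_pos m'0 S0p beta_pos
        by (intro divide_left_mono mult_pos_pos add_pos_nonneg) auto
      then show ?thesis unfolding k_def \<delta>_def by (simp add: field_simps)
    qed
    show "\<not> summable \<delta>"
    proof
      assume "summable \<delta>"
      then have "summable (\<lambda>n. k * inverse (real (Suc n)))"
        by (rule summable_comparison_test'[where N=0]) (use kd k in auto)
      then have "summable (\<lambda>n. inverse (real (Suc n)))" using k by (simp add: summable_cmult_iff)
      then show False using not_summable_harmonic[where 'a=real] summable_Suc_iff[of "\<lambda>n. inverse (real n)"] by simp
    qed
  qed
  have big: "AE \<omega> in M. \<exists>n. T n \<omega> > real k" for k :: nat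
  proof -
    let ?B = "{\<omega>\<in>space M. \<forall>n. T n \<omega> \<le> real k}"
    have B: "?B \<in> sets M" by measurable
    have le: "prob ?B \<le> E n / exp (- t * real k)" for n
    proof -
      have "prob ?B \<le> prob {\<omega>\<in>space M. exp (- t * T n \<omega>) \<ge> exp (- t * real k)}"
        by (rule finite_measure_mono) (use t0 in auto)
      also have "\<dots> \<le> E n / exp (- t * real k)"
        unfolding E_def by (rule integral_Markov_inequality_measure[OF ie sets.empty_sets]) auto
      finally show ?thesis .
    qed
    have "(\<lambda>n. E n / exp (- t * real k)) \<longlonglongrightarrow> 0 / exp (- t * real k)"
      by (intro tendsto_divide E0) auto
    then have "prob ?B \<le> 0 / exp (- t * real k)"
      by (rule LIMSEQ_le_const) (intro exI allI impI le)
    then have "prob ?B = 0" using measure_nonneg[of M ?B] by simp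
    then have "AE \<omega> in M. \<omega> \<notin> ?B"
      using B by (intro AE_not_in) (auto simp: null_sets_def emeasure_eq_measure)
    then show ?thesis using AE_space by eventually_elim (auto simp: not_le)
  qed
  have "AE \<omega> in M. \<forall>k::nat. \<exists>n. T n \<omega> > real k"
    unfolding AE_all_countable by (intro allI big)
  then show ?thesis
    using AE_space
  proof eventually_elim
    case (elim \<omega>)
    show ?case
      unfolding filterlim_at_top_dense
    proof
      fix z :: real
      obtain k :: nat where "z < real k" using reals_Archimedean2 by blast
      moreover obtain n where "T n \<omega> > real k" using elim by blast
      ultimately have "z < T j \<omega>" if "j \<ge> n" for j using T_mono[OF elim(2) that] by linarith
      then show "\<forall>\<^sub>F n in sequentially. z < T n \<omega>" by (rule eventually_sequentiallyI)
    qed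
  qed
qed

text \<open>Since \<open>2 * \<lambda>\<^sub>0 < m\<close> there is \<open>\<rho> < 1/2\<close> such that \<open>B / T powr \<rho>\<close>
  is a supermartingale once \<open>T\<close> is large, hence bounded.\<close>

lemma B_growth: "\<exists>\<rho>. 0 < \<rho> \<and> \<rho> < 1 / 2 \<and> (AE \<omega> in M. \<exists>c N. \<forall>n\<ge>N. B n \<omega> \<le> c * T n \<omega> powr \<rho>)"
proof -
  obtain l m' n0 where mm: "0 \<le> l" "2 * l < m'" "m' < m"
    "\<And>n i. n \<ge> n0 \<Longrightarrow> i \<in> {1..d0} \<Longrightarrow> m' \<le> \<mu> n i" "\<And>n i. n \<ge> n0 \<Longrightarrow> i \<in> {d0<..d} \<Longrightarrow> \<mu> n i \<le> l"
    by (rule mean_bounds) blast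
  have m'0: "m' > 0" using mm by linarith
  \<comment> \<open>At the exponent \<open>l / m'\<close> the mean gain of
    \<open>B / T powr \<kappa>\<close> from minor colors and its loss from dominant ones balance to
    first order; \<open>\<rho>\<close> is placed strictly between it and 1/2.\<close>
  define \<kappa> where "\<kappa> = l / m'"
  define \<rho> where "\<rho> = (\<kappa> + 1 / 2) / 2"
  have \<kappa>: "0 \<le> \<kappa>" "\<kappa> < 1 / 2" "\<kappa> * m' = l" unfolding \<kappa>_def using mm m'0 by (auto simp: pos_divide_less_eq)
  have \<rho>: "\<kappa> < \<rho>" "0 < \<rho>" "\<rho> < 1 / 2" unfolding \<rho>_def using \<kappa> by auto
  obtain u0 where u0: "u0 > 0" "\<And>u. 0 \<le> u \<Longrightarrow> u < u0 \<Longrightarrow> (1 + u) powr (- \<rho>) \<le> 1 - \<kappa> * u"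
    using powr_minus_le_linear[OF \<rho>(1)] by blast
  \<comment> \<open>Once \<open>T\<close> has reached \<open>T0\<close>, a step multiplies it by
    some \<open>1 + u\<close> with \<open>u < u0\<close>.\<close>
  define T0 where "T0 = (\<beta> + 1) / u0"
  have T0: "T0 > 0" unfolding T0_def using u0 beta_pos by simp
  have TBM [measurable]: "T n \<in> borel_measurable M" "B n \<in> borel_measurable M" for n
    using measurable_M[OF T_measurable_G] measurable_M[OF B_measurable_G] by blast+
  define V where "V n \<omega> = B n \<omega> * T n \<omega> powr (- \<rho>)" for n \<omega>
  have [measurable]: "V n \<in> borel_measurable M" for n unfolding V_def by measurable
  have VG: "V n \<in> borel_measurable (G n)" for n unfolding V_def using T_measurable_G[of n] B_measurable_G[of n] by measurable
  have V0: "0 \<le> V n \<omega>" if "\<omega> \<in> space M" for n \<omega> unfolding V_def using B_nonneg[OF that] by simp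
  define cT where "cT = a 1 powr (- \<rho>)"
  have Tp: "T n \<omega> powr (- \<rho>) \<le> cT" if "\<omega> \<in> space M" for n \<omega>
    unfolding cT_def using T_ge[OF that] a1_pos \<rho>(2) by (intro powr_mono2') auto
  have cT0: "cT > 0" unfolding cT_def using a1_pos by simp
  define cV where "cV n = (S0 + \<beta> * real n) * cT" for n
  have Vb: "V n \<omega> \<le> cV n" if w: "\<omega> \<in> space M" for n \<omega>
  proof -
    have "B n \<omega> \<le> S0 + \<beta> * real n" using S_le[OF w, of n] T_pos[OF w, of n] by (simp add: S_eq)
    then show ?thesis unfolding V_def cV_def using Tp[OF w, of n] B_nonneg[OF w, of n] by (intro mult_mono) auto
  qed
  have "AE \<omega> in M. T0 \<le> T N \<omega> \<longrightarrow> (\<exists>c. \<forall>n. V (N + n) \<omega> \<le> c)" if N: "N \<ge> n0" for N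
  proof -
    interpret NF: filtered_prob_space M "\<lambda>n. G (N + n)"
      by unfold_locales (use subalg sets_Suc in auto)
    \<comment> \<open>\<open>T\<close> reaches \<open>T0\<close> only at a random time. Fixing
      \<open>N\<close> and restricting to the event that this has happened by time \<open>N\<close>
      keeps the process adapted; \<open>T\<close> is monotone, so it stays large, and the events for
      all \<open>N\<close> exhaust almost every path.\<close>
    define I where "I \<omega> = (if T0 \<le> T N \<omega> then 1 else 0 :: real)" for \<omega>
    have IG: "I \<in> borel_measurable (G N)" unfolding I_def using T_measurable_G[of N] by measurable
    have [measurable]: "I \<in> borel_measurable M" using IG measurable_M by blast
    have Ib: "0 \<le> I \<omega>" "I \<omega> \<le> 1" for \<omega> by (auto simp: I_def)
    have "AE \<omega> in M. \<exists>c. \<forall>n. I \<omega> * V (N + n) \<omega> \<le> c"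
    proof (rule NF.AE_bounded)
      show "(\<lambda>\<omega>. I \<omega> * V (N + n) \<omega>) \<in> borel_measurable (G (N + n))" for n
        by (intro borel_measurable_times measurable_mono[OF IG] VG) simp
      show "integrable M (\<lambda>\<omega>. I \<omega> * V (N + n) \<omega>)" for n
      proof (rule integrable_bounded)
        show "norm (I \<omega> * V (N + n) \<omega>) \<le> 1 * cV (N + n)" if "\<omega> \<in> space M" for \<omega>
          unfolding norm_mult using Ib[of \<omega>] V0[OF that, of "N + n"] Vb[OF that, of "N + n"] by (intro mult_mono) auto
      qed measurable
      show "0 \<le> I \<omega> * V (N + n) \<omega>" if "\<omega> \<in> space M" for n \<omega> using Ib V0[OF that] by simp
      fix n H assume H: "H \<in> sets (G (N + n))"
      define k where "k = N + n"
      have k: "k \<ge> n0" "N \<le> k" using N unfolding k_def by auto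
      have HG: "H \<in> sets (G k)" using H unfolding k_def .
      then have [measurable]: "H \<in> sets M" by (rule sets_M)
      define W where "W \<omega> = indicator H \<omega> * I \<omega>" for \<omega>
      have WG: "W \<in> borel_measurable (G k)" unfolding W_def using HG measurable_mono[OF IG k(2)] by measurable
      have [measurable]: "W \<in> borel_measurable M" using WG measurable_M by blast
      have Wb: "0 \<le> W \<omega>" "W \<omega> \<le> 1" for \<omega> unfolding W_def using Ib[of \<omega>] by (auto simp: indicator_def)
      \<comment> \<open>Drawing a dominant color multiplies \<open>V\<close> by at most
        \<open>1 - \<kappa> * A / T\<close>; drawing a minor one adds
        \<open>A * T powr (- \<rho>)\<close>. Both changes are bounded linearly in the added
        weight.\<close>
      define \<psi> where "\<psi> i \<omega> = (if i \<le> d0 then W \<omega> * (- \<kappa> * V k \<omega> / T k \<omega>) else W \<omega> * T k \<omega> powr (- \<rho>))" for i :: nat and \<omega>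
      have \<phi>G: "(\<lambda>\<omega>. W \<omega> * V k \<omega>) \<in> borel_measurable (G k)" by (intro borel_measurable_times WG VG)
      have \<psi>G: "\<psi> i \<in> borel_measurable (G k)" for i
        unfolding \<psi>_def using WG VG[of k] T_measurable_G[of k] by (cases "i \<le> d0") simp_all
      define C where "C = cV k + \<kappa> * cV k / a 1 + cT"
      have S0p: "S0 > 0" unfolding S0_def by (rule sum_pos) (use a_pos d0 in auto)
      have cV0: "cV k \<ge> 0" unfolding cV_def using S0p beta_pos cT0 by (intro mult_nonneg_nonneg add_nonneg_nonneg) auto
      have kV0: "\<kappa> * cV k / a 1 \<ge> 0" using \<kappa>(1) cV0 a1_pos by (intro divide_nonneg_nonneg mult_nonneg_nonneg) auto
      have C1: "\<bar>W \<omega> * V k \<omega>\<bar> \<le> C" if w: "\<omega> \<in> space M" for \<omega>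
      proof -
        have "\<bar>W \<omega> * V k \<omega>\<bar> \<le> 1 * cV k"
          unfolding abs_mult using Wb[of \<omega>] V0[OF w, of k] Vb[OF w, of k] by (intro mult_mono) auto
        then show ?thesis unfolding C_def using kV0 cT0 by linarith
      qed
      have C2: "\<bar>\<psi> i \<omega>\<bar> \<le> C" if w: "\<omega> \<in> space M" for i \<omega>
      proof (cases "i \<le> d0")
        case True
        have "\<bar>\<psi> i \<omega>\<bar> = W \<omega> * (\<kappa> * V k \<omega> / T k \<omega>)"
          unfolding \<psi>_def using True Wb[of \<omega>] V0[OF w, of k] T_pos[OF w, of k] \<kappa>(1) by (simp add: abs_mult)
        also have "\<dots> \<le> 1 * (\<kappa> * cV k / a 1)"
          using Wb[of \<omega>] V0[OF w, of k] Vb[OF w, of k] T_ge[OF w, of k] a1_pos \<kappa>(1) T_pos[OF w, of k] cV0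
          by (intro mult_mono frac_le) auto
        finally show ?thesis unfolding C_def using cV0 cT0 by linarith
      next
        case False
        have "\<bar>\<psi> i \<omega>\<bar> = W \<omega> * T k \<omega> powr (- \<rho>)" unfolding \<psi>_def using False Wb[of \<omega>] by simp
        also have "\<dots> \<le> 1 * cT" using Wb[of \<omega>] Tp[OF w, of k] by (intro mult_mono) auto
        finally show ?thesis unfolding C_def using cV0 kV0 by linarith
      qed
      have C3: "\<bar>0::real\<bar> \<le> C" unfolding C_def using cV0 kV0 cT0 by linarith
      note st = integral_step[where \<phi>="\<lambda>i \<omega>. W \<omega> * V k \<omega>" and \<psi>=\<psi> and \<theta>="\<lambda>_ _. 0" and n=k and c=C,
         OF \<phi>G \<psi>G borel_measurable_const C1 C2 C3]
      have iW: "integrable M (\<lambda>\<omega>. W \<omega> * V j \<omega>)" for j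
      proof (rule integrable_bounded)
        show "norm (W \<omega> * V j \<omega>) \<le> 1 * cV j" if "\<omega> \<in> space M" for \<omega>
          unfolding norm_mult using Wb[of \<omega>] V0[OF that, of j] Vb[OF that, of j] by (intro mult_mono) auto
      qed measurable
      have "(\<integral>\<omega>. W \<omega> * V (Suc k) \<omega> \<partial>M) \<le> (\<integral>\<omega>. (\<Sum>i=1..d. X (Suc k) i \<omega> * (W \<omega> * V k \<omega> + \<psi> i \<omega> * A (Suc k) i \<omega> + 0 * (A (Suc k) i \<omega>)\<^sup>2)) \<partial>M)"
      proof (rule integral_mono[OF iW st(2)])
        fix \<omega> assume w: "\<omega> \<in> space M"
        show "W \<omega> * V (Suc k) \<omega> \<le> (\<Sum>i=1..d. X (Suc k) i \<omega> * (W \<omega> * V k \<omega> + \<psi> i \<omega> * A (Suc k) i \<omega> + 0 * (A (Suc k) i \<omega>)\<^sup>2))"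
        proof (rule step_cases[OF w, of k])
          fix i assume i: "i \<in> {1..d}" "\<And>f. (\<Sum>j=1..d. X (Suc k) j \<omega> * f j) = (f i :: real)"
            "T (Suc k) \<omega> = T k \<omega> + (if i \<le> d0 then A (Suc k) i \<omega> else 0)"
            "B (Suc k) \<omega> = B k \<omega> + (if i \<le> d0 then 0 else A (Suc k) i \<omega>)"
          have "W \<omega> * V (Suc k) \<omega> \<le> W \<omega> * V k \<omega> + \<psi> i \<omega> * A (Suc k) i \<omega>"
          proof (cases "i \<le> d0")
            case False
            then show ?thesis unfolding V_def i(3,4) \<psi>_def by (simp add: algebra_simps)
          next
            case True
            show ?thesis
            proof (cases "T0 \<le> T N \<omega>")
              case False
              then have "W \<omega> = 0" by (simp add: W_def I_def)
              then show ?thesis by (simp add: \<psi>_def)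
            next
              case TN: True
              define u where "u = A (Suc k) i \<omega> / T k \<omega>"
              have Tk: "T0 \<le> T k \<omega>" "0 < T k \<omega>" using TN T_mono[OF w k(2)] T_pos[OF w] by auto
              have u: "0 \<le> u" unfolding u_def using A_bounds[OF i(1) w, of k] Tk by simp
              have "u \<le> \<beta> / T0" unfolding u_def using A_bounds[OF i(1) w, of k] Tk T0 beta_pos by (intro frac_le) auto
              also have "\<dots> < u0" unfolding T0_def using u0(1) beta_pos by (simp add: field_simps)
              finally have u': "u < u0" .
              have "T (Suc k) \<omega> = T k \<omega> * (1 + u)" unfolding i(3) u_def using True Tk(2) by (simp add: field_simps)
              then have "V (Suc k) \<omega> = V k \<omega> * (1 + u) powr (- \<rho>)"
                unfolding V_def i(4) using True Tk(2) u by (simp add: powr_mult)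
              also have "\<dots> \<le> V k \<omega> * (1 - \<kappa> * u)"
                by (intro mult_left_mono u0(2)[OF u u'] V0 w)
              finally have "W \<omega> * V (Suc k) \<omega> \<le> W \<omega> * (V k \<omega> * (1 - \<kappa> * u))"
                using Wb by (intro mult_left_mono)
              also have "\<dots> = W \<omega> * V k \<omega> + \<psi> i \<omega> * A (Suc k) i \<omega>"
                unfolding \<psi>_def u_def using True by (simp add: algebra_simps)
              finally show ?thesis .
            qed
          qed
          then show ?thesis unfolding i(2) by simp
        qed
      qed simp_all
      also have "\<dots> = (\<integral>\<omega>. (\<Sum>i=1..d. Z k i \<omega> * (W \<omega> * V k \<omega> + \<psi> i \<omega> * \<mu> k i + 0 * \<sigma> k i)) \<partial>M)"
        by (rule st(1)) simp_all
      also have "\<dots> \<le> (\<integral>\<omega>. W \<omega> * V k \<omega> \<partial>M)"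
      proof (rule integral_mono[OF st(3) iW])
        fix \<omega> assume w: "\<omega> \<in> space M"
        define z where "z = W \<omega> * V k \<omega>"
        have z0: "0 \<le> z" unfolding z_def using Wb V0[OF w] by simp
        have Tk: "0 < T k \<omega>" "0 < S k \<omega>" using T_pos[OF w] S_pos[OF w] by auto
        have sT: "(\<Sum>i\<in>{1..d0}. Z k i \<omega>) = T k \<omega> / S k \<omega>" unfolding Z_eq T_def by (simp add: sum_divide_distrib)
        have sB: "(\<Sum>i\<in>{d0<..d}. Z k i \<omega>) = B k \<omega> / S k \<omega>" unfolding Z_eq B_def by (simp add: sum_divide_distrib)
        have "(\<Sum>i=1..d. Z k i \<omega> * (\<psi> i \<omega> * \<mu> k i)) = (\<Sum>i\<in>{1..d0}. Z k i \<omega> * (\<psi> i \<omega> * \<mu> k i)) + (\<Sum>i\<in>{d0<..d}. Z k i \<omega> * (\<psi> i \<omega> * \<mu> k i))"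
          by (rule sum_colors)
        also have "\<dots> \<le> (\<Sum>i\<in>{1..d0}. Z k i \<omega> * (- (\<kappa> * z / T k \<omega>) * m')) + (\<Sum>i\<in>{d0<..d}. Z k i \<omega> * (W \<omega> * T k \<omega> powr (- \<rho>) * l))"
        proof (intro add_mono sum_mono mult_left_mono)
          fix i assume i: "i \<in> {1..d0}"
          show "0 \<le> Z k i \<omega>" using Z_bounds[of i \<omega> k] i d0 w by auto
          have "\<kappa> * z / T k \<omega> * m' \<le> \<kappa> * z / T k \<omega> * \<mu> k i"
            using mm(4)[OF k(1) i] \<kappa>(1) z0 Tk by (intro mult_left_mono) auto
          then show "\<psi> i \<omega> * \<mu> k i \<le> - (\<kappa> * z / T k \<omega>) * m'"
            unfolding \<psi>_def z_def using i by (simp add: algebra_simps)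
        next
          fix i assume i: "i \<in> {d0<..d}"
          show "0 \<le> Z k i \<omega>" using Z_bounds[of i \<omega> k] i w by auto
          show "\<psi> i \<omega> * \<mu> k i \<le> W \<omega> * T k \<omega> powr (- \<rho>) * l"
            unfolding \<psi>_def using i mm(5)[OF k(1) i] Wb[of \<omega>] by (auto intro!: mult_left_mono)
        qed
        also have "\<dots> = T k \<omega> / S k \<omega> * (- (\<kappa> * z / T k \<omega>) * m') + B k \<omega> / S k \<omega> * (W \<omega> * T k \<omega> powr (- \<rho>) * l)"
          unfolding sum_distrib_right[symmetric] sT sB ..
        \<comment> \<open>Mean gain and mean loss are both proportional to
          \<open>z / S k \<omega>\<close>, and they cancel by the choice of
          \<open>\<kappa>\<close>.\<close>
        also have "\<dots> = (z / S k \<omega>) * (l - \<kappa> * m')"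
          unfolding z_def V_def using Tk by (simp add: field_simps)
        also have "\<dots> = 0" using \<kappa>(3) by simp
        finally have le: "(\<Sum>i=1..d. Z k i \<omega> * (\<psi> i \<omega> * \<mu> k i)) \<le> 0" .
        have "(\<Sum>i=1..d. Z k i \<omega> * (z + \<psi> i \<omega> * \<mu> k i + 0 * \<sigma> k i)) = (\<Sum>i=1..d. Z k i \<omega>) * z + (\<Sum>i=1..d. Z k i \<omega> * (\<psi> i \<omega> * \<mu> k i))"
          unfolding sum_distrib_right by (simp add: sum.distrib distrib_left)
        then show "(\<Sum>i=1..d. Z k i \<omega> * (W \<omega> * V k \<omega> + \<psi> i \<omega> * \<mu> k i + 0 * \<sigma> k i)) \<le> W \<omega> * V k \<omega>"
          using le unfolding z_def[symmetric] sum_Z[OF w] by simp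
      qed simp_all
      finally show "(\<integral>\<omega>. indicator H \<omega> * (I \<omega> * V (N + Suc n) \<omega>) \<partial>M) \<le> (\<integral>\<omega>. indicator H \<omega> * (I \<omega> * V (N + n) \<omega>) \<partial>M)"
        unfolding W_def k_def by (simp add: mult.assoc)
    qed
    then show ?thesis
    proof eventually_elim
      case (elim \<omega>)
      show ?case
      proof
        assume "T0 \<le> T N \<omega>"
        then have "I \<omega> = 1" by (simp add: I_def)
        then show "\<exists>c. \<forall>n. V (N + n) \<omega> \<le> c" using elim by simp
      qed
    qed
  qed
  then have "AE \<omega> in M. \<forall>N\<ge>n0. T0 \<le> T N \<omega> \<longrightarrow> (\<exists>c. \<forall>n. V (N + n) \<omega> \<le> c)"
    unfolding AE_all_countable by auto
  then have "AE \<omega> in M. \<exists>c N. \<forall>n\<ge>N. B n \<omega> \<le> c * T n \<omega> powr \<rho>"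
    using T_tendsto AE_space
  proof eventually_elim
    case (elim \<omega>)
    have "\<forall>\<^sub>F n in sequentially. T0 \<le> T n \<omega>"
      using elim(2) unfolding filterlim_at_top by blast
    then obtain N1 where "\<And>n. n \<ge> N1 \<Longrightarrow> T0 \<le> T n \<omega>" unfolding eventually_sequentially by blast
    then have "T0 \<le> T (max N1 n0) \<omega>" by simp
    then obtain c where c: "\<And>n. V (max N1 n0 + n) \<omega> \<le> c" using elim(1) by (meson max.cobounded2)
    have "B n \<omega> \<le> c * T n \<omega> powr \<rho>" if "n \<ge> max N1 n0" for n
    proof -
      have "V n \<omega> \<le> c" using c[of "n - max N1 n0"] that by simp
      then have "V n \<omega> * T n \<omega> powr \<rho> \<le> c * T n \<omega> powr \<rho>" by (rule mult_right_mono) simp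
      moreover have "V n \<omega> * T n \<omega> powr \<rho> = B n \<omega>"
        unfolding V_def using T_pos[OF elim(3), of n] by (simp add: powr_minus field_simps)
      ultimately show ?thesis by simp
    qed
    then show ?case by blast
  qed
  then show ?thesis using \<rho> by blast
qed

definition minor :: "nat \<Rightarrow> 'a \<Rightarrow> real" where "minor n \<omega> = B n \<omega> / S n \<omega>"

lemma sum_Z_minor: "(\<Sum>i\<in>{d0<..d}. Z n i \<omega>) = minor n \<omega>"
  unfolding minor_def Z_eq B_def by (simp add: sum_divide_distrib)

lemma minor_bounds: "\<omega> \<in> space M \<Longrightarrow> 0 \<le> minor n \<omega> \<and> minor n \<omega> \<le> 1"
  unfolding minor_def using B_nonneg[of \<omega> n] S_pos[of \<omega> n] T_pos[of \<omega> n] by (simp add: S_eq)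

lemma sum_Z_major: "\<omega> \<in> space M \<Longrightarrow> (\<Sum>i\<in>{1..d0}. Z n i \<omega>) = 1 - minor n \<omega>"
  using sum_Z[of \<omega> n] sum_colors[of "\<lambda>i. Z n i \<omega>"] sum_Z_minor[of n \<omega>] by simp

lemma mu_major_eq: "i \<in> {1..d0} \<Longrightarrow> \<mu> n i = \<mu> n 1"
  using urn_B unfolding urn_assms_B_def \<mu>_def by (metis le_add1 plus_1_eq_Suc)

lemma mu_tendsto: "i \<in> {1..d0} \<Longrightarrow> (\<lambda>n. \<mu> n i) \<longlonglongrightarrow> m"
proof -
  assume i: "i \<in> {1..d0}"
  have "(\<lambda>n. \<integral>\<omega>. A n 1 \<omega> \<partial>M) \<longlonglongrightarrow> m" using urn_B unfolding urn_assms_B_def by blast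
  then have "(\<lambda>n. \<mu> n 1) \<longlonglongrightarrow> m" unfolding \<mu>_def by (rule LIMSEQ_Suc)
  then show ?thesis using mu_major_eq[OF i] by simp
qed

lemma sigma_tendsto: "i \<in> {1..d0} \<Longrightarrow> (\<lambda>n. \<sigma> n i) \<longlonglongrightarrow> q i"
  using urn_B unfolding urn_assms_B_def \<sigma>_def by (intro LIMSEQ_Suc[of "\<lambda>n. \<integral>\<omega>. (A n i \<omega>)\<^sup>2 \<partial>M"]) blast

text \<open>The centred increments of \<open>S\<close>, divided by \<open>n + 1\<close>, are almost
  surely summable, so by Kronecker's lemma \<open>S n / n\<close> follows the averaged conditional
  means; these tend to \<open>m\<close> because the share \<open>minor\<close> vanishes. Linear
  growth of \<open>S\<close> then turns the power bound on \<open>B\<close> into one of order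
  \<open>n powr (\<rho> - 1)\<close> for \<open>minor\<close>, and \<open>\<rho> < 1 / 2\<close>
  leaves room for the factor \<open>sqrt n\<close>.\<close>

lemma urn_growth: "AE \<omega> in M. (\<lambda>n. sqrt (real (Suc n)) * minor n \<omega>) \<longlonglongrightarrow> 0 \<and> (\<lambda>n. S n \<omega> / real (Suc n)) \<longlonglongrightarrow> m"
proof -
  obtain \<rho> where \<rho>: "0 < \<rho>" "\<rho> < 1 / 2" and gr: "AE \<omega> in M. \<exists>c N. \<forall>n\<ge>N. B n \<omega> \<le> c * T n \<omega> powr \<rho>"
    using B_growth by blast
  define \<phi> where "\<phi> n (i::nat) \<omega> = - (\<Sum>k=1..d. Z n k \<omega> * \<mu> n k) / real (Suc n)" for n i \<omega>
  define \<psi> where "\<psi> n (i::nat) (\<omega>::'a) = 1 / real (Suc n)" for n i \<omega>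
  have mean: "0 \<le> (\<Sum>k=1..d. Z n k \<omega> * \<mu> n k) \<and> (\<Sum>k=1..d. Z n k \<omega> * \<mu> n k) \<le> \<beta>" if w: "\<omega> \<in> space M" for n \<omega>
    using Z_bounds[OF _ w, of _ n] mu_bounds[of _ n] by (auto intro!: sum_nonneg sum_Z_convex[OF w] simp del: One_nat_def)
  have md: "mart_diff (\<lambda>n \<omega>. \<Sum>i=1..d. X (Suc n) i \<omega> * (\<phi> n i \<omega> + \<psi> n i \<omega> * A (Suc n) i \<omega>)) (\<lambda>n. \<beta> / real (Suc n))"
  proof (rule urn_mart_diff(1)[where c="\<lambda>n. (\<beta> + 1) / real (Suc n)"])
    show "\<phi> n i \<in> borel_measurable (G n)" for n i
      unfolding \<phi>_def by (intro borel_measurable_divide borel_measurable_uminus borel_measurable_sum borel_measurable_times Z_measurable_G) auto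
    show "\<psi> n i \<in> borel_measurable (G n)" for n i unfolding \<psi>_def by simp
    show "\<bar>\<phi> n i \<omega>\<bar> \<le> (\<beta> + 1) / real (Suc n)" if "\<omega> \<in> space M" for n i \<omega>
    proof -
      have "\<bar>\<Sum>k=1..d. Z n k \<omega> * \<mu> n k\<bar> \<le> \<beta> + 1" using mean[OF that, of n] by linarith
      then show ?thesis unfolding \<phi>_def by (simp add: divide_right_mono del: of_nat_Suc One_nat_def)
    qed
    show "\<bar>\<psi> n i \<omega>\<bar> \<le> (\<beta> + 1) / real (Suc n)" for n i \<omega> unfolding \<psi>_def using beta_pos by (simp add: divide_right_mono)
    show "\<bar>\<phi> n i \<omega> + \<psi> n i \<omega> * A (Suc n) i \<omega>'\<bar> \<le> \<beta> / real (Suc n)" if "i \<in> {1..d}" "\<omega> \<in> space M" "\<omega>' \<in> space M" for n i \<omega> \<omega>'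
    proof -
      have "\<phi> n i \<omega> + \<psi> n i \<omega> * A (Suc n) i \<omega>' = (A (Suc n) i \<omega>' - (\<Sum>k=1..d. Z n k \<omega> * \<mu> n k)) / real (Suc n)"
        unfolding \<phi>_def \<psi>_def by (simp add: diff_divide_distrib)
      moreover have "\<bar>A (Suc n) i \<omega>' - (\<Sum>k=1..d. Z n k \<omega> * \<mu> n k)\<bar> \<le> \<beta>"
        using mean[OF that(2), of n] A_bounds[OF that(1,3), of n] by linarith
      ultimately show ?thesis by (simp add: divide_right_mono del: of_nat_Suc One_nat_def)
    qed
    show "(\<Sum>i=1..d. Z n i \<omega> * (\<phi> n i \<omega> + \<psi> n i \<omega> * \<mu> n i)) = 0" if w: "\<omega> \<in> space M" for n \<omega>
    proof -
      define c where "c = (\<Sum>k=1..d. Z n k \<omega> * \<mu> n k)"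
      have "(\<Sum>i=1..d. Z n i \<omega> * (\<phi> n i \<omega> + \<psi> n i \<omega> * \<mu> n i)) = (\<Sum>i=1..d. Z n i \<omega> * (- c / real (Suc n)) + Z n i \<omega> * \<mu> n i * (1 / real (Suc n)))"
        unfolding \<phi>_def \<psi>_def c_def by (rule sum.cong) (auto simp: algebra_simps simp del: One_nat_def)
      also have "\<dots> = (\<Sum>i=1..d. Z n i \<omega>) * (- c / real (Suc n)) + c * (1 / real (Suc n))"
        unfolding c_def sum_distrib_right sum.distrib ..
      also have "\<dots> = 0" unfolding sum_Z[OF w] by simp
      finally show ?thesis .
    qed
  qed
  have "summable (\<lambda>n. (\<beta> / real (Suc n))\<^sup>2)" by (rule summable_square_inverse)
  from mart_diff_summable[OF md this]
  show ?thesis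
    using gr T_tendsto AE_space
  proof eventually_elim
    case (elim \<omega>)
    note w = elim(4)
    define x where "x n = (\<Sum>i=1..d. X (Suc n) i \<omega> * A (Suc n) i \<omega>)" for n
    define c where "c n = (\<Sum>k=1..d. Z n k \<omega> * \<mu> n k)" for n
    have "(\<Sum>i=1..d. X (Suc n) i \<omega> * (\<phi> n i \<omega> + \<psi> n i \<omega> * A (Suc n) i \<omega>)) = (x n - c n) / real (Suc n)" for n
    proof (rule step_cases[OF w, of n])
      fix i assume i: "i \<in> {1..d}" "\<And>f. (\<Sum>j=1..d. X (Suc n) j \<omega> * f j) = (f i :: real)"
      show ?thesis unfolding x_def i(2) c_def \<phi>_def \<psi>_def by (simp add: diff_divide_distrib)
    qed
    with elim(1) have "summable (\<lambda>n. (x n - c n) / real (Suc n))" by simp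
    from kronecker_average[OF this] have xc: "(\<lambda>n. (\<Sum>k<n. x k - c k) / real n) \<longlonglongrightarrow> 0" .
    obtain C N where CN: "\<And>n. n \<ge> N \<Longrightarrow> B n \<omega> \<le> C * T n \<omega> powr \<rho>" using elim(2) by blast
    define D where "D = max C 0"
    have D: "0 \<le> D" "B n \<omega> \<le> D * T n \<omega> powr \<rho>" if "n \<ge> N" for n
      using order_trans[OF CN[OF that] mult_right_mono[of C D "T n \<omega> powr \<rho>"]] by (auto simp: D_def)
    have TS: "T n \<omega> \<le> S n \<omega>" "0 < T n \<omega>" for n using B_nonneg[OF w, of n] T_pos[OF w, of n] by (auto simp: S_eq)
    have minor_le: "minor n \<omega> \<le> D * S n \<omega> powr (\<rho> - 1)" if "n \<ge> N" for n
    proof -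
      have "B n \<omega> \<le> D * S n \<omega> powr \<rho>"
        using D[OF that] TS[of n] \<rho>(1) by (auto intro: order_trans[OF _ mult_left_mono[OF powr_mono2]])
      then have "minor n \<omega> \<le> D * S n \<omega> powr \<rho> / S n \<omega>"
        unfolding minor_def using S_pos[OF w, of n] by (intro divide_right_mono) auto
      also have "\<dots> = D * S n \<omega> powr (\<rho> - 1)" using S_pos[OF w, of n] by (simp add: powr_diff)
      finally show ?thesis .
    qed
    have Slim: "filterlim (\<lambda>n. S n \<omega>) at_top sequentially"
      by (rule filterlim_at_top_mono[OF elim(3)]) (use TS in simp)
    have minor0: "(\<lambda>n. minor n \<omega>) \<longlonglongrightarrow> 0"
    proof (rule Lim_null_comparison)
      show "\<forall>\<^sub>F n in sequentially. norm (minor n \<omega>) \<le> D * S n \<omega> powr (\<rho> - 1)"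
        by (rule eventually_sequentiallyI[of N]) (use minor_le minor_bounds[OF w] in auto)
      have "(\<lambda>n. D * S n \<omega> powr (\<rho> - 1)) \<longlonglongrightarrow> D * 0"
        by (intro tendsto_mult tendsto_const tendsto_neg_powr Slim) (use \<rho> in auto)
      then show "(\<lambda>n. D * S n \<omega> powr (\<rho> - 1)) \<longlonglongrightarrow> 0" by simp
    qed
    have clim: "c \<longlonglongrightarrow> m"
    proof -
      have ceq: "c n = \<mu> n 1 * (1 - minor n \<omega>) + (\<Sum>k\<in>{d0<..d}. Z n k \<omega> * \<mu> n k)" for n
      proof -
        have "(\<Sum>k\<in>{1..d0}. Z n k \<omega> * \<mu> n k) = (\<Sum>k\<in>{1..d0}. Z n k \<omega>) * \<mu> n 1"
          unfolding sum_distrib_right by (rule sum.cong[OF refl]) (rule arg_cong[OF mu_major_eq])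
        then show ?thesis unfolding c_def sum_colors sum_Z_major[OF w] by simp
      qed
      have "(\<lambda>n. \<Sum>k\<in>{d0<..d}. Z n k \<omega> * \<mu> n k) \<longlonglongrightarrow> 0"
      proof (rule Lim_null_comparison)
        have "norm (\<Sum>k\<in>{d0<..d}. Z n k \<omega> * \<mu> n k) \<le> minor n \<omega> * \<beta>" for n
          unfolding sum_Z_minor[symmetric] sum_distrib_right
          by (rule sum_norm_le) (use Z_bounds[OF _ w, of _ n] mu_bounds[of _ n] in \<open>auto simp: abs_mult intro!: mult_mono\<close>)
        then show "\<forall>\<^sub>F n in sequentially. norm (\<Sum>k\<in>{d0<..d}. Z n k \<omega> * \<mu> n k) \<le> minor n \<omega> * \<beta>" by simp
        show "(\<lambda>n. minor n \<omega> * \<beta>) \<longlonglongrightarrow> 0" using tendsto_mult_left_zero[OF minor0] .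
      qed
      moreover have "(\<lambda>n. \<mu> n 1) \<longlonglongrightarrow> m" using mu_tendsto[of 1] d0 by simp
      ultimately have "(\<lambda>n. \<mu> n 1 * (1 - minor n \<omega>) + (\<Sum>k\<in>{d0<..d}. Z n k \<omega> * \<mu> n k)) \<longlonglongrightarrow> m * (1 - 0) + 0"
        by (intro tendsto_intros minor0)
      then show ?thesis unfolding ceq by simp
    qed
    have Ssum: "S n \<omega> = S0 + (\<Sum>k<n. x k - c k) + (\<Sum>k<n. c k)" for n
    proof (induction n)
      case (Suc n)
      have "S (Suc n) \<omega> = S n \<omega> + x n" unfolding x_def by (rule S_Suc)
      then show ?case using Suc by simp
    qed (simp add: S0_def S_def urn_N_def)
    have "(\<lambda>n. (real n / real (Suc n)) * (S0 / real n + (\<Sum>k<n. x k - c k) / real n + (\<Sum>k<n. c k) / real n)) \<longlonglongrightarrow> 1 * (0 + 0 + m)"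
      by (intro tendsto_mult tendsto_add xc cesaro_average[OF clim] lim_const_over_n) real_asymp
    then have "(\<lambda>n. (real n / real (Suc n)) * (S0 / real n + (\<Sum>k<n. x k - c k) / real n + (\<Sum>k<n. c k) / real n)) \<longlonglongrightarrow> m"
      by (simp only: add_0_left mult_1_left)
    then have SL: "(\<lambda>n. S n \<omega> / real (Suc n)) \<longlonglongrightarrow> m"
    proof (rule Lim_transform_eventually)
      show "\<forall>\<^sub>F n in sequentially. (real n / real (Suc n)) * (S0 / real n + (\<Sum>k<n. x k - c k) / real n + (\<Sum>k<n. c k) / real n) = S n \<omega> / real (Suc n)"
      proof (rule eventually_sequentiallyI[of 1])
        fix n :: nat assume "n \<ge> 1"
        then have "real n \<noteq> 0" by simp
        then show "(real n / real (Suc n)) * (S0 / real n + (\<Sum>k<n. x k - c k) / real n + (\<Sum>k<n. c k) / real n) = S n \<omega> / real (Suc n)"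
          unfolding Ssum add_divide_distrib[symmetric] by simp
      qed
    qed
    have "(\<lambda>n. sqrt (real (Suc n)) * minor n \<omega>) \<longlonglongrightarrow> 0"
    proof (rule Lim_null_comparison)
      have "\<forall>\<^sub>F n in sequentially. m / 2 < S n \<omega> / real (Suc n)"
        by (rule order_tendstoD(1)[OF SL]) (use m_pos in simp)
      moreover have "\<forall>\<^sub>F n in sequentially. n \<ge> N" by (rule eventually_ge_at_top)
      ultimately show "\<forall>\<^sub>F n in sequentially. norm (sqrt (real (Suc n)) * minor n \<omega>) \<le> D * (m / 2) powr (\<rho> - 1) * real (Suc n) powr (\<rho> - 1 / 2)"
      proof eventually_elim
        case (elim n)
        have "m / 2 * real (Suc n) \<le> S n \<omega>" using elim(1) by (simp add: pos_less_divide_eq)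
        then have "S n \<omega> powr (\<rho> - 1) \<le> (m / 2 * real (Suc n)) powr (\<rho> - 1)"
          using \<rho> m_pos by (intro powr_mono2') auto
        then have "minor n \<omega> \<le> D * ((m / 2) powr (\<rho> - 1) * real (Suc n) powr (\<rho> - 1))"
        proof -
          have "(m / 2 * real (Suc n)) powr (\<rho> - 1) = (m / 2) powr (\<rho> - 1) * real (Suc n) powr (\<rho> - 1)"
            by (rule powr_mult)
          then show ?thesis
            using order_trans[OF minor_le[OF elim(2)] mult_left_mono[OF \<open>S n \<omega> powr (\<rho> - 1) \<le> _\<close> D(1)[OF elim(2)]]] by simp
        qed
        then have "sqrt (real (Suc n)) * minor n \<omega> \<le> real (Suc n) powr (1 / 2) * (D * ((m / 2) powr (\<rho> - 1) * real (Suc n) powr (\<rho> - 1)))"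
          unfolding powr_half_sqrt[OF of_nat_0_le_iff] by (rule mult_left_mono) simp
        also have "\<dots> = D * (m / 2) powr (\<rho> - 1) * (real (Suc n) powr (1 / 2) * real (Suc n) powr (\<rho> - 1))" by simp
        also have "real (Suc n) powr (1 / 2) * real (Suc n) powr (\<rho> - 1) = real (Suc n) powr (\<rho> - 1 / 2)"
          by (simp flip: powr_add)
        finally show ?case using minor_bounds[OF w, of n] by (simp add: abs_mult)
      qed
      have "(\<lambda>n. D * (m / 2) powr (\<rho> - 1) * real (Suc n) powr (\<rho> - 1 / 2)) \<longlonglongrightarrow> D * (m / 2) powr (\<rho> - 1) * 0"
        by (intro tendsto_mult tendsto_const tendsto_neg_powr filterlim_compose[OF filterlim_real_sequentially filterlim_Suc]) (use \<rho> in auto)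
      then show "(\<lambda>n. D * (m / 2) powr (\<rho> - 1) * real (Suc n) powr (\<rho> - 1 / 2)) \<longlonglongrightarrow> 0" by simp
    qed
    then show ?case using SL by blast
  qed
qed

section \<open>Martingale approximation of the proportions\<close>

text \<open>If color \<open>i\<close> is drawn and weight \<open>x\<close> is added,
  \<open>Z j\<close> moves by \<open>\<epsilon> j n i * x / (S n + x)\<close>.\<close>

definition \<epsilon> :: "nat \<Rightarrow> nat \<Rightarrow> nat \<Rightarrow> 'a \<Rightarrow> real" where
  "\<epsilon> j n i \<omega> = (if i = j then 1 else 0) - Z n j \<omega>"

text \<open>The conditional mean of \<open>\<epsilon> * A\<close>: the predictable part of the
  movement of \<open>Z j\<close> before division by the total weight.\<close>

definition drift :: "nat \<Rightarrow> nat \<Rightarrow> 'a \<Rightarrow> real" where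
  "drift j n \<omega> = (\<Sum>i=1..d. Z n i \<omega> * (\<epsilon> j n i \<omega> * \<mu> n i))"

text \<open>\<open>mart_diff\<close> asks for deterministic bounds, while \<open>S n\<close> grows
  linearly only almost surely. With this factor \<open>good n / S n\<close> is at most
  \<open>2 / m / (n + 1)\<close> at every sample point.\<close>

definition good :: "nat \<Rightarrow> 'a \<Rightarrow> real" where
  "good n \<omega> = (if m / 2 * real (Suc n) \<le> S n \<omega> then 1 else 0)"

text \<open>\<open>R j n\<close> and \<open>W j n\<close> are the martingale parts of the \<open>n\<close>-th increments of \<open>Z j\<close> and of
  \<open>sqrt n * C\<close>. Both are linear in \<open>X\<close> and \<open>X * A\<close> with coefficients known at time \<open>n\<close>; for this,
  \<open>S (Suc n)\<close> in the increment of \<open>Z j\<close> is replaced by \<open>S n\<close>, and the increments are cut off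
  on the event, eventually void, that \<open>S n\<close> is small.\<close>

definition \<phi>R :: "nat \<Rightarrow> nat \<Rightarrow> nat \<Rightarrow> 'a \<Rightarrow> real" where
  "\<phi>R j n i \<omega> = - (good n \<omega> / S n \<omega> * drift j n \<omega>)"

definition \<psi>R :: "nat \<Rightarrow> nat \<Rightarrow> nat \<Rightarrow> 'a \<Rightarrow> real" where
  "\<psi>R j n i \<omega> = good n \<omega> / S n \<omega> * \<epsilon> j n i \<omega>"

definition \<phi>W :: "nat \<Rightarrow> nat \<Rightarrow> nat \<Rightarrow> 'a \<Rightarrow> real" where
  "\<phi>W j n i \<omega> = good n \<omega> * \<epsilon> j n i \<omega> - real (Suc n) * \<phi>R j n i \<omega>"

definition \<psi>W :: "nat \<Rightarrow> nat \<Rightarrow> nat \<Rightarrow> 'a \<Rightarrow> real" where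
  "\<psi>W j n i \<omega> = - (real (Suc n) * \<psi>R j n i \<omega>)"

definition R :: "nat \<Rightarrow> nat \<Rightarrow> 'a \<Rightarrow> real" where
  "R j n \<omega> = (\<Sum>i=1..d. X (Suc n) i \<omega> * (\<phi>R j n i \<omega> + \<psi>R j n i \<omega> * A (Suc n) i \<omega>))"

definition vR :: "nat \<Rightarrow> nat \<Rightarrow> 'a \<Rightarrow> real" where
  "vR j n \<omega> = (\<Sum>i=1..d. Z n i \<omega> * ((\<phi>R j n i \<omega>)\<^sup>2 + 2 * \<phi>R j n i \<omega> * \<psi>R j n i \<omega> * \<mu> n i + (\<psi>R j n i \<omega>)\<^sup>2 * \<sigma> n i))"

definition W :: "nat \<Rightarrow> nat \<Rightarrow> 'a \<Rightarrow> real" where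
  "W j n \<omega> = (\<Sum>i=1..d. X (Suc n) i \<omega> * (\<phi>W j n i \<omega> + \<psi>W j n i \<omega> * A (Suc n) i \<omega>))"

definition vW :: "nat \<Rightarrow> nat \<Rightarrow> 'a \<Rightarrow> real" where
  "vW j n \<omega> = (\<Sum>i=1..d. Z n i \<omega> * ((\<phi>W j n i \<omega>)\<^sup>2 + 2 * \<phi>W j n i \<omega> * \<psi>W j n i \<omega> * \<mu> n i + (\<psi>W j n i \<omega>)\<^sup>2 * \<sigma> n i))"

text \<open>Where \<open>good\<close> is 1 this consists of the drift divided by \<open>S n\<close>
  and of the error made in writing \<open>S n\<close> for \<open>S (Suc n)\<close>. It must be of
  smaller order than \<open>n powr (- 3 / 2)\<close> for its tails to vanish on the scale
  \<open>1 / sqrt n\<close>.\<close>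

definition \<delta> :: "nat \<Rightarrow> nat \<Rightarrow> 'a \<Rightarrow> real" where
  "\<delta> j n \<omega> = Z (Suc n) j \<omega> - Z n j \<omega> - R j n \<omega>"

text \<open>\<open>2 * \<beta>\<close> bounds the centred quantity
  \<open>\<epsilon> * A - drift\<close>, and the factor \<open>2 / m\<close> stems from the cut-off
  \<open>good\<close>.\<close>

definition K :: real where "K = 4 * \<beta> / m"

lemma eps_bound: "j \<in> {1..d} \<Longrightarrow> \<omega> \<in> space M \<Longrightarrow> \<bar>\<epsilon> j n i \<omega>\<bar> \<le> 1"
  using Z_bounds[of j \<omega> n] unfolding \<epsilon>_def by auto

lemma eps_measurable_G: "j \<in> {1..d} \<Longrightarrow> \<epsilon> j n i \<in> borel_measurable (G n)"
  unfolding \<epsilon>_def[abs_def] using Z_measurable_G[of j n] by measurable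

lemma sum_Z_eps:
  assumes "j \<in> {1..d}" "\<omega> \<in> space M"
  shows "(\<Sum>i=1..d. Z n i \<omega> * \<epsilon> j n i \<omega>) = 0"
proof -
  have "(\<Sum>i=1..d. Z n i \<omega> * \<epsilon> j n i \<omega>) = (\<Sum>i=1..d. Z n i \<omega> * (if i = j then 1 else 0)) - (\<Sum>i=1..d. Z n i \<omega>) * Z n j \<omega>"
    unfolding \<epsilon>_def sum_distrib_right by (simp add: right_diff_distrib sum_subtractf)
  also have "(\<Sum>i=1..d. Z n i \<omega> * (if i = j then 1 else 0)) = (\<Sum>i=1..d. if i = j then Z n i \<omega> else 0)"
    by (rule sum.cong) auto
  also have "\<dots> = Z n j \<omega>" using assms(1) by (subst sum.delta) auto
  finally show ?thesis unfolding sum_Z[OF assms(2)] by simp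
qed

lemma drift_measurable_G: "j \<in> {1..d} \<Longrightarrow> drift j n \<in> borel_measurable (G n)"
  unfolding drift_def[abs_def]
  by (intro borel_measurable_sum borel_measurable_times eps_measurable_G Z_measurable_G borel_measurable_const)

lemma drift_bound:
  assumes "j \<in> {1..d}" "\<omega> \<in> space M"
  shows "\<bar>drift j n \<omega>\<bar> \<le> \<beta>"
proof -
  have "\<bar>drift j n \<omega>\<bar> \<le> (\<Sum>i=1..d. \<bar>Z n i \<omega> * (\<epsilon> j n i \<omega> * \<mu> n i)\<bar>)"
    unfolding drift_def by (rule sum_abs)
  also have "\<dots> = (\<Sum>i=1..d. Z n i \<omega> * \<bar>\<epsilon> j n i \<omega> * \<mu> n i\<bar>)"
    by (rule sum.cong) (use Z_bounds[OF _ assms(2)] in \<open>auto simp: abs_mult simp del: One_nat_def\<close>)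
  also have "\<dots> \<le> \<beta>"
  proof (rule sum_Z_convex[OF assms(2)])
    fix i assume i: "i \<in> {1..d}"
    have "\<bar>\<epsilon> j n i \<omega> * \<mu> n i\<bar> \<le> 1 * \<beta>"
      unfolding abs_mult using eps_bound[OF assms, of n i] mu_bounds[OF i, of n] by (intro mult_mono) auto
    then show "\<bar>\<epsilon> j n i \<omega> * \<mu> n i\<bar> \<le> \<beta>" by simp
  qed
  finally show ?thesis .
qed

text \<open>The means \<open>\<mu> n i\<close> agree for \<open>i \<le> d0\<close>, so only the minor colors contribute to the drift.\<close>

lemma drift_bound_minor:
  assumes j: "j \<in> {1..d0}" and w: "\<omega> \<in> space M"
  shows "\<bar>drift j n \<omega>\<bar> \<le> \<beta> * minor n \<omega>"
proof -
  have jd: "j \<in> {1..d}" using j d0 by auto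
  \<comment> \<open>The \<open>\<epsilon>\<close> average to 0 under \<open>Z\<close>, so recentring
    all means at the common value \<open>\<mu> n j\<close> changes nothing and removes the dominant
    colors.\<close>
  have "drift j n \<omega> = drift j n \<omega> - (\<Sum>i=1..d. Z n i \<omega> * \<epsilon> j n i \<omega>) * \<mu> n j"
    unfolding sum_Z_eps[OF jd w] by simp
  also have "\<dots> = (\<Sum>i=1..d. Z n i \<omega> * \<epsilon> j n i \<omega> * (\<mu> n i - \<mu> n j))"
    unfolding drift_def sum_distrib_right sum_subtractf[symmetric] by (rule sum.cong) (auto simp: algebra_simps)
  also have "\<dots> = (\<Sum>i\<in>{d0<..d}. Z n i \<omega> * \<epsilon> j n i \<omega> * (\<mu> n i - \<mu> n j))"
  proof -
    have "\<mu> n i = \<mu> n j" if "i \<in> {1..d0}" for i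
      using mu_major_eq[OF that] mu_major_eq[OF j] by metis
    then have "(\<Sum>i\<in>{1..d0}. Z n i \<omega> * \<epsilon> j n i \<omega> * (\<mu> n i - \<mu> n j)) = 0" by (intro sum.neutral) auto
    then show ?thesis unfolding sum_colors by simp
  qed
  finally have eq: "drift j n \<omega> = \<dots>" .
  have "norm (drift j n \<omega>) \<le> (\<Sum>i\<in>{d0<..d}. Z n i \<omega> * \<beta>)"
    unfolding eq
  proof (rule sum_norm_le)
    fix i assume "i \<in> {d0<..d}"
    then have i: "i \<in> {1..d}" using d0 by auto
    have "\<bar>\<mu> n i - \<mu> n j\<bar> \<le> \<beta>" using mu_bounds[OF i, of n] mu_bounds[OF jd, of n] by (auto simp: abs_le_iff)
    then have "\<bar>Z n i \<omega>\<bar> * \<bar>\<epsilon> j n i \<omega>\<bar> * \<bar>\<mu> n i - \<mu> n j\<bar> \<le> Z n i \<omega> * 1 * \<beta>"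
      using Z_bounds[OF i w, of n] eps_bound[OF jd w, of n i] by (intro mult_mono) auto
    then show "norm (Z n i \<omega> * \<epsilon> j n i \<omega> * (\<mu> n i - \<mu> n j)) \<le> Z n i \<omega> * \<beta>" by (simp add: abs_mult)
  qed
  also have "\<dots> = \<beta> * minor n \<omega>" unfolding sum_Z_minor[symmetric] sum_distrib_right[symmetric] by simp
  finally show ?thesis by simp
qed

lemma good_measurable_G: "good n \<in> borel_measurable (G n)"
  unfolding good_def[abs_def] using S_measurable_G[of n] by measurable

lemma good_S_bound:
  assumes "\<omega> \<in> space M"
  shows "0 \<le> good n \<omega> / S n \<omega> \<and> good n \<omega> / S n \<omega> \<le> 2 / m / real (Suc n)"
proof (cases "m / 2 * real (Suc n) \<le> S n \<omega>")
  case True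
  have "1 / S n \<omega> \<le> 1 / (m / 2 * real (Suc n))"
    using True m_pos by (intro divide_left_mono mult_pos_pos S_pos[OF assms]) auto
  then show ?thesis using True S_pos[OF assms, of n] by (simp add: good_def del: of_nat_Suc)
next
  case False
  then show ?thesis using m_pos by (simp add: good_def)
qed

lemma RW_measurable_G:
  assumes "j \<in> {1..d}"
  shows "\<phi>R j n i \<in> borel_measurable (G n)" "\<psi>R j n i \<in> borel_measurable (G n)"
    "\<phi>W j n i \<in> borel_measurable (G n)" "\<psi>W j n i \<in> borel_measurable (G n)"
proof -
  note [measurable] = good_measurable_G[of n] S_measurable_G[of n] drift_measurable_G[OF assms, of n] eps_measurable_G[OF assms, of n i]
  show 1: "\<phi>R j n i \<in> borel_measurable (G n)" unfolding \<phi>R_def[abs_def] by measurable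
  show 2: "\<psi>R j n i \<in> borel_measurable (G n)" unfolding \<psi>R_def[abs_def] by measurable
  note [measurable] = 1 2
  show "\<phi>W j n i \<in> borel_measurable (G n)" unfolding \<phi>W_def[abs_def] by measurable
  show "\<psi>W j n i \<in> borel_measurable (G n)" unfolding \<psi>W_def[abs_def] by measurable
qed

lemma R_bounds:
  assumes j: "j \<in> {1..d}" and w: "\<omega> \<in> space M"
  shows "\<bar>\<phi>R j n i \<omega>\<bar> \<le> (\<beta> + 1) * (2 / m / real (Suc n))" "\<bar>\<psi>R j n i \<omega>\<bar> \<le> (\<beta> + 1) * (2 / m / real (Suc n))"
    "i \<in> {1..d} \<Longrightarrow> \<omega>' \<in> space M \<Longrightarrow> \<bar>\<phi>R j n i \<omega> + \<psi>R j n i \<omega> * A (Suc n) i \<omega>'\<bar> \<le> K / real (Suc n)"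
proof -
  define h where "h = good n \<omega> / S n \<omega>"
  have h: "0 \<le> h" "h \<le> 2 / m / real (Suc n)" using good_S_bound[OF w, of n] unfolding h_def by auto
  have "\<bar>\<phi>R j n i \<omega>\<bar> = \<bar>drift j n \<omega>\<bar> * h" unfolding \<phi>R_def h_def[symmetric] using h by (simp add: abs_mult)
  also have "\<dots> \<le> (\<beta> + 1) * (2 / m / real (Suc n))"
    using drift_bound[OF j w, of n] h beta_pos by (intro mult_mono) auto
  finally show "\<bar>\<phi>R j n i \<omega>\<bar> \<le> (\<beta> + 1) * (2 / m / real (Suc n))" .
  have "\<bar>\<psi>R j n i \<omega>\<bar> = \<bar>\<epsilon> j n i \<omega>\<bar> * h" unfolding \<psi>R_def h_def[symmetric] using h by (simp add: abs_mult)
  also have "\<dots> \<le> (\<beta> + 1) * (2 / m / real (Suc n))"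
    using eps_bound[OF j w, of n i] h beta_pos by (intro mult_mono) auto
  finally show "\<bar>\<psi>R j n i \<omega>\<bar> \<le> (\<beta> + 1) * (2 / m / real (Suc n))" .
  show "\<bar>\<phi>R j n i \<omega> + \<psi>R j n i \<omega> * A (Suc n) i \<omega>'\<bar> \<le> K / real (Suc n)" if i: "i \<in> {1..d}" and w': "\<omega>' \<in> space M"
  proof -
    have "\<bar>\<epsilon> j n i \<omega> * A (Suc n) i \<omega>'\<bar> \<le> 1 * \<beta>"
      unfolding abs_mult using eps_bound[OF j w, of n i] A_bounds[OF i w', of n] by (intro mult_mono) auto
    then have "\<bar>\<epsilon> j n i \<omega> * A (Suc n) i \<omega>' - drift j n \<omega>\<bar> \<le> 2 * \<beta>" using drift_bound[OF j w, of n] by linarith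
    then have "\<bar>\<epsilon> j n i \<omega> * A (Suc n) i \<omega>' - drift j n \<omega>\<bar> * h \<le> 2 * \<beta> * (2 / m / real (Suc n))"
      using h beta_pos by (intro mult_mono) auto
    moreover have "\<phi>R j n i \<omega> + \<psi>R j n i \<omega> * A (Suc n) i \<omega>' = (\<epsilon> j n i \<omega> * A (Suc n) i \<omega>' - drift j n \<omega>) * h"
      unfolding \<phi>R_def \<psi>R_def h_def by (simp add: algebra_simps)
    ultimately show ?thesis using h(1) unfolding K_def by (simp add: abs_mult del: of_nat_Suc)
  qed
qed

lemma W_bounds:
  assumes j: "j \<in> {1..d}" and w: "\<omega> \<in> space M"
  shows "\<bar>\<phi>W j n i \<omega>\<bar> \<le> 1 + (\<beta> + 1) * (2 / m)" "\<bar>\<psi>W j n i \<omega>\<bar> \<le> 1 + (\<beta> + 1) * (2 / m)"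
    "i \<in> {1..d} \<Longrightarrow> \<omega>' \<in> space M \<Longrightarrow> \<bar>\<phi>W j n i \<omega> + \<psi>W j n i \<omega> * A (Suc n) i \<omega>'\<bar> \<le> 1 + K"
proof -
  have g: "\<bar>good n \<omega> * \<epsilon> j n i \<omega>\<bar> \<le> 1" using eps_bound[OF j w, of n i] by (simp add: good_def)
  have sc: "\<bar>real (Suc n) * x\<bar> \<le> c" if "\<bar>x\<bar> \<le> c / real (Suc n)" for x c
  proof -
    have "real (Suc n) * \<bar>x\<bar> \<le> real (Suc n) * (c / real (Suc n))" using that by (intro mult_left_mono) auto
    then show ?thesis by (simp add: abs_mult del: of_nat_Suc)
  qed
  have "\<bar>real (Suc n) * \<phi>R j n i \<omega>\<bar> \<le> (\<beta> + 1) * (2 / m)"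
    by (rule sc) (use R_bounds(1)[OF j w, of n i] in simp)
  then show "\<bar>\<phi>W j n i \<omega>\<bar> \<le> 1 + (\<beta> + 1) * (2 / m)" using g unfolding \<phi>W_def by linarith
  have "\<bar>real (Suc n) * \<psi>R j n i \<omega>\<bar> \<le> (\<beta> + 1) * (2 / m)"
    by (rule sc) (use R_bounds(2)[OF j w, of n i] in simp)
  then show "\<bar>\<psi>W j n i \<omega>\<bar> \<le> 1 + (\<beta> + 1) * (2 / m)" unfolding \<psi>W_def by linarith
  show "\<bar>\<phi>W j n i \<omega> + \<psi>W j n i \<omega> * A (Suc n) i \<omega>'\<bar> \<le> 1 + K" if i: "i \<in> {1..d}" and w': "\<omega>' \<in> space M"
  proof -
    have "\<bar>real (Suc n) * (\<phi>R j n i \<omega> + \<psi>R j n i \<omega> * A (Suc n) i \<omega>')\<bar> \<le> K"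
      by (rule sc) (rule R_bounds(3)[OF j w i w'])
    moreover have "\<phi>W j n i \<omega> + \<psi>W j n i \<omega> * A (Suc n) i \<omega>' = good n \<omega> * \<epsilon> j n i \<omega> - real (Suc n) * (\<phi>R j n i \<omega> + \<psi>R j n i \<omega> * A (Suc n) i \<omega>')"
      unfolding \<phi>W_def \<psi>W_def by (simp add: algebra_simps)
    ultimately show ?thesis using g by linarith
  qed
qed

lemma R_zero:
  assumes j: "j \<in> {1..d}" and w: "\<omega> \<in> space M"
  shows "(\<Sum>i=1..d. Z n i \<omega> * (\<phi>R j n i \<omega> + \<psi>R j n i \<omega> * \<mu> n i)) = 0"
proof -
  define h where "h = good n \<omega> / S n \<omega>"
  have "(\<Sum>i=1..d. Z n i \<omega> * (\<phi>R j n i \<omega> + \<psi>R j n i \<omega> * \<mu> n i)) = (\<Sum>i=1..d. Z n i \<omega> * (- (h * drift j n \<omega>)) + Z n i \<omega> * (\<epsilon> j n i \<omega> * \<mu> n i) * h)"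
    unfolding \<phi>R_def \<psi>R_def h_def by (rule sum.cong) (auto simp: algebra_simps)
  also have "\<dots> = (\<Sum>i=1..d. Z n i \<omega>) * (- (h * drift j n \<omega>)) + drift j n \<omega> * h"
    unfolding drift_def sum_distrib_right sum.distrib ..
  finally show ?thesis unfolding sum_Z[OF w] by simp
qed

lemma W_zero:
  assumes j: "j \<in> {1..d}" and w: "\<omega> \<in> space M"
  shows "(\<Sum>i=1..d. Z n i \<omega> * (\<phi>W j n i \<omega> + \<psi>W j n i \<omega> * \<mu> n i)) = 0"
proof -
  have "(\<Sum>i=1..d. Z n i \<omega> * (\<phi>W j n i \<omega> + \<psi>W j n i \<omega> * \<mu> n i)) =
    (\<Sum>i=1..d. Z n i \<omega> * \<epsilon> j n i \<omega> * good n \<omega> - Z n i \<omega> * (\<phi>R j n i \<omega> + \<psi>R j n i \<omega> * \<mu> n i) * real (Suc n))"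
    unfolding \<phi>W_def \<psi>W_def by (rule sum.cong) (auto simp: algebra_simps)
  also have "\<dots> = (\<Sum>i=1..d. Z n i \<omega> * \<epsilon> j n i \<omega>) * good n \<omega> - (\<Sum>i=1..d. Z n i \<omega> * (\<phi>R j n i \<omega> + \<psi>R j n i \<omega> * \<mu> n i)) * real (Suc n)"
    unfolding sum_distrib_right sum_subtractf ..
  finally show ?thesis unfolding R_zero[OF assms] sum_Z_eps[OF assms] by simp
qed

lemma
  assumes j: "j \<in> {1..d}"
  shows R_mart_diff: "mart_diff (R j) (\<lambda>n. K / real (Suc n))" and R_cond_var: "cond_var (R j) (vR j)"
    and vR_bounds: "\<omega> \<in> space M \<Longrightarrow> 0 \<le> vR j n \<omega>" "\<omega> \<in> space M \<Longrightarrow> vR j n \<omega> \<le> (K / real (Suc n))\<^sup>2"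
  using urn_mart_diff[OF RW_measurable_G(1,2)[OF j] R_bounds(1,2)[OF j] R_bounds(3)[OF j] R_zero[OF j]]
  unfolding R_def[abs_def] vR_def[abs_def] by blast+

lemma
  assumes j: "j \<in> {1..d}"
  shows W_mart_diff: "mart_diff (W j) (\<lambda>n. 1 + K)" and W_cond_var: "cond_var (W j) (vW j)"
    and vW_bounds: "\<omega> \<in> space M \<Longrightarrow> 0 \<le> vW j n \<omega>" "\<omega> \<in> space M \<Longrightarrow> vW j n \<omega> \<le> (1 + K)\<^sup>2"
  using urn_mart_diff[OF RW_measurable_G(3,4)[OF j] W_bounds(1,2)[OF j] W_bounds(3)[OF j] W_zero[OF j]]
  unfolding W_def[abs_def] vW_def[abs_def] by blast+

lemma X_step:
  assumes w: "\<omega> \<in> space M" and j: "j \<in> {1..d}"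
    and i: "i \<in> {1..d}" "\<And>f. (\<Sum>k=1..d. X (Suc n) k \<omega> * f k) = (f i :: real)"
  shows "X (Suc n) j \<omega> = (if i = j then 1 else 0)"
proof -
  have "X (Suc n) j \<omega> = (\<Sum>k=1..d. if k = j then X (Suc n) k \<omega> else 0)" using j by (subst sum.delta) auto
  also have "\<dots> = (\<Sum>k=1..d. X (Suc n) k \<omega> * (if k = j then 1 else 0))" by (rule sum.cong) auto
  also have "\<dots> = (if i = j then 1 else 0)" by (rule i(2))
  finally show ?thesis .
qed

text \<open>With \<open>s = S n\<close> and added weight \<open>x\<close>, the increment
  \<open>e * x / (s + x)\<close> equals \<open>e * x / s\<close> minus
  \<open>e * x * (x / (s * (s + x)))\<close>. The first part minus \<open>drift / s\<close> is
  \<open>R\<close>, so the drift, carried by the minor colors, and this quadratic error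
  remain.\<close>

lemma delta_bound:
  assumes w: "\<omega> \<in> space M" and j: "j \<in> {1..d0}" and g: "m / 2 * real (Suc n) \<le> S n \<omega>"
  shows "\<bar>\<delta> j n \<omega>\<bar> \<le> \<beta> * minor n \<omega> / S n \<omega> + \<beta>\<^sup>2 / (S n \<omega>)\<^sup>2"
proof (rule step_cases[OF w, of n])
  fix i assume i: "i \<in> {1..d}" "\<And>f. (\<Sum>k=1..d. X (Suc n) k \<omega> * f k) = (f i :: real)" "S (Suc n) \<omega> = S n \<omega> + A (Suc n) i \<omega>"
  have jd: "j \<in> {1..d}" using j d0 by auto
  define s where "s = S n \<omega>"
  define x where "x = A (Suc n) i \<omega>"
  define e where "e = \<epsilon> j n i \<omega>"
  have s: "s > 0" unfolding s_def by (rule S_pos[OF w])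
  have x: "0 \<le> x" "x \<le> \<beta>" using A_bounds[OF i(1) w, of n] unfolding x_def by auto
  have e: "\<bar>e\<bar> \<le> 1" using eps_bound[OF jd w] unfolding e_def by simp
  have "N (Suc n) j \<omega> = N n j \<omega> + (if i = j then 1 else 0) * x"
    unfolding N_Suc X_step[OF w jd i(1,2)] x_def by auto
  then have "Z (Suc n) j \<omega> - Z n j \<omega> = (N n j \<omega> + (if i = j then 1 else 0) * x) / (s + x) - N n j \<omega> / s"
    unfolding Z_eq i(3) s_def x_def by simp
  also have "\<dots> = e * x / (s + x)"
    unfolding e_def \<epsilon>_def Z_eq s_def[symmetric] using s x by (simp add: field_simps add_pos_nonneg)
  finally have Zd: "Z (Suc n) j \<omega> - Z n j \<omega> = e * x / (s + x)" .
  have "R j n \<omega> = (e * x - drift j n \<omega>) / s"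
    unfolding R_def i(2) \<phi>R_def \<psi>R_def using g by (simp add: good_def e_def x_def s_def diff_divide_distrib)
  moreover have "e * x / (s + x) = e * x / s - e * x * (x / (s * (s + x)))"
  proof -
    have "s \<noteq> 0" "s + x \<noteq> 0" using s x by auto
    then have "1 / s - 1 / (s + x) = x / (s * (s + x))" by (simp add: diff_frac_eq)
    then have "e * x * (x / (s * (s + x))) = e * x * (1 / s - 1 / (s + x))" by (simp only:)
    then show ?thesis by (simp add: right_diff_distrib)
  qed
  ultimately have "\<delta> j n \<omega> = drift j n \<omega> / s - e * x * (x / (s * (s + x)))"
    unfolding \<delta>_def Zd by (simp add: diff_divide_distrib)
  moreover have "\<bar>drift j n \<omega> / s\<bar> \<le> \<beta> * minor n \<omega> / s"
    using drift_bound_minor[OF j w, of n] s by (simp add: divide_right_mono)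
  moreover have "\<bar>e * x * (x / (s * (s + x)))\<bar> \<le> \<beta>\<^sup>2 / s\<^sup>2"
  proof -
    have "\<bar>e * x * (x / (s * (s + x)))\<bar> = \<bar>e\<bar> * x * (x / (s * (s + x)))" using s x by (simp add: abs_mult)
    also have "\<dots> \<le> 1 * \<beta> * (\<beta> / (s * s))"
      using e x s by (intro mult_mono frac_le) auto
    finally show ?thesis by (simp add: power2_eq_square)
  qed
  ultimately show ?thesis unfolding s_def by linarith
qed

text \<open>With \<open>1 / S n\<close> of order \<open>1 / n\<close>, the factor
  \<open>n powr (3 / 2)\<close> turns the drift part of the bound into
  \<open>sqrt n * minor n\<close> and the quadratic part into \<open>1 / sqrt n\<close>. The first
  of these is where the exponent below 1/2 is spent.\<close>

lemma delta_tendsto: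
  assumes w: "\<omega> \<in> space M" and j: "j \<in> {1..d0}"
    and lim: "(\<lambda>n. sqrt (real (Suc n)) * minor n \<omega>) \<longlonglongrightarrow> 0" "\<forall>\<^sub>F n in sequentially. m / 2 * real (Suc n) \<le> S n \<omega>"
  shows "(\<lambda>n. real (Suc n) * sqrt (real (Suc n)) * \<delta> j n \<omega>) \<longlonglongrightarrow> 0"
proof (rule Lim_null_comparison)
  show "\<forall>\<^sub>F n in sequentially. norm (real (Suc n) * sqrt (real (Suc n)) * \<delta> j n \<omega>) \<le>
    2 / m * \<beta> * (sqrt (real (Suc n)) * minor n \<omega>) + (2 / m * \<beta>)\<^sup>2 * (1 / sqrt (real (Suc n)))"
    using lim(2)
  proof eventually_elim
    case (elim n)
    define k where "k = real (Suc n)"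
    have k: "k > 0" unfolding k_def by simp
    have le: "1 / S n \<omega> \<le> 2 / m / k"
      using good_S_bound[OF w, of n] elim unfolding k_def by (simp add: good_def del: of_nat_Suc)
    have R: "0 \<le> minor n \<omega>" using minor_bounds[OF w] by blast
    have "\<bar>\<delta> j n \<omega>\<bar> \<le> \<beta> * minor n \<omega> * (1 / S n \<omega>) + \<beta>\<^sup>2 * (1 / S n \<omega>)\<^sup>2"
      using delta_bound[OF w j elim] by (simp add: power_divide)
    also have "\<dots> \<le> \<beta> * minor n \<omega> * (2 / m / k) + \<beta>\<^sup>2 * (2 / m / k)\<^sup>2"
      using le R beta_pos S_pos[OF w, of n] by (intro add_mono mult_left_mono power_mono) auto
    finally have "k * sqrt k * \<bar>\<delta> j n \<omega>\<bar> \<le> k * sqrt k * (\<beta> * minor n \<omega> * (2 / m / k) + \<beta>\<^sup>2 * (2 / m / k)\<^sup>2)"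
      using k by (intro mult_left_mono) auto
    also have "\<dots> = 2 / m * \<beta> * (sqrt k * minor n \<omega>) + (2 / m * \<beta>)\<^sup>2 * (sqrt k / k)"
      using k m_pos by (simp add: field_simps power2_eq_square)
    also have "sqrt k / k = 1 / sqrt k" using k by (simp add: field_simps)
    finally show ?case using k unfolding k_def[symmetric] by (simp add: abs_mult)
  qed
  have "(\<lambda>n. 2 / m * \<beta> * (sqrt (real (Suc n)) * minor n \<omega>) + (2 / m * \<beta>)\<^sup>2 * (1 / sqrt (real (Suc n)))) \<longlonglongrightarrow> 2 / m * \<beta> * 0 + (2 / m * \<beta>)\<^sup>2 * 0"
    by (intro tendsto_add tendsto_mult tendsto_const lim(1)) real_asymp
  then show "(\<lambda>n. 2 / m * \<beta> * (sqrt (real (Suc n)) * minor n \<omega>) + (2 / m * \<beta>)\<^sup>2 * (1 / sqrt (real (Suc n)))) \<longlonglongrightarrow> 0" by simp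
qed

text \<open>Collects the almost sure facts on one event. Along such a path the increments
  \<open>R + \<delta>\<close> of \<open>Z j\<close> are summable, so that \<open>urn_Zlim\<close>,
  which is defined through \<open>lim\<close>, is a genuine limit.\<close>

lemma AE_path:
  "AE \<omega> in M. \<omega> \<in> space M \<and> (\<lambda>n. minor n \<omega>) \<longlonglongrightarrow> 0 \<and> (\<lambda>n. S n \<omega> / real (Suc n)) \<longlonglongrightarrow> m
      \<and> (\<forall>\<^sub>F n in sequentially. m / 2 * real (Suc n) \<le> S n \<omega>)
      \<and> (\<forall>j\<in>{1..d0}. (\<lambda>n. Z n j \<omega>) \<longlonglongrightarrow> Zl j \<omega> \<and> summable (\<lambda>n. R j n \<omega>) \<and>
          (\<lambda>n. real (Suc n) * sqrt (real (Suc n)) * \<delta> j n \<omega>) \<longlonglongrightarrow> 0)"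
proof -
  have "AE \<omega> in M. \<forall>j\<in>{1..d0}. summable (\<lambda>n. R j n \<omega>)"
    by (rule AE_finite_allI)
      (use d0 in \<open>auto intro!: mart_diff_summable[OF R_mart_diff summable_square_inverse] simp del: One_nat_def\<close>)
  then show ?thesis
    using urn_growth AE_space
  proof eventually_elim
    case (elim \<omega>)
    note w = elim(3)
    have r: "(\<lambda>n. sqrt (real (Suc n)) * minor n \<omega>) \<longlonglongrightarrow> 0" and SL: "(\<lambda>n. S n \<omega> / real (Suc n)) \<longlonglongrightarrow> m" using elim(2) by auto
    have "\<forall>\<^sub>F n in sequentially. m / 2 < S n \<omega> / real (Suc n)"
      by (rule order_tendstoD(1)[OF SL]) (use m_pos in simp)
    then have ev: "\<forall>\<^sub>F n in sequentially. m / 2 * real (Suc n) \<le> S n \<omega>"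
      by eventually_elim (simp add: pos_less_divide_eq del: of_nat_Suc)
    have minor: "(\<lambda>n. minor n \<omega>) \<longlonglongrightarrow> 0"
    proof (rule Lim_null_comparison[OF _ r])
      have "norm (minor n \<omega>) \<le> sqrt (real (Suc n)) * minor n \<omega>" for n
      proof -
        have "1 * minor n \<omega> \<le> sqrt (real (Suc n)) * minor n \<omega>" using minor_bounds[OF w, of n] by (intro mult_right_mono) auto
        then show ?thesis using minor_bounds[OF w, of n] by simp
      qed
      then show "\<forall>\<^sub>F n in sequentially. norm (minor n \<omega>) \<le> sqrt (real (Suc n)) * minor n \<omega>" by simp
    qed
    have "(\<lambda>n. Z n j \<omega>) \<longlonglongrightarrow> Zl j \<omega> \<and> summable (\<lambda>n. R j n \<omega>) \<and> (\<lambda>n. real (Suc n) * sqrt (real (Suc n)) * \<delta> j n \<omega>) \<longlonglongrightarrow> 0"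
      if j: "j \<in> {1..d0}" for j
    proof -
      have sR: "summable (\<lambda>n. R j n \<omega>)" using elim(1) j by blast
      note dl = delta_tendsto[OF w j r ev]
      have s\<delta>: "summable (\<lambda>n. \<delta> j n \<omega>)" by (rule sqrt_tail(1)[OF dl])
      have Zn: "Z n j \<omega> = Z 0 j \<omega> + (\<Sum>k<n. R j k \<omega> + \<delta> j k \<omega>)" for n
        by (induction n) (auto simp: \<delta>_def)
      have "(\<lambda>n. Z 0 j \<omega> + (\<Sum>k<n. R j k \<omega> + \<delta> j k \<omega>)) \<longlonglongrightarrow> Z 0 j \<omega> + (\<Sum>k. R j k \<omega> + \<delta> j k \<omega>)"
        by (intro tendsto_intros summable_LIMSEQ summable_add sR s\<delta>)
      then have "(\<lambda>n. Z n j \<omega>) \<longlonglongrightarrow> Z 0 j \<omega> + (\<Sum>k. R j k \<omega> + \<delta> j k \<omega>)" by (simp only: Zn[symmetric])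
      then have "(\<lambda>n. Z n j \<omega>) \<longlonglongrightarrow> Zl j \<omega>" unfolding urn_Zlim_def using limI by metis
      then show ?thesis using sR dl by blast
    qed
    then show ?case using w minor SL ev by blast
  qed
qed

text \<open>Telescoping gives \<open>Zl - Z n\<close> as the tail of \<open>R + \<delta>\<close>,
  whence the sign; \<open>sqrt_tail\<close> disposes of the part from
  \<open>\<delta>\<close>.\<close>

lemma D_approx:
  assumes j: "j \<in> {1..d0}"
  shows "AE \<omega> in M. (\<lambda>n. urn_D d a X A n j \<omega> + sqrt (real n) * (\<Sum>k. R j (k + n) \<omega>)) \<longlonglongrightarrow> 0"
  using AE_path
proof eventually_elim
  case (elim \<omega>)
  have Zl: "(\<lambda>n. Z n j \<omega>) \<longlonglongrightarrow> Zl j \<omega>" and sR: "summable (\<lambda>n. R j n \<omega>)"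
    and dl: "(\<lambda>n. real (Suc n) * sqrt (real (Suc n)) * \<delta> j n \<omega>) \<longlonglongrightarrow> 0"
    using elim j by auto
  have s\<delta>: "summable (\<lambda>n. \<delta> j n \<omega>)" by (rule sqrt_tail(1)[OF dl])
  have "urn_D d a X A n j \<omega> + sqrt (real n) * (\<Sum>k. R j (k + n) \<omega>) = - (sqrt (real n) * (\<Sum>k. \<delta> j (k + n) \<omega>))" for n
  proof -
    have "(\<lambda>k. Z (k + n) j \<omega>) \<longlonglongrightarrow> Zl j \<omega>" by (rule LIMSEQ_ignore_initial_segment[OF Zl])
    from telescope_sums[OF this]
    have "(\<lambda>k. R j (k + n) \<omega> + \<delta> j (k + n) \<omega>) sums (Zl j \<omega> - Z n j \<omega>)"
      unfolding \<delta>_def by simp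
    moreover have "summable (\<lambda>k. R j (k + n) \<omega>)" "summable (\<lambda>k. \<delta> j (k + n) \<omega>)"
      using summable_iff_shift[of "\<lambda>k. R j k \<omega>" n] summable_iff_shift[of "\<lambda>k. \<delta> j k \<omega>" n] sR s\<delta> by simp_all
    ultimately have "Zl j \<omega> - Z n j \<omega> = (\<Sum>k. R j (k + n) \<omega>) + (\<Sum>k. \<delta> j (k + n) \<omega>)"
      by (simp add: sums_iff suminf_add)
    then have "Z n j \<omega> - Zl j \<omega> = - ((\<Sum>k. R j (k + n) \<omega>) + (\<Sum>k. \<delta> j (k + n) \<omega>))" by simp
    then show ?thesis unfolding urn_D_def by (simp only:) (simp add: algebra_simps)
  qed
  then show ?case using tendsto_minus[OF sqrt_tail(2)[OF dl]] by simp
qed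

text \<open>By summation by parts, \<open>n\<close> times the difference of empirical mean and
  \<open>Z n\<close> is the sum over \<open>k < n\<close> of
  \<open>X (k + 1) - Z k - (k + 1) * (Z (k + 1) - Z k)\<close>. Writing \<open>R\<close> for the
  increment of \<open>Z\<close> and inserting the cut-off gives \<open>W\<close>, with the error
  \<open>x\<close>.\<close>

lemma C_approx:
  assumes j: "j \<in> {1..d0}"
  shows "AE \<omega> in M. (\<lambda>n. urn_C d a X A n j \<omega> - (\<Sum>k<n. W j k \<omega>) / sqrt (real n)) \<longlonglongrightarrow> 0"
  using AE_path
proof eventually_elim
  case (elim \<omega>)
  have w: "\<omega> \<in> space M" and ev: "\<forall>\<^sub>F n in sequentially. m / 2 * real (Suc n) \<le> S n \<omega>"
    and dl: "(\<lambda>n. real (Suc n) * sqrt (real (Suc n)) * \<delta> j n \<omega>) \<longlonglongrightarrow> 0"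
    using elim j by auto
  have jd: "j \<in> {1..d}" using j d0 by auto
  define x where "x k = (1 - good k \<omega>) * (X (Suc k) j \<omega> - Z k j \<omega>) - real (Suc k) * \<delta> j k \<omega>" for k
  have Wk: "W j k \<omega> = good k \<omega> * (X (Suc k) j \<omega> - Z k j \<omega>) - real (Suc k) * R j k \<omega>" for k
  proof (rule step_cases[OF w, of k])
    fix i assume i: "i \<in> {1..d}" "\<And>f. (\<Sum>l=1..d. X (Suc k) l \<omega> * f l) = (f i :: real)"
    show ?thesis
      unfolding W_def R_def i(2) X_step[OF w jd i] \<phi>W_def \<psi>W_def by (simp add: \<epsilon>_def algebra_simps)
  qed
  have sm: "(\<Sum>k<n. X (Suc k) j \<omega>) - real n * Z n j \<omega> = (\<Sum>k<n. W j k \<omega>) + (\<Sum>k<n. x k)" for n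
    by (induction n) (auto simp: Wk x_def \<delta>_def algebra_simps)
  have "urn_C d a X A n j \<omega> - (\<Sum>k<n. W j k \<omega>) / sqrt (real n) = (\<Sum>k<n. x k) / sqrt (real n)" for n
  proof (cases "n = 0")
    case False
    have "(\<Sum>k=1..n. X k j \<omega>) = (\<Sum>k<n. X (Suc k) j \<omega>)"
      by (induction n) auto
    then have "urn_C d a X A n j \<omega> = sqrt (real n) * (((\<Sum>k<n. X (Suc k) j \<omega>) - real n * Z n j \<omega>) / real n)"
      unfolding urn_C_def urn_mean_def using False by (simp add: diff_divide_distrib)
    also have "\<dots> = ((\<Sum>k<n. X (Suc k) j \<omega>) - real n * Z n j \<omega>) / sqrt (real n)"
    proof -
      have "sqrt (real n) / real n = 1 / sqrt (real n)" using False by (simp add: field_simps)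
      then have "sqrt (real n) * (y / real n) = y / sqrt (real n)" for y
        by (metis mult.commute mult_1_right times_divide_eq_left times_divide_eq_right)
      then show ?thesis .
    qed
    finally show ?thesis unfolding sm by (simp add: add_divide_distrib)
  qed (simp add: urn_C_def)
  moreover have "(\<lambda>n. (\<Sum>k<n. x k) / sqrt (real n)) \<longlonglongrightarrow> 0"
  proof (rule sqrt_average)
    \<comment> \<open>The cut-off part of \<open>x\<close> vanishes for large \<open>k\<close>, so
      only the part from \<open>\<delta>\<close> has to be estimated.\<close>
    have "(\<lambda>k. - (real (Suc k) * sqrt (real (Suc k)) * \<delta> j k \<omega>)) \<longlonglongrightarrow> 0" using tendsto_minus[OF dl] by simp
    then show "(\<lambda>k. sqrt (real (Suc k)) * x k) \<longlonglongrightarrow> 0"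
    proof (rule Lim_transform_eventually)
      show "\<forall>\<^sub>F k in sequentially. - (real (Suc k) * sqrt (real (Suc k)) * \<delta> j k \<omega>) = sqrt (real (Suc k)) * x k"
        using ev by eventually_elim (simp add: x_def good_def)
    qed
  qed
  ultimately show ?case by simp
qed

section \<open>Limits of the conditional variances\<close>

text \<open>The dominant colors converge term by term. For the minor colors no limits of the moments
  are assumed, but the expression is a second moment and so at most \<open>C^2\<close>, while their
  total share \<open>minor\<close> tends to 0.\<close>

lemma quadratic_limit:
  fixes x y :: "nat \<Rightarrow> nat \<Rightarrow> real"
  assumes w: "\<omega> \<in> space M" and minor: "(\<lambda>n. minor n \<omega>) \<longlonglongrightarrow> 0"
    and Z: "\<And>i. i \<in> {1..d0} \<Longrightarrow> (\<lambda>n. Z n i \<omega>) \<longlonglongrightarrow> Zl i \<omega>"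
    and xy: "\<And>i. i \<in> {1..d0} \<Longrightarrow> (\<lambda>n. x n i) \<longlonglongrightarrow> x' i" "\<And>i. i \<in> {1..d0} \<Longrightarrow> (\<lambda>n. y n i) \<longlonglongrightarrow> y' i"
    and b: "\<And>n i \<omega>'. i \<in> {1..d} \<Longrightarrow> \<omega>' \<in> space M \<Longrightarrow> \<bar>x n i + y n i * A (Suc n) i \<omega>'\<bar> \<le> C"
  shows "(\<lambda>n. \<Sum>i=1..d. Z n i \<omega> * ((x n i)\<^sup>2 + 2 * x n i * y n i * \<mu> n i + (y n i)\<^sup>2 * \<sigma> n i)) \<longlonglongrightarrow>
    (\<Sum>i\<in>{1..d0}. Zl i \<omega> * ((x' i)\<^sup>2 + 2 * x' i * y' i * m + (y' i)\<^sup>2 * q i))"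
proof -
  let ?f = "\<lambda>n i. (x n i)\<^sup>2 + 2 * x n i * y n i * \<mu> n i + (y n i)\<^sup>2 * \<sigma> n i"
  have fb: "0 \<le> ?f n i \<and> ?f n i \<le> C\<^sup>2" if "i \<in> {1..d}" for n i
    by (rule second_moment_bounds[OF that b[OF that]])
  have "(\<lambda>n. \<Sum>i\<in>{1..d0}. Z n i \<omega> * ?f n i) \<longlonglongrightarrow> (\<Sum>i\<in>{1..d0}. Zl i \<omega> * ((x' i)\<^sup>2 + 2 * x' i * y' i * m + (y' i)\<^sup>2 * q i))"
    by (intro tendsto_intros Z xy mu_tendsto sigma_tendsto)
  moreover have "(\<lambda>n. \<Sum>i\<in>{d0<..d}. Z n i \<omega> * ?f n i) \<longlonglongrightarrow> 0"
  proof (rule Lim_null_comparison)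
    have "norm (\<Sum>i\<in>{d0<..d}. Z n i \<omega> * ?f n i) \<le> minor n \<omega> * C\<^sup>2" for n
      unfolding sum_Z_minor[symmetric] sum_distrib_right
    proof (rule sum_norm_le)
      fix i assume "i \<in> {d0<..d}"
      then have i: "i \<in> {1..d}" by auto
      show "norm (Z n i \<omega> * ?f n i) \<le> Z n i \<omega> * C\<^sup>2"
        unfolding real_norm_def abs_mult using fb[OF i, of n] Z_bounds[OF i w, of n] by (intro mult_mono) auto
    qed
    then show "\<forall>\<^sub>F n in sequentially. norm (\<Sum>i\<in>{d0<..d}. Z n i \<omega> * ?f n i) \<le> minor n \<omega> * C\<^sup>2" by simp
    show "(\<lambda>n. minor n \<omega> * C\<^sup>2) \<longlonglongrightarrow> 0" using tendsto_mult_left_zero[OF minor] .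
  qed
  ultimately show ?thesis unfolding sum_colors using tendsto_add by fastforce
qed

text \<open>All coefficients are built from four convergent pieces: the cut-off tends to 1,
  \<open>S n / (n + 1)\<close> to \<open>m\<close>, \<open>Z n j\<close> to its limit, and the drift
  to 0 together with \<open>minor\<close>.\<close>

lemma coefficient_limits:
  assumes w: "\<omega> \<in> space M" and j: "j \<in> {1..d0}" and minor: "(\<lambda>n. minor n \<omega>) \<longlonglongrightarrow> 0" and SL: "(\<lambda>n. S n \<omega> / real (Suc n)) \<longlonglongrightarrow> m"
    and ev: "\<forall>\<^sub>F n in sequentially. m / 2 * real (Suc n) \<le> S n \<omega>" and Z: "(\<lambda>n. Z n j \<omega>) \<longlonglongrightarrow> Zl j \<omega>"
  shows "(\<lambda>n. real (Suc n) * \<phi>R j n i \<omega>) \<longlonglongrightarrow> 0"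
    and "(\<lambda>n. real (Suc n) * \<psi>R j n i \<omega>) \<longlonglongrightarrow> ((if i = j then 1 else 0) - Zl j \<omega>) / m"
    and "(\<lambda>n. \<phi>W j n i \<omega>) \<longlonglongrightarrow> (if i = j then 1 else 0) - Zl j \<omega>"
    and "(\<lambda>n. \<psi>W j n i \<omega>) \<longlonglongrightarrow> - (((if i = j then 1 else 0) - Zl j \<omega>) / m)"
proof -
  have g: "(\<lambda>n. good n \<omega>) \<longlonglongrightarrow> 1"
    by (rule tendsto_eventually) (use ev in \<open>eventually_elim; simp add: good_def\<close>)
  have "(\<lambda>n. good n \<omega> / (S n \<omega> / real (Suc n))) \<longlonglongrightarrow> 1 / m" by (intro tendsto_divide g SL) (use m_pos in simp)
  then have h: "(\<lambda>n. real (Suc n) * (good n \<omega> / S n \<omega>)) \<longlonglongrightarrow> 1 / m" by (simp add: mult.commute)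
  have e: "(\<lambda>n. \<epsilon> j n i \<omega>) \<longlonglongrightarrow> (if i = j then 1 else 0) - Zl j \<omega>" unfolding \<epsilon>_def by (intro tendsto_intros Z)
  have dr: "(\<lambda>n. drift j n \<omega>) \<longlonglongrightarrow> 0"
  proof (rule Lim_null_comparison)
    show "\<forall>\<^sub>F n in sequentially. norm (drift j n \<omega>) \<le> \<beta> * minor n \<omega>" using drift_bound_minor[OF j w] by simp
    show "(\<lambda>n. \<beta> * minor n \<omega>) \<longlonglongrightarrow> 0" using tendsto_mult_right_zero[OF minor] .
  qed
  have "(\<lambda>n. - (real (Suc n) * (good n \<omega> / S n \<omega>) * drift j n \<omega>)) \<longlonglongrightarrow> - (1 / m * 0)" by (intro tendsto_minus tendsto_mult h dr)
  then show 1: "(\<lambda>n. real (Suc n) * \<phi>R j n i \<omega>) \<longlonglongrightarrow> 0" unfolding \<phi>R_def by (simp add: mult.assoc)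
  have "(\<lambda>n. real (Suc n) * (good n \<omega> / S n \<omega>) * \<epsilon> j n i \<omega>) \<longlonglongrightarrow> 1 / m * ((if i = j then 1 else 0) - Zl j \<omega>)" by (intro tendsto_mult h e)
  then show 2: "(\<lambda>n. real (Suc n) * \<psi>R j n i \<omega>) \<longlonglongrightarrow> ((if i = j then 1 else 0) - Zl j \<omega>) / m" unfolding \<psi>R_def by (simp add: mult.assoc)
  have "(\<lambda>n. good n \<omega> * \<epsilon> j n i \<omega> - real (Suc n) * \<phi>R j n i \<omega>) \<longlonglongrightarrow> 1 * ((if i = j then 1 else 0) - Zl j \<omega>) - 0" by (intro tendsto_diff tendsto_mult g e 1)
  then show "(\<lambda>n. \<phi>W j n i \<omega>) \<longlonglongrightarrow> (if i = j then 1 else 0) - Zl j \<omega>" unfolding \<phi>W_def by (simp only: mult_1_left diff_zero)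
  show "(\<lambda>n. \<psi>W j n i \<omega>) \<longlonglongrightarrow> - (((if i = j then 1 else 0) - Zl j \<omega>) / m)" unfolding \<psi>W_def by (intro tendsto_minus 2)
qed

lemma sum_Zl: "AE \<omega> in M. (\<Sum>i\<in>{1..d0}. Zl i \<omega>) = 1"
  using AE_path
proof eventually_elim
  case (elim \<omega>)
  have w: "\<omega> \<in> space M" and minor: "(\<lambda>n. minor n \<omega>) \<longlonglongrightarrow> 0" using elim by auto
  have "(\<lambda>n. \<Sum>i\<in>{1..d0}. Z n i \<omega>) \<longlonglongrightarrow> (\<Sum>i\<in>{1..d0}. Zl i \<omega>)" by (intro tendsto_sum) (use elim in blast)
  moreover have "(\<lambda>n. \<Sum>i\<in>{1..d0}. Z n i \<omega>) \<longlonglongrightarrow> 1 - 0" unfolding sum_Z_major[OF w] by (intro tendsto_intros minor)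
  ultimately show ?case using LIMSEQ_unique by fastforce
qed

text \<open>The scaled martingale increment has the limiting form \<open>e * A / m\<close>, with
  \<open>e = 1 - Zl j\<close> when color \<open>j\<close> is drawn and \<open>e = - Zl j\<close>
  otherwise. Splitting off the color \<open>j\<close> gives the two terms of
  \<open>urn_V\<close>.\<close>

lemma V_eq:
  assumes j: "j \<in> {1..d0}"
  shows "(\<Sum>i\<in>{1..d0}. Zl i \<omega> * ((((if i = j then 1 else 0) - Zl j \<omega>) / m)\<^sup>2 * q i)) = urn_V d d0 a X A m q j \<omega>"
proof -
  define z where "z i = Zl i \<omega>" for i
  have "(\<Sum>i\<in>{1..d0}. z i * ((((if i = j then 1 else 0) - z j) / m)\<^sup>2 * q i)) =
    z j * (((1 - z j) / m)\<^sup>2 * q j) + (\<Sum>i\<in>{1..d0} - {j}. z i * ((((if i = j then 1 else 0) - z j) / m)\<^sup>2 * q i))"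
    using sum.remove[OF _ j, of "\<lambda>i. z i * ((((if i = j then 1 else 0) - z j) / m)\<^sup>2 * q i)"] by simp
  also have "(\<Sum>i\<in>{1..d0} - {j}. z i * ((((if i = j then 1 else 0) - z j) / m)\<^sup>2 * q i)) = (\<Sum>i\<in>{1..d0} - {j}. (z j)\<^sup>2 / m\<^sup>2 * (q i * z i))"
    by (rule sum.cong) (auto simp: power_divide)
  also have "\<dots> = (z j)\<^sup>2 / m\<^sup>2 * (\<Sum>i\<in>{1..d0} - {j}. q i * z i)" by (rule sum_distrib_left[symmetric])
  also have "z j * (((1 - z j) / m)\<^sup>2 * q j) + (z j)\<^sup>2 / m\<^sup>2 * (\<Sum>i\<in>{1..d0} - {j}. q i * z i) =
    z j / m\<^sup>2 * (q j * (1 - z j)\<^sup>2 + z j * (\<Sum>i\<in>{1..d0} - {j}. q i * z i))"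
  proof -
    have "x * ((y / m)\<^sup>2 * c) + x\<^sup>2 / m\<^sup>2 * s = x / m\<^sup>2 * (c * y\<^sup>2 + x * s)" for x y c s
      by (simp add: power_divide power2_eq_square algebra_simps add_divide_distrib)
    then show ?thesis .
  qed
  finally show ?thesis unfolding urn_V_def z_def Let_def .
qed

text \<open>The increment behind \<open>C\<close> has the limiting form
  \<open>e * (1 - A / m)\<close>. Since \<open>A\<close> has limiting mean \<open>m\<close>, its
  second moment is that of \<open>e * A / m\<close> minus \<open>e^2\<close>; averaged over the
  colors, \<open>e^2\<close> gives the Bernoulli variance \<open>Zl j * (1 - Zl j)\<close>.\<close>

lemma U_eq:
  assumes j: "j \<in> {1..d0}" and one: "(\<Sum>i\<in>{1..d0}. Zl i \<omega>) = 1"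
  defines "e \<equiv> \<lambda>i. (if i = j then 1 else 0) - Zl j \<omega>"
  shows "(\<Sum>i\<in>{1..d0}. Zl i \<omega> * ((e i)\<^sup>2 + 2 * e i * (- (e i / m)) * m + (- (e i / m))\<^sup>2 * q i)) = urn_U d d0 a X A m q j \<omega>"
proof -
  have "(\<Sum>i\<in>{1..d0}. Zl i \<omega> * ((e i)\<^sup>2 + 2 * e i * (- (e i / m)) * m + (- (e i / m))\<^sup>2 * q i)) =
    (\<Sum>i\<in>{1..d0}. Zl i \<omega> * ((e i / m)\<^sup>2 * q i) - Zl i \<omega> * (e i)\<^sup>2)"
    using m_pos by (intro sum.cong) (auto simp: algebra_simps power2_eq_square)
  also have "\<dots> = urn_V d d0 a X A m q j \<omega> - (\<Sum>i\<in>{1..d0}. Zl i \<omega> * (e i)\<^sup>2)"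
    unfolding sum_subtractf e_def V_eq[OF j] ..
  also have "(\<Sum>i\<in>{1..d0}. Zl i \<omega> * (e i)\<^sup>2) = Zl j \<omega> * (1 - Zl j \<omega>)"
  proof -
    have "(\<Sum>i\<in>{1..d0}. Zl i \<omega> * (e i)\<^sup>2) = Zl j \<omega> * (1 - Zl j \<omega>)\<^sup>2 + (\<Sum>i\<in>{1..d0} - {j}. Zl i \<omega> * (e i)\<^sup>2)"
      using sum.remove[OF _ j, of "\<lambda>i. Zl i \<omega> * (e i)\<^sup>2"] by (simp add: e_def)
    also have "(\<Sum>i\<in>{1..d0} - {j}. Zl i \<omega> * (e i)\<^sup>2) = (\<Sum>i\<in>{1..d0} - {j}. Zl i \<omega> * (Zl j \<omega>)\<^sup>2)"
      by (rule sum.cong) (auto simp: e_def)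
    also have "\<dots> = (\<Sum>i\<in>{1..d0} - {j}. Zl i \<omega>) * (Zl j \<omega>)\<^sup>2" by (rule sum_distrib_right[symmetric])
    also have "(\<Sum>i\<in>{1..d0} - {j}. Zl i \<omega>) = 1 - Zl j \<omega>"
      using sum.remove[OF _ j, of "\<lambda>i. Zl i \<omega>"] one by simp
    finally show ?thesis by (simp add: power2_eq_square algebra_simps)
  qed
  finally show ?thesis unfolding urn_U_def .
qed

lemma variance_limits:
  assumes j: "j \<in> {1..d0}"
  shows "AE \<omega> in M. (\<lambda>n. (real (Suc n))\<^sup>2 * vR j n \<omega>) \<longlonglongrightarrow> urn_V d d0 a X A m q j \<omega>"
    and "AE \<omega> in M. (\<lambda>n. vW j n \<omega>) \<longlonglongrightarrow> urn_U d d0 a X A m q j \<omega>"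
proof -
  have jd: "j \<in> {1..d}" using j d0 by auto
  show "AE \<omega> in M. (\<lambda>n. (real (Suc n))\<^sup>2 * vR j n \<omega>) \<longlonglongrightarrow> urn_V d d0 a X A m q j \<omega>"
    using AE_path
  proof eventually_elim
    case (elim \<omega>)
    have w: "\<omega> \<in> space M" and minor: "(\<lambda>n. minor n \<omega>) \<longlonglongrightarrow> 0" and SL: "(\<lambda>n. S n \<omega> / real (Suc n)) \<longlonglongrightarrow> m"
      and ev: "\<forall>\<^sub>F n in sequentially. m / 2 * real (Suc n) \<le> S n \<omega>" and Z: "\<And>i. i \<in> {1..d0} \<Longrightarrow> (\<lambda>n. Z n i \<omega>) \<longlonglongrightarrow> Zl i \<omega>"
      using elim by blast+
    note cl = coefficient_limits[OF w j minor SL ev Z[OF j]]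
    have "\<bar>real (Suc n) * \<phi>R j n i \<omega> + real (Suc n) * \<psi>R j n i \<omega> * A (Suc n) i \<omega>'\<bar> \<le> K"
      if "i \<in> {1..d}" "\<omega>' \<in> space M" for n i \<omega>'
    proof -
      have "real (Suc n) * \<bar>\<phi>R j n i \<omega> + \<psi>R j n i \<omega> * A (Suc n) i \<omega>'\<bar> \<le> real (Suc n) * (K / real (Suc n))"
        by (intro mult_left_mono R_bounds(3)[OF jd w that]) simp
      moreover have "real (Suc n) * \<phi>R j n i \<omega> + real (Suc n) * \<psi>R j n i \<omega> * A (Suc n) i \<omega>' = real (Suc n) * (\<phi>R j n i \<omega> + \<psi>R j n i \<omega> * A (Suc n) i \<omega>')"
        by (simp only: distrib_left mult.assoc)
      ultimately show ?thesis by (simp only: abs_mult abs_of_nat) simp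
    qed
    from quadratic_limit[OF w minor Z cl(1,2) this]
    have "(\<lambda>n. \<Sum>i=1..d. Z n i \<omega> * ((real (Suc n) * \<phi>R j n i \<omega>)\<^sup>2 + 2 * (real (Suc n) * \<phi>R j n i \<omega>) * (real (Suc n) * \<psi>R j n i \<omega>) * \<mu> n i + (real (Suc n) * \<psi>R j n i \<omega>)\<^sup>2 * \<sigma> n i))
      \<longlonglongrightarrow> (\<Sum>i\<in>{1..d0}. Zl i \<omega> * ((((if i = j then 1 else 0) - Zl j \<omega>) / m)\<^sup>2 * q i))" by simp
    moreover have "(\<Sum>i=1..d. Z n i \<omega> * ((real (Suc n) * \<phi>R j n i \<omega>)\<^sup>2 + 2 * (real (Suc n) * \<phi>R j n i \<omega>) * (real (Suc n) * \<psi>R j n i \<omega>) * \<mu> n i + (real (Suc n) * \<psi>R j n i \<omega>)\<^sup>2 * \<sigma> n i))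
      = (real (Suc n))\<^sup>2 * vR j n \<omega>" for n
      unfolding vR_def sum_distrib_left by (rule sum.cong) (auto simp: power2_eq_square algebra_simps simp del: of_nat_Suc)
    ultimately show ?case unfolding V_eq[OF j] by simp
  qed
  show "AE \<omega> in M. (\<lambda>n. vW j n \<omega>) \<longlonglongrightarrow> urn_U d d0 a X A m q j \<omega>"
    using AE_path sum_Zl
  proof eventually_elim
    case (elim \<omega>)
    have w: "\<omega> \<in> space M" and minor: "(\<lambda>n. minor n \<omega>) \<longlonglongrightarrow> 0" and SL: "(\<lambda>n. S n \<omega> / real (Suc n)) \<longlonglongrightarrow> m"
      and ev: "\<forall>\<^sub>F n in sequentially. m / 2 * real (Suc n) \<le> S n \<omega>" and Z: "\<And>i. i \<in> {1..d0} \<Longrightarrow> (\<lambda>n. Z n i \<omega>) \<longlonglongrightarrow> Zl i \<omega>"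
      using elim(1) by blast+
    note cl = coefficient_limits[OF w j minor SL ev Z[OF j]]
    from quadratic_limit[OF w minor Z cl(3,4) W_bounds(3)[OF jd w]]
    show ?case unfolding vW_def U_eq[OF j elim(2)] .
  qed
qed

section \<open>The limit theorems for the urn\<close>

lemma Zl_measurable: "i \<in> {1..d} \<Longrightarrow> Zl i \<in> borel_measurable Finf"
  unfolding urn_Zlim_def[abs_def]
  by (rule borel_measurable_lim_metric) (rule measurable_Finf[OF Z_measurable_G])

text \<open>\<open>product_tendsto\<close> asks for limit variances determined by the filtration,
  hence \<open>Finf\<close> in place of \<open>M\<close>.\<close>

lemma UV_measurable:
  assumes j: "j \<in> {1..d0}"
  shows "urn_U d d0 a X A m q j \<in> borel_measurable Finf" "urn_V d d0 a X A m q j \<in> borel_measurable Finf"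
proof -
  have Z: "Zl i \<in> borel_measurable Finf" if "i \<in> {1..d0}" for i using Zl_measurable that d0 by auto
  show V: "urn_V d d0 a X A m q j \<in> borel_measurable Finf"
    unfolding urn_V_def[abs_def] Let_def
    by (intro borel_measurable_times borel_measurable_divide borel_measurable_add borel_measurable_power
        borel_measurable_diff borel_measurable_sum borel_measurable_const Z j) auto
  show "urn_U d d0 a X A m q j \<in> borel_measurable Finf"
    unfolding urn_U_def[abs_def]
    by (intro borel_measurable_times borel_measurable_diff borel_measurable_const Z V j)
qed

lemma C_measurable: "j \<in> {1..d} \<Longrightarrow> (\<lambda>\<omega>. urn_C d a X A n j \<omega>) \<in> borel_measurable (G n)"
  unfolding urn_C_def urn_mean_def
  by (intro borel_measurable_times borel_measurable_diff borel_measurable_divide borel_measurable_sum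
      borel_measurable_const XA_measurable_G Z_measurable_G) auto

lemma D_measurable: "j \<in> {1..d} \<Longrightarrow> (\<lambda>\<omega>. urn_D d a X A n j \<omega>) \<in> borel_measurable Finf"
  unfolding urn_D_def
  by (intro borel_measurable_times borel_measurable_diff borel_measurable_const measurable_Finf[OF Z_measurable_G] Zl_measurable)

lemma urn_clt:
  assumes j: "j \<in> {1..d0}"
  defines "U \<equiv> urn_U d d0 a X A m q j" and "V \<equiv> urn_V d d0 a X A m q j"
  shows "stably_converges M (\<lambda>n. urn_C d a X A n j) (gaussian_kernel U)"
    and "strongly_stably_converges M G (\<lambda>n. urn_D d a X A n j) (gaussian_kernel V)"
    and "stably_converges M (\<lambda>n \<omega>. (urn_C d a X A n j \<omega>, urn_D d a X A n j \<omega>))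
      (prod_kernel (gaussian_kernel U) (gaussian_kernel V))"
proof -
  have jd: "j \<in> {1..d}" using j d0 by auto
  let ?C = "\<lambda>n. urn_C d a X A n j" and ?D = "\<lambda>n. urn_D d a X A n j"
  note UVF = UV_measurable[OF j, folded U_def V_def]
  have UV: "U \<in> borel_measurable M" "V \<in> borel_measurable M"
    using UVF measurable_from_subalg[OF subalgebra_Finf] by blast+
  have CM: "?C n \<in> borel_measurable M" for n by (rule measurable_M[OF C_measurable[OF jd]])
  have DM: "?D n \<in> borel_measurable M" for n by (rule measurable_from_subalg[OF subalgebra_Finf D_measurable[OF jd]])
  have stab: "(\<lambda>n. \<integral>\<omega>. indicator H \<omega> * f (?C n \<omega>) \<partial>M) \<longlonglongrightarrow> (\<integral>\<omega>. indicator H \<omega> * (\<integral>x. f x \<partial>gaussian 0 (U \<omega>)) \<partial>M)"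
    if "H \<in> sets M" "continuous_on UNIV f" "\<And>x. \<bar>f x\<bar> \<le> c" for H and f :: "real \<Rightarrow> real" and c
    by (rule stable_clt[OF W_mart_diff[OF jd] W_cond_var[OF jd] vW_bounds(1)[OF jd] vW_bounds(2)[OF jd] UV(1) variance_limits(2)[OF j, folded U_def] CM C_approx[OF j] that])
  show "stably_converges M ?C (gaussian_kernel U)"
    by (rule stably_convergesI[OF prob_space_axioms CM gaussian_kernel_measurable[OF UV(1)]])
      (unfold gaussian_kernel_def, rule stab)
  \<comment> \<open>The approximation of \<open>V\<close> that is known at time \<open>n\<close>.
    With this choice the condition of \<open>strong_clt\<close> comparing \<open>L\<close> with the
    scaled conditional variances holds identically.\<close>
  define L where "L n \<omega> = (real (Suc n))\<^sup>2 * vR j n \<omega>" for n \<omega>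
  have LG: "L n \<in> borel_measurable (G n)" for n
    using R_cond_var[OF jd] unfolding L_def cond_var_def by (intro borel_measurable_times borel_measurable_const) blast
  have L0: "0 \<le> L n \<omega>" if "\<omega> \<in> space M" for n \<omega> unfolding L_def using vR_bounds(1)[OF jd that] by simp
  have LK: "L n \<omega> \<le> K\<^sup>2" if "\<omega> \<in> space M" for n \<omega>
  proof -
    have "L n \<omega> \<le> (real (Suc n))\<^sup>2 * (K / real (Suc n))\<^sup>2"
      unfolding L_def by (intro mult_left_mono vR_bounds(2)[OF jd that]) simp
    then show ?thesis by (simp add: power_divide del: of_nat_Suc)
  qed
  have LV: "AE \<omega> in M. (\<lambda>n. L n \<omega>) \<longlonglongrightarrow> V \<omega>" unfolding L_def V_def by (rule variance_limits(1)[OF j])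
  have L1: "(\<lambda>n. \<integral>\<omega>. \<bar>real_cond_exp M (G n) (\<lambda>\<omega>. f (?D n \<omega>)) \<omega> - (\<integral>x. f x \<partial>gaussian 0 (V \<omega>))\<bar> \<partial>M) \<longlonglongrightarrow> 0"
    if f: "continuous_on UNIV f" "\<And>x. \<bar>f x\<bar> \<le> c" for f :: "real \<Rightarrow> real" and c
  proof (rule cond_exp_gaussian_L1[OF LG UV(2) LV DM f])
    fix H :: "nat \<Rightarrow> 'a set" assume H: "\<And>n. H n \<in> sets (G n)"
    show "(\<lambda>n. \<integral>\<omega>. indicator (H n) \<omega> * (f (?D n \<omega>) - (\<integral>x. f x \<partial>gaussian 0 (L n \<omega>))) \<partial>M) \<longlonglongrightarrow> 0"
    proof (rule strong_clt[OF R_mart_diff[OF jd] R_cond_var[OF jd] vR_bounds(1)[OF jd] vR_bounds(2)[OF jd] LG L0 LK _ _ DM D_approx[OF j] H f])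
      show "AE \<omega> in M. (\<lambda>k. (real (Suc k))\<^sup>2 * vR j k \<omega> - L k \<omega>) \<longlonglongrightarrow> 0" unfolding L_def by simp
      show "AE \<omega> in M. convergent (\<lambda>n. L n \<omega>)" using LV by eventually_elim (rule convergentI)
    qed
  qed
  show "strongly_stably_converges M G ?D (gaussian_kernel V)"
    by (rule strongly_stably_convergesI[OF DM UV(2) L1])
  show "stably_converges M (\<lambda>n \<omega>. (?C n \<omega>, ?D n \<omega>)) (prod_kernel (gaussian_kernel U) (gaussian_kernel V))"
  proof (rule stably_converges_pairI[OF prob_space_axioms CM DM UV])
    fix f g :: "real \<Rightarrow> real" and b c H
    assume H: "H \<in> sets M" and f: "continuous_on UNIV f" "\<And>x. \<bar>f x\<bar> \<le> b" and g: "continuous_on UNIV g" "\<And>x. \<bar>g x\<bar> \<le> c"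
    show "(\<lambda>n. \<integral>\<omega>. indicator H \<omega> * (f (?C n \<omega>) * g (?D n \<omega>)) \<partial>M) \<longlonglongrightarrow>
      (\<integral>\<omega>. indicator H \<omega> * ((\<integral>x. f x \<partial>gaussian 0 (U \<omega>)) * (\<integral>x. g x \<partial>gaussian 0 (V \<omega>))) \<partial>M)"
      by (rule product_tendsto[OF C_measurable[OF jd] D_measurable[OF jd] UVF f g stab[OF _ f] L1[OF g] H])
  qed
qed

end

theorem corollary5:
  fixes M :: "'a measure" and d d0 :: nat
    and X A :: "nat \<Rightarrow> nat \<Rightarrow> 'a \<Rightarrow> real"
    and a q :: "nat \<Rightarrow> real" and m :: real
  assumes "2 \<le> d" and "1 \<le> d0" and "d0 \<le> d"
    and "urn_assms_A M d a X A"
    and "urn_assms_B M d d0 A m q"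
    and "2 * urn_lambda0 M d d0 A < ereal m"
  shows "\<forall>j\<in>{1..d0}.
    stably_converges M (\<lambda>n. urn_C d a X A n j)
      (gaussian_kernel (urn_U d d0 a X A m q j)) \<and>
    strongly_stably_converges M (urn_G M d X A) (\<lambda>n. urn_D d a X A n j)
      (gaussian_kernel (urn_V d d0 a X A m q j)) \<and>
    stably_converges M (\<lambda>n \<omega>. (urn_C d a X A n j \<omega>, urn_D d a X A n j \<omega>))
      (prod_kernel (gaussian_kernel (urn_U d d0 a X A m q j))
                   (gaussian_kernel (urn_V d d0 a X A m q j)))"
proof -
  interpret urn M d d0 X A a q m
    using assms by unfold_locales
  show ?thesis using urn_clt by blast
qed

end
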